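(* Let $\mu$ be Lebesgue measure on $[0,1]$ and $G = \mathrm{Aut}^*(\mu)$. (1) For every $1 \le p < \infty$, the action $\cdot_p$ of $G$ on $L_p(\mu)$ is by linear isometries preserving the lattice operations, and it induces an isomorphism of topological groups $\mathrm{Aut}^*(\mu) \cong \mathrm{Aut}\bigl(L_p(\mu),|\cdot|\bigr)$, where the latter is the group of isometric Banach lattice automorphisms of $L_p(\mu)$ with the topology of pointwise norm convergence. In particular $\mathrm{Aut}^*(\mu)$ is a Polish, Roelcke-precompact group. (2) If $X$ is a nonempty complete metric space with a jointly continuous action of $\mathrm{Aut}^*(\mu)$ by isometries which is transitive, then $X$ is a singleton.
   Context: $\mathrm{Aut}^*(\mu)$ is the group of measure-class-preserving transformations of $\mu$: bijections $\varphi$ between full-measure subsets of $[0,1]$ such that $\varphi$ and $\varphi^{-1}$ are measurable and preserve the ideal of null sets, identified when equal almost everywhere. For $1\le p<\infty$, $\varphi\in \mathrm{Aut}^*(\mu)$ and $f \in L_p(\mu)$ (real-valued), set $\varphi\cdot_p f = \left(\frac{d\varphi_*\mu}{d\mu}\right)^{1/p} \, (f\circ\varphi^{-1})$, where $\varphi_*\mu(A) = \mu(\varphi^{-1}A)$. The group $\mathrm{Aut}^*(\mu)$ is given the topology of pointwise norm convergence of its action $\cdot_2$ on $L_2(\mu)$. A topological group $G$ is Roelcke-precompact if for every open neighbourhood $U$ of the identity there is a finite $F\subseteq G$ with $UFU=G$. *)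

theory Defs
  imports "HOL-Analysis.Analysis"
begin

definition mu :: "real measure" where
  "mu = lebesgue_on {0..1}"

definition autstar_rep_on :: "(real \<Rightarrow> real) \<Rightarrow> real set \<Rightarrow> real set \<Rightarrow> bool" where
  "autstar_rep_on \<phi> A B \<longleftrightarrow>
     A \<in> sets mu \<and> B \<in> sets mu \<and>
     space mu - A \<in> null_sets mu \<and> space mu - B \<in> null_sets mu \<and>
     bij_betw \<phi> A B \<and>
     (\<forall>S \<in> sets mu. \<phi> -` S \<inter> A \<in> sets mu \<and> \<phi> ` (S \<inter> A) \<in> sets mu) \<and>
     (\<forall>S \<in> null_sets mu. \<phi> -` S \<inter> A \<in> null_sets mu \<and> \<phi> ` (S \<inter> A) \<in> null_sets mu)"

definition autstar_rep :: "(real \<Rightarrow> real) \<Rightarrow> bool" where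
  "autstar_rep \<phi> \<longleftrightarrow> (\<exists>A B. autstar_rep_on \<phi> A B)"

definition autstar_dom :: "(real \<Rightarrow> real) \<Rightarrow> real set" where
  "autstar_dom \<phi> = (SOME A. \<exists>B. autstar_rep_on \<phi> A B)"

definition autstar_inv_rep :: "(real \<Rightarrow> real) \<Rightarrow> real \<Rightarrow> real" where
  "autstar_inv_rep \<phi> = inv_into (autstar_dom \<phi>) \<phi>"

definition autstar_class :: "(real \<Rightarrow> real) \<Rightarrow> (real \<Rightarrow> real) set" where
  "autstar_class \<phi> = {\<psi>. autstar_rep \<psi> \<and> (AE x in mu. \<psi> x = \<phi> x)}"

definition AutStar :: "(real \<Rightarrow> real) set set" where
  "AutStar = autstar_class ` {\<phi>. autstar_rep \<phi>}"

definition arep :: "(real \<Rightarrow> real) set \<Rightarrow> real \<Rightarrow> real" where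
  "arep C = (SOME \<phi>. \<phi> \<in> C)"

definition autstar_one :: "(real \<Rightarrow> real) set" where
  "autstar_one = autstar_class id"

definition autstar_mult :: "(real \<Rightarrow> real) set \<Rightarrow> (real \<Rightarrow> real) set \<Rightarrow> (real \<Rightarrow> real) set" where
  "autstar_mult C D = autstar_class (arep C \<circ> arep D)"

definition autstar_inverse :: "(real \<Rightarrow> real) set \<Rightarrow> (real \<Rightarrow> real) set" where
  "autstar_inverse C = autstar_class (autstar_inv_rep (arep C))"

definition Lp_rep :: "real \<Rightarrow> (real \<Rightarrow> real) set" where
  "Lp_rep p = {f. f \<in> borel_measurable mu \<and> integrable mu (\<lambda>x. \<bar>f x\<bar> powr p)}"

definition lp_class :: "real \<Rightarrow> (real \<Rightarrow> real) \<Rightarrow> (real \<Rightarrow> real) set" where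
  "lp_class p f = {g \<in> Lp_rep p. AE x in mu. g x = f x}"

definition Lp :: "real \<Rightarrow> (real \<Rightarrow> real) set set" where
  "Lp p = lp_class p ` Lp_rep p"

definition lrep :: "(real \<Rightarrow> real) set \<Rightarrow> real \<Rightarrow> real" where
  "lrep F = (SOME f. f \<in> F)"

definition lp_norm :: "real \<Rightarrow> (real \<Rightarrow> real) set \<Rightarrow> real" where
  "lp_norm p F = (\<integral>x. \<bar>lrep F x\<bar> powr p \<partial>mu) powr (1 / p)"

definition lp_add :: "real \<Rightarrow> (real \<Rightarrow> real) set \<Rightarrow> (real \<Rightarrow> real) set \<Rightarrow> (real \<Rightarrow> real) set" where
  "lp_add p F G = lp_class p (\<lambda>x. lrep F x + lrep G x)"

definition lp_scale :: "real \<Rightarrow> real \<Rightarrow> (real \<Rightarrow> real) set \<Rightarrow> (real \<Rightarrow> real) set" where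
  "lp_scale p c F = lp_class p (\<lambda>x. c * lrep F x)"

definition lp_sup :: "real \<Rightarrow> (real \<Rightarrow> real) set \<Rightarrow> (real \<Rightarrow> real) set \<Rightarrow> (real \<Rightarrow> real) set" where
  "lp_sup p F G = lp_class p (\<lambda>x. max (lrep F x) (lrep G x))"

definition lp_inf :: "real \<Rightarrow> (real \<Rightarrow> real) set \<Rightarrow> (real \<Rightarrow> real) set \<Rightarrow> (real \<Rightarrow> real) set" where
  "lp_inf p F G = lp_class p (\<lambda>x. min (lrep F x) (lrep G x))"

definition lp_dist :: "real \<Rightarrow> (real \<Rightarrow> real) set \<Rightarrow> (real \<Rightarrow> real) set \<Rightarrow> real" where
  "lp_dist p F G = lp_norm p (lp_add p F (lp_scale p (-1) G))"

definition act :: "real \<Rightarrow> (real \<Rightarrow> real) \<Rightarrow> (real \<Rightarrow> real) \<Rightarrow> real \<Rightarrow> real" where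
  "act p \<phi> f = (\<lambda>x. enn2real (RN_deriv mu (distr mu mu \<phi>) x) powr (1 / p)
                      * f (autstar_inv_rep \<phi> x))"

definition Phi :: "real \<Rightarrow> (real \<Rightarrow> real) set \<Rightarrow> (real \<Rightarrow> real) set \<Rightarrow> (real \<Rightarrow> real) set" where
  "Phi p C = restrict (\<lambda>F. lp_class p (act p (arep C) (lrep F))) (Lp p)"

definition autstar_top :: "(real \<Rightarrow> real) set topology" where
  "autstar_top = topology_generated_by
     {{C \<in> AutStar. lp_dist 2 (Phi 2 C F) G < e} | F G e. F \<in> Lp 2 \<and> G \<in> Lp 2 \<and> e > 0}"

definition aut_lattice :: "real \<Rightarrow> ((real \<Rightarrow> real) set \<Rightarrow> (real \<Rightarrow> real) set) set" where
  "aut_lattice p = {T. T \<in> extensional (Lp p) \<and> bij_betw T (Lp p) (Lp p) \<and>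
     (\<forall>F \<in> Lp p. \<forall>G \<in> Lp p. T (lp_add p F G) = lp_add p (T F) (T G)) \<and>
     (\<forall>c. \<forall>F \<in> Lp p. T (lp_scale p c F) = lp_scale p c (T F)) \<and>
     (\<forall>F \<in> Lp p. lp_norm p (T F) = lp_norm p F) \<and>
     (\<forall>F \<in> Lp p. \<forall>G \<in> Lp p. T (lp_sup p F G) = lp_sup p (T F) (T G)) \<and>
     (\<forall>F \<in> Lp p. \<forall>G \<in> Lp p. T (lp_inf p F G) = lp_inf p (T F) (T G))}"

definition aut_lattice_top :: "real \<Rightarrow> ((real \<Rightarrow> real) set \<Rightarrow> (real \<Rightarrow> real) set) topology" where
  "aut_lattice_top p = topology_generated_by
     {{T \<in> aut_lattice p. lp_dist p (T F) G < e} | F G e. F \<in> Lp p \<and> G \<in> Lp p \<and> e > 0}"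

definition Polish_space :: "'a topology \<Rightarrow> bool" where
  "Polish_space X \<longleftrightarrow> completely_metrizable_space X \<and> separable_space X"

definition roelcke_precompact_autstar :: bool where
  "roelcke_precompact_autstar \<longleftrightarrow>
     (\<forall>U. openin autstar_top U \<and> autstar_one \<in> U \<longrightarrow>
        (\<exists>F. finite F \<and> F \<subseteq> AutStar \<and>
           {autstar_mult (autstar_mult u f) v | u f v. u \<in> U \<and> f \<in> F \<and> v \<in> U} = AutStar))"

end

theory Submission
  imports Defs
begin

text \<open>
  An element of \<open>Aut\<^sup>*(\<mu>)\<close> is handled through a nonsingular map \<open>f\<close>, an almost-everywhere inverse \<open>g\<close>
  and the density \<open>w\<close> of the image measure, so that it acts on \<open>L\<^sub>p\<close> by \<open>k \<mapsto> w\<^sup>1\<^sup>/\<^sup>p \<cdot> (k \<circ> g)\<close>.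

  Surjectivity. The constant 1 and the identity function generate \<open>L\<^sub>p\<close> as a closed vector lattice. If
  \<open>T\<close> is a lattice isometry, \<open>h = T 1\<close> and \<open>\<psi> = T id / h\<close>, then \<open>T k = h \<cdot> (k \<circ> \<psi>)\<close> holds for these two
  vectors, hence everywhere; the same for \<open>T\<^sup>-\<^sup>1\<close> shows that \<open>\<psi>\<close> is invertible almost everywhere.

  Topology. The Mazur map \<open>k \<mapsto> sgn k \<cdot> \<bar>k\<bar>\<^sup>p\<^sup>/\<^sup>q\<close> is a homeomorphism from \<open>L\<^sub>p\<close> to \<open>L\<^sub>q\<close> intertwining the
  actions, so all exponents give one topology. For \<open>p = 1\<close> it is metrised by the action on 1 and on the
  identity function, and adding the same distance of the inverses gives a complete metric.

  Roelcke precompactness. Cut \<open>[0,1]\<close> according to the coarse position of \<open>x\<close> and of \<open>f x\<close> and the coarse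
  size of the density. Up to a small error, a double coset is determined by the measures of the pieces and of
  their images; very small densities are absorbed on the right, very large ones on the left.

  Transitive actions. Only one consequence of continuity is used: an element supported on a set of small
  measure moves a given point little. Composing maps that compress a small set further and further, each
  supported on a small set, gives a convergent sequence of points whose limit is fixed by all elements
  supported on some set of positive measure; by transitivity every point \<open>x\<close> has such a set. Call \<open>E\<close>
  compressible if elements of the stabiliser of \<open>x\<close> supported on \<open>E\<close> can enlarge a small part of \<open>E\<close> to
  almost all of \<open>E\<close>. There is a largest compressible set. If it is not of full measure, shrink it to a null set
  by a sequence of translates of \<open>x\<close> that converges; the limit is again fixed by the elements supported on a
  set of positive measure, which yields a compressible set disjoint from the largest one. If it is of full
  measure, conjugating small supports to almost full supports shows that \<open>x\<close> is fixed by the whole group.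
\<close>

section \<open>Nonsingular maps and the group\<close>

text \<open>Group and function spaces consist of almost everywhere classes with chosen
  representatives, so the work is done on representatives and carried to classes once. Altering maps
  on null sets is harmless only because every map involved pulls null sets back to null sets. A
  merely measurable map need not pull Lebesgue sets back to Lebesgue sets; until nonsingularity is
  known it is composed with Borel functions only. The complete metric includes the inverses because
  a pointwise limit of surjective isometries need not be surjective. In the Roelcke part, the points
  whose image has small density form a set of small measure, while the image points of large density
  form a set of small measure. This is why the two exceptional ranges are absorbed on opposite
  sides. Transitivity enters because a limit of translates of a point lies again in the orbit, so a
  property of the limit can be moved back to the point itself.\<close>

lemma space_mu [simp]: "space mu = {0..1}"
  by (simp add: mu_def)

lemma sets_mu: "S \<in> sets mu \<longleftrightarrow> S \<subseteq> {0..1} \<and> S \<in> sets lebesgue"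
  unfolding mu_def by (auto simp: sets_restrict_space_iff sets_restrict_space)

interpretation mu: complete_measure mu
  unfolding mu_def
proof
  fix A B :: "real set"
  assume "B \<subseteq> A" "A \<in> null_sets (lebesgue_on {0..1})"
  then have "A \<in> null_sets lebesgue" "A \<subseteq> {0..1}"
    by (auto simp: null_sets_restrict_space dest: null_setsD2 sets.sets_into_space)
  then have "B \<in> null_sets lebesgue" "B \<subseteq> {0..1}"
    using \<open>B \<subseteq> A\<close> null_sets_completion_subset by blast+
  then show "B \<in> sets (lebesgue_on {0..1})"
    by (auto simp: sets_restrict_space_iff)
qed

lemma emeasure_mu_space: "emeasure mu {0..1} = 1"
  unfolding mu_def by (simp add: emeasure_restrict_space)

interpretation mu: finite_measure mu
  by standard (simp add: emeasure_mu_space)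

lemma measure_mu_space [simp]: "measure mu {0..1} = 1"
  by (simp add: measure_def emeasure_mu_space)

lemma borel_measurable_mu: "f \<in> borel_measurable borel \<Longrightarrow> f \<in> borel_measurable mu"
  unfolding mu_def by (simp add: measurable_completion measurable_restrict_space1)

lemma id_measurable_mu: "(\<lambda>x. x) \<in> borel_measurable mu"
  by (rule borel_measurable_mu) simp

lemma measurable_mu_borel: "f \<in> mu \<rightarrow>\<^sub>M mu \<Longrightarrow> f \<in> borel_measurable mu"
  by (rule measurable_compose[OF _ id_measurable_mu])

lemma borel_Int_mu: "S \<in> sets borel \<Longrightarrow> S \<inter> {0..1} \<in> sets mu"
  by (auto simp: sets_mu)

text \<open>Completeness of \<open>mu\<close> enters here: a set that differs from a measurable one
  by a null set is measurable, so maps may be changed on null sets freely.\<close>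

lemma mu_AE_sets: "A \<in> sets mu \<Longrightarrow> B \<subseteq> {0..1} \<Longrightarrow> (AE x in mu. x \<in> A \<longleftrightarrow> x \<in> B) \<Longrightarrow> B \<in> sets mu"
  by (rule mu.in_sets_AE[of A B]) auto

lemma measurable_mu_AE:
  assumes "f \<in> measurable mu M" "AE x in mu. f x = g x" "\<And>x. x \<in> {0..1} \<Longrightarrow> g x \<in> space M"
  shows "g \<in> measurable mu M"
proof (rule measurableI)
  show "x \<in> space mu \<Longrightarrow> g x \<in> space M" for x using assms(3) by simp
  fix A assume A: "A \<in> sets M"
  show "g -` A \<inter> space mu \<in> sets mu"
    by (rule mu_AE_sets[OF measurable_sets[OF assms(1) A]]) (use assms(2) in \<open>auto\<close>)
qed

text \<open>Total self-maps with an almost everywhere inverse replace bijections between conull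
  sets, so that composition and inversion need no bookkeeping of domains. The null set clause lets
  almost everywhere statements be pulled back along either map.\<close>

definition nsp :: "(real \<Rightarrow> real) \<Rightarrow> (real \<Rightarrow> real) \<Rightarrow> bool" where
  "nsp f g \<longleftrightarrow> f \<in> mu \<rightarrow>\<^sub>M mu \<and> g \<in> mu \<rightarrow>\<^sub>M mu \<and>
     (\<forall>N\<in>null_sets mu. f -` N \<inter> space mu \<in> null_sets mu \<and> g -` N \<inter> space mu \<in> null_sets mu) \<and>
     (AE x in mu. g (f x) = x) \<and> (AE x in mu. f (g x) = x)"

lemma nsp_sym: "nsp f g \<Longrightarrow> nsp g f"
  by (auto simp: nsp_def)

lemma nsp_measurable: "nsp f g \<Longrightarrow> f \<in> mu \<rightarrow>\<^sub>M mu" "nsp f g \<Longrightarrow> g \<in> mu \<rightarrow>\<^sub>M mu"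
  by (auto simp: nsp_def)

lemma nsp_borel: "nsp f g \<Longrightarrow> f \<in> borel_measurable mu" "nsp f g \<Longrightarrow> g \<in> borel_measurable mu"
  using nsp_measurable measurable_mu_borel by blast+

lemma nsp_space: "nsp f g \<Longrightarrow> x \<in> {0..1} \<Longrightarrow> f x \<in> {0..1}" "nsp f g \<Longrightarrow> x \<in> {0..1} \<Longrightarrow> g x \<in> {0..1}"
  using measurable_space[OF nsp_measurable(1), of f g x] measurable_space[OF nsp_measurable(2), of f g x]
  by (simp_all del: atLeastAtMost_iff)

lemma nsp_gf: "nsp f g \<Longrightarrow> AE x in mu. g (f x) = x"
  and nsp_fg: "nsp f g \<Longrightarrow> AE x in mu. f (g x) = x"
  by (auto simp: nsp_def)

lemma AE_pullback:
  assumes f: "\<And>N. N \<in> null_sets mu \<Longrightarrow> f -` N \<inter> space mu \<in> null_sets mu" "\<And>x. x \<in> {0..1} \<Longrightarrow> f x \<in> {0..1}"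
    and P: "AE y in mu. P y"
  shows "AE x in mu. P (f x)"
proof -
  from P obtain N where N: "N \<in> null_sets mu" "{y \<in> space mu. \<not> P y} \<subseteq> N"
    unfolding eventually_ae_filter by auto
  show ?thesis
  proof (rule AE_I'[OF f(1)[OF N(1)]], rule subsetI)
    fix x assume "x \<in> {x \<in> space mu. \<not> P (f x)}"
    then have "x \<in> space mu" "f x \<in> {y \<in> space mu. \<not> P y}" using f(2)[of x] by simp_all
    then show "x \<in> f -` N \<inter> space mu" using N(2) by blast
  qed
qed

lemma nsp_AE:
  assumes "nsp f g" "AE y in mu. P y"
  shows "AE x in mu. P (f x)" "AE x in mu. P (g x)"
  using AE_pullback[of f P] AE_pullback[of g P] assms nsp_space[OF assms(1)] by (auto simp: nsp_def)

lemma nsp_AE_iff: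
  assumes "nsp f g"
  shows "(AE x in mu. P (f x)) \<longleftrightarrow> (AE y in mu. P y)"
proof
  assume "AE x in mu. P (f x)"
  from nsp_AE(2)[OF assms this] nsp_fg[OF assms] show "AE y in mu. P y" by eventually_elim auto
qed (rule nsp_AE[OF assms])

lemma nspI:
  assumes "f \<in> mu \<rightarrow>\<^sub>M mu" "g \<in> mu \<rightarrow>\<^sub>M mu"
    and "\<And>N. N \<in> null_sets mu \<Longrightarrow> AE x in mu. f x \<notin> N" "\<And>N. N \<in> null_sets mu \<Longrightarrow> AE x in mu. g x \<notin> N"
    and "AE x in mu. g (f x) = x" "AE x in mu. f (g x) = x"
  shows "nsp f g"
  unfolding nsp_def
proof (intro conjI ballI)
  fix N assume N: "N \<in> null_sets mu"
  show "f -` N \<inter> space mu \<in> null_sets mu"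
    unfolding mu.null_sets_iff_AE using assms(3)[OF N] by auto
  show "g -` N \<inter> space mu \<in> null_sets mu"
    unfolding mu.null_sets_iff_AE using assms(4)[OF N] by auto
qed (use assms in auto)

lemma nsp_null: "nsp f g \<Longrightarrow> N \<in> null_sets mu \<Longrightarrow> AE x in mu. f x \<notin> N"
  using AE_not_in nsp_AE by blast

lemma nsp_id: "nsp (\<lambda>x. x) (\<lambda>x. x)"
  by (rule nspI) (auto intro: AE_not_in)

lemma nsp_comp:
  assumes a: "nsp f g" and b: "nsp f' g'"
  shows "nsp (f \<circ> f') (g' \<circ> g)"
proof (rule nspI)
  show "f \<circ> f' \<in> mu \<rightarrow>\<^sub>M mu" "g' \<circ> g \<in> mu \<rightarrow>\<^sub>M mu"
    using nsp_measurable a b measurable_comp by blast+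
  show "AE x in mu. (f \<circ> f') x \<notin> N" if "N \<in> null_sets mu" for N
    using nsp_AE(1)[OF b nsp_null[OF a that]] by simp
  show "AE x in mu. (g' \<circ> g) x \<notin> N" if "N \<in> null_sets mu" for N
    using nsp_AE(2)[OF a nsp_null[OF nsp_sym[OF b] that]] by simp
  show "AE x in mu. (g' \<circ> g) ((f \<circ> f') x) = x"
    using nsp_AE(1)[OF b nsp_gf[OF a]] nsp_gf[OF b] by eventually_elim simp
  show "AE x in mu. (f \<circ> f') ((g' \<circ> g) x) = x"
    using nsp_AE(2)[OF a nsp_fg[OF b]] nsp_fg[OF a] by eventually_elim simp
qed

text \<open>Almost everywhere \<open>g x = g' (f' (g x)) = g' (f (g x)) = g' x\<close>; each
  equality is a known one pulled back along \<open>g\<close>. Hence the class of a map determines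
  the class of its inverse.\<close>

lemma nsp_inverse_unique:
  assumes a: "nsp f g" and b: "nsp f' g'" and e: "AE x in mu. f x = f' x"
  shows "AE x in mu. g x = g' x"
  using nsp_AE(2)[OF a nsp_gf[OF b]] nsp_AE(2)[OF a e] nsp_fg[OF a]
  by eventually_elim simp

text \<open>The entry point from the given encoding: restrict \<phi> to the chosen conull domain,
  invert it there, and extend both maps to the whole interval.\<close>

lemma autstar_rep_nsp:
  assumes "autstar_rep \<phi>"
  obtains f g where "nsp f g" "AE x in mu. f x = \<phi> x" "AE x in mu. g x = autstar_inv_rep \<phi> x"
proof -
  define A where "A = autstar_dom \<phi>"
  have "\<exists>B. autstar_rep_on \<phi> A B"
    using assms unfolding autstar_rep_def A_def autstar_dom_def by (rule someI_ex)
  then obtain B where B: "autstar_rep_on \<phi> A B" by blast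
  have As: "A \<in> sets mu" "B \<in> sets mu" "A \<subseteq> {0..1}" "B \<subseteq> {0..1}"
    and nA: "{0..1} - A \<in> null_sets mu" and nB: "{0..1} - B \<in> null_sets mu"
    and bij: "bij_betw \<phi> A B"
    and m: "\<And>S. S \<in> sets mu \<Longrightarrow> \<phi> -` S \<inter> A \<in> sets mu" "\<And>S. S \<in> sets mu \<Longrightarrow> \<phi> ` (S \<inter> A) \<in> sets mu"
    and n: "\<And>S. S \<in> null_sets mu \<Longrightarrow> \<phi> -` S \<inter> A \<in> null_sets mu"
           "\<And>S. S \<in> null_sets mu \<Longrightarrow> \<phi> ` (S \<inter> A) \<in> null_sets mu"
    using B sets.sets_into_space[of _ mu] unfolding autstar_rep_on_def space_mu by blast+
  have AEA: "AE x in mu. x \<in> A" "AE x in mu. x \<in> B"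
    using nA nB AE_not_in[OF nA] AE_not_in[OF nB] AE_space[of mu] by auto
  \<comment> \<open>The value 0 off the conull sets is a filler that keeps both maps inside the unit
    interval.\<close>
  define f where "f x = (if x \<in> A then \<phi> x else 0)" for x
  define g where "g = (\<lambda>x. if x \<in> B then inv_into A \<phi> x else 0)"
  have inj: "inj_on \<phi> A" and im: "\<phi> ` A = B" using bij by (auto simp: bij_betw_def)
  have gB: "g y \<in> A" "\<phi> (g y) = y" if "y \<in> B" for y
    using that im inv_into_into[of y \<phi> A] f_inv_into_f[of y \<phi> A] by (auto simp: g_def)
  have gf: "g (\<phi> x) = x" if "x \<in> A" for x
    using that im inj by (auto simp: g_def)
  \<comment> \<open>Preimages under the inverse are images under \<phi>; this is where the
    conditions on images in \<open>autstar_rep_on\<close> are used.\<close>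
  have gim: "g -` S \<inter> B = \<phi> ` (S \<inter> A)" for S
  proof
    show "g -` S \<inter> B \<subseteq> \<phi> ` (S \<inter> A)"
    proof
      fix y assume "y \<in> g -` S \<inter> B"
      then show "y \<in> \<phi> ` (S \<inter> A)" using gB[of y] by (intro image_eqI[of y \<phi> "g y"]) auto
    qed
    show "\<phi> ` (S \<inter> A) \<subseteq> g -` S \<inter> B" using gf im by auto
  qed
  have "nsp f g"
  proof (rule nspI)
    show "f \<in> mu \<rightarrow>\<^sub>M mu"
    proof (rule measurableI)
      show "x \<in> space mu \<Longrightarrow> f x \<in> space mu" for x using im As by (auto simp: f_def)
      fix S assume S: "S \<in> sets mu"
      show "f -` S \<inter> space mu \<in> sets mu"
        by (rule mu_AE_sets[OF m(1)[OF S]]) (use AEA(1) in \<open>auto simp: f_def\<close>)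
    qed
    show "g \<in> mu \<rightarrow>\<^sub>M mu"
    proof (rule measurableI)
      show "x \<in> space mu \<Longrightarrow> g x \<in> space mu" for x using gB[of x] As by (auto simp: g_def)
      fix S assume S: "S \<in> sets mu"
      have "g -` S \<inter> B \<in> sets mu" using m(2)[OF S] gim by simp
      then show "g -` S \<inter> space mu \<in> sets mu"
        by (rule mu_AE_sets) (use AEA(2) in \<open>auto\<close>)
    qed
    fix N assume N: "N \<in> null_sets mu"
    show "AE x in mu. f x \<notin> N"
      using AE_not_in[OF n(1)[OF N]] AEA(1) by eventually_elim (auto simp: f_def)
    have "g -` N \<inter> B \<in> null_sets mu" using n(2)[OF N] gim by simp
    from AE_not_in[OF this] show "AE x in mu. g x \<notin> N"
      using AEA(2) by eventually_elim auto
  next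
    show "AE x in mu. g (f x) = x" using AEA(1) by eventually_elim (auto simp: f_def gf)
    show "AE x in mu. f (g x) = x" using AEA(2) by eventually_elim (auto simp: f_def gB)
  qed
  moreover have "AE x in mu. f x = \<phi> x" using AEA(1) by eventually_elim (auto simp: f_def)
  moreover have "AE x in mu. g x = autstar_inv_rep \<phi> x"
    using AEA(2) by eventually_elim (auto simp: g_def autstar_inv_rep_def A_def)
  ultimately show ?thesis by (rule that)
qed

text \<open>The sets where \<open>g \<circ> f\<close> and \<open>f \<circ> g\<close> are the
  identity are conull, and between them \<open>f\<close> is a genuine bijection with inverse
  \<open>g\<close>. Images under \<open>f\<close> are therefore preimages under
  \<open>g\<close>.\<close>

lemma nsp_autstar_rep:
  assumes "nsp f g"
  shows "autstar_rep f"
proof -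
  have gf: "(\<lambda>x. g (f x)) \<in> borel_measurable mu" and fg: "(\<lambda>x. f (g x)) \<in> borel_measurable mu"
    using nsp_measurable[OF assms] measurable_mu_borel measurable_compose by blast+
  define A where "A = {x \<in> space mu. g (f x) = x}"
  define B where "B = {x \<in> space mu. f (g x) = x}"
  have AB: "A \<in> sets mu" "B \<in> sets mu" unfolding A_def B_def using gf fg id_measurable_mu by measurable
  have nul: "space mu - A \<in> null_sets mu" "space mu - B \<in> null_sets mu"
    using nsp_gf[OF assms] nsp_fg[OF assms] unfolding A_def B_def mu.null_sets_iff_AE by auto
  have bij: "bij_betw f A B"
  proof (rule bij_betw_byWitness[where f' = g])
    show "f ` A \<subseteq> B" "g ` B \<subseteq> A" using nsp_space[OF assms] unfolding A_def B_def space_mu by (auto simp del: atLeastAtMost_iff)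
  qed (simp_all add: A_def B_def)
  have im: "f ` (S \<inter> A) = (g -` S \<inter> space mu) \<inter> B" for S
  proof
    show "f ` (S \<inter> A) \<subseteq> (g -` S \<inter> space mu) \<inter> B"
      using nsp_space(1)[OF assms] unfolding A_def B_def space_mu by (auto simp del: atLeastAtMost_iff)
    show "(g -` S \<inter> space mu) \<inter> B \<subseteq> f ` (S \<inter> A)"
    proof
      fix y assume "y \<in> (g -` S \<inter> space mu) \<inter> B"
      then show "y \<in> f ` (S \<inter> A)"
        using nsp_space(2)[OF assms] unfolding A_def B_def space_mu
        by (intro image_eqI[of y f "g y"]) (auto simp del: atLeastAtMost_iff)
    qed
  qed
  have pre: "f -` S \<inter> A = (f -` S \<inter> space mu) \<inter> A" for S by (auto simp: A_def)
  have "autstar_rep_on f A B"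
    unfolding autstar_rep_on_def im pre
  proof (intro conjI ballI)
    fix S assume S: "S \<in> sets mu"
    show "f -` S \<inter> space mu \<inter> A \<in> sets mu" using measurable_sets[OF nsp_measurable(1)[OF assms] S] AB by auto
    show "g -` S \<inter> space mu \<inter> B \<in> sets mu" using measurable_sets[OF nsp_measurable(2)[OF assms] S] AB by auto
  next
    fix S assume S: "S \<in> null_sets mu"
    then have "f -` S \<inter> space mu \<in> null_sets mu" "g -` S \<inter> space mu \<in> null_sets mu"
      using assms by (auto simp: nsp_def)
    then show "f -` S \<inter> space mu \<inter> A \<in> null_sets mu" "g -` S \<inter> space mu \<inter> B \<in> null_sets mu"
      using AB by (auto intro: null_set_Int2 null_set_Int1)
  qed (use AB nul bij in auto)
  then show ?thesis unfolding autstar_rep_def by blast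
qed

lemma autstar_class_eqI: "AE x in mu. f x = g x \<Longrightarrow> autstar_class f = autstar_class g"
  unfolding autstar_class_def
  by (rule Collect_cong) (auto elim: eventually_elim2)

lemma AutStar_nsp:
  assumes "C \<in> AutStar"
  obtains f g where "nsp f g" "C = autstar_class f"
proof -
  obtain \<phi> where "autstar_rep \<phi>" and C: "C = autstar_class \<phi>" using assms by (auto simp: AutStar_def)
  then obtain f g where "nsp f g" "AE x in mu. f x = \<phi> x" by (metis autstar_rep_nsp)
  then show ?thesis using that C autstar_class_eqI by metis
qed

lemma nsp_AutStar: "nsp f g \<Longrightarrow> autstar_class f \<in> AutStar"
  using nsp_autstar_rep by (auto simp: AutStar_def)

lemma arep_class:
  assumes "nsp f g"
  shows "autstar_rep (arep (autstar_class f))" "AE x in mu. arep (autstar_class f) x = f x"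
proof -
  have "f \<in> autstar_class f" using nsp_autstar_rep[OF assms] by (simp add: autstar_class_def)
  then have "arep (autstar_class f) \<in> autstar_class f" unfolding arep_def by (rule someI[of "\<lambda>\<phi>. \<phi> \<in> autstar_class f"])
  then show "autstar_rep (arep (autstar_class f))" "AE x in mu. arep (autstar_class f) x = f x"
    by (auto simp: autstar_class_def)
qed

text \<open>The domain on which the representative is inverted comes from a choice; by uniqueness of
  almost everywhere inverses the choice affects only a null set.\<close>

lemma autstar_inv_rep_AE:
  assumes "nsp f g" "autstar_rep \<phi>" "AE x in mu. \<phi> x = f x"
  shows "AE x in mu. autstar_inv_rep \<phi> x = g x"
proof -
  obtain f' g' where a: "nsp f' g'" "AE x in mu. f' x = \<phi> x" "AE x in mu. g' x = autstar_inv_rep \<phi> x"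
    using autstar_rep_nsp[OF assms(2)] by blast
  have "AE x in mu. f' x = f x" using a(2) assms(3) by eventually_elim simp
  from nsp_inverse_unique[OF a(1) assms(1) this] a(3) show ?thesis by eventually_elim simp
qed

lemma autstar_mult_class:
  assumes "nsp f g" "nsp f' g'"
  shows "autstar_mult (autstar_class f) (autstar_class f') = autstar_class (f \<circ> f')"
  unfolding autstar_mult_def
proof (rule autstar_class_eqI)
  show "AE x in mu. (arep (autstar_class f) \<circ> arep (autstar_class f')) x = (f \<circ> f') x"
    using nsp_AE(1)[OF assms(2) arep_class(2)[OF assms(1)]] arep_class(2)[OF assms(2)]
    by eventually_elim simp
qed

lemma autstar_inverse_class:
  assumes "nsp f g"
  shows "autstar_inverse (autstar_class f) = autstar_class g"
  unfolding autstar_inverse_def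
  by (rule autstar_class_eqI) (rule autstar_inv_rep_AE[OF assms arep_class[OF assms]])

lemma autstar_one_class: "autstar_one = autstar_class (\<lambda>x. x)"
  by (simp add: autstar_one_def id_def)

text \<open>With \<open>F = k \<circ> f\<close> the identity says that \<open>w\<close> is the
  density of the image measure of \<open>mu\<close> under \<open>f\<close>. Stated through the
  inverse \<open>g\<close> it is a change of variables in the form in which the action uses it.
  Nonnegativity is demanded at every point so that powers of \<open>w\<close> multiply without
  exceptional sets.\<close>

definition nst :: "(real \<Rightarrow> real) \<Rightarrow> (real \<Rightarrow> real) \<Rightarrow> (real \<Rightarrow> real) \<Rightarrow> bool" where
  "nst f g w \<longleftrightarrow> nsp f g \<and> w \<in> borel_measurable mu \<and> (\<forall>x. 0 \<le> w x) \<and>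
     (\<forall>F\<in>borel_measurable mu. (\<integral>\<^sup>+x. ennreal (w x) * F (g x) \<partial>mu) = (\<integral>\<^sup>+x. F x \<partial>mu))"

definition rnd :: "(real \<Rightarrow> real) \<Rightarrow> real \<Rightarrow> real" where
  "rnd f x = enn2real (RN_deriv mu (distr mu mu f) x)"

lemma distr_cong_mu:
  assumes "f \<in> mu \<rightarrow>\<^sub>M mu" "AE x in mu. f x = \<phi> x"
  shows "distr mu mu \<phi> = distr mu mu f"
  unfolding distr_def
proof (rule measure_of_eq)
  show "sets mu \<subseteq> Pow (space mu)" by (rule sets.space_closed)
  fix S assume "S \<in> sigma_sets (space mu) (sets mu)"
  then have S: "S \<in> sets mu" unfolding sets.sigma_sets_eq .
  have m: "f -` S \<inter> space mu \<in> sets mu" using measurable_sets[OF assms(1) S] .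
  have e: "AE x in mu. x \<in> f -` S \<inter> space mu \<longleftrightarrow> x \<in> \<phi> -` S \<inter> space mu"
    using assms(2) by eventually_elim auto
  have "\<phi> -` S \<inter> space mu \<in> sets mu" by (rule mu_AE_sets[OF m _ e]) auto
  then show "emeasure mu (\<phi> -` S \<inter> space mu) = emeasure mu (f -` S \<inter> space mu)"
    using m e by (intro emeasure_eq_AE) auto
qed

lemma rnd_cong:
  assumes "f \<in> mu \<rightarrow>\<^sub>M mu" "AE x in mu. f x = \<phi> x"
  shows "rnd \<phi> = rnd f"
  using distr_cong_mu[OF assms] by (auto simp: rnd_def)

text \<open>The image measure is absolutely continuous since \<open>f\<close> pulls null sets back
  to null sets, and it is finite, so its derivative is finite almost everywhere and
  \<open>enn2real\<close> loses nothing. Integrating \<open>F \<circ> g\<close> against it gives the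
  integral of \<open>F \<circ> g \<circ> f\<close>, which is that of \<open>F\<close>.\<close>

lemma nst_rnd:
  assumes "nsp f g"
  shows "nst f g (rnd f)"
proof -
  have f [measurable]: "f \<in> mu \<rightarrow>\<^sub>M mu" and g [measurable]: "g \<in> mu \<rightarrow>\<^sub>M mu" using nsp_measurable[OF assms] by auto
  let ?N = "distr mu mu f"
  have ac: "absolutely_continuous mu ?N"
    unfolding absolutely_continuous_def
  proof
    fix N assume N: "N \<in> null_sets mu"
    then have "f -` N \<inter> space mu \<in> null_sets mu" using assms by (auto simp: nsp_def)
    then show "N \<in> null_sets ?N" using N by (auto simp: null_sets_def emeasure_distr[OF f])
  qed
  interpret N: finite_measure ?N by (rule mu.finite_measure_distr[OF f])
  have fin: "AE x in mu. RN_deriv mu ?N x \<noteq> \<infinity>"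
    by (rule mu.RN_deriv_finite[OF N.sigma_finite_measure_axioms ac]) simp
  then have e: "AE x in mu. ennreal (rnd f x) = RN_deriv mu ?N x"
    by eventually_elim (auto simp: rnd_def top.not_eq_extremum)
  have d: "density mu (RN_deriv mu ?N) = ?N" by (rule mu.density_RN_deriv[OF ac]) simp
  have "(\<integral>\<^sup>+x. ennreal (rnd f x) * F (g x) \<partial>mu) = (\<integral>\<^sup>+x. F x \<partial>mu)" if F [measurable]: "F \<in> borel_measurable mu" for F
  proof -
    have "(\<integral>\<^sup>+x. ennreal (rnd f x) * F (g x) \<partial>mu) = (\<integral>\<^sup>+x. RN_deriv mu ?N x * F (g x) \<partial>mu)"
      by (rule nn_integral_cong_AE) (use e in \<open>eventually_elim, simp\<close>)
    also have "\<dots> = (\<integral>\<^sup>+x. F (g x) \<partial>density mu (RN_deriv mu ?N))"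
      by (rule nn_integral_density[symmetric]) measurable
    also have "\<dots> = (\<integral>\<^sup>+x. F (g (f x)) \<partial>mu)"
      unfolding d by (rule nn_integral_distr) measurable
    also have "\<dots> = (\<integral>\<^sup>+x. F x \<partial>mu)"
      by (rule nn_integral_cong_AE) (use nsp_gf[OF assms] in \<open>eventually_elim, simp\<close>)
    finally show ?thesis .
  qed
  moreover have "rnd f \<in> borel_measurable mu" unfolding rnd_def[abs_def] by measurable
  ultimately show ?thesis using assms by (simp add: nst_def) (simp add: rnd_def)
qed

lemma nst_nsp: "nst f g w \<Longrightarrow> nsp f g"
  and nst_borel: "nst f g w \<Longrightarrow> w \<in> borel_measurable mu"
  and nst_nonneg: "nst f g w \<Longrightarrow> 0 \<le> w x"
  and nst_nn_integral: "nst f g w \<Longrightarrow> F \<in> borel_measurable mu \<Longrightarrow> (\<integral>\<^sup>+x. ennreal (w x) * F (g x) \<partial>mu) = (\<integral>\<^sup>+x. F x \<partial>mu)"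
  by (auto simp: nst_def)

lemma AutStar_nst:
  assumes "C \<in> AutStar"
  obtains f g w where "nst f g w" "C = autstar_class f"
  using assms AutStar_nsp nst_rnd by metis

text \<open>Testing with the indicator of a set composed with \<open>f\<close> returns the indicator
  after composing with \<open>g\<close>; so both densities have the same integral over every
  measurable set.\<close>

lemma nst_unique:
  assumes a: "nst f g w" and b: "nst f' g' w'" and e: "AE x in mu. f x = f' x"
  shows "AE x in mu. w x = w' x"
proof -
  note na = nst_nsp[OF a] and nb = nst_nsp[OF b]
  have [measurable]: "f \<in> mu \<rightarrow>\<^sub>M mu" "g \<in> mu \<rightarrow>\<^sub>M mu" "w \<in> borel_measurable mu" "w' \<in> borel_measurable mu"
    using nsp_measurable[OF na] nst_borel a b by auto
  have g: "AE x in mu. g x = g' x" by (rule nsp_inverse_unique[OF na nb e])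
  have eq: "emeasure (density mu w) S = emeasure (density mu w') S" if S [measurable]: "S \<in> sets mu" for S
  proof -
    let ?F = "\<lambda>x. indicator S (f x) :: ennreal"
    have [measurable]: "?F \<in> borel_measurable mu" by measurable
    have "emeasure (density mu w) S = (\<integral>\<^sup>+x. ennreal (w x) * ?F (g x) \<partial>mu)"
      by (subst emeasure_density) (auto intro!: nn_integral_cong_AE eventually_mono[OF nsp_fg[OF na]])
    also have "\<dots> = (\<integral>\<^sup>+x. ennreal (w' x) * ?F (g' x) \<partial>mu)"
      using nst_nn_integral[OF a, of ?F] nst_nn_integral[OF b, of ?F] by simp
    also have "\<dots> = emeasure (density mu w') S"
      using nsp_fg[OF na] g by (subst emeasure_density) (auto intro!: nn_integral_cong_AE elim!: AE_mp)
    finally show ?thesis .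
  qed
  have "density mu w = density mu w'"
    by (rule measure_eqI) (use eq in auto)
  then have "AE x in mu. ennreal (w x) = ennreal (w' x)"
    by (subst (asm) mu.density_unique_iff) auto
  then show ?thesis using nst_nonneg[OF a] nst_nonneg[OF b] by simp
qed

text \<open>Test with the indicator of the zero set of \<open>w \<circ> f\<close>: the weighted
  integral vanishes, so \<open>w \<circ> f\<close> is almost everywhere nonzero, and this transfers
  to \<open>w\<close>.\<close>

lemma nst_pos:
  assumes a: "nst f g w"
  shows "AE x in mu. 0 < w x"
proof -
  note na = nst_nsp[OF a]
  have [measurable]: "f \<in> mu \<rightarrow>\<^sub>M mu" "g \<in> mu \<rightarrow>\<^sub>M mu" "w \<in> borel_measurable mu"
    using nsp_measurable[OF na] nst_borel a by auto
  let ?F = "\<lambda>x. indicator {0} (w (f x)) :: ennreal"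
  have "(\<integral>\<^sup>+x. ?F x \<partial>mu) = (\<integral>\<^sup>+x. ennreal (w x) * ?F (g x) \<partial>mu)"
    by (rule nst_nn_integral[OF a, symmetric]) measurable
  also have "\<dots> = (\<integral>\<^sup>+x. 0 \<partial>mu)"
    by (rule nn_integral_cong_AE) (use nsp_fg[OF na] in \<open>eventually_elim, auto simp: indicator_def\<close>)
  finally have "(\<integral>\<^sup>+x. ?F x \<partial>mu) = 0" by simp
  then have "AE x in mu. ?F x = 0" by (subst (asm) nn_integral_0_iff_AE) auto
  then have "AE x in mu. w (f x) \<noteq> 0" by eventually_elim (auto simp: indicator_def)
  then have "AE x in mu. w x \<noteq> 0" using nsp_AE_iff[OF na, of "\<lambda>x. w x \<noteq> 0"] by simp
  then show ?thesis using nst_nonneg[OF a] by (simp add: order.strict_iff_order)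
qed

lemma nst_id: "nst (\<lambda>x. x) (\<lambda>x. x) (\<lambda>x. 1)"
  by (simp add: nst_def nsp_id)

lemma nst_comp:
  assumes a: "nst f g w" and b: "nst f' g' w'"
  shows "nst (f \<circ> f') (g' \<circ> g) (\<lambda>x. w x * w' (g x))"
proof -
  note na = nst_nsp[OF a] and nb = nst_nsp[OF b]
  have [measurable]: "g \<in> mu \<rightarrow>\<^sub>M mu" "g' \<in> mu \<rightarrow>\<^sub>M mu" "w \<in> borel_measurable mu" "w' \<in> borel_measurable mu"
    using nsp_measurable na nb nst_borel a b by auto
  have "(\<integral>\<^sup>+x. ennreal (w x * w' (g x)) * F ((g' \<circ> g) x) \<partial>mu) = (\<integral>\<^sup>+x. F x \<partial>mu)"
    if [measurable]: "F \<in> borel_measurable mu" for F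
  proof -
    have "(\<integral>\<^sup>+x. ennreal (w x * w' (g x)) * F ((g' \<circ> g) x) \<partial>mu)
      = (\<integral>\<^sup>+x. ennreal (w x) * (ennreal (w' (g x)) * F (g' (g x))) \<partial>mu)"
      using nst_nonneg[OF a] nst_nonneg[OF b] by (simp add: ennreal_mult mult.assoc)
    also have "\<dots> = (\<integral>\<^sup>+x. ennreal (w' x) * F (g' x) \<partial>mu)"
      by (rule nst_nn_integral[OF a, where F = "\<lambda>x. ennreal (w' x) * F (g' x)"]) measurable
    also have "\<dots> = (\<integral>\<^sup>+x. F x \<partial>mu)" by (rule nst_nn_integral[OF b]) measurable
    finally show ?thesis .
  qed
  then show ?thesis
    using nsp_comp[OF na nb] nst_nonneg[OF a] nst_nonneg[OF b] by (simp add: nst_def)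
qed

text \<open>Apply the change of variables to \<open>F (f x) / w (f x)\<close>; after composing with
  \<open>g\<close> the weight cancels, by positivity of \<open>w\<close>.\<close>

lemma nst_inverse:
  assumes a: "nst f g w"
  shows "nst g f (\<lambda>x. 1 / w (f x))"
proof -
  note na = nst_nsp[OF a]
  have [measurable]: "f \<in> mu \<rightarrow>\<^sub>M mu" "g \<in> mu \<rightarrow>\<^sub>M mu" "w \<in> borel_measurable mu"
    using nsp_measurable[OF na] nst_borel a by auto
  have "(\<integral>\<^sup>+x. ennreal (1 / w (f x)) * F (f x) \<partial>mu) = (\<integral>\<^sup>+x. F x \<partial>mu)"
    if [measurable]: "F \<in> borel_measurable mu" for F
  proof -
    have "(\<integral>\<^sup>+x. ennreal (1 / w (f x)) * F (f x) \<partial>mu)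
        = (\<integral>\<^sup>+x. ennreal (w x) * (ennreal (1 / w (f (g x))) * F (f (g x))) \<partial>mu)"
      by (rule nst_nn_integral[OF a, where F="\<lambda>x. ennreal (1 / w (f x)) * F (f x)", symmetric]) measurable
    also have "\<dots> = (\<integral>\<^sup>+x. F x \<partial>mu)"
    proof (rule nn_integral_cong_AE)
      show "AE x in mu. ennreal (w x) * (ennreal (1 / w (f (g x))) * F (f (g x))) = F x"
        using nsp_fg[OF na] nst_pos[OF a]
      proof eventually_elim
        case (elim x)
        have "ennreal (w x) * ennreal (1 / w x) = 1"
          using elim by (simp add: ennreal_mult[symmetric])
        then show ?case using elim by (simp add: mult.assoc[symmetric])
      qed
    qed
    finally show ?thesis .
  qed
  then show ?thesis using nsp_sym[OF na] nst_nonneg[OF a] by (simp add: nst_def)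
qed

lemma nst_integral:
  fixes K :: "real \<Rightarrow> real"
  assumes a: "nst f g w" and K [measurable]: "K \<in> borel_measurable mu"
  shows "integrable mu (\<lambda>x. w x * K (g x)) \<longleftrightarrow> integrable mu K"
    and "(\<integral>x. w x * K (g x) \<partial>mu) = (\<integral>x. K x \<partial>mu)"
proof -
  have [measurable]: "g \<in> mu \<rightarrow>\<^sub>M mu" "w \<in> borel_measurable mu"
    using nsp_measurable[OF nst_nsp[OF a]] nst_borel a by auto
  \<comment> \<open>The signs \<open>s = 1\<close> and \<open>s = -1\<close> give the positive and
    the negative part, from which the real integral is assembled.\<close>
  have e: "(\<integral>\<^sup>+x. ennreal (s * (w x * K (g x))) \<partial>mu) = (\<integral>\<^sup>+x. ennreal (s * K x) \<partial>mu)" for s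
  proof -
    have "(\<integral>\<^sup>+x. ennreal (s * (w x * K (g x))) \<partial>mu) = (\<integral>\<^sup>+x. ennreal (w x) * ennreal (s * K (g x)) \<partial>mu)"
      using nst_nonneg[OF a] by (intro nn_integral_cong) (simp add: ennreal_mult'[symmetric] mult_ac)
    also have "\<dots> = (\<integral>\<^sup>+x. ennreal (s * K x) \<partial>mu)"
      by (rule nst_nn_integral[OF a, of "\<lambda>x. ennreal (s * K x)"]) measurable
    finally show ?thesis .
  qed
  have n: "(\<integral>\<^sup>+x. ennreal (norm (w x * K (g x))) \<partial>mu) = (\<integral>\<^sup>+x. ennreal (norm (K x)) \<partial>mu)"
  proof -
    have "(\<integral>\<^sup>+x. ennreal (norm (w x * K (g x))) \<partial>mu) = (\<integral>\<^sup>+x. ennreal (w x) * ennreal (norm (K (g x))) \<partial>mu)"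
      using nst_nonneg[OF a] by (intro nn_integral_cong) (simp add: ennreal_mult'[symmetric] abs_mult)
    also have "\<dots> = (\<integral>\<^sup>+x. ennreal (norm (K x)) \<partial>mu)"
      by (rule nst_nn_integral[OF a, of "\<lambda>x. ennreal (norm (K x))"]) measurable
    finally show ?thesis .
  qed
  show i: "integrable mu (\<lambda>x. w x * K (g x)) \<longleftrightarrow> integrable mu K"
    unfolding integrable_iff_bounded n by simp
  show "(\<integral>x. w x * K (g x) \<partial>mu) = (\<integral>x. K x \<partial>mu)"
  proof (cases "integrable mu K")
    case True
    then show ?thesis using i e[of 1] e[of "-1"] by (simp add: real_lebesgue_integral_def)
  next
    case False
    then show ?thesis using i by (simp add: not_integrable_integral_eq)
  qed
qed

section \<open>The action on Lebesgue spaces\<close>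

definition nrm :: "real \<Rightarrow> (real \<Rightarrow> real) \<Rightarrow> real" where
  "nrm p f = (\<integral>x. \<bar>f x\<bar> powr p \<partial>mu) powr (1 / p)"

lemma Lp_rep_borel [measurable_dest]: "f \<in> Lp_rep p \<Longrightarrow> f \<in> borel_measurable mu"
  and Lp_rep_integrable: "f \<in> Lp_rep p \<Longrightarrow> integrable mu (\<lambda>x. \<bar>f x\<bar> powr p)"
  by (auto simp: Lp_rep_def)

lemma Lp_rep_dominated:
  assumes "0 \<le> p" "w \<in> Lp_rep p" "g \<in> borel_measurable mu" "AE x in mu. \<bar>g x\<bar> \<le> \<bar>w x\<bar>"
  shows "g \<in> Lp_rep p"
proof -
  note [measurable] = assms(3)
  have "integrable mu (\<lambda>x. \<bar>g x\<bar> powr p)"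
  proof (rule Bochner_Integration.integrable_bound[OF Lp_rep_integrable[OF assms(2)]])
    show "AE x in mu. norm (\<bar>g x\<bar> powr p) \<le> norm (\<bar>w x\<bar> powr p)"
      using assms(4) by eventually_elim (use assms(1) in \<open>simp add: powr_mono2\<close>)
  qed measurable
  then show ?thesis using assms by (simp add: Lp_rep_def)
qed

lemma Lp_rep_const: "(\<lambda>x. c) \<in> Lp_rep p"
  by (simp add: Lp_rep_def)

lemma Lp_rep_bounded:
  assumes "0 \<le> p" "f \<in> borel_measurable mu" "AE x in mu. \<bar>f x\<bar> \<le> c"
  shows "f \<in> Lp_rep p"
  by (rule Lp_rep_dominated[OF assms(1) Lp_rep_const[of c] assms(2)]) (use assms(3) in auto)

lemma Lp_rep_id: "0 \<le> p \<Longrightarrow> (\<lambda>x. x) \<in> Lp_rep p"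
  by (rule Lp_rep_bounded[of _ _ 1]) (auto intro!: AE_I2 id_measurable_mu)

lemma Lp_rep_scale: "f \<in> Lp_rep p \<Longrightarrow> (\<lambda>x. c * f x) \<in> Lp_rep p"
  unfolding Lp_rep_def by (auto simp: abs_mult powr_mult)

lemma Lp_rep_abs: "f \<in> Lp_rep p \<Longrightarrow> (\<lambda>x. \<bar>f x\<bar>) \<in> Lp_rep p"
  unfolding Lp_rep_def by auto

lemma powr_add_le:
  fixes a b p :: real
  assumes "0 \<le> p" "0 \<le> a" "0 \<le> b"
  shows "(a + b) powr p \<le> 2 powr p * (a powr p + b powr p)"
proof -
  have "(a + b) powr p \<le> (2 * max a b) powr p" using assms by (intro powr_mono2) auto
  also have "\<dots> = 2 powr p * max a b powr p" using assms by (simp add: powr_mult)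
  also have "\<dots> \<le> 2 powr p * (a powr p + b powr p)"
    using assms by (intro mult_left_mono) (auto simp: max_def)
  finally show ?thesis .
qed

lemma Lp_rep_add:
  assumes "0 \<le> p" "f \<in> Lp_rep p" "g \<in> Lp_rep p"
  shows "(\<lambda>x. f x + g x) \<in> Lp_rep p"
proof -
  note [measurable] = assms(2,3)[THEN Lp_rep_borel]
  have "integrable mu (\<lambda>x. 2 powr p * (\<bar>f x\<bar> powr p + \<bar>g x\<bar> powr p))"
    using assms by (auto intro: Lp_rep_integrable)
  then have "integrable mu (\<lambda>x. \<bar>f x + g x\<bar> powr p)"
  proof (rule Bochner_Integration.integrable_bound)
    show "AE x in mu. norm (\<bar>f x + g x\<bar> powr p) \<le> norm (2 powr p * (\<bar>f x\<bar> powr p + \<bar>g x\<bar> powr p))"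
    proof (intro AE_I2)
      fix x
      have "\<bar>f x + g x\<bar> powr p \<le> (\<bar>f x\<bar> + \<bar>g x\<bar>) powr p" using assms(1) by (intro powr_mono2) auto
      also have "\<dots> \<le> 2 powr p * (\<bar>f x\<bar> powr p + \<bar>g x\<bar> powr p)"
        using assms(1) by (rule powr_add_le) auto
      finally show "norm (\<bar>f x + g x\<bar> powr p) \<le> norm (2 powr p * (\<bar>f x\<bar> powr p + \<bar>g x\<bar> powr p))" by simp
    qed
  qed measurable
  then show ?thesis by (simp add: Lp_rep_def)
qed

lemma Lp_rep_diff:
  assumes "0 \<le> p" "f \<in> Lp_rep p" "g \<in> Lp_rep p"
  shows "(\<lambda>x. f x - g x) \<in> Lp_rep p"
  using Lp_rep_add[OF assms(1,2) Lp_rep_scale[OF assms(3), of "-1"]] by simp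

lemma Lp_rep_max:
  assumes "0 \<le> p" "f \<in> Lp_rep p" "g \<in> Lp_rep p"
  shows "(\<lambda>x. max (f x) (g x)) \<in> Lp_rep p"
proof (rule Lp_rep_dominated[OF assms(1) Lp_rep_add[OF assms(1) assms(2,3)[THEN Lp_rep_abs]]])
  show "(\<lambda>x. max (f x) (g x)) \<in> borel_measurable mu" using assms(2,3)[THEN Lp_rep_borel] by measurable
qed auto

lemma Lp_rep_min:
  assumes "0 \<le> p" "f \<in> Lp_rep p" "g \<in> Lp_rep p"
  shows "(\<lambda>x. min (f x) (g x)) \<in> Lp_rep p"
proof (rule Lp_rep_dominated[OF assms(1) Lp_rep_add[OF assms(1) assms(2,3)[THEN Lp_rep_abs]]])
  show "(\<lambda>x. min (f x) (g x)) \<in> borel_measurable mu" using assms(2,3)[THEN Lp_rep_borel] by measurable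
qed auto

section \<open>The \<open>p\<close>-norm and Minkowski's inequality\<close>

lemma nrm_nonneg: "0 \<le> nrm p f"
  by (simp add: nrm_def)

lemma nrm_cong_AE:
  assumes "f \<in> borel_measurable mu" "AE x in mu. f x = g x"
  shows "nrm p f = nrm p g"
proof -
  have "g \<in> borel_measurable mu" by (rule measurable_mu_AE[OF assms]) auto
  then have "(\<integral>x. \<bar>f x\<bar> powr p \<partial>mu) = (\<integral>x. \<bar>g x\<bar> powr p \<partial>mu)"
    using assms by (intro integral_cong_AE) auto
  then show ?thesis by (simp add: nrm_def)
qed

lemma nrm_powr: "0 < p \<Longrightarrow> nrm p f powr p = (\<integral>x. \<bar>f x\<bar> powr p \<partial>mu)"
  by (simp add: nrm_def powr_powr)

lemma nrm_1: "nrm 1 f = (\<integral>x. \<bar>f x\<bar> \<partial>mu)"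
  by (simp add: nrm_def)

lemma nrm_scale:
  assumes "0 < p"
  shows "nrm p (\<lambda>x. c * f x) = \<bar>c\<bar> * nrm p f"
  unfolding nrm_def using assms by (simp add: abs_mult powr_mult powr_powr)

lemma nrm_minus_commute: "nrm p (\<lambda>x. f x - g x) = nrm p (\<lambda>x. g x - f x)"
  by (simp add: nrm_def abs_minus_commute)

lemma nrm_eq_0_iff:
  assumes "0 < p" "f \<in> Lp_rep p"
  shows "nrm p f = 0 \<longleftrightarrow> (AE x in mu. f x = 0)"
proof -
  have "nrm p f = 0 \<longleftrightarrow> (\<integral>x. \<bar>f x\<bar> powr p \<partial>mu) = 0" using assms by (simp add: nrm_def)
  also have "\<dots> \<longleftrightarrow> (AE x in mu. \<bar>f x\<bar> powr p = 0)"
    by (rule integral_nonneg_eq_0_iff_AE[OF Lp_rep_integrable[OF assms(2)]]) simp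
  finally show ?thesis by simp
qed

lemma nrm_mono:
  assumes "0 < p" "g \<in> Lp_rep p" "f \<in> borel_measurable mu" "AE x in mu. \<bar>f x\<bar> \<le> \<bar>g x\<bar>"
  shows "nrm p f \<le> nrm p g"
proof -
  have "f \<in> Lp_rep p" by (rule Lp_rep_dominated[OF _ assms(2-4)]) (use assms(1) in simp)
  moreover have "AE x in mu. \<bar>f x\<bar> powr p \<le> \<bar>g x\<bar> powr p"
    using assms(4) by eventually_elim (use assms(1) in \<open>simp add: powr_mono2\<close>)
  ultimately have "(\<integral>x. \<bar>f x\<bar> powr p \<partial>mu) \<le> (\<integral>x. \<bar>g x\<bar> powr p \<partial>mu)"
    using assms(2) by (intro integral_mono_AE Lp_rep_integrable)
  then show ?thesis unfolding nrm_def using assms by (intro powr_mono2) auto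
qed

text \<open>Convexity of the power function including the end point 0, where it amounts to
  \<open>s powr p \<le> s\<close> for \<open>s\<close> between 0 and 1.\<close>

lemma powr_convex_comb:
  fixes p t x y :: real
  assumes "1 \<le> p" "0 \<le> t" "t \<le> 1" "0 \<le> x" "0 \<le> y"
  shows "(t * x + (1 - t) * y) powr p \<le> t * x powr p + (1 - t) * y powr p"
proof -
  have le: "s powr p \<le> s" if "0 \<le> s" "s \<le> 1" for s
    using powr_mono'[OF assms(1) that] that by simp
  consider "x = 0" | "y = 0" | "x > 0" "y > 0" using assms by linarith
  then show ?thesis
  proof cases
    case 1
    then show ?thesis using le[of "1 - t"] assms by (auto simp: powr_mult intro: mult_right_mono)
  next
    case 2
    then show ?thesis using le[of t] assms by (auto simp: powr_mult intro: mult_right_mono)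
  next
    case 3
    then show ?thesis
      using convex_onD[OF powr_convex[OF assms(1)], of "1 - t" x y] assms by simp
  qed
qed

text \<open>Minkowski's inequality by convexity instead of Hoelder: both functions are normalised
  and the convexity inequality is integrated pointwise. If one norm is 0 the function vanishes
  almost everywhere.\<close>

lemma nrm_triangle:
  assumes p: "1 \<le> p" and fg: "f \<in> Lp_rep p" "g \<in> Lp_rep p"
  shows "nrm p (\<lambda>x. f x + g x) \<le> nrm p f + nrm p g"
proof -
  note [measurable] = fg[THEN Lp_rep_borel]
  define a where "a = nrm p f"
  define b where "b = nrm p g"
  have ab: "0 \<le> a" "0 \<le> b" by (auto simp: a_def b_def nrm_nonneg)
  consider "a = 0" | "b = 0" | "a > 0" "b > 0" using ab by linarith
  then show ?thesis
  proof cases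
    case 1
    then have "AE x in mu. f x = 0" using nrm_eq_0_iff[of p f] p fg by (simp add: a_def)
    then have "nrm p (\<lambda>x. f x + g x) = nrm p g" by (intro nrm_cong_AE) auto
    then show ?thesis using ab by (simp add: a_def)
  next
    case 2
    then have "AE x in mu. g x = 0" using nrm_eq_0_iff[of p g] p fg by (simp add: b_def)
    then have "nrm p (\<lambda>x. f x + g x) = nrm p f" by (intro nrm_cong_AE) auto
    then show ?thesis using ab by (simp add: b_def)
  next
    case 3
    \<comment> \<open>The weights are proportional to the norms, so
      \<open>(\<bar>f x\<bar> + \<bar>g x\<bar>) / (a + b)\<close> is the convex combination, with
      weights \<open>t\<close> and \<open>1 - t\<close>, of two functions of norm 1.\<close>
    define t where "t = a / (a + b)"
    have t: "0 \<le> t" "t \<le> 1" "1 - t = b / (a + b)" using 3 by (auto simp: t_def field_simps)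
    have fa: "(\<integral>x. \<bar>f x\<bar> powr p \<partial>mu) = a powr p" "(\<integral>x. \<bar>g x\<bar> powr p \<partial>mu) = b powr p"
      using nrm_powr[of p] p by (auto simp: a_def b_def)
    have pt: "\<bar>f x + g x\<bar> powr p \<le> (a + b) powr p * (t * (\<bar>f x\<bar> powr p / a powr p) + (1 - t) * (\<bar>g x\<bar> powr p / b powr p))" for x
    proof -
      have "\<bar>f x + g x\<bar> \<le> (a + b) * (t * (\<bar>f x\<bar> / a) + (1 - t) * (\<bar>g x\<bar> / b))"
      proof -
        have "(a + b) * (t * (\<bar>f x\<bar> / a) + (1 - t) * (\<bar>g x\<bar> / b)) = \<bar>f x\<bar> + \<bar>g x\<bar>"
          unfolding t(3) using 3 by (simp add: t_def distrib_left)
        then show ?thesis by simp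
      qed
      then have "\<bar>f x + g x\<bar> powr p \<le> ((a + b) * (t * (\<bar>f x\<bar> / a) + (1 - t) * (\<bar>g x\<bar> / b))) powr p"
        using p by (intro powr_mono2) auto
      also have "\<dots> = (a + b) powr p * (t * (\<bar>f x\<bar> / a) + (1 - t) * (\<bar>g x\<bar> / b)) powr p"
        using 3 t by (simp add: powr_mult)
      also have "\<dots> \<le> (a + b) powr p * (t * (\<bar>f x\<bar> / a) powr p + (1 - t) * (\<bar>g x\<bar> / b) powr p)"
        using 3 t p by (intro mult_left_mono powr_convex_comb) auto
      finally show ?thesis using 3 by (simp add: powr_divide)
    qed
    have i: "integrable mu (\<lambda>x. (a + b) powr p * (t * (\<bar>f x\<bar> powr p / a powr p) + (1 - t) * (\<bar>g x\<bar> powr p / b powr p)))"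
      using fg[THEN Lp_rep_integrable] by auto
    have "(\<integral>x. \<bar>f x + g x\<bar> powr p \<partial>mu) \<le> (\<integral>x. (a + b) powr p * (t * (\<bar>f x\<bar> powr p / a powr p) + (1 - t) * (\<bar>g x\<bar> powr p / b powr p)) \<partial>mu)"
      using pt i Lp_rep_add[of p f g] p fg by (intro integral_mono Lp_rep_integrable) auto
    also have "\<dots> = (a + b) powr p * (t * (a powr p / a powr p) + (1 - t) * (b powr p / b powr p))"
      using fg[THEN Lp_rep_integrable] by (simp add: fa)
    also have "\<dots> = (a + b) powr p" using 3 by simp
    finally have "nrm p (\<lambda>x. f x + g x) \<le> ((a + b) powr p) powr (1 / p)"
      unfolding nrm_def using p by (intro powr_mono2) auto
    also have "\<dots> = a + b" using p 3 by (simp add: powr_powr)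
    finally show ?thesis by (simp add: a_def b_def)
  qed
qed

lemma nrm_triangle_diff:
  assumes p: "1 \<le> p" and fg: "f \<in> Lp_rep p" "g \<in> Lp_rep p" "h \<in> Lp_rep p"
  shows "nrm p (\<lambda>x. f x - h x) \<le> nrm p (\<lambda>x. f x - g x) + nrm p (\<lambda>x. g x - h x)"
  using nrm_triangle[OF p Lp_rep_diff[of p f g] Lp_rep_diff[of p g h]] assms by simp

section \<open>Operations on classes of functions\<close>

lemma lp_class_eq_iff:
  assumes "f \<in> Lp_rep p"
  shows "lp_class p f = lp_class p g \<longleftrightarrow> (AE x in mu. f x = g x)"
proof
  assume e: "lp_class p f = lp_class p g"
  have "f \<in> lp_class p f" using assms by (simp add: lp_class_def)
  then have "f \<in> lp_class p g" using e by simp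
  then show "AE x in mu. f x = g x" by (simp add: lp_class_def)
next
  assume "AE x in mu. f x = g x"
  then show "lp_class p f = lp_class p g"
    unfolding lp_class_def by (intro Collect_cong) (auto elim: eventually_elim2)
qed

lemma lp_classI: "f \<in> Lp_rep p \<Longrightarrow> lp_class p f \<in> Lp p"
  by (simp add: Lp_def)

lemma lrep_class:
  assumes "f \<in> Lp_rep p"
  shows "lrep (lp_class p f) \<in> Lp_rep p" "AE x in mu. lrep (lp_class p f) x = f x"
proof -
  have "f \<in> lp_class p f" using assms by (simp add: lp_class_def)
  then have "lrep (lp_class p f) \<in> lp_class p f" unfolding lrep_def by (rule someI[of "\<lambda>g. g \<in> lp_class p f"])
  then show "lrep (lp_class p f) \<in> Lp_rep p" "AE x in mu. lrep (lp_class p f) x = f x"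
    by (auto simp: lp_class_def)
qed

lemma lrep_Lp:
  assumes "F \<in> Lp p"
  shows "lrep F \<in> Lp_rep p" "lp_class p (lrep F) = F"
proof -
  obtain f where f: "f \<in> Lp_rep p" "F = lp_class p f" using assms by (auto simp: Lp_def)
  show "lrep F \<in> Lp_rep p" using lrep_class[OF f(1)] f(2) by simp
  then show "lp_class p (lrep F) = F" using lrep_class[OF f(1)] f(2) lp_class_eq_iff by auto
qed

lemma Lp_cases:
  assumes "F \<in> Lp p" obtains f where "f \<in> Lp_rep p" "F = lp_class p f"
  using lrep_Lp[OF assms] that by metis

lemma lp_norm_class: "f \<in> Lp_rep p \<Longrightarrow> lp_norm p (lp_class p f) = nrm p f"
  unfolding lp_norm_def nrm_def[symmetric]
  by (intro nrm_cong_AE lrep_class(2) Lp_rep_borel[OF lrep_class(1)])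

lemma lp_add_class:
  assumes "0 \<le> p" "f \<in> Lp_rep p" "g \<in> Lp_rep p"
  shows "lp_add p (lp_class p f) (lp_class p g) = lp_class p (\<lambda>x. f x + g x)"
  unfolding lp_add_def
  by (subst lp_class_eq_iff) (use assms lrep_class[of f p] lrep_class[of g p] in \<open>auto intro!: Lp_rep_add\<close>)

lemma lp_scale_class:
  assumes "f \<in> Lp_rep p"
  shows "lp_scale p c (lp_class p f) = lp_class p (\<lambda>x. c * f x)"
  unfolding lp_scale_def
  by (subst lp_class_eq_iff) (use assms lrep_class[of f p] in \<open>auto intro!: Lp_rep_scale\<close>)

lemma lp_sup_class:
  assumes "0 \<le> p" "f \<in> Lp_rep p" "g \<in> Lp_rep p"
  shows "lp_sup p (lp_class p f) (lp_class p g) = lp_class p (\<lambda>x. max (f x) (g x))"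
  unfolding lp_sup_def
  by (subst lp_class_eq_iff) (use assms lrep_class[of f p] lrep_class[of g p] in \<open>auto intro!: Lp_rep_max\<close>)

lemma lp_inf_class:
  assumes "0 \<le> p" "f \<in> Lp_rep p" "g \<in> Lp_rep p"
  shows "lp_inf p (lp_class p f) (lp_class p g) = lp_class p (\<lambda>x. min (f x) (g x))"
  unfolding lp_inf_def
  by (subst lp_class_eq_iff) (use assms lrep_class[of f p] lrep_class[of g p] in \<open>auto intro!: Lp_rep_min\<close>)

lemma lp_dist_class:
  assumes "0 \<le> p" "f \<in> Lp_rep p" "g \<in> Lp_rep p"
  shows "lp_dist p (lp_class p f) (lp_class p g) = nrm p (\<lambda>x. f x - g x)"
  using assms Lp_rep_diff[OF assms]
  by (simp add: lp_dist_def lp_scale_class lp_add_class Lp_rep_scale[of g p "-1", simplified] lp_norm_class)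

lemma lp_dist_nonneg: "0 \<le> lp_dist p F G"
  by (simp add: lp_dist_def lp_norm_def)

lemma lp_dist_commute:
  assumes "0 \<le> p" "F \<in> Lp p" "G \<in> Lp p" shows "lp_dist p F G = lp_dist p G F"
  using assms by (auto elim!: Lp_cases simp: lp_dist_class intro: nrm_minus_commute)

lemma lp_dist_triangle:
  assumes "1 \<le> p" "F \<in> Lp p" "G \<in> Lp p" "H \<in> Lp p" shows "lp_dist p F H \<le> lp_dist p F G + lp_dist p G H"
  using assms by (auto elim!: Lp_cases simp: lp_dist_class intro: nrm_triangle_diff)

lemma lp_dist_eq_0_iff:
  assumes "0 < p" "F \<in> Lp p" "G \<in> Lp p" shows "lp_dist p F G = 0 \<longleftrightarrow> F = G"
proof -
  obtain f where f: "f \<in> Lp_rep p" "F = lp_class p f" using assms(2) by (rule Lp_cases)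
  obtain g where g: "g \<in> Lp_rep p" "G = lp_class p g" using assms(3) by (rule Lp_cases)
  show ?thesis
    using assms f g by (simp add: lp_dist_class nrm_eq_0_iff Lp_rep_diff lp_class_eq_iff)
qed

text \<open>The action at the level of functions, with the inverse map and the density as parameters
  instead of being extracted by choice as in \<open>act\<close>.\<close>

definition opr :: "real \<Rightarrow> (real \<Rightarrow> real) \<Rightarrow> (real \<Rightarrow> real) \<Rightarrow> (real \<Rightarrow> real) \<Rightarrow> real \<Rightarrow> real" where
  "opr p g w k x = w x powr (1 / p) * k (g x)"

lemma opr_borel:
  assumes "nst f g w" "k \<in> borel_measurable mu"
  shows "opr p g w k \<in> borel_measurable mu"
proof -
  have [measurable]: "g \<in> mu \<rightarrow>\<^sub>M mu" "w \<in> borel_measurable mu" "k \<in> borel_measurable mu"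
    using nsp_measurable[OF nst_nsp[OF assms(1)]] nst_borel assms by auto
  show ?thesis unfolding opr_def[abs_def] by measurable
qed

text \<open>The exponent \<open>1 / p\<close> in the weight is made for this identity: after taking
  \<open>p\<close>-th powers the weight is \<open>w\<close> itself, so all norm identities reduce to
  one change of variables, for every \<open>p\<close>.\<close>

lemma opr_powr:
  assumes "nst f g w" "0 < p"
  shows "\<bar>opr p g w k x\<bar> powr p = w x * \<bar>k (g x)\<bar> powr p"
  using assms(2) nst_nonneg[OF assms(1), of x] by (simp add: opr_def abs_mult powr_mult powr_powr)

lemma opr_Lp:
  assumes "nst f g w" "0 < p" "k \<in> Lp_rep p"
  shows "opr p g w k \<in> Lp_rep p"
  unfolding Lp_rep_def
  using opr_borel[OF assms(1)] Lp_rep_borel[OF assms(3)] Lp_rep_integrable[OF assms(3)]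
    nst_integral(1)[OF assms(1), of "\<lambda>x. \<bar>k x\<bar> powr p"]
  by (simp add: opr_powr[OF assms(1,2)])

lemma opr_nrm:
  assumes "nst f g w" "0 < p" "k \<in> borel_measurable mu"
  shows "nrm p (opr p g w k) = nrm p k"
  unfolding nrm_def opr_powr[OF assms(1,2)]
  using nst_integral(2)[OF assms(1), of "\<lambda>x. \<bar>k x\<bar> powr p"] assms(3) by simp

lemma opr_comp:
  assumes "nst f g w" "nst f' g' w'"
  shows "opr p g w (opr p g' w' k) = opr p (g' \<circ> g) (\<lambda>x. w x * w' (g x)) k"
  using nst_nonneg[OF assms(1)] nst_nonneg[OF assms(2)] by (auto simp: opr_def powr_mult)

lemma opr_add: "opr p g w (\<lambda>x. k x + l x) x = opr p g w k x + opr p g w l x"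
  and opr_diff: "opr p g w (\<lambda>x. k x - l x) x = opr p g w k x - opr p g w l x"
  and opr_scale: "opr p g w (\<lambda>x. c * k x) x = c * opr p g w k x"
  and opr_max: "opr p g w (\<lambda>x. max (k x) (l x)) x = max (opr p g w k x) (opr p g w l x)"
  and opr_min: "opr p g w (\<lambda>x. min (k x) (l x)) x = min (opr p g w k x) (opr p g w l x)"
  by (auto simp: opr_def algebra_simps max_mult_distrib_left min_mult_distrib_left)

text \<open>The choices hidden in \<open>Phi\<close> (representatives of both classes, domain of
  inversion, version of the derivative) influence the result on a null set only. Later arguments can
  therefore compute with \<open>opr\<close> and any convenient data \<open>f\<close>,
  \<open>g\<close>, \<open>w\<close>.\<close>

lemma Phi_class:
  assumes a: "nst f g w" and p: "0 < p" and k: "k \<in> Lp_rep p"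
  shows "Phi p (autstar_class f) (lp_class p k) = lp_class p (opr p g w k)"
proof -
  note na = nst_nsp[OF a]
  define \<phi> where "\<phi> = arep (autstar_class f)"
  define l where "l = lrep (lp_class p k)"
  have ph: "autstar_rep \<phi>" "AE x in mu. \<phi> x = f x" using arep_class[OF na] by (auto simp: \<phi>_def)
  have "rnd \<phi> = rnd f" using ph(2) by (intro rnd_cong nsp_measurable(1)[OF na]) (auto elim: eventually_mono)
  then have r: "AE x in mu. rnd \<phi> x = w x"
    using nst_unique[OF nst_rnd[OF na] a] by simp
  have i: "AE x in mu. autstar_inv_rep \<phi> x = g x" by (rule autstar_inv_rep_AE[OF na ph])
  have l: "AE x in mu. l (g x) = k (g x)" using nsp_AE(2)[OF na lrep_class(2)[OF k]] by (simp add: l_def)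
  have "AE x in mu. act p \<phi> l x = opr p g w k x"
    using r i l by eventually_elim (simp add: act_def opr_def rnd_def)
  then have "AE x in mu. opr p g w k x = act p \<phi> l x" by (auto elim: eventually_mono)
  then have "lp_class p (opr p g w k) = lp_class p (act p \<phi> l)"
    using lp_class_eq_iff[OF opr_Lp[OF a p k]] by blast
  then show ?thesis using lp_classI[OF k] by (simp add: Phi_def \<phi>_def l_def)
qed

section \<open>Group laws and the action by lattice isometries\<close>

lemma Phi_Lp: "C \<in> AutStar \<Longrightarrow> 0 < p \<Longrightarrow> F \<in> Lp p \<Longrightarrow> Phi p C F \<in> Lp p"
  by (auto elim!: AutStar_nst Lp_cases simp: Phi_class intro!: lp_classI opr_Lp)

lemma AutStar_mult: "C \<in> AutStar \<Longrightarrow> D \<in> AutStar \<Longrightarrow> autstar_mult C D \<in> AutStar"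
  by (elim AutStar_nsp) (simp add: autstar_mult_class nsp_AutStar[OF nsp_comp])

lemma AutStar_inverse: "C \<in> AutStar \<Longrightarrow> autstar_inverse C \<in> AutStar"
  by (elim AutStar_nsp) (simp add: autstar_inverse_class nsp_AutStar[OF nsp_sym])

lemma AutStar_one: "autstar_one \<in> AutStar"
  unfolding autstar_one_class by (rule nsp_AutStar[OF nsp_id])

lemma autstar_left_inverse: "C \<in> AutStar \<Longrightarrow> autstar_mult (autstar_inverse C) C = autstar_one"
  by (elim AutStar_nsp)
    (use nsp_gf in \<open>auto simp: autstar_inverse_class autstar_one_class autstar_mult_class[OF nsp_sym]
      intro!: autstar_class_eqI\<close>)

lemma autstar_right_inverse: "C \<in> AutStar \<Longrightarrow> autstar_mult C (autstar_inverse C) = autstar_one"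
  by (elim AutStar_nsp)
    (use nsp_fg in \<open>auto simp: autstar_inverse_class autstar_one_class autstar_mult_class[OF _ nsp_sym]
      intro!: autstar_class_eqI\<close>)

lemma Phi_one:
  assumes "0 < p" "F \<in> Lp p"
  shows "Phi p autstar_one F = F"
proof -
  obtain k where k: "k \<in> Lp_rep p" "F = lp_class p k" using assms(2) by (rule Lp_cases)
  have "opr p (\<lambda>x. x) (\<lambda>x. 1) k = k" by (auto simp: opr_def)
  then show ?thesis using Phi_class[OF nst_id assms(1) k(1)] k(2) by (simp add: autstar_one_class)
qed

lemma Phi_mult_app:
  assumes "0 < p" "C \<in> AutStar" "D \<in> AutStar" "F \<in> Lp p"
  shows "Phi p (autstar_mult C D) F = Phi p C (Phi p D F)"
proof -
  obtain f g w where a: "nst f g w" "C = autstar_class f" using assms(2) by (rule AutStar_nst)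
  obtain f' g' w' where b: "nst f' g' w'" "D = autstar_class f'" using assms(3) by (rule AutStar_nst)
  obtain k where k: "k \<in> Lp_rep p" "F = lp_class p k" using assms(4) by (rule Lp_cases)
  show ?thesis
    using a b k assms(1)
    by (simp add: autstar_mult_class[OF nst_nsp nst_nsp] Phi_class opr_Lp Phi_class[OF nst_comp] opr_comp)
qed

lemma Phi_mult:
  assumes "0 < p" "C \<in> AutStar" "D \<in> AutStar"
  shows "Phi p (autstar_mult C D) = compose (Lp p) (Phi p C) (Phi p D)"
proof
  fix F
  show "Phi p (autstar_mult C D) F = compose (Lp p) (Phi p C) (Phi p D) F"
  proof (cases "F \<in> Lp p")
    case True
    then show ?thesis using Phi_mult_app[OF assms] by (simp add: compose_def)
  qed (simp add: compose_def Phi_def)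
qed

lemma Phi_inverse_app:
  assumes "0 < p" "C \<in> AutStar" "F \<in> Lp p"
  shows "Phi p C (Phi p (autstar_inverse C) F) = F" "Phi p (autstar_inverse C) (Phi p C F) = F"
  using assms Phi_mult_app[symmetric] Phi_one AutStar_inverse[OF assms(2)]
  by (simp_all add: autstar_left_inverse autstar_right_inverse)

lemma Phi_dist:
  assumes "0 < p" "C \<in> AutStar" "F \<in> Lp p" "G \<in> Lp p"
  shows "lp_dist p (Phi p C F) (Phi p C G) = lp_dist p F G"
proof -
  obtain f g w where a: "nst f g w" "C = autstar_class f" using assms(2) by (rule AutStar_nst)
  obtain k where k: "k \<in> Lp_rep p" "F = lp_class p k" using assms(3) by (rule Lp_cases)
  obtain l where l: "l \<in> Lp_rep p" "G = lp_class p l" using assms(4) by (rule Lp_cases)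
  have "nrm p (\<lambda>x. opr p g w k x - opr p g w l x) = nrm p (opr p g w (\<lambda>x. k x - l x))"
    by (simp add: opr_diff[abs_def])
  also have "\<dots> = nrm p (\<lambda>x. k x - l x)"
    using k l assms(1) Lp_rep_borel by (intro opr_nrm[OF a(1)]) auto
  finally show ?thesis using a k l assms(1) by (simp add: Phi_class lp_dist_class opr_Lp)
qed

lemma Phi_aut_lattice:
  assumes "1 \<le> p" "C \<in> AutStar"
  shows "Phi p C \<in> aut_lattice p"
proof -
  have p: "0 < p" "0 \<le> p" using assms by auto
  obtain f g w where a: "nst f g w" "C = autstar_class f" using assms(2) by (rule AutStar_nst)
  note s = Phi_class[OF a(1) p(1)] opr_Lp[OF a(1) p(1)]
  have "bij_betw (Phi p C) (Lp p) (Lp p)"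
    by (rule bij_betw_byWitness[where f' = "Phi p (autstar_inverse C)"])
      (use assms p in \<open>auto simp: Phi_inverse_app intro: Phi_Lp AutStar_inverse\<close>)
  moreover have "Phi p C (lp_add p F G) = lp_add p (Phi p C F) (Phi p C G)" if "F \<in> Lp p" "G \<in> Lp p" for F G
    using that p a by (auto elim!: Lp_cases simp: lp_add_class s Lp_rep_add opr_add[abs_def])
  moreover have "Phi p C (lp_scale p c F) = lp_scale p c (Phi p C F)" if "F \<in> Lp p" for c F
    using that p a by (auto elim!: Lp_cases simp: lp_scale_class s Lp_rep_scale opr_scale[abs_def])
  moreover have "lp_norm p (Phi p C F) = lp_norm p F" if "F \<in> Lp p" for F
    using that p a by (auto elim!: Lp_cases simp: lp_norm_class s opr_nrm[OF a(1) p(1)] Lp_rep_borel)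
  moreover have "Phi p C (lp_sup p F G) = lp_sup p (Phi p C F) (Phi p C G)" if "F \<in> Lp p" "G \<in> Lp p" for F G
    using that p a by (auto elim!: Lp_cases simp: lp_sup_class s Lp_rep_max opr_max[abs_def])
  moreover have "Phi p C (lp_inf p F G) = lp_inf p (Phi p C F) (Phi p C G)" if "F \<in> Lp p" "G \<in> Lp p" for F G
    using that p a by (auto elim!: Lp_cases simp: lp_inf_class s Lp_rep_min opr_min[abs_def])
  ultimately show ?thesis by (simp add: aut_lattice_def Phi_def)
qed

text \<open>The image of 1 is a power of the density; dividing the image of the identity function by
  it, which is possible since the density is positive, recovers the inverse map, and that determines
  the map. Only two vectors are used, which later yields a metric.\<close>

lemma Phi_inj:
  assumes p: "1 \<le> p" and C: "C \<in> AutStar" and D: "D \<in> AutStar"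
    and e: "Phi p C (lp_class p (\<lambda>x. 1)) = Phi p D (lp_class p (\<lambda>x. 1))"
      "Phi p C (lp_class p (\<lambda>x. x)) = Phi p D (lp_class p (\<lambda>x. x))"
  shows "C = D"
proof -
  have p': "0 < p" "0 \<le> p" using p by auto
  obtain f g w where a: "nst f g w" "C = autstar_class f" using C by (rule AutStar_nst)
  obtain f' g' w' where b: "nst f' g' w'" "D = autstar_class f'" using D by (rule AutStar_nst)
  have "lp_class p (opr p g w (\<lambda>x. 1)) = lp_class p (opr p g' w' (\<lambda>x. 1))"
    using e(1) by (simp add: Phi_class[OF a(1) p'(1)] Phi_class[OF b(1) p'(1)] a(2) b(2) Lp_rep_const)
  then have 1: "AE x in mu. w x powr (1 / p) = w' x powr (1 / p)"
    by (subst (asm) lp_class_eq_iff) (auto simp: opr_Lp[OF a(1) p'(1)] Lp_rep_const opr_def)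
  have "lp_class p (opr p g w (\<lambda>x. x)) = lp_class p (opr p g' w' (\<lambda>x. x))"
    using e(2) by (simp add: Phi_class[OF a(1) p'(1)] Phi_class[OF b(1) p'(1)] a(2) b(2) Lp_rep_id p')
  then have 2: "AE x in mu. w x powr (1 / p) * g x = w' x powr (1 / p) * g' x"
    by (subst (asm) lp_class_eq_iff) (auto simp: opr_Lp[OF a(1) p'(1)] Lp_rep_id p' opr_def)
  have "AE x in mu. g x = g' x"
    using 1 2 nst_pos[OF a(1)] by eventually_elim auto
  from nsp_inverse_unique[OF nsp_sym[OF nst_nsp[OF a(1)]] nsp_sym[OF nst_nsp[OF b(1)]] this]
  show ?thesis unfolding a(2) b(2) by (rule autstar_class_eqI)
qed

section \<open>Lattice isometries are weighted compositions\<close>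

lemma null_sets_mu_borel:
  assumes "N \<in> null_sets mu"
  obtains N' where "N' \<in> sets borel" "N \<subseteq> N'" "N' \<inter> {0..1} \<in> null_sets mu"
proof -
  have "N \<in> null_sets lebesgue" using assms unfolding mu_def by (subst (asm) null_sets_restrict_space) auto
  then obtain N' where N': "N \<subseteq> N'" "N' \<in> null_sets lborel" by (auto simp: null_sets_completion_iff2)
  have "N' \<in> null_sets lebesgue" using N'(2) by (rule null_sets_completionI)
  then have "N' \<inter> {0..1} \<in> null_sets lebesgue" by (rule null_set_Int2) simp
  then have "N' \<inter> {0..1} \<in> null_sets mu" unfolding mu_def by (subst null_sets_restrict_space) auto
  then show ?thesis using that N' by auto
qed

text \<open>A Lebesgue set is a Borel set up to a subset of a Borel null set. The Borel part has a
  measurable preimage, and the null part is avoided almost everywhere by nonsingularity.\<close>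

lemma measurable_mu_muI:
  assumes f: "f \<in> borel_measurable mu" "\<And>x. x \<in> {0..1} \<Longrightarrow> f x \<in> {0..1}"
    and N: "\<And>N. N \<in> null_sets mu \<Longrightarrow> AE x in mu. f x \<notin> N"
  shows "f \<in> mu \<rightarrow>\<^sub>M mu"
proof (rule measurableI)
  show "x \<in> space mu \<Longrightarrow> f x \<in> space mu" for x using f(2) unfolding space_mu .
  fix S assume "S \<in> sets mu"
  then have S: "S \<in> sets lebesgue" "S \<subseteq> {0..1}" by (auto simp: sets_mu)
  from S(1) obtain S1 N1 N' where S1: "S = S1 \<union> N1" "N1 \<subseteq> N'" "N' \<in> null_sets lborel" "S1 \<in> sets lborel"
    by (rule sets_completionE)
  have "N' \<in> null_sets lebesgue" using S1(3) by (rule null_sets_completionI)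
  then have "N' \<inter> {0..1} \<in> null_sets lebesgue" by (rule null_set_Int2) simp
  then have "N' \<inter> {0..1} \<in> null_sets mu" unfolding mu_def by (subst null_sets_restrict_space) auto
  then have ae: "AE x in mu. f x \<notin> N' \<inter> {0..1}" by (rule N)
  have "f -` S1 \<inter> space mu \<in> sets mu" using f(1) S1(4) by (intro measurable_sets[OF f(1)]) simp
  then show "f -` S \<inter> space mu \<in> sets mu"
  proof (rule mu_AE_sets)
    show "AE x in mu. x \<in> f -` S1 \<inter> space mu \<longleftrightarrow> x \<in> f -` S \<inter> space mu"
      using ae AE_space
    proof eventually_elim
      case (elim x)
      then have "f x \<notin> N'" using f(2)[of x] by simp
      then show ?case using S1 by auto
    qed
  qed auto
qed

lemma mu_borel_rep:
  fixes f :: "real \<Rightarrow> real"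
  assumes "f \<in> borel_measurable mu"
  obtains f' where "f' \<in> borel_measurable borel" "AE x in mu. f x = f' x"
proof -
  have "(\<lambda>x. if x \<in> {0..1} then f x else 0) \<in> borel_measurable lebesgue"
    using assms unfolding mu_def by (rule borel_measurable_if_I) simp
  then obtain f' where f': "f' \<in> borel_measurable lborel" "AE x in lborel. (if x \<in> {0..1} then f x else 0) = f' x"
    using completion_ex_borel_measurable_real by blast
  have "AE x in lebesgue. (if x \<in> {0..1} then f x else 0) = f' x" using f'(2) by (rule AE_completion)
  then have "AE x in mu. f x = f' x"
    unfolding mu_def by (subst AE_restrict_space_iff) (auto elim: eventually_mono)
  then show ?thesis using f'(1) that by simp
qed

lemma Lp_rep_cong_AE:
  assumes "f \<in> Lp_rep p" "0 \<le> p" "AE x in mu. f x = g x"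
  shows "g \<in> Lp_rep p"
proof (rule Lp_rep_dominated[OF assms(2,1)])
  show "g \<in> borel_measurable mu"
    by (rule measurable_mu_AE[OF Lp_rep_borel[OF assms(1)] assms(3)]) simp
  show "AE x in mu. \<bar>g x\<bar> \<le> \<bar>f x\<bar>" using assms(3) by eventually_elim simp
qed

lemma Lp_dominated_limit:
  assumes p: "1 \<le> p" and F: "\<And>n. F n \<in> borel_measurable mu" and f: "f \<in> borel_measurable mu"
    and lim: "AE x in mu. (\<lambda>n. F n x) \<longlonglongrightarrow> f x"
    and w: "w \<in> Lp_rep p" "\<And>n. AE x in mu. \<bar>F n x\<bar> \<le> w x"
  shows "f \<in> Lp_rep p" "\<And>n. F n \<in> Lp_rep p" "(\<lambda>n. nrm p (\<lambda>x. F n x - f x)) \<longlonglongrightarrow> 0"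
proof -
  note [measurable] = F f
  have ae: "AE x in mu. \<forall>n. \<bar>F n x\<bar> \<le> w x" using w(2) by (simp add: AE_all_countable)
  have aef: "AE x in mu. \<bar>f x\<bar> \<le> w x"
    using ae lim
  proof eventually_elim
    case (elim x)
    have "(\<lambda>n. \<bar>F n x\<bar>) \<longlonglongrightarrow> \<bar>f x\<bar>" using elim(2) by (rule tendsto_rabs)
    then show ?case by (rule LIMSEQ_le_const2) (use elim in auto)
  qed
  show fL: "f \<in> Lp_rep p"
    by (rule Lp_rep_dominated[OF _ w(1) f]) (use p aef in \<open>auto elim!: eventually_mono\<close>)
  show "F n \<in> Lp_rep p" for n
    by (rule Lp_rep_dominated[OF _ w(1) F]) (use p w(2)[of n] in \<open>auto elim!: eventually_mono\<close>)
  have "(\<lambda>n. \<integral>x. \<bar>F n x - f x\<bar> powr p \<partial>mu) \<longlonglongrightarrow> (\<integral>x. 0 \<partial>mu)"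
  proof (rule integral_dominated_convergence[where w = "\<lambda>x. \<bar>2 * w x\<bar> powr p"])
    show "integrable mu (\<lambda>x. \<bar>2 * w x\<bar> powr p)" by (rule Lp_rep_integrable[OF Lp_rep_scale[OF w(1)]])
    show "AE x in mu. (\<lambda>n. \<bar>F n x - f x\<bar> powr p) \<longlonglongrightarrow> 0"
      using lim
    proof eventually_elim
      case (elim x)
      have "(\<lambda>n. \<bar>F n x - f x\<bar>) \<longlonglongrightarrow> 0" using elim by (simp add: LIM_zero tendsto_rabs_zero)
      then have "(\<lambda>n. \<bar>F n x - f x\<bar> powr p) \<longlonglongrightarrow> 0 powr p"
        using p by (intro tendsto_powr') auto
      then show ?case using p by simp
    qed
    show "AE x in mu. norm (\<bar>F n x - f x\<bar> powr p) \<le> \<bar>2 * w x\<bar> powr p" for n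
      using ae aef
    proof eventually_elim
      case (elim x)
      then have "\<bar>F n x\<bar> \<le> w x" "\<bar>f x\<bar> \<le> w x" by auto
      then have "\<bar>F n x - f x\<bar> \<le> \<bar>2 * w x\<bar>" by linarith
      then show ?case using p by (simp add: powr_mono2)
    qed
  qed measurable
  then have "(\<lambda>n. (\<integral>x. \<bar>F n x - f x\<bar> powr p \<partial>mu) powr (1 / p)) \<longlonglongrightarrow> 0 powr (1 / p)"
    using p by (intro tendsto_powr') auto
  then show "(\<lambda>n. nrm p (\<lambda>x. F n x - f x)) \<longlonglongrightarrow> 0" by (simp add: nrm_def)
qed

text \<open>A monotone class argument: ramps built from 1 and the identity give indicators of
  half-lines, these generate the Borel sets, then follow simple functions and dominated limits.
  Limits are required at every point and not just almost everywhere: the argument will be composed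
  with a map not yet known to be nonsingular.\<close>

lemma Lp_induct_borel:
  fixes P :: "(real \<Rightarrow> real) \<Rightarrow> bool"
  assumes p: "1 \<le> p" and f: "f \<in> borel_measurable borel" "f \<in> Lp_rep p"
    and one: "P (\<lambda>x. 1)" and ident: "P (\<lambda>x. x)"
    and scale: "\<And>c f. P f \<Longrightarrow> P (\<lambda>x. c * f x)"
    and add: "\<And>f g. P f \<Longrightarrow> P g \<Longrightarrow> P (\<lambda>x. f x + g x)"
    and max: "\<And>f g. P f \<Longrightarrow> P g \<Longrightarrow> P (\<lambda>x. max (f x) (g x))"
    and lim: "\<And>F f w. (\<And>n. P (F n)) \<Longrightarrow> (\<And>x. (\<lambda>n. F n x) \<longlonglongrightarrow> f x) \<Longrightarrow> w \<in> Lp_rep p \<Longrightarrow>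
               (\<And>n x. x \<in> {0..1} \<Longrightarrow> \<bar>F n x\<bar> \<le> w x) \<Longrightarrow> P f"
  shows "P f"
proof -
  have const: "P (\<lambda>x. c)" for c using scale[OF one, of c] by simp
  have diff: "P (\<lambda>x. f x - g x)" if "P f" "P g" for f g using add[OF that(1) scale[OF that(2), of "-1"]] by simp
  \<comment> \<open>The minimum comes for free from
    \<open>min a b = a + b - max a b\<close>.\<close>
  have min: "P (\<lambda>x. min (f x) (g x))" if "P f" "P g" for f g
    using diff[OF add[OF that] max[OF that]] by (simp add: min_def max_def if_distrib cong: if_cong)
  \<comment> \<open>Ramps of slope \<open>n\<close>, truncated to the unit interval, increase to the
    indicator of the open half-line.\<close>
  have lt: "P (indicator {..<q})" for q :: real
  proof (rule lim[where F="\<lambda>n x. max 0 (min 1 (real n * (q - x)))" and w="\<lambda>x. 1"])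
    show "P (\<lambda>x. max 0 (min 1 (real n * (q - x))))" for n
      by (intro max min const scale diff ident)
    show "(\<lambda>n. max 0 (min 1 (real n * (q - x)))) \<longlonglongrightarrow> indicator {..<q} x" for x
    proof (cases "x < q")
      case True
      obtain m where m: "1 / (q - x) < real m" using reals_Archimedean2 by blast
      have "\<forall>\<^sub>F n in sequentially. max 0 (min 1 (real n * (q - x))) = 1"
      proof (rule eventually_sequentiallyI[of m])
        fix n assume "m \<le> n"
        then have "1 / (q - x) \<le> real n" using m by linarith
        then have "1 \<le> real n * (q - x)" using True by (simp add: field_simps)
        then show "max 0 (min 1 (real n * (q - x))) = 1" by simp
      qed
      then show ?thesis using True by (simp add: tendsto_eventually)
    next
      case False
      then have "max 0 (min 1 (real n * (q - x))) = 0" for n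
        using mult_nonneg_nonpos[of "real n" "q - x"] by simp
      then show ?thesis using False by simp
    qed
  qed (auto intro: Lp_rep_const)
  have ind: "P (indicator A)" if "A \<in> sets borel" for A :: "real set"
  proof -
    have "A \<in> sigma_sets UNIV (range lessThan)"
      using that by (subst (asm) borel_Iio) simp
    then show ?thesis
    proof (rule sigma_sets_induct_disjoint[rotated 2])
      show "Int_stable (range lessThan :: real set set)"
        unfolding Int_stable_def
      proof (intro ballI)
        fix A B :: "real set" assume "A \<in> range lessThan" "B \<in> range lessThan"
        then obtain a b where "A = {..<a}" "B = {..<b}" by auto
        then have "A \<inter> B = {..<Orderings.min a b}" by auto
        then show "A \<inter> B \<in> range lessThan" by blast
      qed
      show "P (indicator B)" if "B \<in> range lessThan" for B :: "real set" using that lt by auto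
      show "P (indicator {})" using const[of 0] by (simp add: indicator_def[abs_def])
      show "P (indicator (UNIV - B))" if "P (indicator B)" for B :: "real set"
      proof -
        have "(\<lambda>x. 1 - indicator B x) = (indicator (UNIV - B) :: real \<Rightarrow> real)"
          by (auto simp: indicator_def)
        then show ?thesis using diff[OF one that] by simp
      qed
      fix B :: "nat \<Rightarrow> real set"
      assume dis: "disjoint_family B" and PB: "\<And>i. P (indicator (B i))"
      show "P (indicator (\<Union>i. B i))"
      proof (rule lim[where F="\<lambda>n x. \<Sum>i<n. indicator (B i) x" and w="\<lambda>x. 1"])
        show "P (\<lambda>x. \<Sum>i<n. indicator (B i) x)" for n
          by (induction n) (auto intro: add PB const)
        have e: "(\<Sum>i<n. indicator (B i) x) = (indicator (\<Union>i<n. B i) x :: real)" for n x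
        proof -
          have "disjoint_family_on B {..<n}" using dis by (rule disjoint_family_on_mono[rotated]) auto
          then show ?thesis by (simp add: indicator_UN_disjoint)
        qed
        show "(\<lambda>n. \<Sum>i<n. indicator (B i) x) \<longlonglongrightarrow> (indicator (\<Union>i. B i) x :: real)" for x
          unfolding e by (rule LIMSEQ_indicator_UN)
        show "\<bar>\<Sum>i<n. indicator (B i) x\<bar> \<le> (1::real)" for n x
          unfolding e by (simp add: indicator_def)
      qed (auto intro: Lp_rep_const)
    qed auto
  qed
  have simple: "P u" if "simple_function borel u" for u
  proof -
    have fin: "finite (u ` UNIV)" and m: "\<And>y. u -` {y} \<in> sets borel"
      using that measurable_sets[OF borel_measurable_simple_function[OF that], of "{y}" for y]
      by (auto simp: simple_function_def)
    have "P (\<lambda>x. \<Sum>y\<in>S. y * indicator (u -` {y}) x)" if "finite S" for S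
      using that
    proof induction
      case empty
      show ?case using const[of 0] by simp
    next
      case (insert y S)
      show ?case
        unfolding sum.insert[OF insert.hyps] by (rule add[OF scale[OF ind[OF m]] insert.IH])
    qed
    from this[OF fin] have "P (\<lambda>x. \<Sum>y\<in>u ` UNIV. y * indicator (u -` {y}) x)" .
    moreover have "(\<Sum>y\<in>u ` UNIV. y * indicator (u -` {y}) x) = u x" for x
    proof -
      have "(\<Sum>y\<in>u ` UNIV. y * indicator (u -` {y}) x) = (\<Sum>y\<in>u ` UNIV. if y = u x then u x else 0)"
        by (intro sum.cong) (auto simp: indicator_def)
      also have "\<dots> = u x" using fin by simp
      finally show ?thesis .
    qed
    ultimately show ?thesis by simp
  qed
  have nonneg: "P u" if u: "u \<in> borel_measurable borel" "\<And>x. 0 \<le> u x" "u \<in> Lp_rep p" for u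
  proof -
    obtain U where U: "incseq U" "\<And>i. simple_function borel (U i)" "\<And>x. bdd_above (range (\<lambda>i. U i x))"
      "\<And>i x. 0 \<le> U i x" "u = (SUP i. U i)"
      using borel_measurable_implies_simple_function_sequence_real[OF u(1,2)] by blast
    have ux: "u x = (SUP i. U i x)" for x using U(5) by (simp add: image_comp)
    have inc: "incseq (\<lambda>i. U i x)" for x using U(1) by (simp add: incseq_def le_fun_def)
    show ?thesis
    proof (rule lim[where F=U and w=u])
      show "(\<lambda>n. U n x) \<longlonglongrightarrow> u x" for x
        unfolding ux using U(3) inc by (rule LIMSEQ_incseq_SUP)
      show "\<bar>U n x\<bar> \<le> u x" for n x
        using U(4)[of n x] cSUP_upper[OF _ U(3), of n x] by (simp add: ux)
    qed (use simple U u in auto)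
  qed
  have "P (\<lambda>x. max (f x) 0 - max (- f x) 0)"
  proof (rule diff)
    show "P (\<lambda>x. max (f x) 0)"
      using f p by (intro nonneg Lp_rep_max Lp_rep_const) auto
    show "P (\<lambda>x. max (- f x) 0)"
      using f p Lp_rep_scale[OF f(2), of "-1"] by (intro nonneg Lp_rep_max Lp_rep_const) auto
  qed
  moreover have "(\<lambda>x. max (f x) 0 - max (- f x) 0) = f" by (auto simp: max_def)
  ultimately show ?thesis by simp
qed

text \<open>The version for arbitrary Lebesgue functions, with limits in norm; dominated convergence
  turns the pointwise limits of the Borel version into norm limits.\<close>

lemma Lp_induct:
  fixes P :: "(real \<Rightarrow> real) \<Rightarrow> bool"
  assumes p: "1 \<le> p"
    and one: "P (\<lambda>x. 1)" and ident: "P (\<lambda>x. x)"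
    and scale: "\<And>c f. f \<in> Lp_rep p \<Longrightarrow> P f \<Longrightarrow> P (\<lambda>x. c * f x)"
    and add: "\<And>f g. f \<in> Lp_rep p \<Longrightarrow> g \<in> Lp_rep p \<Longrightarrow> P f \<Longrightarrow> P g \<Longrightarrow> P (\<lambda>x. f x + g x)"
    and max: "\<And>f g. f \<in> Lp_rep p \<Longrightarrow> g \<in> Lp_rep p \<Longrightarrow> P f \<Longrightarrow> P g \<Longrightarrow> P (\<lambda>x. max (f x) (g x))"
    and lim: "\<And>F f. f \<in> Lp_rep p \<Longrightarrow> (\<And>n. F n \<in> Lp_rep p) \<Longrightarrow> (\<And>n. P (F n)) \<Longrightarrow>
               (\<lambda>n. nrm p (\<lambda>x. F n x - f x)) \<longlonglongrightarrow> 0 \<Longrightarrow> P f"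
    and f: "f \<in> Lp_rep p"
  shows "P f"
proof -
  have p0: "0 \<le> p" using p by simp
  obtain f' where f': "f' \<in> borel_measurable borel" "AE x in mu. f x = f' x"
    using mu_borel_rep[OF Lp_rep_borel[OF f]] by blast
  have "f' \<in> Lp_rep p" by (rule Lp_rep_cong_AE[OF f p0 f'(2)])
  with f'(1) have "f' \<in> Lp_rep p \<and> P f'"
  proof (rule Lp_induct_borel[OF p, where P="\<lambda>f. f \<in> Lp_rep p \<and> P f"])
    show "(\<lambda>x. 1) \<in> Lp_rep p \<and> P (\<lambda>x. 1)" "(\<lambda>x. x) \<in> Lp_rep p \<and> P (\<lambda>x. x)"
      using one ident Lp_rep_const Lp_rep_id[OF p0] by auto
    fix F :: "nat \<Rightarrow> real \<Rightarrow> real" and f w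
    assume F: "\<And>n. F n \<in> Lp_rep p \<and> P (F n)" "\<And>x. (\<lambda>n. F n x) \<longlonglongrightarrow> f x" "w \<in> Lp_rep p"
       "\<And>n x. x \<in> {0..1} \<Longrightarrow> \<bar>F n x\<bar> \<le> w x"
    have m: "\<And>n. F n \<in> borel_measurable mu" using F(1) Lp_rep_borel by blast
    have mf: "f \<in> borel_measurable mu" by (rule borel_measurable_LIMSEQ_real[OF F(2) m])
    have ae: "AE x in mu. \<bar>F n x\<bar> \<le> w x" for n by (rule AE_I2) (use F(4) in auto)
    have lae: "AE x in mu. (\<lambda>n. F n x) \<longlonglongrightarrow> f x" using F(2) by simp
    note L = Lp_dominated_limit[OF p m mf lae F(3) ae]
    show "f \<in> Lp_rep p \<and> P f" using lim[of f F] F(1) L by blast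
  qed (use scale add max Lp_rep_scale Lp_rep_add[OF p0] Lp_rep_max[OF p0] in auto)
  then have f'L: "f' \<in> Lp_rep p" "P f'" by auto
  \<comment> \<open>The limit clause for the constant sequence \<open>f'\<close> passes from the
    Borel representative to the given function.\<close>
  have "AE x in mu. f' x - f x = 0" using f'(2) by eventually_elim simp
  then have "nrm p (\<lambda>x. f' x - f x) = 0"
    using nrm_eq_0_iff[OF _ Lp_rep_diff[OF p0 f'L(1) f]] p by simp
  then show ?thesis using lim[of f "\<lambda>n. f'"] f f'L by simp
qed

section \<open>The form of a lattice isometry\<close>

lemma aut_latticeD:
  assumes "T \<in> aut_lattice p"
  shows "T \<in> extensional (Lp p)" "bij_betw T (Lp p) (Lp p)"
    "\<And>F. F \<in> Lp p \<Longrightarrow> T F \<in> Lp p"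
    "\<And>F G. F \<in> Lp p \<Longrightarrow> G \<in> Lp p \<Longrightarrow> T (lp_add p F G) = lp_add p (T F) (T G)"
    "\<And>c F. F \<in> Lp p \<Longrightarrow> T (lp_scale p c F) = lp_scale p c (T F)"
    "\<And>F. F \<in> Lp p \<Longrightarrow> lp_norm p (T F) = lp_norm p F"
    "\<And>F G. F \<in> Lp p \<Longrightarrow> G \<in> Lp p \<Longrightarrow> T (lp_sup p F G) = lp_sup p (T F) (T G)"
    "\<And>F G. F \<in> Lp p \<Longrightarrow> G \<in> Lp p \<Longrightarrow> T (lp_inf p F G) = lp_inf p (T F) (T G)"
  using assms by (auto simp: aut_lattice_def bij_betw_def)

lemma lp_closed:
  assumes "0 \<le> p" "F \<in> Lp p" "G \<in> Lp p"
  shows "lp_add p F G \<in> Lp p" "lp_scale p c F \<in> Lp p" "lp_sup p F G \<in> Lp p" "lp_inf p F G \<in> Lp p"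
proof -
  obtain f where f: "f \<in> Lp_rep p" "F = lp_class p f" using assms(2) by (rule Lp_cases)
  obtain g where g: "g \<in> Lp_rep p" "G = lp_class p g" using assms(3) by (rule Lp_cases)
  show "lp_add p F G \<in> Lp p" "lp_scale p c F \<in> Lp p" "lp_sup p F G \<in> Lp p" "lp_inf p F G \<in> Lp p"
    using f g assms(1)
    by (simp_all add: lp_add_class lp_scale_class lp_sup_class lp_inf_class lp_classI Lp_rep_add Lp_rep_scale Lp_rep_max Lp_rep_min)
qed

lemma aut_lattice_dist:
  assumes "0 \<le> p" "T \<in> aut_lattice p" "F \<in> Lp p" "G \<in> Lp p"
  shows "lp_dist p (T F) (T G) = lp_dist p F G"
  unfolding lp_dist_def
  using assms aut_latticeD[OF assms(2)] lp_closed[OF assms(1)] by metis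

lemma aut_lattice_inverse:
  assumes p: "0 \<le> p" and T: "T \<in> aut_lattice p"
  obtains S where "S \<in> aut_lattice p" "\<And>F. F \<in> Lp p \<Longrightarrow> S (T F) = F" "\<And>F. F \<in> Lp p \<Longrightarrow> T (S F) = F"
proof -
  note D = aut_latticeD[OF T]
  define S where "S = restrict (inv_into (Lp p) T) (Lp p)"
  have ST: "S (T F) = F" "T (S F) = F" "S F \<in> Lp p" if "F \<in> Lp p" for F
    using that D(2,3) bij_betw_inv_into_left[OF D(2)] bij_betw_inv_into_right[OF D(2)]
      bij_betwE[OF bij_betw_inv_into[OF D(2)]] by (auto simp: S_def)
  have eqI: "S F = G" if "F \<in> Lp p" "G \<in> Lp p" "F = T G" for F G using that ST by simp
  have "S \<in> aut_lattice p"
    unfolding aut_lattice_def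
  proof (intro CollectI conjI ballI allI)
    show "S \<in> extensional (Lp p)" by (simp add: S_def)
    show "bij_betw S (Lp p) (Lp p)"
      by (rule bij_betw_byWitness[where f'=T]) (use ST D in auto)
    fix F assume F: "F \<in> Lp p"
    show "lp_norm p (S F) = lp_norm p F" using D(6)[of "S F"] ST F by simp
    show "S (lp_scale p c F) = lp_scale p c (S F)" for c
      by (rule eqI) (use F ST D p lp_closed in auto)
    fix G assume G: "G \<in> Lp p"
    show "S (lp_add p F G) = lp_add p (S F) (S G)" "S (lp_sup p F G) = lp_sup p (S F) (S G)"
      "S (lp_inf p F G) = lp_inf p (S F) (S G)"
      by (rule eqI; use F G ST D p lp_closed in auto)+
  qed
  then show ?thesis using that ST by blast
qed

text \<open>The formula is stable under linear and lattice operations and under limits, so it need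
  only hold for 1 and the identity function. It is proved for Borel functions first, since for them
  the composition with \<psi> makes sense anyway. Applied to indicators of Borel null sets it shows
  that \<psi> is nonsingular, and only then does it extend to all Lebesgue representatives.\<close>

lemma aut_lattice_weighted_composition:
  assumes p: "1 \<le> p" and T: "T \<in> aut_lattice p"
  obtains h \<psi> where "h \<in> Lp_rep p" "AE x in mu. 0 < h x" "\<And>x. 0 \<le> h x" "\<psi> \<in> mu \<rightarrow>\<^sub>M mu"
    "\<And>N. N \<in> null_sets mu \<Longrightarrow> AE x in mu. \<psi> x \<notin> N"
    "\<And>f. f \<in> Lp_rep p \<Longrightarrow> (\<lambda>x. h x * f (\<psi> x)) \<in> Lp_rep p"
    "\<And>f. f \<in> Lp_rep p \<Longrightarrow> T (lp_class p f) = lp_class p (\<lambda>x. h x * f (\<psi> x))"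
proof -
  have p0: "0 \<le> p" "0 < p" using p by auto
  note D = aut_latticeD[OF T]
  define \<tau> where "\<tau> f = lrep (T (lp_class p f))" for f
  have tL: "\<tau> f \<in> Lp_rep p" "T (lp_class p f) = lp_class p (\<tau> f)" if "f \<in> Lp_rep p" for f
    using lrep_Lp[OF D(3)[OF lp_classI[OF that]]] by (auto simp: \<tau>_def)
  have scale: "AE x in mu. \<tau> (\<lambda>x. c * f x) x = c * \<tau> f x" if "f \<in> Lp_rep p" for f c
    using D(5)[OF lp_classI[OF that], of c] tL[OF that] tL[OF Lp_rep_scale[OF that]]
    by (simp add: lp_scale_class that lp_class_eq_iff)
  have add: "AE x in mu. \<tau> (\<lambda>x. f x + g x) x = \<tau> f x + \<tau> g x" if "f \<in> Lp_rep p" "g \<in> Lp_rep p" for f g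
    using D(4)[OF that[THEN lp_classI]] tL[OF that(1)] tL[OF that(2)] tL[OF Lp_rep_add[OF p0(1) that]]
    by (simp add: lp_add_class that lp_class_eq_iff p0)
  have max: "AE x in mu. \<tau> (\<lambda>x. max (f x) (g x)) x = max (\<tau> f x) (\<tau> g x)" if "f \<in> Lp_rep p" "g \<in> Lp_rep p" for f g
    using D(7)[OF that[THEN lp_classI]] tL[OF that(1)] tL[OF that(2)] tL[OF Lp_rep_max[OF p0(1) that]]
    by (simp add: lp_sup_class that lp_class_eq_iff p0)
  have min: "AE x in mu. \<tau> (\<lambda>x. min (f x) (g x)) x = min (\<tau> f x) (\<tau> g x)" if "f \<in> Lp_rep p" "g \<in> Lp_rep p" for f g
    using D(8)[OF that[THEN lp_classI]] tL[OF that(1)] tL[OF that(2)] tL[OF Lp_rep_min[OF p0(1) that]]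
    by (simp add: lp_inf_class that lp_class_eq_iff p0)
  have cong: "\<tau> f = \<tau> g" if "f \<in> Lp_rep p" "AE x in mu. f x = g x" for f g
    using lp_class_eq_iff[OF that(1), of g] that(2) by (simp add: \<tau>_def)
  have L1: "(\<lambda>x. 1) \<in> Lp_rep p" and L0: "(\<lambda>x. 0) \<in> Lp_rep p" and Lid: "(\<lambda>x. x) \<in> Lp_rep p"
    using Lp_rep_const Lp_rep_id[OF p0(1)] by auto
  have zero: "AE x in mu. \<tau> (\<lambda>x. 0) x = 0" using scale[OF L0, of 0] by simp
  have pos: "AE x in mu. 0 \<le> \<tau> f x" if "f \<in> Lp_rep p" "AE x in mu. 0 \<le> f x" for f
  proof -
    have "AE x in mu. f x = max (f x) 0" using that(2) by eventually_elim simp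
    from cong[OF that(1) this] have "AE x in mu. \<tau> f x = max (\<tau> f x) (\<tau> (\<lambda>x. 0) x)"
      using max[OF that(1) L0] by simp
    then show ?thesis using zero by eventually_elim simp
  qed
  define h where "h x = \<bar>\<tau> (\<lambda>x. 1) x\<bar>" for x
  have hnn: "0 \<le> h x" for x by (simp add: h_def)
  have h1: "AE x in mu. \<tau> (\<lambda>x. 1) x = h x" using pos[OF L1] by (auto simp: h_def)
  have hL: "h \<in> Lp_rep p" using Lp_rep_abs[OF tL(1)[OF L1]] by (simp add: h_def[abs_def])
  \<comment> \<open>Let \<open>k\<close> be mapped to the indicator of the zero set of
    \<open>h\<close>. The minimum of \<open>k\<close> and 1 goes to the minimum of that indicator
    and \<open>h\<close>, which is 0; by injectivity \<open>min (k x) 1\<close> vanishes, hence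
    \<open>k\<close> vanishes, and so does the indicator.\<close>
  have hpos: "AE x in mu. 0 < h x"
  proof -
    note [measurable] = Lp_rep_borel[OF hL]
    define A where "A = {x \<in> space mu. h x = 0}"
    have A: "A \<in> sets mu" unfolding A_def by measurable
    have AL: "(indicator A :: real \<Rightarrow> real) \<in> Lp_rep p"
      using A by (intro Lp_rep_bounded[of p _ 1] p0) auto
    obtain K where K: "K \<in> Lp p" "T K = lp_class p (indicator A)"
    proof -
      have "lp_class p (indicator A) \<in> T ` Lp p" using bij_betw_imp_surj_on[OF D(2)] lp_classI[OF AL] by simp
      then show ?thesis using that by (metis imageE)
    qed
    obtain k where k: "k \<in> Lp_rep p" "K = lp_class p k" using K(1) by (rule Lp_cases)
    have tk: "AE x in mu. \<tau> k x = indicator A x"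
      using K(2) tL(2)[OF k(1)] k(2) lp_class_eq_iff[OF tL(1)[OF k(1)], of "indicator A"] by simp
    have "AE x in mu. \<tau> (\<lambda>x. min (k x) 1) x = 0"
      using min[OF k(1) L1] tk h1 by eventually_elim (auto simp: indicator_def A_def hnn)
    then have "AE x in mu. \<tau> (\<lambda>x. min (k x) 1) x = \<tau> (\<lambda>x. 0) x" using zero by eventually_elim simp
    then have "T (lp_class p (\<lambda>x. min (k x) 1)) = T (lp_class p (\<lambda>x. 0))"
      using tL[OF Lp_rep_min[OF p0(1) k(1) L1]] tL[OF L0] by (simp add: lp_class_eq_iff)
    then have "lp_class p (\<lambda>x. min (k x) 1) = lp_class p (\<lambda>x. 0)"
      using bij_betw_imp_inj_on[OF D(2)] lp_classI[OF Lp_rep_min[OF p0(1) k(1) L1]] lp_classI[OF L0]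
      by (meson inj_onD)
    then have "AE x in mu. min (k x) 1 = 0"
      using lp_class_eq_iff[OF Lp_rep_min[OF p0(1) k(1) L1]] by simp
    then have "AE x in mu. k x = 0" by eventually_elim (auto simp: min_def split: if_splits)
    then have k0: "\<tau> k = \<tau> (\<lambda>x. 0)" by (rule cong[OF k(1)])
    have "AE x in mu. (indicator A x :: real) = 0" using tk zero unfolding k0 by eventually_elim simp
    then show ?thesis using AE_space
    proof eventually_elim
      case (elim x)
      then have "h x \<noteq> 0" by (auto simp: A_def indicator_def split: if_splits)
      then show ?case using hnn[of x] by simp
    qed
  qed
  \<comment> \<open>The truncation forces values in the unit interval at every point; almost
    everywhere it changes nothing, as the image of the identity function lies between 0 and
    \<open>h\<close>.\<close>
  define \<psi> where "\<psi> x = max 0 (min 1 (\<tau> (\<lambda>x. x) x / h x))" for x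
  have psi_meas: "\<psi> \<in> borel_measurable mu"
    unfolding \<psi>_def[abs_def] using Lp_rep_borel[OF hL] Lp_rep_borel[OF tL(1)[OF Lid]] by measurable
  have id_nonneg: "AE x in mu. 0 \<le> \<tau> (\<lambda>x. x) x" by (rule pos[OF Lid]) (auto intro: AE_I2)
  \<comment> \<open>On the unit interval the identity function equals its minimum with 1, and the
    isometry preserves minima.\<close>
  have id_le: "AE x in mu. \<tau> (\<lambda>x. x) x \<le> h x"
  proof -
    have "\<tau> (\<lambda>x. x) = \<tau> (\<lambda>x. min x 1)" by (rule cong[OF Lid]) (auto intro: AE_I2)
    then have "AE x in mu. \<tau> (\<lambda>x. x) x = Orderings.min (\<tau> (\<lambda>x. x) x) (\<tau> (\<lambda>x. 1) x)"
      using min[OF Lid L1] by simp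
    then show ?thesis using h1 
    proof eventually_elim
      case (elim x)
      show ?case using elim(2) min.cobounded2[of "\<tau> (\<lambda>x. x) x" "\<tau> (\<lambda>x. 1) x"] unfolding elim(1)[symmetric] by simp
    qed
  qed
  have psi: "AE x in mu. h x * \<psi> x = \<tau> (\<lambda>x. x) x"
    using hpos id_nonneg id_le by eventually_elim (simp add: \<psi>_def)
  have "f \<in> borel_measurable borel \<and> f \<in> Lp_rep p \<and> (AE x in mu. \<tau> f x = h x * f (\<psi> x))"
    if "f \<in> borel_measurable borel" "f \<in> Lp_rep p" for f
    using that
  proof (rule Lp_induct_borel[OF p, where P="\<lambda>f. f \<in> borel_measurable borel \<and> f \<in> Lp_rep p \<and> (AE x in mu. \<tau> f x = h x * f (\<psi> x))"])
    show "(\<lambda>x. 1) \<in> borel_measurable borel \<and> (\<lambda>x. 1) \<in> Lp_rep p \<and> (AE x in mu. \<tau> (\<lambda>x. 1) x = h x * 1)"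
      using h1 L1 by simp
    show "(\<lambda>x. x) \<in> borel_measurable borel \<and> (\<lambda>x. x) \<in> Lp_rep p \<and> (AE x in mu. \<tau> (\<lambda>x. x) x = h x * \<psi> x)"
      using psi Lid by (auto elim: eventually_mono)
  next
    fix c f assume a: "f \<in> borel_measurable borel \<and> f \<in> Lp_rep p \<and> (AE x in mu. \<tau> f x = h x * f (\<psi> x))"
    show "(\<lambda>x. c * f x) \<in> borel_measurable borel \<and> (\<lambda>x. c * f x) \<in> Lp_rep p \<and>
        (AE x in mu. \<tau> (\<lambda>x. c * f x) x = h x * (c * f (\<psi> x)))"
    proof (intro conjI)
      have ae: "AE x in mu. \<tau> f x = h x * f (\<psi> x)" and fL: "f \<in> Lp_rep p" using a by auto
      show "AE x in mu. \<tau> (\<lambda>x. c * f x) x = h x * (c * f (\<psi> x))"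
        using scale[OF fL, of c] ae by eventually_elim simp
    qed (use a Lp_rep_scale in auto)
  next
    fix f g assume a: "f \<in> borel_measurable borel \<and> f \<in> Lp_rep p \<and> (AE x in mu. \<tau> f x = h x * f (\<psi> x))"
      and b: "g \<in> borel_measurable borel \<and> g \<in> Lp_rep p \<and> (AE x in mu. \<tau> g x = h x * g (\<psi> x))"
    then have fg: "f \<in> Lp_rep p" "g \<in> Lp_rep p" by auto
    have ae: "AE x in mu. \<tau> f x = h x * f (\<psi> x) \<and> \<tau> g x = h x * g (\<psi> x)" using a b by auto
    have "AE x in mu. \<tau> (\<lambda>x. f x + g x) x = h x * (f (\<psi> x) + g (\<psi> x))"
      using add[OF fg] ae by eventually_elim (simp add: distrib_left)
    then show "(\<lambda>x. f x + g x) \<in> borel_measurable borel \<and> (\<lambda>x. f x + g x) \<in> Lp_rep p \<and>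
        (AE x in mu. \<tau> (\<lambda>x. f x + g x) x = h x * (f (\<psi> x) + g (\<psi> x)))"
      using a b Lp_rep_add[OF p0(1) fg] by auto
    have "AE x in mu. \<tau> (\<lambda>x. max (f x) (g x)) x = h x * max (f (\<psi> x)) (g (\<psi> x))"
      using max[OF fg] ae by eventually_elim (simp add: hnn max_mult_distrib_left)
    then show "(\<lambda>x. max (f x) (g x)) \<in> borel_measurable borel \<and> (\<lambda>x. max (f x) (g x)) \<in> Lp_rep p \<and>
        (AE x in mu. \<tau> (\<lambda>x. max (f x) (g x)) x = h x * max (f (\<psi> x)) (g (\<psi> x)))"
      using a b Lp_rep_max[OF p0(1) fg] by auto
  next
    fix F :: "nat \<Rightarrow> real \<Rightarrow> real" and f w
    assume F: "\<And>n. F n \<in> borel_measurable borel \<and> F n \<in> Lp_rep p \<and> (AE x in mu. \<tau> (F n) x = h x * F n (\<psi> x))"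
       and lim: "\<And>x. (\<lambda>n. F n x) \<longlonglongrightarrow> f x" and w: "w \<in> Lp_rep p"
       "\<And>n x. x \<in> {0..1} \<Longrightarrow> \<bar>F n x\<bar> \<le> w x"
    have fb: "f \<in> borel_measurable borel" by (rule borel_measurable_LIMSEQ_real[OF lim]) (use F in auto)
    have m: "\<And>n. F n \<in> borel_measurable mu" using F Lp_rep_borel by blast
    have ae: "AE x in mu. \<bar>F n x\<bar> \<le> w x" for n by (rule AE_I2) (use w(2) in auto)
    have lae: "AE x in mu. (\<lambda>n. F n x) \<longlonglongrightarrow> f x" using lim by simp
    note L = Lp_dominated_limit[OF p m borel_measurable_mu[OF fb] lae w(1) ae]
    note fL = L(1)
    have "(\<lambda>n. nrm p (\<lambda>x. F n x - f x)) \<longlonglongrightarrow> 0" by (rule L(3))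
    moreover have "nrm p (\<lambda>x. F n x - f x) = nrm p (\<lambda>x. \<tau> (F n) x - \<tau> f x)" for n
      using aut_lattice_dist[OF p0(1) T, of "lp_class p (F n)" "lp_class p f"] F[of n] fL tL[of "F n"] tL[of f]
      by (simp add: lp_classI lp_dist_class p0)
    ultimately have "(\<lambda>n. nrm p (\<lambda>x. \<tau> (F n) x - \<tau> f x)) \<longlonglongrightarrow> 0" by simp
    then have "(\<lambda>n. nrm p (\<lambda>x. \<tau> (F n) x - \<tau> f x) powr p) \<longlonglongrightarrow> 0 powr p"
      using p by (intro tendsto_powr') (auto simp: nrm_nonneg)
    then have "(\<lambda>n. \<integral>x. norm (\<bar>\<tau> (F n) x - \<tau> f x\<bar> powr p) \<partial>mu) \<longlonglongrightarrow> 0"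
      using p0 by (simp add: nrm_powr)
    moreover have "integrable mu (\<lambda>x. \<bar>\<tau> (F n) x - \<tau> f x\<bar> powr p)" for n
      using F[of n] fL tL p0 by (intro Lp_rep_integrable Lp_rep_diff) auto
    \<comment> \<open>Convergence of the integrals gives pointwise convergence along a subsequence,
      enough to identify the limit.\<close>
    ultimately obtain r where r: "strict_mono r" "AE x in mu. (\<lambda>n. \<bar>\<tau> (F (r n)) x - \<tau> f x\<bar> powr p) \<longlonglongrightarrow> 0"
      using tendsto_L1_AE_subseq[of mu "\<lambda>n x. \<bar>\<tau> (F n) x - \<tau> f x\<bar> powr p"] by blast
    have all: "AE x in mu. \<forall>n. \<tau> (F n) x = h x * F n (\<psi> x)" using F by (simp add: AE_all_countable)
    have "AE x in mu. \<tau> f x = h x * f (\<psi> x)"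
      using r(2) all
    proof eventually_elim
      case (elim x)
      have "(\<lambda>n. (\<bar>\<tau> (F (r n)) x - \<tau> f x\<bar> powr p) powr (1 / p)) \<longlonglongrightarrow> 0 powr (1 / p)"
        using p elim(1) by (intro tendsto_powr') auto
      then have "(\<lambda>n. \<bar>\<tau> (F (r n)) x - \<tau> f x\<bar>) \<longlonglongrightarrow> 0" using p by (simp add: powr_powr)
      then have "(\<lambda>n. h x * F (r n) (\<psi> x)) \<longlonglongrightarrow> \<tau> f x"
        using elim(2) by (simp add: tendsto_rabs_zero_iff LIM_zero_iff)
      moreover have "(\<lambda>n. h x * F (r n) (\<psi> x)) \<longlonglongrightarrow> h x * f (\<psi> x)"
        using LIMSEQ_subseq_LIMSEQ[OF lim r(1), of "\<psi> x"] by (intro tendsto_mult_left) (simp add: o_def)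
      ultimately show ?case by (rule LIMSEQ_unique)
    qed
    then show "f \<in> borel_measurable borel \<and> f \<in> Lp_rep p \<and> (AE x in mu. \<tau> f x = h x * f (\<psi> x))"
      using fb fL by simp
  qed
  then have form: "AE x in mu. \<tau> f x = h x * f (\<psi> x)" if "f \<in> borel_measurable borel" "f \<in> Lp_rep p" for f
    using that by blast
  \<comment> \<open>The indicator of a Borel null set is the zero vector, so its image
    \<open>h\<close> times the indicator at \<open>\<psi> x\<close> is 0; positivity of
    \<open>h\<close> does the rest.\<close>
  have null: "AE x in mu. \<psi> x \<notin> N" if N: "N \<in> null_sets mu" for N
  proof -
    obtain N' where N': "N' \<in> sets borel" "N \<subseteq> N'" "N' \<inter> {0..1} \<in> null_sets mu"
      by (rule null_sets_mu_borel[OF N])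
    let ?f = "indicator N' :: real \<Rightarrow> real"
    have ae: "AE x in mu. ?f x = 0" using AE_not_in[OF N'(3)] AE_space by eventually_elim (auto simp: indicator_def)
    have b: "?f \<in> borel_measurable borel" using N'(1) by measurable
    have "?f \<in> Lp_rep p" by (rule Lp_rep_bounded[of p _ 1]) (use b p0 borel_measurable_mu in auto)
    note fo = form[OF b this] and c = cong[OF this ae]
    show ?thesis using fo zero hpos unfolding c
      by eventually_elim (use N'(2) in \<open>auto simp: indicator_def split: if_splits\<close>)
  qed
  have pm: "\<psi> \<in> mu \<rightarrow>\<^sub>M mu" by (rule measurable_mu_muI[OF psi_meas _ null]) (auto simp: \<psi>_def)
  have form': "AE x in mu. \<tau> f x = h x * f (\<psi> x)" if f: "f \<in> Lp_rep p" for f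
  proof -
    obtain f' where f': "f' \<in> borel_measurable borel" "AE x in mu. f x = f' x"
      using mu_borel_rep[OF Lp_rep_borel[OF f]] by blast
    have "f' \<in> Lp_rep p" by (rule Lp_rep_cong_AE[OF f p0(1) f'(2)])
    from form[OF f'(1) this] cong[OF f f'(2)] have "AE x in mu. \<tau> f x = h x * f' (\<psi> x)" by simp
    moreover have "AE x in mu. f (\<psi> x) = f' (\<psi> x)"
    proof (rule AE_pullback[OF _ _ f'(2)])
      show "\<psi> -` N \<inter> space mu \<in> null_sets mu" if "N \<in> null_sets mu" for N
        unfolding mu.null_sets_iff_AE using null[OF that] by auto
    qed (auto simp: \<psi>_def)
    ultimately show ?thesis by eventually_elim simp
  qed
  show ?thesis
  proof (rule that[OF hL hpos _ pm null])
    show "0 \<le> h x" for x by (simp add: h_def)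
    fix f assume f: "f \<in> Lp_rep p"
    show "(\<lambda>x. h x * f (\<psi> x)) \<in> Lp_rep p" by (rule Lp_rep_cong_AE[OF tL(1)[OF f] p0(1) form'[OF f]])
    show "T (lp_class p f) = lp_class p (\<lambda>x. h x * f (\<psi> x))"
      using tL[OF f] form'[OF f] by (simp add: lp_class_eq_iff)
  qed
qed

text \<open>Isometry and inverse are both weighted compositions. Comparing their composite with the
  identity on the two vectors 1 and \<open>x\<close> first gives that the product of the weights is
  1, then that \<theta> and \<psi> are inverse to each other. The group element is \<theta>, because
  the action composes with the inverse map.\<close>

lemma Phi_surj:
  assumes p: "1 \<le> p" and T: "T \<in> aut_lattice p"
  shows "\<exists>C\<in>AutStar. Phi p C = T"
proof -
  have p0: "0 \<le> p" "0 < p" using p by auto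
  obtain S where S: "S \<in> aut_lattice p" "\<And>F. F \<in> Lp p \<Longrightarrow> S (T F) = F" "\<And>F. F \<in> Lp p \<Longrightarrow> T (S F) = F"
    using aut_lattice_inverse[OF p0(1) T] by blast
  obtain h \<psi> where h: "h \<in> Lp_rep p" "AE x in mu. 0 < h x" "\<And>x. 0 \<le> h x" "\<psi> \<in> mu \<rightarrow>\<^sub>M mu"
    "\<And>N. N \<in> null_sets mu \<Longrightarrow> AE x in mu. \<psi> x \<notin> N"
    "\<And>f. f \<in> Lp_rep p \<Longrightarrow> (\<lambda>x. h x * f (\<psi> x)) \<in> Lp_rep p"
    "\<And>f. f \<in> Lp_rep p \<Longrightarrow> T (lp_class p f) = lp_class p (\<lambda>x. h x * f (\<psi> x))"
    using aut_lattice_weighted_composition[OF p T] by blast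
  obtain k \<theta> where k: "k \<in> Lp_rep p" "AE x in mu. 0 < k x" "\<And>x. 0 \<le> k x" "\<theta> \<in> mu \<rightarrow>\<^sub>M mu"
    "\<And>N. N \<in> null_sets mu \<Longrightarrow> AE x in mu. \<theta> x \<notin> N"
    "\<And>f. f \<in> Lp_rep p \<Longrightarrow> (\<lambda>x. k x * f (\<theta> x)) \<in> Lp_rep p"
    "\<And>f. f \<in> Lp_rep p \<Longrightarrow> S (lp_class p f) = lp_class p (\<lambda>x. k x * f (\<theta> x))"
    using aut_lattice_weighted_composition[OF p S(1)] by blast
  have ts: "AE x in mu. f x = h x * (k (\<psi> x) * f (\<theta> (\<psi> x)))" if f: "f \<in> Lp_rep p" for f
  proof -
    have "lp_class p f = T (S (lp_class p f))" using S(3) lp_classI[OF f] by simp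
    also have "\<dots> = lp_class p (\<lambda>x. h x * (k (\<psi> x) * f (\<theta> (\<psi> x))))"
      using k(7)[OF f] h(7)[OF k(6)[OF f]] by simp
    finally show ?thesis using lp_class_eq_iff[OF f] by simp
  qed
  have st: "AE x in mu. f x = k x * (h (\<theta> x) * f (\<psi> (\<theta> x)))" if f: "f \<in> Lp_rep p" for f
  proof -
    have "lp_class p f = S (T (lp_class p f))" using S(2) lp_classI[OF f] by simp
    also have "\<dots> = lp_class p (\<lambda>x. k x * (h (\<theta> x) * f (\<psi> (\<theta> x))))"
      using h(7)[OF f] k(7)[OF h(6)[OF f]] by simp
    finally show ?thesis using lp_class_eq_iff[OF f] by simp
  qed
  have L1: "(\<lambda>x. 1) \<in> Lp_rep p" and Lid: "(\<lambda>x. x) \<in> Lp_rep p"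
    using Lp_rep_const Lp_rep_id[OF p0(1)] by auto
  have tp: "AE x in mu. \<theta> (\<psi> x) = x"
    using ts[OF L1] ts[OF Lid]
  proof eventually_elim
    case (elim x)
    have "x = (h x * (k (\<psi> x) * 1)) * \<theta> (\<psi> x)" using elim(2) by (simp add: mult.assoc)
    then show ?case unfolding elim(1)[symmetric] by simp
  qed
  have pt: "AE x in mu. \<psi> (\<theta> x) = x"
    using st[OF L1] st[OF Lid]
  proof eventually_elim
    case (elim x)
    have "x = (k x * (h (\<theta> x) * 1)) * \<psi> (\<theta> x)" using elim(2) by (simp add: mult.assoc)
    then show ?case unfolding elim(1)[symmetric] by simp
  qed
  have n: "nsp \<theta> \<psi>" by (rule nspI[OF k(4) h(4) k(5) h(5) pt tp])
  define w where "w x = h x powr p" for x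
  have [measurable]: "w \<in> borel_measurable mu" unfolding w_def[abs_def] using Lp_rep_borel[OF h(1)] by measurable
  have [measurable]: "\<psi> \<in> mu \<rightarrow>\<^sub>M mu" by (rule h(4))
  \<comment> \<open>Preservation of the norms of indicators says exactly that
    \<open>h powr p\<close> is the density: its integral over the preimage of a set under \<psi> is
    the measure of the set.\<close>
  have me: "distr (density mu w) mu \<psi> = mu"
  proof (rule measure_eqI)
    fix A assume "A \<in> sets (distr (density mu w) mu \<psi>)"
    then have A [measurable]: "A \<in> sets mu" by simp
    let ?f = "indicator A :: real \<Rightarrow> real"
    have fL: "?f \<in> Lp_rep p" by (rule Lp_rep_bounded[of p _ 1]) (use p0 in auto)
    have fp: "\<bar>?f x\<bar> powr p = ?f x" for x using p0 by (simp add: indicator_def)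
    have "nrm p (\<lambda>x. h x * ?f (\<psi> x)) = nrm p ?f"
      using aut_latticeD(6)[OF T lp_classI[OF fL]] h(7)[OF fL] lp_norm_class[OF fL] lp_norm_class[OF h(6)[OF fL]] by simp
    then have "nrm p (\<lambda>x. h x * ?f (\<psi> x)) powr p = nrm p ?f powr p" by simp
    then have "(\<integral>x. \<bar>h x * ?f (\<psi> x)\<bar> powr p \<partial>mu) = (\<integral>x. \<bar>?f x\<bar> powr p \<partial>mu)" by (simp only: nrm_powr[OF p0(2)])
    then have "(\<integral>x. w x * ?f (\<psi> x) \<partial>mu) = measure mu (A \<inter> {0..1})"
      unfolding fp using h(3) by (simp add: abs_mult powr_mult fp[simplified] w_def)
    moreover have "A \<inter> {0..1} = A" using A sets.sets_into_space[OF A] by auto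
    moreover have "integrable mu (\<lambda>x. w x * ?f (\<psi> x))"
      using Lp_rep_integrable[OF h(6)[OF fL]] h(3) by (simp add: abs_mult powr_mult fp[simplified] w_def)
    ultimately have "(\<integral>\<^sup>+x. ennreal (w x * ?f (\<psi> x)) \<partial>mu) = ennreal (measure mu A)"
      using h(3) by (subst nn_integral_eq_integral) (auto simp: w_def)
    then have e: "(\<integral>\<^sup>+x. ennreal (w x * ?f (\<psi> x)) \<partial>mu) = emeasure mu A" by (simp add: mu.emeasure_eq_measure)
    have "emeasure (distr (density mu w) mu \<psi>) A = emeasure (density mu w) (\<psi> -` A \<inter> space mu)"
      by (simp add: emeasure_distr)
    also have "\<dots> = (\<integral>\<^sup>+x. ennreal (w x * ?f (\<psi> x)) \<partial>mu)"
    proof (subst emeasure_density)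
      show "(\<integral>\<^sup>+x. ennreal (w x) * indicator (\<psi> -` A \<inter> space mu) x \<partial>mu) = (\<integral>\<^sup>+x. ennreal (w x * ?f (\<psi> x)) \<partial>mu)"
        by (rule nn_integral_cong) (auto simp: indicator_def)
    qed measurable
    finally show "emeasure (distr (density mu w) mu \<psi>) A = emeasure mu A" using e by simp
  qed simp
  have "(\<integral>\<^sup>+x. ennreal (w x) * F (\<psi> x) \<partial>mu) = (\<integral>\<^sup>+x. F x \<partial>mu)" if [measurable]: "F \<in> borel_measurable mu" for F
  proof -
    have "(\<integral>\<^sup>+x. ennreal (w x) * F (\<psi> x) \<partial>mu) = (\<integral>\<^sup>+x. F (\<psi> x) \<partial>density mu w)"
      by (rule nn_integral_density[symmetric]) measurable
    also have "\<dots> = (\<integral>\<^sup>+x. F x \<partial>distr (density mu w) mu \<psi>)"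
      by (rule nn_integral_distr[symmetric]) measurable
    finally show ?thesis unfolding me .
  qed
  then have a: "nst \<theta> \<psi> w" using n by (simp add: nst_def) (simp add: w_def)
  have "Phi p (autstar_class \<theta>) = T"
  proof
    fix F
    show "Phi p (autstar_class \<theta>) F = T F"
    proof (cases "F \<in> Lp p")
      case True
      then obtain f where f: "f \<in> Lp_rep p" "F = lp_class p f" by (rule Lp_cases)
      have "opr p \<psi> w f = (\<lambda>x. h x * f (\<psi> x))" using h(3) p0 by (auto simp: opr_def w_def powr_powr)
      then show ?thesis using Phi_class[OF a p0(2) f(1)] h(7)[OF f(1)] f(2) by simp
    next
      case False
      then show ?thesis using aut_latticeD(1)[OF T] by (simp add: Phi_def extensional_def)
    qed
  qed
  then show ?thesis using nsp_AutStar[OF n] by blast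
qed

lemma Phi_bij:
  assumes p: "1 \<le> p"
  shows "bij_betw (Phi p) AutStar (aut_lattice p)"
  unfolding bij_betw_def
proof
  show "inj_on (Phi p) AutStar" by (rule inj_onI) (use Phi_inj[OF p] in metis)
  show "Phi p ` AutStar = aut_lattice p"
    using Phi_aut_lattice[OF p] Phi_surj[OF p] by (auto simp: image_iff)
qed

section \<open>Independence of the topology from the exponent\<close>

definition spow :: "real \<Rightarrow> real \<Rightarrow> real" where
  "spow \<theta> s = sgn s * \<bar>s\<bar> powr \<theta>"

lemma abs_spow: "\<bar>spow \<theta> s\<bar> = \<bar>s\<bar> powr \<theta>"
  by (cases "s = 0") (simp_all add: spow_def abs_mult)

lemma sgn_spow: "sgn (spow \<theta> s) = sgn s"
  by (cases "s = 0") (simp_all add: spow_def sgn_mult)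

lemma spow_spow: "\<theta> * \<eta> = 1 \<Longrightarrow> spow \<theta> (spow \<eta> s) = s"
  unfolding spow_def[of \<theta>] sgn_spow abs_spow by (simp add: powr_powr mult.commute[of \<eta>] sgn_mult_abs)

lemma spow_borel [measurable]:
  assumes [measurable]: "f \<in> borel_measurable M"
  shows "(\<lambda>x. spow \<theta> (f x)) \<in> borel_measurable M"
proof -
  have "(\<lambda>x. \<bar>f x\<bar> powr \<theta>) \<in> borel_measurable M"
    by (intro powr_real_measurable borel_measurable_abs borel_measurable_const assms)
  then show ?thesis unfolding spow_def by measurable
qed

text \<open>By homogeneity two cases suffice. If \<open>t\<close> is relatively close to
  \<open>s\<close>, continuity of the power at 1 gives the first term; otherwise both numbers are
  bounded by a multiple of their distance, which gives the second. The bound has the powers that can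
  be integrated directly.\<close>

lemma spow_modulus:
  assumes \<theta>: "0 < \<theta>" and q: "0 < q" and e: "0 < \<epsilon>"
  obtains K where "0 \<le> K" "\<And>s t. \<bar>spow \<theta> s - spow \<theta> t\<bar> powr q \<le> \<epsilon> * \<bar>s\<bar> powr (\<theta> * q) + K * \<bar>s - t\<bar> powr (\<theta> * q)"
proof -
  define \<eta> where "\<eta> = \<epsilon> powr (1 / q)"
  have \<eta>: "0 < \<eta>" "\<eta> powr q = \<epsilon>" using q e by (auto simp: \<eta>_def powr_powr)
  have "isCont (\<lambda>x. x powr \<theta>) (1::real)" by (intro continuous_intros) auto
  then obtain d where d: "0 < d" "\<And>x::real. dist x 1 < d \<Longrightarrow> dist (x powr \<theta>) (1 powr \<theta>) < \<eta>"
    using \<eta>(1) unfolding continuous_at_eps_delta by blast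
  define \<delta> where "\<delta> = min (d / 2) (1 / 2)"
  have \<delta>: "0 < \<delta>" "\<delta> < 1" "\<delta> < d" using d(1) by (auto simp: \<delta>_def)
  \<comment> \<open>In the second case
    \<open>\<bar>s\<bar> \<le> \<bar>s - t\<bar> / \<delta>\<close>, and
    \<open>\<bar>t\<bar>\<close> exceeds \<open>\<bar>s\<bar>\<close> by at most one more
    \<open>\<bar>s - t\<bar>\<close>; \<open>M\<close> covers both.\<close>
  define M where "M = 1 + 1 / \<delta>"
  have M: "0 < M" using \<delta> by (auto simp: M_def add_pos_pos)
  define K where "K = (2 * M powr \<theta>) powr q"
  show ?thesis
  proof (rule that)
    show "0 \<le> K" by (simp add: K_def)
    fix s t :: real
    show "\<bar>spow \<theta> s - spow \<theta> t\<bar> powr q \<le> \<epsilon> * \<bar>s\<bar> powr (\<theta> * q) + K * \<bar>s - t\<bar> powr (\<theta> * q)"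
    proof (cases "s \<noteq> 0 \<and> \<bar>s - t\<bar> \<le> \<delta> * \<bar>s\<bar>")
      case True
      define x where "x = t / s"
      have t: "t = s * x" using True by (simp add: x_def)
      have "\<bar>s\<bar> * \<bar>1 - x\<bar> \<le> \<bar>s\<bar> * \<delta>" using True by (simp add: t abs_mult[symmetric] algebra_simps)
      then have x: "\<bar>1 - x\<bar> \<le> \<delta>" using True by simp
      then have x0: "0 < x" using \<delta> by linarith
      have "\<bar>x powr \<theta> - 1\<bar> \<le> \<eta>" using d(2)[of x] x \<delta> by (simp add: dist_real_def abs_minus_commute)
      moreover have "spow \<theta> s - spow \<theta> t = spow \<theta> s * (1 - x powr \<theta>)"
        using x0 by (simp add: t spow_def sgn_mult abs_mult powr_mult algebra_simps)
      ultimately have "\<bar>spow \<theta> s - spow \<theta> t\<bar> \<le> \<bar>s\<bar> powr \<theta> * \<eta>"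
        by (simp add: abs_mult abs_spow mult_left_mono abs_minus_commute)
      then have "\<bar>spow \<theta> s - spow \<theta> t\<bar> powr q \<le> (\<bar>s\<bar> powr \<theta> * \<eta>) powr q"
        using q by (intro powr_mono2) auto
      also have "\<dots> = \<epsilon> * \<bar>s\<bar> powr (\<theta> * q)" using \<eta> by (simp add: powr_mult powr_powr)
      finally show ?thesis using \<open>0 \<le> K\<close> by (simp add: add_increasing2)
    next
      case False
      then have "\<delta> * \<bar>s\<bar> \<le> \<bar>s - t\<bar>" by auto
      then have s1: "\<bar>s\<bar> \<le> \<bar>s - t\<bar> * (1 / \<delta>)" using \<delta> by (simp add: field_simps)
      then have s: "\<bar>s\<bar> \<le> M * \<bar>s - t\<bar>" by (simp add: M_def algebra_simps)
      have t: "\<bar>t\<bar> \<le> M * \<bar>s - t\<bar>" using s1 by (simp add: M_def algebra_simps)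
      have "\<bar>spow \<theta> s - spow \<theta> t\<bar> \<le> \<bar>s\<bar> powr \<theta> + \<bar>t\<bar> powr \<theta>"
        using abs_spow[of \<theta> s] abs_spow[of \<theta> t] by linarith
      also have "\<dots> \<le> (M * \<bar>s - t\<bar>) powr \<theta> + (M * \<bar>s - t\<bar>) powr \<theta>"
        using s t \<theta> by (intro add_mono powr_mono2) auto
      also have "\<dots> = 2 * M powr \<theta> * \<bar>s - t\<bar> powr \<theta>" using M by (simp add: powr_mult)
      finally have "\<bar>spow \<theta> s - spow \<theta> t\<bar> powr q \<le> (2 * M powr \<theta> * \<bar>s - t\<bar> powr \<theta>) powr q"
        using q by (intro powr_mono2) auto
      also have "\<dots> = K * \<bar>s - t\<bar> powr (\<theta> * q)" using M by (simp add: K_def powr_mult powr_powr)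
      finally show ?thesis using e by (simp add: add_increasing)
    qed
  qed
qed

lemma spow_Lp:
  assumes "0 < p" "0 < q" "f \<in> Lp_rep p"
  shows "(\<lambda>x. spow (p / q) (f x)) \<in> Lp_rep q"
  using assms Lp_rep_integrable[OF assms(3)] by (simp add: Lp_rep_def abs_spow powr_powr)

text \<open>Continuity at a fixed \<open>f\<close>: integrate the pointwise bound. The coefficient
  \<epsilon> is adapted to the norm of \<open>f\<close> and then \<delta> to the resulting
  \<open>K\<close>, each taking half of the allowed error.\<close>

lemma spow_continuous:
  assumes p: "0 < p" and q: "0 < q" and f: "f \<in> Lp_rep p" and e: "0 < e"
  obtains \<delta> where "0 < \<delta>" "\<And>g. g \<in> Lp_rep p \<Longrightarrow> nrm p (\<lambda>x. f x - g x) < \<delta> \<Longrightarrow>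
      nrm q (\<lambda>x. spow (p / q) (f x) - spow (p / q) (g x)) < e"
proof -
  define I where "I = (\<integral>x. \<bar>f x\<bar> powr p \<partial>mu)"
  have I: "0 \<le> I" by (simp add: I_def)
  define E where "E = e powr q"
  have E: "0 < E" using e by (simp add: E_def)
  define \<epsilon> where "\<epsilon> = E / 2 / (I + 1)"
  have eps: "0 < \<epsilon>" "\<epsilon> * I \<le> E / 2" using E I by (auto simp: \<epsilon>_def field_simps)
  obtain K where K: "0 \<le> K" "\<And>s t. \<bar>spow (p / q) s - spow (p / q) t\<bar> powr q \<le> \<epsilon> * \<bar>s\<bar> powr (p / q * q) + K * \<bar>s - t\<bar> powr (p / q * q)"
    using spow_modulus[of "p / q" q \<epsilon>] p q eps by auto
  define \<delta> where "\<delta> = (E / 2 / (K + 1)) powr (1 / p)"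
  have \<delta>: "0 < \<delta>" "K * \<delta> powr p < E / 2"
    using E K(1) p by (auto simp: \<delta>_def powr_powr field_simps)
  show ?thesis
  proof (rule that[OF \<delta>(1)])
    fix g assume g: "g \<in> Lp_rep p" and d: "nrm p (\<lambda>x. f x - g x) < \<delta>"
    have fg: "(\<lambda>x. f x - g x) \<in> Lp_rep p" using Lp_rep_diff[of p f g] p f g by simp
    have m: "(\<lambda>x. spow (p / q) (f x) - spow (p / q) (g x)) \<in> Lp_rep q"
      using Lp_rep_diff[OF _ spow_Lp[OF p q f] spow_Lp[OF p q g]] q by simp
    have "(\<integral>x. \<bar>spow (p / q) (f x) - spow (p / q) (g x)\<bar> powr q \<partial>mu) \<le> (\<integral>x. \<epsilon> * \<bar>f x\<bar> powr p + K * \<bar>f x - g x\<bar> powr p \<partial>mu)"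
      using K(2) q Lp_rep_integrable[OF f] Lp_rep_integrable[OF fg] Lp_rep_integrable[OF m]
      by (intro integral_mono) auto
    also have "\<dots> = \<epsilon> * I + K * (\<integral>x. \<bar>f x - g x\<bar> powr p \<partial>mu)"
      using Lp_rep_integrable[OF f] Lp_rep_integrable[OF fg] by (simp add: I_def)
    also have "(\<integral>x. \<bar>f x - g x\<bar> powr p \<partial>mu) = nrm p (\<lambda>x. f x - g x) powr p" using p by (simp add: nrm_powr)
    also have "\<epsilon> * I + K * nrm p (\<lambda>x. f x - g x) powr p \<le> \<epsilon> * I + K * \<delta> powr p"
      using d p K by (intro add_left_mono mult_left_mono powr_mono2) (auto simp: nrm_nonneg)
    also have "\<dots> < E" using eps \<delta> by linarith
    finally have "nrm q (\<lambda>x. spow (p / q) (f x) - spow (p / q) (g x)) < E powr (1 / q)"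
      unfolding nrm_def using q by (intro powr_less_mono2) auto
    also have "\<dots> = e" using e q by (simp add: E_def powr_powr)
    finally show "nrm q (\<lambda>x. spow (p / q) (f x) - spow (p / q) (g x)) < e" .
  qed
qed

lemma opr_spow:
  assumes "nst f g w" "0 < p" "0 < q"
  shows "opr q g w (\<lambda>x. spow (p / q) (k x)) x = spow (p / q) (opr p g w k x)"
proof (cases "w x = 0")
  case False
  then have "0 < w x" using nst_nonneg[OF assms(1), of x] by simp
  then show ?thesis using assms(2,3)
    by (simp add: opr_def spow_def sgn_mult abs_mult powr_mult powr_powr)
qed (simp add: opr_def spow_def)

section \<open>Comparison of the topologies given by different exponents\<close>

definition topp :: "real \<Rightarrow> (real \<Rightarrow> real) set topology" where
  "topp p = topology_generated_by
     {{C \<in> AutStar. lp_dist p (Phi p C F) G < e} | F G e. F \<in> Lp p \<and> G \<in> Lp p \<and> e > 0}"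

lemma autstar_top_topp: "autstar_top = topp 2"
  by (simp add: autstar_top_def topp_def)

lemma topp_basic:
  "F \<in> Lp p \<Longrightarrow> G \<in> Lp p \<Longrightarrow> 0 < e \<Longrightarrow> openin (topp p) {C \<in> AutStar. lp_dist p (Phi p C F) G < e}"
  unfolding topp_def by (rule topology_generated_by_Basis) auto

lemma Phi_dist_one_zero:
  assumes "1 \<le> p" "C \<in> AutStar"
  shows "lp_dist p (Phi p C (lp_class p (\<lambda>x. 0))) (lp_class p (\<lambda>x. 0)) = 0"
proof -
  obtain f g w where a: "nst f g w" "C = autstar_class f" using assms(2) by (rule AutStar_nst)
  have p: "0 < p" "0 \<le> p" using assms by auto
  show ?thesis using Phi_class[OF a(1) p(1) Lp_rep_const[of 0]] a(2) p
    by (simp add: lp_dist_class[OF p(2) opr_Lp[OF a(1) p(1) Lp_rep_const] Lp_rep_const] opr_def nrm_def)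
qed

lemma openin_topp_AutStar: "1 \<le> p \<Longrightarrow> openin (topp p) AutStar"
  using topp_basic[OF lp_classI lp_classI, of "\<lambda>x. 0" p "\<lambda>x. 0" 1] Phi_dist_one_zero[of p]
  by (simp add: Lp_rep_const cong: conj_cong)

lemma topspace_topp: "1 \<le> p \<Longrightarrow> topspace (topp p) = AutStar"
proof
  show "topspace (topp p) \<subseteq> AutStar" unfolding topp_def topology_generated_by_topspace by auto
  show "1 \<le> p \<Longrightarrow> AutStar \<subseteq> topspace (topp p)" by (rule openin_subset[OF openin_topp_AutStar])
qed

text \<open>The subbasic sets are balls around arbitrary vectors \<open>G\<close>; the triangle
  inequality recentres them at the image of \<open>F\<close> under the point in question, giving a
  usable neighbourhood base.\<close>

lemma openin_topp_iff:
  assumes p: "1 \<le> p"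
  shows "openin (topp p) U \<longleftrightarrow> U \<subseteq> AutStar \<and> (\<forall>C\<in>U. \<exists>K e. finite K \<and> K \<subseteq> Lp p \<and> 0 < e \<and>
     (\<forall>D\<in>AutStar. (\<forall>F\<in>K. lp_dist p (Phi p D F) (Phi p C F) < e) \<longrightarrow> D \<in> U))" (is "?L U \<longleftrightarrow> ?R U")
proof
  have p0: "0 \<le> p" "0 < p" using p by auto
  assume "?L U"
  then have "generate_topology_on {{C \<in> AutStar. lp_dist p (Phi p C F) G < e} | F G e. F \<in> Lp p \<and> G \<in> Lp p \<and> e > 0} U"
    by (simp add: topp_def openin_topology_generated_by_iff)
  then show "?R U"
  proof induction
    case (Int a b)
    show ?case
    proof (intro conjI ballI)
      fix C assume C: "C \<in> a \<inter> b"
      have "C \<in> a" "C \<in> b" using C by auto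
      from bspec[OF conjunct2[OF Int.IH(1)] this(1)]
      obtain K e where K: "finite K" "K \<subseteq> Lp p" "0 < e"
        "\<forall>D\<in>AutStar. (\<forall>F\<in>K. lp_dist p (Phi p D F) (Phi p C F) < e) \<longrightarrow> D \<in> a"
        by (elim exE conjE)
      from bspec[OF conjunct2[OF Int.IH(2)] \<open>C \<in> b\<close>]
      obtain K' e' where K': "finite K'" "K' \<subseteq> Lp p" "0 < e'"
        "\<forall>D\<in>AutStar. (\<forall>F\<in>K'. lp_dist p (Phi p D F) (Phi p C F) < e') \<longrightarrow> D \<in> b"
        by (elim exE conjE)
      show "\<exists>K e. finite K \<and> K \<subseteq> Lp p \<and> 0 < e \<and>
          (\<forall>D\<in>AutStar. (\<forall>F\<in>K. lp_dist p (Phi p D F) (Phi p C F) < e) \<longrightarrow> D \<in> a \<inter> b)"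
      proof (rule exI[of _ "K \<union> K'"], rule exI[of _ "min e e'"], intro conjI ballI impI)
        fix D assume D: "D \<in> AutStar" "\<forall>F\<in>K \<union> K'. lp_dist p (Phi p D F) (Phi p C F) < min e e'"
        then show "D \<in> a \<inter> b" using K(4) K'(4) by (simp add: ball_Un)
      qed (use K(1-3) K'(1-3) in auto)
    next
      show "a \<inter> b \<subseteq> AutStar" using Int.IH(1) by blast
    qed
  next
    case (UN K)
    show ?case
    proof (intro conjI ballI)
      fix C assume "C \<in> \<Union>K"
      then obtain k where k: "k \<in> K" "C \<in> k" by blast
      then have kK: "k \<subseteq> \<Union>K" by blast
      from bspec[OF conjunct2[OF UN.IH[OF k(1)]] k(2)]
      obtain K' e where K': "finite K'" "K' \<subseteq> Lp p" "0 < e"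
        "\<forall>D\<in>AutStar. (\<forall>F\<in>K'. lp_dist p (Phi p D F) (Phi p C F) < e) \<longrightarrow> D \<in> k"
        by (elim exE conjE)
      show "\<exists>Ka e. finite Ka \<and> Ka \<subseteq> Lp p \<and> 0 < e \<and>
          (\<forall>D\<in>AutStar. (\<forall>F\<in>Ka. lp_dist p (Phi p D F) (Phi p C F) < e) \<longrightarrow> D \<in> \<Union>K)"
        by (rule exI[of _ K'], rule exI[of _ e], intro conjI ballI impI) (use K' kK in blast)+
    next
      show "\<Union>K \<subseteq> AutStar" using UN.IH by blast
    qed
  next
    case (Basis s)
    then obtain F G e where s: "s = {C \<in> AutStar. lp_dist p (Phi p C F) G < e}" "F \<in> Lp p" "G \<in> Lp p" "e > 0"
      by auto
    show ?case
    proof (intro conjI ballI)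
      fix C assume C: "C \<in> s"
      let ?r = "e - lp_dist p (Phi p C F) G"
      show "\<exists>K e. finite K \<and> K \<subseteq> Lp p \<and> 0 < e \<and>
          (\<forall>D\<in>AutStar. (\<forall>F\<in>K. lp_dist p (Phi p D F) (Phi p C F) < e) \<longrightarrow> D \<in> s)"
      proof (rule exI[of _ "{F}"], rule exI[of _ ?r], intro conjI ballI impI)
        fix D assume D: "D \<in> AutStar" "\<forall>F\<in>{F}. lp_dist p (Phi p D F) (Phi p C F) < ?r"
        have "lp_dist p (Phi p D F) G \<le> lp_dist p (Phi p D F) (Phi p C F) + lp_dist p (Phi p C F) G"
          using lp_dist_triangle[OF p Phi_Lp[OF D(1) p0(2) s(2)] Phi_Lp[OF _ p0(2) s(2)] s(3)] C s by auto
        then show "D \<in> s" using D s by auto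
      qed (use C s in auto)
    qed (use s in auto)
  qed auto
next
  have p0: "0 \<le> p" "0 < p" using p by auto
  assume R: "?R U"
  show "?L U"
  proof (subst openin_subopen, intro ballI)
    fix C assume C: "C \<in> U"
    from bspec[OF conjunct2[OF R] C]
    obtain K e where K: "finite K" "K \<subseteq> Lp p" "0 < e"
      "\<forall>D\<in>AutStar. (\<forall>F\<in>K. lp_dist p (Phi p D F) (Phi p C F) < e) \<longrightarrow> D \<in> U"
      by (elim exE conjE)
    have CA: "C \<in> AutStar" using C R by auto
    define T where "T = AutStar \<inter> (\<Inter>F\<in>K. {D \<in> AutStar. lp_dist p (Phi p D F) (Phi p C F) < e})"
    have self: "lp_dist p (Phi p C F) (Phi p C F) = 0" if "F \<in> K" for F
      using lp_dist_eq_0_iff[OF p0(2), of "Phi p C F" "Phi p C F"] Phi_Lp[OF CA p0(2)] that K by auto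
    have "openin (topp p) T"
    proof (cases "K = {}")
      case True
      then show ?thesis using openin_topp_AutStar[OF p] by (simp add: T_def)
    next
      case False
      then show ?thesis unfolding T_def
        using K Phi_Lp[OF CA p0(2)] openin_topp_AutStar[OF p]
        by (intro openin_Int openin_INT2) (auto intro!: topp_basic)
    qed
    moreover have "C \<in> T" "T \<subseteq> U" using K CA self by (auto simp: T_def)
    ultimately show "\<exists>T. openin (topp p) T \<and> C \<in> T \<and> T \<subseteq> U" by blast
  qed
qed

text \<open>Take the Mazur image of the test vector. The Mazur map commutes with the action, so it
  is enough that the inverse Mazur map is continuous at the one vector
  \<open>Phi q C F'\<close>.\<close>

lemma topp_transfer:
  assumes p: "1 \<le> p" and q: "1 \<le> q" and F: "F \<in> Lp p" and C: "C \<in> AutStar" and e: "0 < e"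
  obtains F' \<delta> where "F' \<in> Lp q" "0 < \<delta>"
    "\<And>D. D \<in> AutStar \<Longrightarrow> lp_dist q (Phi q D F') (Phi q C F') < \<delta> \<Longrightarrow> lp_dist p (Phi p D F) (Phi p C F) < e"
proof -
  have p0: "0 < p" "0 < q" "0 \<le> p" "0 \<le> q" using p q by auto
  obtain k where k: "k \<in> Lp_rep p" "F = lp_class p k" using F by (rule Lp_cases)
  define m where "m = (\<lambda>x. spow (p / q) (k x))"
  have m: "m \<in> Lp_rep q" unfolding m_def by (rule spow_Lp[OF p0(1,2) k(1)])
  obtain f g w where a: "nst f g w" "C = autstar_class f" using C by (rule AutStar_nst)
  obtain \<delta> where d: "0 < \<delta>" "\<And>l. l \<in> Lp_rep q \<Longrightarrow> nrm q (\<lambda>x. opr q g w m x - l x) < \<delta> \<Longrightarrow>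
      nrm p (\<lambda>x. spow (q / p) (opr q g w m x) - spow (q / p) (l x)) < e"
    using spow_continuous[OF p0(2,1) opr_Lp[OF a(1) p0(2) m] e] by blast
  have unpow: "spow (q / p) (opr q g' w' m x) = opr p g' w' k x" if "nst f' g' w'" for f' g' w' x
    unfolding m_def opr_spow[OF that p0(1,2)] using p0 by (intro spow_spow) auto
  show ?thesis
  proof (rule that[OF lp_classI[OF m] d(1)])
    fix D assume D: "D \<in> AutStar" "lp_dist q (Phi q D (lp_class q m)) (Phi q C (lp_class q m)) < \<delta>"
    obtain f' g' w' where b: "nst f' g' w'" "D = autstar_class f'" using D(1) by (rule AutStar_nst)
    have "nrm q (\<lambda>x. opr q g w m x - opr q g' w' m x) < \<delta>"
      using D(2) a b p0 m opr_Lp[OF a(1) p0(2) m] opr_Lp[OF b(1) p0(2) m]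
      by (simp add: Phi_class lp_dist_class nrm_minus_commute[of _ "opr q g w m"])
    from d(2)[OF opr_Lp[OF b(1) p0(2) m] this]
    have "nrm p (\<lambda>x. opr p g w k x - opr p g' w' k x) < e" unfolding unpow[OF a(1)] unpow[OF b(1)] .
    then show "lp_dist p (Phi p D F) (Phi p C F) < e"
      using a b p0 k opr_Lp[OF a(1) p0(1) k(1)] opr_Lp[OF b(1) p0(1) k(1)]
      by (simp add: Phi_class lp_dist_class nrm_minus_commute[of _ "opr p g w k"])
  qed
qed

lemma topp_finer:
  assumes p: "1 \<le> p" and q: "1 \<le> q" and U: "openin (topp p) U"
  shows "openin (topp q) U"
  unfolding openin_topp_iff[OF q]
proof (intro conjI ballI)
  show UA: "U \<subseteq> AutStar" using U openin_topp_iff[OF p] by blast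
  fix C assume C: "C \<in> U"
  then obtain K e where K: "finite K" "K \<subseteq> Lp p" "0 < e"
      "\<And>D. D\<in>AutStar \<Longrightarrow> \<forall>F\<in>K. lp_dist p (Phi p D F) (Phi p C F) < e \<Longrightarrow> D \<in> U"
    using U openin_topp_iff[OF p, of U] by meson
  have CA: "C \<in> AutStar" using C UA by auto
  have "\<forall>F\<in>K. \<exists>F' \<delta>. F' \<in> Lp q \<and> 0 < \<delta> \<and> (\<forall>D\<in>AutStar. lp_dist q (Phi q D F') (Phi q C F') < \<delta> \<longrightarrow>
      lp_dist p (Phi p D F) (Phi p C F) < e)"
  proof
    fix F assume "F \<in> K"
    then have "F \<in> Lp p" using K(2) by auto
    from topp_transfer[OF p q this CA K(3)] show "\<exists>F' \<delta>. F' \<in> Lp q \<and> 0 < \<delta> \<and>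
      (\<forall>D\<in>AutStar. lp_dist q (Phi q D F') (Phi q C F') < \<delta> \<longrightarrow> lp_dist p (Phi p D F) (Phi p C F) < e)" by metis
  qed
  then obtain m \<delta> where m: "\<And>F. F \<in> K \<Longrightarrow> m F \<in> Lp q" "\<And>F. F \<in> K \<Longrightarrow> 0 < \<delta> F"
      "\<And>F D. F \<in> K \<Longrightarrow> D \<in> AutStar \<Longrightarrow> lp_dist q (Phi q D (m F)) (Phi q C (m F)) < \<delta> F \<Longrightarrow> lp_dist p (Phi p D F) (Phi p C F) < e"
    by metis
  \<comment> \<open>The inserted 1 keeps the minimum meaningful and positive when there are no test
    vectors.\<close>
  define d where "d = Min (insert 1 (\<delta> ` K))"
  have d: "0 < d" "\<And>F. F \<in> K \<Longrightarrow> d \<le> \<delta> F" using K(1) m(2) by (auto simp: d_def)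
  show "\<exists>K e. finite K \<and> K \<subseteq> Lp q \<and> 0 < e \<and>
     (\<forall>D\<in>AutStar. (\<forall>F\<in>K. lp_dist q (Phi q D F) (Phi q C F) < e) \<longrightarrow> D \<in> U)"
  proof (rule exI[of _ "m ` K"], rule exI[of _ d], intro conjI ballI impI)
    fix D assume D: "D \<in> AutStar" "\<forall>F\<in>m ` K. lp_dist q (Phi q D F) (Phi q C F) < d"
    show "D \<in> U"
    proof (rule K(4)[OF D(1)], rule ballI)
      fix F assume F: "F \<in> K"
      have "lp_dist q (Phi q D (m F)) (Phi q C (m F)) < \<delta> F" using D(2) d(2)[OF F] F by fastforce
      then show "lp_dist p (Phi p D F) (Phi p C F) < e" by (rule m(3)[OF F D(1)])
    qed
  qed (use K m d in auto)
qed

lemma autstar_top_eq_topp: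
  assumes "1 \<le> p" shows "autstar_top = topp p"
  unfolding autstar_top_topp topology_eq using topp_finer[of 2 p] topp_finer[of p 2] assms by auto

lemma topspace_autstar_top: "topspace autstar_top = AutStar"
  unfolding autstar_top_topp by (rule topspace_topp) simp

text \<open>Injectivity makes images commute with finite intersections, so images of generated open
  sets are generated by the images of the generators.\<close>

lemma homeomorphic_map_generated:
  assumes bij: "bij_betw h A B" and sub: "\<And>S. S \<in> \<S> \<Longrightarrow> S \<subseteq> A" and un: "\<Union>\<S> = A"
  shows "homeomorphic_map (topology_generated_by \<S>) (topology_generated_by ((`) h ` \<S>)) h"
proof (rule bijective_open_imp_homeomorphic_map)
  have inj: "inj_on h A" and im: "h ` A = B" using bij by (auto simp: bij_betw_def)
  have un': "\<Union>((`) h ` \<S>) = B" using un im by auto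
  show "continuous_map (topology_generated_by \<S>) (topology_generated_by ((`) h ` \<S>)) h"
  proof (rule continuous_on_generated_topo)
    show "h ` topspace (topology_generated_by \<S>) \<subseteq> \<Union>((`) h ` \<S>)"
      unfolding topology_generated_by_topspace by auto
    fix U assume "U \<in> (`) h ` \<S>"
    then obtain S where S: "S \<in> \<S>" "U = h ` S" by auto
    have "h -` U \<inter> topspace (topology_generated_by \<S>) = S"
      unfolding topology_generated_by_topspace un S(2) using inj sub[OF S(1)] by (auto dest: inj_onD)
    then show "openin (topology_generated_by \<S>) (h -` U \<inter> topspace (topology_generated_by \<S>))"
      using topology_generated_by_Basis[OF S(1)] by simp
  qed
  show "open_map (topology_generated_by \<S>) (topology_generated_by ((`) h ` \<S>)) h"
    unfolding open_map_def
  proof (intro allI impI)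
    fix U assume "openin (topology_generated_by \<S>) U"
    then have "generate_topology_on \<S> U" by (simp add: openin_topology_generated_by_iff)
    then have "U \<subseteq> A \<and> openin (topology_generated_by ((`) h ` \<S>)) (h ` U)"
    proof induction
      case (Int a b)
      then have "h ` (a \<inter> b) = h ` a \<inter> h ` b" by (intro inj_on_image_Int[OF inj]) auto
      then show ?case using Int by auto
    next
      case (UN K)
      have "h ` \<Union>K = \<Union>((`) h ` K)" by auto
      then show ?case using UN by auto
    next
      case (Basis s)
      then show ?case using sub by (auto intro: topology_generated_by_Basis)
    qed auto
    then show "openin (topology_generated_by ((`) h ` \<S>)) (h ` U)" by simp
  qed
  show "h ` topspace (topology_generated_by \<S>) = topspace (topology_generated_by ((`) h ` \<S>))"
    unfolding topology_generated_by_topspace by auto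
  show "inj_on h (topspace (topology_generated_by \<S>))"
    unfolding topology_generated_by_topspace un by (rule inj)
qed

lemma Phi_homeomorphic:
  assumes p: "1 \<le> p"
  shows "homeomorphic_map autstar_top (aut_lattice_top p) (Phi p)"
proof -
  let ?S = "{{C \<in> AutStar. lp_dist p (Phi p C F) G < e} | F G e. F \<in> Lp p \<and> G \<in> Lp p \<and> e > 0}"
  have im: "Phi p ` {C \<in> AutStar. lp_dist p (Phi p C F) G < e} = {T \<in> aut_lattice p. lp_dist p (T F) G < e}" for F G e
    using Phi_bij[OF p] by (auto simp: bij_betw_def)
  have e: "(`) (Phi p) ` ?S = {{T \<in> aut_lattice p. lp_dist p (T F) G < e} | F G e. F \<in> Lp p \<and> G \<in> Lp p \<and> e > 0}"
    (is "_ = ?T")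
  proof
    show "(`) (Phi p) ` ?S \<subseteq> ?T" using im by blast
    show "?T \<subseteq> (`) (Phi p) ` ?S"
    proof
      fix V assume "V \<in> ?T"
      then obtain F G e where "V = {T \<in> aut_lattice p. lp_dist p (T F) G < e}" "F \<in> Lp p" "G \<in> Lp p" "e > 0" by blast
      then have "V = Phi p ` {C \<in> AutStar. lp_dist p (Phi p C F) G < e}"
        and "{C \<in> AutStar. lp_dist p (Phi p C F) G < e} \<in> ?S"
        using im by blast+
      then show "V \<in> (`) (Phi p) ` ?S" by (rule image_eqI)
    qed
  qed
  have "homeomorphic_map (topology_generated_by ?S) (topology_generated_by ((`) (Phi p) ` ?S)) (Phi p)"
  proof (rule homeomorphic_map_generated[OF Phi_bij[OF p]])
    show "\<Union>?S = AutStar" using topspace_topp[OF p] unfolding topp_def topology_generated_by_topspace .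
  qed auto
  then show ?thesis unfolding e autstar_top_eq_topp[OF p] topp_def aut_lattice_top_def .
qed

text \<open>The distance from \<open>C' D' F\<close> to \<open>G\<close> splits over
  \<open>C' D F\<close> and \<open>C D F\<close>. In the first part \<open>C'\<close> cancels
  because it is an isometry, so continuity of the two factors at the vectors \<open>F\<close> and
  \<open>D F\<close> is enough.\<close>

lemma autstar_mult_continuous:
  "continuous_map (prod_topology autstar_top autstar_top) autstar_top (\<lambda>(C, D). autstar_mult C D)"
  unfolding autstar_top_topp topp_def[of 2]
proof (rule continuous_on_generated_topo)
  let ?X = "topology_generated_by {{C \<in> AutStar. lp_dist 2 (Phi 2 C F) G < e} |F G e. F \<in> Lp 2 \<and> G \<in> Lp 2 \<and> 0 < e}"
  have X: "?X = topp 2" by (simp add: topp_def)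
  have ts: "topspace (prod_topology ?X ?X) = AutStar \<times> AutStar" unfolding X by (simp add: topspace_topp)
  show "(\<lambda>(C, D). autstar_mult C D) ` topspace (prod_topology ?X ?X)
      \<subseteq> \<Union>{{C \<in> AutStar. lp_dist 2 (Phi 2 C F) G < e} |F G e. F \<in> Lp 2 \<and> G \<in> Lp 2 \<and> 0 < e}"
    unfolding ts using AutStar_mult topspace_topp[of 2] unfolding topp_def topology_generated_by_topspace by auto
  fix U assume "U \<in> {{C \<in> AutStar. lp_dist 2 (Phi 2 C F) G < e} |F G e. F \<in> Lp 2 \<and> G \<in> Lp 2 \<and> 0 < e}"
  then obtain F G e where U: "U = {C \<in> AutStar. lp_dist 2 (Phi 2 C F) G < e}" "F \<in> Lp 2" "G \<in> Lp 2" "0 < e" by blast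
  show "openin (prod_topology ?X ?X) ((\<lambda>(C, D). autstar_mult C D) -` U \<inter> topspace (prod_topology ?X ?X))"
    unfolding ts unfolding X
  proof (subst openin_subopen, intro ballI)
    fix z assume "z \<in> (\<lambda>(C, D). autstar_mult C D) -` U \<inter> AutStar \<times> AutStar"
    then obtain C D where z: "z = (C, D)" "C \<in> AutStar" "D \<in> AutStar" "lp_dist 2 (Phi 2 (autstar_mult C D) F) G < e"
      by (auto simp: U)
    note L = Phi_Lp[where p=2, simplified]
    define H where "H = Phi 2 D F"
    have H: "H \<in> Lp 2" unfolding H_def by (rule L[OF z(3) U(2)])
    have CH: "Phi 2 C H \<in> Lp 2" by (rule L[OF z(2) H])
    have zd: "lp_dist 2 (Phi 2 C H) G < e" using z U(2) by (simp add: H_def Phi_mult_app)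
    \<comment> \<open>Half of the slack for each of the two perturbations.\<close>
    define r where "r = (e - lp_dist 2 (Phi 2 C H) G) / 2"
    have r: "0 < r" using zd by (simp add: r_def)
    have self: "lp_dist 2 F' F' = 0" if "F' \<in> Lp 2" for F' using lp_dist_eq_0_iff[of 2 F' F'] that by simp
    define V where "V = {C' \<in> AutStar. lp_dist 2 (Phi 2 C' H) (Phi 2 C H) < r}"
    define W where "W = {D' \<in> AutStar. lp_dist 2 (Phi 2 D' F) H < r}"
    have "openin (topp 2) V" "openin (topp 2) W"
      unfolding V_def W_def using topp_basic H CH r U(2) by auto
    then have "openin (prod_topology (topp 2) (topp 2)) (V \<times> W)" by (simp add: openin_prod_Times_iff)
    moreover have "z \<in> V \<times> W" using z r self[OF CH] self[OF H] by (simp add: V_def W_def H_def)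
    moreover have "V \<times> W \<subseteq> (\<lambda>(C, D). autstar_mult C D) -` U \<inter> AutStar \<times> AutStar"
    proof
      fix y assume "y \<in> V \<times> W"
      then obtain C' D' where y: "y = (C', D')" "C' \<in> AutStar" "D' \<in> AutStar"
        "lp_dist 2 (Phi 2 C' H) (Phi 2 C H) < r" "lp_dist 2 (Phi 2 D' F) H < r" by (auto simp: V_def W_def)
      note D'F = L[OF y(3) U(2)]
      have "lp_dist 2 (Phi 2 C' (Phi 2 D' F)) G \<le> lp_dist 2 (Phi 2 C' (Phi 2 D' F)) (Phi 2 C' H) + lp_dist 2 (Phi 2 C' H) G"
        by (intro lp_dist_triangle L y U D'F H) simp
      also have "lp_dist 2 (Phi 2 C' H) G \<le> lp_dist 2 (Phi 2 C' H) (Phi 2 C H) + lp_dist 2 (Phi 2 C H) G"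
        by (intro lp_dist_triangle L y U CH H) simp
      also have "lp_dist 2 (Phi 2 C' (Phi 2 D' F)) (Phi 2 C' H) = lp_dist 2 (Phi 2 D' F) H"
        by (intro Phi_dist y D'F H) simp
      finally have "lp_dist 2 (Phi 2 C' (Phi 2 D' F)) G < e" using y by (simp add: r_def)
      then show "y \<in> (\<lambda>(C, D). autstar_mult C D) -` U \<inter> AutStar \<times> AutStar"
        using y U by (simp add: AutStar_mult Phi_mult_app)
    qed
    ultimately show "\<exists>T. openin (prod_topology (topp 2) (topp 2)) T \<and> z \<in> T \<and> T \<subseteq> (\<lambda>(C, D). autstar_mult C D) -` U \<inter> AutStar \<times> AutStar"
      by blast
  qed
qed

text \<open>Applying the isometry \<open>C\<close> turns a distance between inverses into a distance
  between \<open>C\<close> and \<open>D\<close> at another vector. Inversion is therefore controlled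
  by the same topology.\<close>

lemma Phi_inverse_dist:
  assumes "1 \<le> p" "C \<in> AutStar" "D \<in> AutStar" "F \<in> Lp p"
  shows "lp_dist p (Phi p (autstar_inverse C) F) (Phi p (autstar_inverse D) F)
       = lp_dist p (Phi p C (Phi p (autstar_inverse D) F)) (Phi p D (Phi p (autstar_inverse D) F))"
proof -
  have p: "0 < p" "0 \<le> p" using assms(1) by auto
  note L = Phi_Lp[OF AutStar_inverse p(1)]
  have "lp_dist p (Phi p (autstar_inverse C) F) (Phi p (autstar_inverse D) F)
    = lp_dist p (Phi p C (Phi p (autstar_inverse C) F)) (Phi p C (Phi p (autstar_inverse D) F))"
    using assms p L by (simp add: Phi_dist)
  also have "\<dots> = lp_dist p F (Phi p C (Phi p (autstar_inverse D) F))" using assms p by (simp add: Phi_inverse_app)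
  finally show ?thesis using assms p L Phi_Lp by (simp add: Phi_inverse_app lp_dist_commute)
qed

lemma autstar_inverse_continuous: "continuous_map autstar_top autstar_top autstar_inverse"
  unfolding continuous_map_def topspace_autstar_top
proof (intro conjI allI impI)
  show "autstar_inverse \<in> AutStar \<rightarrow> AutStar" using AutStar_inverse by auto
  fix U assume "openin autstar_top U"
  then have U: "openin (topp 2) U" by (simp add: autstar_top_topp)
  have two: "1 \<le> (2::real)" by simp
  show "openin autstar_top {C \<in> AutStar. autstar_inverse C \<in> U}"
    unfolding autstar_top_topp openin_topp_iff[OF two]
  proof (intro conjI ballI)
    fix C assume "C \<in> {C \<in> AutStar. autstar_inverse C \<in> U}"
    then have C: "C \<in> AutStar" "autstar_inverse C \<in> U" by auto
    then obtain K e where K: "finite K" "K \<subseteq> Lp 2" "0 < e"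
      "\<And>D. D\<in>AutStar \<Longrightarrow> \<forall>F\<in>K. lp_dist 2 (Phi 2 D F) (Phi 2 (autstar_inverse C) F) < e \<Longrightarrow> D \<in> U"
      using U openin_topp_iff[OF two, of U] by meson
    show "\<exists>K e. finite K \<and> K \<subseteq> Lp 2 \<and> 0 < e \<and>
      (\<forall>D\<in>AutStar. (\<forall>F\<in>K. lp_dist 2 (Phi 2 D F) (Phi 2 C F) < e) \<longrightarrow> D \<in> {C \<in> AutStar. autstar_inverse C \<in> U})"
    proof (rule exI[of _ "Phi 2 (autstar_inverse C) ` K"], rule exI[of _ e], intro conjI ballI impI)
      fix D assume D: "D \<in> AutStar" "\<forall>F\<in>Phi 2 (autstar_inverse C) ` K. lp_dist 2 (Phi 2 D F) (Phi 2 C F) < e"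
      have "autstar_inverse D \<in> U"
        by (rule K(4)[OF AutStar_inverse[OF D(1)]])
          (use D K(2) Phi_inverse_dist[of 2 D C] C in auto)
      then show "D \<in> {C \<in> AutStar. autstar_inverse C \<in> U}" using D by simp
    qed (use K Phi_Lp[OF AutStar_inverse[OF C(1)], of 2] in auto)
  qed auto
qed

section \<open>Polishness\<close>

lemma lp_dist_add:
  assumes p: "1 \<le> p" and L: "F \<in> Lp p" "G \<in> Lp p" "F' \<in> Lp p" "G' \<in> Lp p"
  shows "lp_dist p (lp_add p F G) (lp_add p F' G') \<le> lp_dist p F F' + lp_dist p G G'"
proof -
  have p0: "0 \<le> p" using p by simp
  obtain f where f: "f \<in> Lp_rep p" "F = lp_class p f" using L(1) by (rule Lp_cases)
  obtain g where g: "g \<in> Lp_rep p" "G = lp_class p g" using L(2) by (rule Lp_cases)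
  obtain f' where f': "f' \<in> Lp_rep p" "F' = lp_class p f'" using L(3) by (rule Lp_cases)
  obtain g' where g': "g' \<in> Lp_rep p" "G' = lp_class p g'" using L(4) by (rule Lp_cases)
  have "nrm p (\<lambda>x. f x + g x - (f' x + g' x)) = nrm p (\<lambda>x. (f x - f' x) + (g x - g' x))"
    by (simp add: algebra_simps)
  also have "\<dots> \<le> nrm p (\<lambda>x. f x - f' x) + nrm p (\<lambda>x. g x - g' x)"
    by (intro nrm_triangle p Lp_rep_diff p0 f g f' g')
  finally show ?thesis using f g f' g' p0 by (simp add: lp_add_class lp_dist_class Lp_rep_add)
qed

lemma lp_dist_lattice:
  assumes p: "1 \<le> p" and L: "F \<in> Lp p" "G \<in> Lp p" "F' \<in> Lp p" "G' \<in> Lp p"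
  shows "lp_dist p (lp_sup p F G) (lp_sup p F' G') \<le> lp_dist p F F' + lp_dist p G G'"
    and "lp_dist p (lp_inf p F G) (lp_inf p F' G') \<le> lp_dist p F F' + lp_dist p G G'"
proof -
  have p0: "0 \<le> p" "0 < p" using p by auto
  obtain f where f: "f \<in> Lp_rep p" "F = lp_class p f" using L(1) by (rule Lp_cases)
  obtain g where g: "g \<in> Lp_rep p" "G = lp_class p g" using L(2) by (rule Lp_cases)
  obtain f' where f': "f' \<in> Lp_rep p" "F' = lp_class p f'" using L(3) by (rule Lp_cases)
  obtain g' where g': "g' \<in> Lp_rep p" "G' = lp_class p g'" using L(4) by (rule Lp_cases)
  note reps = f(1) g(1) f'(1) g'(1)
  note [measurable] = reps[THEN Lp_rep_borel]
  have s: "(\<lambda>x. \<bar>f x - f' x\<bar> + \<bar>g x - g' x\<bar>) \<in> Lp_rep p"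
    by (intro Lp_rep_add Lp_rep_abs Lp_rep_diff p0 reps)
  have t: "nrm p (\<lambda>x. \<bar>f x - f' x\<bar> + \<bar>g x - g' x\<bar>) \<le> nrm p (\<lambda>x. f x - f' x) + nrm p (\<lambda>x. g x - g' x)"
    using nrm_triangle[OF p Lp_rep_abs[OF Lp_rep_diff[OF p0(1) f(1) f'(1)]] Lp_rep_abs[OF Lp_rep_diff[OF p0(1) g(1) g'(1)]]]
    by (simp add: nrm_def)
  have "nrm p (\<lambda>x. max (f x) (g x) - max (f' x) (g' x)) \<le> nrm p (\<lambda>x. \<bar>f x - f' x\<bar> + \<bar>g x - g' x\<bar>)"
    by (rule nrm_mono[OF p0(2) s]) (auto intro!: AE_I2)
  then show "lp_dist p (lp_sup p F G) (lp_sup p F' G') \<le> lp_dist p F F' + lp_dist p G G'"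
    using f g f' g' p0 t by (simp add: lp_sup_class lp_dist_class Lp_rep_max)
  have "nrm p (\<lambda>x. min (f x) (g x) - min (f' x) (g' x)) \<le> nrm p (\<lambda>x. \<bar>f x - f' x\<bar> + \<bar>g x - g' x\<bar>)"
    by (rule nrm_mono[OF p0(2) s]) (auto intro!: AE_I2)
  then show "lp_dist p (lp_inf p F G) (lp_inf p F' G') \<le> lp_dist p F F' + lp_dist p G G'"
    using f g f' g' p0 t by (simp add: lp_inf_class lp_dist_class Lp_rep_min)
qed

lemma lp_dist_scale:
  assumes p: "0 < p" and L: "F \<in> Lp p" "F' \<in> Lp p"
  shows "lp_dist p (lp_scale p c F) (lp_scale p c F') = \<bar>c\<bar> * lp_dist p F F'"
proof -
  obtain f where f: "f \<in> Lp_rep p" "F = lp_class p f" using L(1) by (rule Lp_cases)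
  obtain f' where f': "f' \<in> Lp_rep p" "F' = lp_class p f'" using L(2) by (rule Lp_cases)
  have "nrm p (\<lambda>x. c * f x - c * f' x) = nrm p (\<lambda>x. c * (f x - f' x))" by (simp add: algebra_simps)
  also have "\<dots> = \<bar>c\<bar> * nrm p (\<lambda>x. f x - f' x)" by (rule nrm_scale[OF p])
  finally show ?thesis using f f' p by (simp add: lp_scale_class lp_dist_class Lp_rep_scale)
qed

lemma lp_norm_diff:
  assumes p: "1 \<le> p" and L: "F \<in> Lp p" "F' \<in> Lp p"
  shows "lp_norm p F \<le> lp_norm p F' + lp_dist p F F'"
proof -
  have p0: "0 \<le> p" using p by simp
  obtain f where f: "f \<in> Lp_rep p" "F = lp_class p f" using L(1) by (rule Lp_cases)
  obtain f' where f': "f' \<in> Lp_rep p" "F' = lp_class p f'" using L(2) by (rule Lp_cases)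
  show ?thesis
    using nrm_triangle[OF p f'(1) Lp_rep_diff[OF p0 f(1) f'(1)]] f f' p0
    by (simp add: lp_norm_class lp_dist_class)
qed

definition lp_conv :: "(nat \<Rightarrow> (real \<Rightarrow> real) set) \<Rightarrow> (real \<Rightarrow> real) set \<Rightarrow> bool" where
  "lp_conv X F \<longleftrightarrow> (\<forall>n. X n \<in> Lp 1) \<and> F \<in> Lp 1 \<and> (\<lambda>n. lp_dist 1 (X n) F) \<longlonglongrightarrow> 0"

lemma lp_conv_dominated:
  assumes "\<And>n. X n \<in> Lp 1" "F \<in> Lp 1" "\<And>n. lp_dist 1 (X n) F \<le> b n" "b \<longlonglongrightarrow> 0"
  shows "lp_conv X F"
  unfolding lp_conv_def using assms by (auto intro!: tendsto_sandwich[OF _ _ tendsto_const assms(4)] simp: lp_dist_nonneg)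

lemma lp_conv_unique:
  assumes "lp_conv X F" "lp_conv X G" shows "F = G"
proof -
  have L: "\<And>n. X n \<in> Lp 1" "F \<in> Lp 1" "G \<in> Lp 1" using assms by (auto simp: lp_conv_def)
  have "(\<lambda>n. lp_dist 1 (X n) F + lp_dist 1 (X n) G) \<longlonglongrightarrow> 0 + 0"
    by (intro tendsto_add) (use assms in \<open>auto simp: lp_conv_def\<close>)
  moreover have "lp_dist 1 F G \<le> lp_dist 1 (X n) F + lp_dist 1 (X n) G" for n
    using lp_dist_triangle[of 1 F "X n" G] lp_dist_commute[of 1 F "X n"] L by simp
  ultimately have "lp_dist 1 F G \<le> 0" by (intro LIMSEQ_le_const) auto
  then have "lp_dist 1 F G = 0" using lp_dist_nonneg[of 1 F G] by simp
  then show ?thesis using lp_dist_eq_0_iff[of 1 F G] L by simp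
qed

lemma lp_conv_ops:
  assumes a: "lp_conv X F" and b: "lp_conv Y G"
  shows "lp_conv (\<lambda>n. lp_add 1 (X n) (Y n)) (lp_add 1 F G)"
    "lp_conv (\<lambda>n. lp_sup 1 (X n) (Y n)) (lp_sup 1 F G)"
    "lp_conv (\<lambda>n. lp_inf 1 (X n) (Y n)) (lp_inf 1 F G)"
    "lp_conv (\<lambda>n. lp_scale 1 c (X n)) (lp_scale 1 c F)"
    "(\<lambda>n. lp_norm 1 (X n)) \<longlonglongrightarrow> lp_norm 1 F"
proof -
  have L: "\<And>n. X n \<in> Lp 1" "\<And>n. Y n \<in> Lp 1" "F \<in> Lp 1" "G \<in> Lp 1"
    and l: "(\<lambda>n. lp_dist 1 (X n) F) \<longlonglongrightarrow> 0" "(\<lambda>n. lp_dist 1 (Y n) G) \<longlonglongrightarrow> 0"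
    using a b by (auto simp: lp_conv_def)
  have s: "(\<lambda>n. lp_dist 1 (X n) F + lp_dist 1 (Y n) G) \<longlonglongrightarrow> 0" using tendsto_add[OF l] by simp
  note cl = lp_closed[where p=1, simplified]
  show "lp_conv (\<lambda>n. lp_add 1 (X n) (Y n)) (lp_add 1 F G)"
    by (rule lp_conv_dominated[OF _ _ _ s]) (use L cl lp_dist_add[of 1] in auto)
  show "lp_conv (\<lambda>n. lp_sup 1 (X n) (Y n)) (lp_sup 1 F G)"
    by (rule lp_conv_dominated[OF _ _ _ s]) (use L cl lp_dist_lattice[of 1] in auto)
  show "lp_conv (\<lambda>n. lp_inf 1 (X n) (Y n)) (lp_inf 1 F G)"
    by (rule lp_conv_dominated[OF _ _ _ s]) (use L cl lp_dist_lattice[of 1] in auto)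
  have "(\<lambda>n. \<bar>c\<bar> * lp_dist 1 (X n) F) \<longlonglongrightarrow> 0" using tendsto_mult_right_zero[OF l(1)] by simp
  then show "lp_conv (\<lambda>n. lp_scale 1 c (X n)) (lp_scale 1 c F)"
    by (rule lp_conv_dominated[rotated 3]) (use L cl lp_dist_scale[of 1] in auto)
  have "\<bar>lp_norm 1 (X n) - lp_norm 1 F\<bar> \<le> lp_dist 1 (X n) F" for n
    using lp_norm_diff[of 1 "X n" F] lp_norm_diff[of 1 F "X n"] lp_dist_commute[of 1 F "X n"] L by (simp add: abs_le_iff)
  then have "(\<lambda>n. lp_norm 1 (X n) - lp_norm 1 F) \<longlonglongrightarrow> 0"
    by (intro Lim_null_comparison[OF _ l(1)] always_eventually allI) (simp only: real_norm_def)
  then show "(\<lambda>n. lp_norm 1 (X n)) \<longlonglongrightarrow> lp_norm 1 F" by (rule LIM_zero_cancel)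
qed

text \<open>Riesz-Fischer: a subsequence converges almost everywhere, and Fatou's lemma applied to
  the distances to that subsequence carries the Cauchy bound over to the limit.\<close>

lemma L1_complete:
  assumes L: "\<And>n. X n \<in> Lp 1"
    and C: "\<And>e. 0 < e \<Longrightarrow> \<exists>N. \<forall>m\<ge>N. \<forall>n\<ge>N. lp_dist 1 (X m) (X n) < e"
  shows "\<exists>F. lp_conv X F"
proof -
  define s where "s n = lrep (X n)" for n
  have s: "s n \<in> Lp_rep 1" "X n = lp_class 1 (s n)" for n
    using lrep_Lp[OF L] by (auto simp: s_def)
  have d: "lp_dist 1 (X m) (X n) = (\<integral>x. norm (s m x - s n x) \<partial>mu)" for m n
    by (simp add: s(2) lp_dist_class s(1) nrm_1)
  have sm [measurable]: "s n \<in> borel_measurable mu" for n using Lp_rep_borel[OF s(1)] .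
  have L1: "f \<in> Lp_rep 1 \<longleftrightarrow> f \<in> borel_measurable mu \<and> integrable mu f" for f
    by (auto simp: Lp_rep_def integrable_abs_iff)
  have int: "integrable mu (s n)" for n using s(1) L1 by blast
  obtain r where r: "strict_mono r" "AE x in mu. Cauchy (\<lambda>i. s (r i) x)"
  proof (rule cauchy_L1_AE_cauchy_subseq[OF int])
    show "\<exists>N. \<forall>i\<ge>N. \<forall>j\<ge>N. (\<integral>x. norm (s i x - s j x) \<partial>mu) < e" if "0 < e" for e
      using C[OF that] by (simp only: d)
  qed
  define f where "f x = lim (\<lambda>i. s (r i) x)" for x
  have fm [measurable]: "f \<in> borel_measurable mu" unfolding f_def by measurable
  have lim: "AE x in mu. (\<lambda>i. s (r i) x) \<longlonglongrightarrow> f x"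
    using r(2) by eventually_elim (simp add: f_def Cauchy_convergent_iff convergent_LIMSEQ_iff)
  have est: "(\<integral>\<^sup>+x. ennreal (norm (s n x - f x)) \<partial>mu) \<le> ennreal e"
    if N: "\<forall>m\<ge>N. \<forall>n\<ge>N. lp_dist 1 (X m) (X n) < e" and n: "N \<le> n" for n N e
  proof -
    have "(\<integral>\<^sup>+x. ennreal (norm (s n x - f x)) \<partial>mu) = (\<integral>\<^sup>+x. liminf (\<lambda>i. ennreal (norm (s n x - s (r i) x))) \<partial>mu)"
    proof (rule nn_integral_cong_AE)
      show "AE x in mu. ennreal (norm (s n x - f x)) = liminf (\<lambda>i. ennreal (norm (s n x - s (r i) x)))"
        using lim
      proof eventually_elim
        case (elim x)
        have "(\<lambda>i. ennreal (norm (s n x - s (r i) x))) \<longlonglongrightarrow> ennreal (norm (s n x - f x))"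
          by (intro tendsto_ennrealI tendsto_norm tendsto_diff tendsto_const elim)
        from lim_imp_Liminf[OF _ this] show ?case by simp
      qed
    qed
    also have "\<dots> \<le> liminf (\<lambda>i. \<integral>\<^sup>+x. ennreal (norm (s n x - s (r i) x)) \<partial>mu)"
      by (rule nn_integral_liminf) measurable
    also have "\<dots> \<le> ennreal e"
    proof (rule Liminf_le)
      show "\<forall>\<^sub>F i in sequentially. (\<integral>\<^sup>+x. ennreal (norm (s n x - s (r i) x)) \<partial>mu) \<le> ennreal e"
      proof (rule eventually_sequentiallyI)
        fix i assume "N \<le> i"
        then have "N \<le> r i" using seq_suble[OF r(1), of i] by simp
        then have "(\<integral>x. norm (s n x - s (r i) x) \<partial>mu) \<le> e" using N n by (simp add: d less_imp_le)
        then show "(\<integral>\<^sup>+x. ennreal (norm (s n x - s (r i) x)) \<partial>mu) \<le> ennreal e"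
          using int by (subst nn_integral_eq_integral) (auto intro!: ennreal_leI)
      qed
    qed simp
    finally show ?thesis .
  qed
  obtain N where N: "\<forall>m\<ge>N. \<forall>n\<ge>N. lp_dist 1 (X m) (X n) < 1" using C[of 1] by auto
  have "(\<integral>\<^sup>+x. ennreal (norm (s N x - f x)) \<partial>mu) < \<infinity>"
    using est[OF N order_refl] by (rule order.strict_trans1) simp
  then have "integrable mu (\<lambda>x. s N x - f x)" by (intro integrableI_bounded) auto
  then have "integrable mu (\<lambda>x. s N x - (s N x - f x))" by (rule Bochner_Integration.integrable_diff[OF int])
  then have fi: "integrable mu f" by simp
  then have fL: "f \<in> Lp_rep 1" by (simp add: L1)
  have "lp_conv X (lp_class 1 f)"
    unfolding lp_conv_def
  proof (intro conjI allI L lp_classI fL LIMSEQ_I)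
    fix e :: real assume e: "0 < e"
    obtain N where N: "\<forall>m\<ge>N. \<forall>n\<ge>N. lp_dist 1 (X m) (X n) < e / 2" using C[of "e / 2"] e by auto
    show "\<exists>N. \<forall>n\<ge>N. norm (lp_dist 1 (X n) (lp_class 1 f) - 0) < e"
    proof (intro exI allI impI)
      fix n assume n: "N \<le> n"
      have "ennreal (\<integral>x. norm (s n x - f x) \<partial>mu) = (\<integral>\<^sup>+x. ennreal (norm (s n x - f x)) \<partial>mu)"
        using int fi by (subst nn_integral_eq_integral) auto
      also have "\<dots> \<le> ennreal (e / 2)" by (rule est[OF N n])
      finally have "(\<integral>x. norm (s n x - f x) \<partial>mu) \<le> e / 2" using e by (simp add: ennreal_le_iff)
      moreover have "lp_dist 1 (X n) (lp_class 1 f) = (\<integral>x. norm (s n x - f x) \<partial>mu)"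
        by (simp add: s(2) lp_dist_class s(1) nrm_1 fL)
      ultimately show "norm (lp_dist 1 (X n) (lp_class 1 f) - 0) < e" using e lp_dist_nonneg[of 1 "X n" "lp_class 1 f"] by simp
    qed
  qed
  then show ?thesis by blast
qed

section \<open>Distances on the group from the action on \<open>Lp 1\<close>\<close>

definition pdist :: "(real \<Rightarrow> real) set \<Rightarrow> (real \<Rightarrow> real) set \<Rightarrow> (real \<Rightarrow> real) \<Rightarrow> real" where
  "pdist C D f = lp_dist 1 (Phi 1 C (lp_class 1 f)) (Phi 1 D (lp_class 1 f))"

definition gdist :: "(real \<Rightarrow> real) set \<Rightarrow> (real \<Rightarrow> real) set \<Rightarrow> real" where
  "gdist C D = pdist C D (\<lambda>x. 1) + pdist C D (\<lambda>x. x)"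

lemma L1_id: "(\<lambda>x. x) \<in> Lp_rep 1"
  by (rule Lp_rep_id) simp

lemma Phi1_L: "C \<in> AutStar \<Longrightarrow> f \<in> Lp_rep 1 \<Longrightarrow> Phi 1 C (lp_class 1 f) \<in> Lp 1"
  by (intro Phi_Lp lp_classI) auto

lemma pdist_nonneg: "0 \<le> pdist C D f"
  by (simp add: pdist_def lp_dist_nonneg)

lemma gdist_nonneg: "0 \<le> gdist C D"
  by (simp add: gdist_def pdist_nonneg)

lemma pdist_commute:
  assumes "C \<in> AutStar" "D \<in> AutStar" "f \<in> Lp_rep 1"
  shows "pdist C D f = pdist D C f"
  unfolding pdist_def by (intro lp_dist_commute Phi1_L assms) simp

lemma pdist_triangle:
  assumes "C \<in> AutStar" "D \<in> AutStar" "E \<in> AutStar" "f \<in> Lp_rep 1"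
  shows "pdist C E f \<le> pdist C D f + pdist D E f"
  unfolding pdist_def by (intro lp_dist_triangle Phi1_L assms) simp

text \<open>The closure properties for an induction over functions. In the last one the factor 2
  arises because replacing \<open>f\<close> by \<open>g\<close> costs the same norm once under
  \<open>C\<close> and once under \<open>D\<close>.\<close>

lemma pdist_ops:
  assumes C: "C \<in> AutStar" and D: "D \<in> AutStar" and fg: "f \<in> Lp_rep 1" "g \<in> Lp_rep 1"
  shows "pdist C D (\<lambda>x. c * f x) = \<bar>c\<bar> * pdist C D f"
    "pdist C D (\<lambda>x. f x + g x) \<le> pdist C D f + pdist C D g"
    "pdist C D (\<lambda>x. max (f x) (g x)) \<le> pdist C D f + pdist C D g"
    "pdist C D f \<le> pdist C D g + 2 * nrm 1 (\<lambda>x. g x - f x)"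
proof -
  note c = aut_latticeD[OF Phi_aut_lattice[of 1, OF _ C], simplified]
  note d = aut_latticeD[OF Phi_aut_lattice[of 1, OF _ D], simplified]
  note L = Phi1_L[OF C] Phi1_L[OF D]
  have 0: "Phi 1 E (lp_class 1 (\<lambda>x. c * f x)) = lp_scale 1 c (Phi 1 E (lp_class 1 f))" if "E \<in> AutStar" for E
    using aut_latticeD(5)[OF Phi_aut_lattice[OF _ that] lp_classI[OF fg(1)], of c] fg by (simp add: lp_scale_class)
  show "pdist C D (\<lambda>x. c * f x) = \<bar>c\<bar> * pdist C D f"
    unfolding pdist_def 0[OF C] 0[OF D] by (intro lp_dist_scale L fg) simp
  have 1: "Phi 1 E (lp_class 1 (\<lambda>x. f x + g x)) = lp_add 1 (Phi 1 E (lp_class 1 f)) (Phi 1 E (lp_class 1 g))" if "E \<in> AutStar" for E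
    using aut_latticeD(4)[OF Phi_aut_lattice[OF _ that] lp_classI[OF fg(1)] lp_classI[OF fg(2)]] fg by (simp add: lp_add_class)
  show "pdist C D (\<lambda>x. f x + g x) \<le> pdist C D f + pdist C D g"
    unfolding pdist_def 1[OF C] 1[OF D] by (intro lp_dist_add L fg) simp
  have 2: "Phi 1 E (lp_class 1 (\<lambda>x. max (f x) (g x))) = lp_sup 1 (Phi 1 E (lp_class 1 f)) (Phi 1 E (lp_class 1 g))" if "E \<in> AutStar" for E
    using aut_latticeD(7)[OF Phi_aut_lattice[OF _ that] lp_classI[OF fg(1)] lp_classI[OF fg(2)]] fg by (simp add: lp_sup_class)
  show "pdist C D (\<lambda>x. max (f x) (g x)) \<le> pdist C D f + pdist C D g"
    unfolding pdist_def 2[OF C] 2[OF D] by (intro lp_dist_lattice L fg) simp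
  have e: "lp_dist 1 (Phi 1 E (lp_class 1 f)) (Phi 1 E (lp_class 1 g)) = nrm 1 (\<lambda>x. g x - f x)" if "E \<in> AutStar" for E
    using Phi_dist[of 1 E "lp_class 1 f" "lp_class 1 g"] that fg
    by (simp add: lp_classI lp_dist_class nrm_minus_commute[of _ f])
  have "pdist C D f \<le> lp_dist 1 (Phi 1 C (lp_class 1 f)) (Phi 1 C (lp_class 1 g)) + lp_dist 1 (Phi 1 C (lp_class 1 g)) (Phi 1 D (lp_class 1 f))"
    unfolding pdist_def by (intro lp_dist_triangle L fg) simp
  also have "lp_dist 1 (Phi 1 C (lp_class 1 g)) (Phi 1 D (lp_class 1 f)) \<le> pdist C D g + lp_dist 1 (Phi 1 D (lp_class 1 g)) (Phi 1 D (lp_class 1 f))"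
    unfolding pdist_def by (intro lp_dist_triangle L fg) simp
  also have "lp_dist 1 (Phi 1 D (lp_class 1 g)) (Phi 1 D (lp_class 1 f)) = lp_dist 1 (Phi 1 D (lp_class 1 f)) (Phi 1 D (lp_class 1 g))"
    by (intro lp_dist_commute L fg) simp
  finally show "pdist C D f \<le> pdist C D g + 2 * nrm 1 (\<lambda>x. g x - f x)" using e[OF C] e[OF D] by simp
qed

text \<open>The constant 1 and the identity function generate \<open>L\<^sub>1\<close> as a closed sublattice; hence
  uniform control of an action on these two vectors yields control on every vector.\<close>

lemma pdist_controlled:
  assumes R: "\<And>C D. R C D \<Longrightarrow> C \<in> AutStar \<and> D \<in> AutStar" and f: "f \<in> Lp_rep 1" and e: "0 < e"
  shows "\<exists>\<delta>>0. \<forall>C D. R C D \<longrightarrow> gdist C D < \<delta> \<longrightarrow> pdist C D f < e"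
proof -
  have "\<forall>e>0. \<exists>\<delta>>0. \<forall>C D. R C D \<longrightarrow> gdist C D < \<delta> \<longrightarrow> pdist C D f < e"
  proof (rule Lp_induct[where p=1 and P="\<lambda>f. \<forall>e>0. \<exists>\<delta>>0. \<forall>C D. R C D \<longrightarrow> gdist C D < \<delta> \<longrightarrow> pdist C D f < e"])
    show "\<forall>e>0. \<exists>\<delta>>0. \<forall>C D. R C D \<longrightarrow> gdist C D < \<delta> \<longrightarrow> pdist C D (\<lambda>x. 1) < e"
    proof (intro allI impI)
      fix e :: real assume "0 < e"
      then show "\<exists>\<delta>>0. \<forall>C D. R C D \<longrightarrow> gdist C D < \<delta> \<longrightarrow> pdist C D (\<lambda>x. 1) < e"
        by (intro exI[of _ e]) (smt (verit) gdist_def pdist_nonneg)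
    qed
    show "\<forall>e>0. \<exists>\<delta>>0. \<forall>C D. R C D \<longrightarrow> gdist C D < \<delta> \<longrightarrow> pdist C D (\<lambda>x. x) < e"
    proof (intro allI impI)
      fix e :: real assume "0 < e"
      then show "\<exists>\<delta>>0. \<forall>C D. R C D \<longrightarrow> gdist C D < \<delta> \<longrightarrow> pdist C D (\<lambda>x. x) < e"
        by (intro exI[of _ e]) (smt (verit) gdist_def pdist_nonneg)
    qed
  next
    fix c and f :: "real \<Rightarrow> real" assume f: "f \<in> Lp_rep 1"
      and P: "\<forall>e>0. \<exists>\<delta>>0. \<forall>C D. R C D \<longrightarrow> gdist C D < \<delta> \<longrightarrow> pdist C D f < e"
    show "\<forall>e>0. \<exists>\<delta>>0. \<forall>C D. R C D \<longrightarrow> gdist C D < \<delta> \<longrightarrow> pdist C D (\<lambda>x. c * f x) < e"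
    proof (intro allI impI)
      fix e :: real assume e: "0 < e"
      have "0 < e / (\<bar>c\<bar> + 1)" using e by simp
      then obtain \<delta> where d: "0 < \<delta>" "\<And>C D. R C D \<Longrightarrow> gdist C D < \<delta> \<Longrightarrow> pdist C D f < e / (\<bar>c\<bar> + 1)" using P by blast
      show "\<exists>\<delta>>0. \<forall>C D. R C D \<longrightarrow> gdist C D < \<delta> \<longrightarrow> pdist C D (\<lambda>x. c * f x) < e"
      proof (rule exI[of _ \<delta>], intro conjI allI impI d(1))
        fix C D assume r: "R C D" "gdist C D < \<delta>"
        have "(\<bar>c\<bar> + 1) * pdist C D f < e" using d(2)[OF r] by (simp add: field_simps)
        moreover have "\<bar>c\<bar> * pdist C D f \<le> (\<bar>c\<bar> + 1) * pdist C D f" by (intro mult_right_mono pdist_nonneg) simp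
        ultimately show "pdist C D (\<lambda>x. c * f x) < e" using pdist_ops(1)[of C D f f c] R[OF r(1)] f by simp
      qed
    qed
  next
    fix f g :: "real \<Rightarrow> real" assume f: "f \<in> Lp_rep 1" and g: "g \<in> Lp_rep 1"
      and P: "\<forall>e>0. \<exists>\<delta>>0. \<forall>C D. R C D \<longrightarrow> gdist C D < \<delta> \<longrightarrow> pdist C D f < e"
      and Q: "\<forall>e>0. \<exists>\<delta>>0. \<forall>C D. R C D \<longrightarrow> gdist C D < \<delta> \<longrightarrow> pdist C D g < e"
    have *: "\<exists>\<delta>>0. \<forall>C D. R C D \<longrightarrow> gdist C D < \<delta> \<longrightarrow> pdist C D f + pdist C D g < e" if e: "0 < e" for e
    proof -
      obtain \<delta> where d: "0 < \<delta>" "\<And>C D. R C D \<Longrightarrow> gdist C D < \<delta> \<Longrightarrow> pdist C D f < e / 2" using P e half_gt_zero by blast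
      obtain \<delta>' where d': "0 < \<delta>'" "\<And>C D. R C D \<Longrightarrow> gdist C D < \<delta>' \<Longrightarrow> pdist C D g < e / 2" using Q e half_gt_zero by blast
      show ?thesis by (rule exI[of _ "min \<delta> \<delta>'"]) (use d d' in fastforce)
    qed
    show "\<forall>e>0. \<exists>\<delta>>0. \<forall>C D. R C D \<longrightarrow> gdist C D < \<delta> \<longrightarrow> pdist C D (\<lambda>x. f x + g x) < e"
      using * pdist_ops(2)[OF _ _ f g] R by (meson order.strict_trans1)
    show "\<forall>e>0. \<exists>\<delta>>0. \<forall>C D. R C D \<longrightarrow> gdist C D < \<delta> \<longrightarrow> pdist C D (\<lambda>x. max (f x) (g x)) < e"
      using * pdist_ops(3)[OF _ _ f g] R by (meson order.strict_trans1)
  next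
    fix F :: "nat \<Rightarrow> real \<Rightarrow> real" and f assume f: "f \<in> Lp_rep 1" and F: "\<And>n. F n \<in> Lp_rep 1"
      and P: "\<And>n. \<forall>e>0. \<exists>\<delta>>0. \<forall>C D. R C D \<longrightarrow> gdist C D < \<delta> \<longrightarrow> pdist C D (F n) < e"
      and lim: "(\<lambda>n. nrm 1 (\<lambda>x. F n x - f x)) \<longlonglongrightarrow> 0"
    show "\<forall>e>0. \<exists>\<delta>>0. \<forall>C D. R C D \<longrightarrow> gdist C D < \<delta> \<longrightarrow> pdist C D f < e"
    proof (intro allI impI)
      fix e :: real assume e: "0 < e"
      obtain n where n: "nrm 1 (\<lambda>x. F n x - f x) < e / 4"
        using LIMSEQ_D[OF lim, of "e / 4"] e nrm_nonneg by (auto simp: abs_of_nonneg)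
      obtain \<delta> where d: "0 < \<delta>" "\<And>C D. R C D \<Longrightarrow> gdist C D < \<delta> \<Longrightarrow> pdist C D (F n) < e / 2" using P[of n] e half_gt_zero by blast
      show "\<exists>\<delta>>0. \<forall>C D. R C D \<longrightarrow> gdist C D < \<delta> \<longrightarrow> pdist C D f < e"
      proof (rule exI[of _ \<delta>], intro conjI allI impI d(1))
        fix C D assume r: "R C D" "gdist C D < \<delta>"
        show "pdist C D f < e" using d(2)[OF r] pdist_ops(4)[of C D f "F n"] R[OF r(1)] f F n by auto
      qed
    qed
  qed (use f in auto)
  then show ?thesis using e by blast
qed

lemma gdist_commute: "C \<in> AutStar \<Longrightarrow> D \<in> AutStar \<Longrightarrow> gdist C D = gdist D C"
  unfolding gdist_def by (simp add: pdist_commute Lp_rep_const L1_id)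

lemma gdist_triangle: "C \<in> AutStar \<Longrightarrow> D \<in> AutStar \<Longrightarrow> E \<in> AutStar \<Longrightarrow> gdist C E \<le> gdist C D + gdist D E"
  unfolding gdist_def
  using pdist_triangle[of C D E "\<lambda>x. 1"] pdist_triangle[of C D E "\<lambda>x. x"] by (simp add: Lp_rep_const L1_id)

lemma gdist_eq_0:
  assumes "C \<in> AutStar" "D \<in> AutStar" shows "gdist C D = 0 \<longleftrightarrow> C = D"
proof
  assume "gdist C D = 0"
  then have "pdist C D (\<lambda>x. 1) = 0" "pdist C D (\<lambda>x. x) = 0"
    using pdist_nonneg[of C D "\<lambda>x. 1"] pdist_nonneg[of C D "\<lambda>x. x"] by (auto simp: gdist_def)
  then show "C = D"
    using Phi_inj[of 1 C D] assms Phi1_L lp_dist_eq_0_iff[of 1] by (simp add: pdist_def Lp_rep_const L1_id)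
next
  assume "C = D"
  then show "gdist C D = 0"
    using lp_dist_eq_0_iff[OF _ Phi1_L[OF assms(2) Lp_rep_const[of 1]] Phi1_L[OF assms(2) Lp_rep_const[of 1]]]
      lp_dist_eq_0_iff[OF _ Phi1_L[OF assms(2) L1_id] Phi1_L[OF assms(2) L1_id]]
    by (simp add: gdist_def pdist_def)
qed

text \<open>For exponent 1, control of two vectors implies control of any finite set of vectors, so
  balls of \<open>gdist\<close> form a neighbourhood base.\<close>

lemma openin_autstar_iff:
  "openin autstar_top U \<longleftrightarrow> U \<subseteq> AutStar \<and> (\<forall>C\<in>U. \<exists>e>0. \<forall>D\<in>AutStar. gdist D C < e \<longrightarrow> D \<in> U)"
proof -
  have one: "1 \<le> (1::real)" by simp
  have e: "openin autstar_top U \<longleftrightarrow> openin (topp 1) U" using autstar_top_eq_topp[OF one] by simp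
  show ?thesis
    unfolding e openin_topp_iff[OF one]
  proof (intro conj_cong refl ball_cong)
    fix C assume UA: "U \<subseteq> AutStar" and "C \<in> U"
    then have C: "C \<in> AutStar" by auto
    show "(\<exists>K e. finite K \<and> K \<subseteq> Lp 1 \<and> 0 < e \<and> (\<forall>D\<in>AutStar. (\<forall>F\<in>K. lp_dist 1 (Phi 1 D F) (Phi 1 C F) < e) \<longrightarrow> D \<in> U))
      \<longleftrightarrow> (\<exists>e>0. \<forall>D\<in>AutStar. gdist D C < e \<longrightarrow> D \<in> U)" (is "?L \<longleftrightarrow> ?R")
    proof
      assume ?L
      then obtain K e where K: "finite K" "K \<subseteq> Lp 1" "0 < e"
        "\<forall>D\<in>AutStar. (\<forall>F\<in>K. lp_dist 1 (Phi 1 D F) (Phi 1 C F) < e) \<longrightarrow> D \<in> U" by (elim exE conjE)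
      have "\<forall>F\<in>K. \<exists>\<delta>>0. \<forall>D\<in>AutStar. gdist D C < \<delta> \<longrightarrow> lp_dist 1 (Phi 1 D F) (Phi 1 C F) < e"
      proof
        fix F assume "F \<in> K"
        then have "F \<in> Lp 1" using K(2) by auto
        then obtain f where f: "f \<in> Lp_rep 1" "F = lp_class 1 f" by (rule Lp_cases)
        show "\<exists>\<delta>>0. \<forall>D\<in>AutStar. gdist D C < \<delta> \<longrightarrow> lp_dist 1 (Phi 1 D F) (Phi 1 C F) < e"
          using pdist_controlled[of "\<lambda>D C'. D \<in> AutStar \<and> C' = C" f e] C f K(3) unfolding pdist_def by blast
      qed
      then obtain \<delta> where d: "\<And>F. F \<in> K \<Longrightarrow> 0 < \<delta> F"
        "\<And>F D. F \<in> K \<Longrightarrow> D \<in> AutStar \<Longrightarrow> gdist D C < \<delta> F \<Longrightarrow> lp_dist 1 (Phi 1 D F) (Phi 1 C F) < e" by metis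
      show ?R
      proof (rule exI[of _ "Min (insert 1 (\<delta> ` K))"], intro conjI ballI impI)
        fix D assume D: "D \<in> AutStar" "gdist D C < Min (insert 1 (\<delta> ` K))"
        then have "gdist D C < \<delta> F" if "F \<in> K" for F using K(1) that by auto
        then show "D \<in> U" using K(4) d(2) D(1) by blast
      qed (use K(1) d(1) in auto)
    next
      assume ?R
      then obtain e where e: "0 < e" "\<And>D. D\<in>AutStar \<Longrightarrow> gdist D C < e \<Longrightarrow> D \<in> U" by blast
      show ?L
      proof (rule exI[of _ "{lp_class 1 (\<lambda>x. 1), lp_class 1 (\<lambda>x. x)}"], rule exI[of _ "e / 2"], intro conjI ballI impI)
        fix D assume D: "D \<in> AutStar"
          "\<forall>F\<in>{lp_class 1 (\<lambda>x. 1), lp_class 1 (\<lambda>x. x)}. lp_dist 1 (Phi 1 D F) (Phi 1 C F) < e / 2"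
        have "gdist D C < e" using D(2) by (simp add: gdist_def pdist_def)
        then show "D \<in> U" by (rule e(2)[OF D(1)])
      qed (use e(1) in \<open>auto simp: lp_classI Lp_rep_const L1_id\<close>)
    qed
  qed
qed

text \<open>The inverses are added so that a Cauchy sequence yields limits of both the maps and
  their inverses. The value 0 off the group serves the axioms of \<open>Metric_space\<close> that
  range over all points.\<close>

definition cdist :: "(real \<Rightarrow> real) set \<Rightarrow> (real \<Rightarrow> real) set \<Rightarrow> real" where
  "cdist C D = (if C \<in> AutStar \<and> D \<in> AutStar then gdist C D + gdist (autstar_inverse C) (autstar_inverse D) else 0)"

interpretation cd: Metric_space AutStar cdist
proof
  show "0 \<le> cdist C D" for C D by (simp add: cdist_def gdist_nonneg)
  show "cdist C D = cdist D C" for C D by (simp add: cdist_def gdist_commute AutStar_inverse)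
  show "cdist C D = 0 \<longleftrightarrow> C = D" if "C \<in> AutStar" "D \<in> AutStar" for C D
  proof -
    have "cdist C D = 0 \<longleftrightarrow> gdist C D = 0 \<and> gdist (autstar_inverse C) (autstar_inverse D) = 0"
      using that gdist_nonneg[of C D] gdist_nonneg[of "autstar_inverse C" "autstar_inverse D"]
      by (simp add: cdist_def add_nonneg_eq_0_iff)
    then show ?thesis
      unfolding gdist_eq_0[OF that] gdist_eq_0[OF that[THEN AutStar_inverse]] by blast
  qed
  show "cdist C E \<le> cdist C D + cdist D E" if "C \<in> AutStar" "D \<in> AutStar" "E \<in> AutStar" for C D E
    using that gdist_triangle[OF that] gdist_triangle[OF that[THEN AutStar_inverse]] by (simp add: cdist_def)
qed

lemma autstar_top_metric: "cd.mtopology = autstar_top"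
  unfolding topology_eq
proof (intro allI iffI)
  fix U assume "openin autstar_top U"
  then have UA: "U \<subseteq> AutStar" and U: "\<forall>C\<in>U. \<exists>e>0. \<forall>D\<in>AutStar. gdist D C < e \<longrightarrow> D \<in> U"
    unfolding openin_autstar_iff by auto
  show "openin cd.mtopology U"
    unfolding cd.openin_mtopology
  proof (intro conjI allI impI UA)
    fix C assume C: "C \<in> U"
    from bspec[OF U C] obtain e where e: "0 < e" "\<forall>D\<in>AutStar. gdist D C < e \<longrightarrow> D \<in> U" by (elim exE conjE)
    have "cd.mball C e \<subseteq> U"
    proof
      fix D assume "D \<in> cd.mball C e"
      then have D: "C \<in> AutStar" "D \<in> AutStar" "cdist C D < e" by auto
      have "gdist D C \<le> cdist C D"
        using D gdist_commute[OF D(2,1)] gdist_nonneg[of "autstar_inverse C" "autstar_inverse D"] by (simp add: cdist_def)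
      then show "D \<in> U" using e(2) D(2,3) by simp
    qed
    then show "\<exists>r>0. cd.mball C r \<subseteq> U" using e(1) by blast
  qed
next
  fix U assume "openin cd.mtopology U"
  then have UA: "U \<subseteq> AutStar" and U: "\<forall>C. C \<in> U \<longrightarrow> (\<exists>r>0. cd.mball C r \<subseteq> U)"
    unfolding cd.openin_mtopology by auto
  have one: "1 \<le> (1::real)" by simp
  show "openin autstar_top U"
    unfolding autstar_top_eq_topp[OF one] openin_topp_iff[OF one]
  proof (intro conjI ballI UA)
    fix C assume CU: "C \<in> U"
    then have C: "C \<in> AutStar" using UA by auto
    obtain r where r: "0 < r" "cd.mball C r \<subseteq> U" using U CU by blast
    let ?i = "Phi 1 (autstar_inverse C)"
    \<comment> \<open>The first two vectors control \<open>D\<close> itself. The other two control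
      its inverse, since a distance of inverses at \<open>F\<close> equals a distance at the image
      of \<open>F\<close> under the inverse of \<open>C\<close>. Four quarters make up
      \<open>r\<close>.\<close>
    let ?K = "{lp_class 1 (\<lambda>x. 1), lp_class 1 (\<lambda>x. x), ?i (lp_class 1 (\<lambda>x. 1)), ?i (lp_class 1 (\<lambda>x. x))}"
    have L: "lp_class 1 (\<lambda>x. 1) \<in> Lp 1" "lp_class 1 (\<lambda>x. x) \<in> Lp 1" by (auto simp: lp_classI Lp_rep_const L1_id)
    show "\<exists>K e. finite K \<and> K \<subseteq> Lp 1 \<and> 0 < e \<and> (\<forall>D\<in>AutStar. (\<forall>F\<in>K. lp_dist 1 (Phi 1 D F) (Phi 1 C F) < e) \<longrightarrow> D \<in> U)"
    proof (rule exI[of _ ?K], rule exI[of _ "r / 4"], intro conjI ballI impI)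
      fix D assume D: "D \<in> AutStar" "\<forall>F\<in>?K. lp_dist 1 (Phi 1 D F) (Phi 1 C F) < r / 4"
      have "gdist D C < r / 2" using D(2) by (simp add: gdist_def pdist_def)
      moreover have "gdist (autstar_inverse D) (autstar_inverse C) < r / 2"
        unfolding gdist_def pdist_def Phi_inverse_dist[OF one D(1) C L(1)] Phi_inverse_dist[OF one D(1) C L(2)]
        using D(2) by simp
      ultimately have "cdist D C < r" using C D(1) by (simp add: cdist_def)
      then show "D \<in> U" using r(2) C D(1) cd.commute by (auto simp: subset_iff)
    qed (use r(1) L Phi_Lp[OF AutStar_inverse[OF C]] in auto)
  qed
qed

text \<open>The images of each vector under the sequence and under the inverses converge in
  \<open>Lp 1\<close>. The two limit maps are mutually inverse because all maps are isometries, and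
  they inherit the lattice structure; surjectivity of \<open>Phi 1\<close> then produces the limit
  in the group.\<close>

lemma cdist_complete: "cd.mcomplete"
  unfolding cd.mcomplete_def
proof (intro allI impI)
  fix \<sigma> assume ca: "cd.MCauchy \<sigma>"
  then have sA: "\<And>n. \<sigma> n \<in> AutStar"
    and sC: "\<And>e. 0 < e \<Longrightarrow> \<exists>N. \<forall>n n'. N \<le> n \<longrightarrow> N \<le> n' \<longrightarrow> cdist (\<sigma> n) (\<sigma> n') < e"
    by (auto simp: cd.MCauchy_def)
  note siA = AutStar_inverse[OF sA]
  have gen: "\<exists>F. lp_conv (\<lambda>n. Phi 1 (\<tau> n) G) F"
    if tA: "\<And>n. \<tau> n \<in> AutStar" and le: "\<And>m n. gdist (\<tau> m) (\<tau> n) \<le> cdist (\<sigma> m) (\<sigma> n)" and G: "G \<in> Lp 1" for \<tau> G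
  proof (rule L1_complete)
    show "Phi 1 (\<tau> n) G \<in> Lp 1" for n by (intro Phi_Lp tA G) simp
    obtain g where g: "g \<in> Lp_rep 1" "G = lp_class 1 g" using G by (rule Lp_cases)
    fix e :: real assume "0 < e"
    \<comment> \<open>Here the control is taken uniformly over all pairs, as the Cauchy property
      requires, and not around a fixed element.\<close>
    then obtain \<delta> where d: "0 < \<delta>" "\<And>C D. C \<in> AutStar \<and> D \<in> AutStar \<Longrightarrow> gdist C D < \<delta> \<Longrightarrow> pdist C D g < e"
      using pdist_controlled[of "\<lambda>C D. C \<in> AutStar \<and> D \<in> AutStar" g e] g by blast
    obtain N where N: "\<forall>n n'. N \<le> n \<longrightarrow> N \<le> n' \<longrightarrow> cdist (\<sigma> n) (\<sigma> n') < \<delta>" using sC[OF d(1)] by blast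
    show "\<exists>N. \<forall>m\<ge>N. \<forall>n\<ge>N. lp_dist 1 (Phi 1 (\<tau> m) G) (Phi 1 (\<tau> n) G) < e"
    proof (intro exI allI impI)
      fix m n assume "N \<le> m" "N \<le> n"
      then have "gdist (\<tau> m) (\<tau> n) < \<delta>" using N le[of m n] by (meson order.strict_trans1)
      then show "lp_dist 1 (Phi 1 (\<tau> m) G) (Phi 1 (\<tau> n) G) < e"
        using d(2)[of "\<tau> m" "\<tau> n"] tA g(2) by (simp add: pdist_def)
    qed
  qed
  have l1: "gdist (\<sigma> m) (\<sigma> n) \<le> cdist (\<sigma> m) (\<sigma> n)"
    and l2: "gdist (autstar_inverse (\<sigma> m)) (autstar_inverse (\<sigma> n)) \<le> cdist (\<sigma> m) (\<sigma> n)" for m n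
    using sA gdist_nonneg by (auto simp: cdist_def)
  define T where "T = restrict (\<lambda>G. SOME F. lp_conv (\<lambda>n. Phi 1 (\<sigma> n) G) F) (Lp 1)"
  define S where "S = (\<lambda>G. SOME F. lp_conv (\<lambda>n. Phi 1 (autstar_inverse (\<sigma> n)) G) F)"
  have T: "lp_conv (\<lambda>n. Phi 1 (\<sigma> n) G) (T G)" if "G \<in> Lp 1" for G
    using someI_ex[OF gen[OF sA l1 that]] that by (simp add: T_def)
  have S: "lp_conv (\<lambda>n. Phi 1 (autstar_inverse (\<sigma> n)) G) (S G)" if "G \<in> Lp 1" for G
    using someI_ex[OF gen[OF siA l2 that]] that by (simp add: S_def)
  have TL: "T G \<in> Lp 1" and SL: "S G \<in> Lp 1" if "G \<in> Lp 1" for G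
    using T[OF that] S[OF that] by (auto simp: lp_conv_def)
  have d0: "(\<lambda>n. lp_dist 1 (Phi 1 (\<sigma> n) G) (T G)) \<longlonglongrightarrow> 0"
    "(\<lambda>n. lp_dist 1 (Phi 1 (autstar_inverse (\<sigma> n)) G) (S G)) \<longlonglongrightarrow> 0" if "G \<in> Lp 1" for G
    using T[OF that] S[OF that] by (auto simp: lp_conv_def)
  note PL = Phi_Lp[OF sA, where p=1, simplified] Phi_Lp[OF siA, where p=1, simplified]
  have TS: "T (S G) = G" if G: "G \<in> Lp 1" for G
  proof (rule lp_conv_unique[OF T[OF SL[OF G]]])
    show "lp_conv (\<lambda>n. Phi 1 (\<sigma> n) (S G)) G"
    proof (rule lp_conv_dominated[OF _ G _ d0(2)[OF G]])
      fix n
      have "lp_dist 1 (Phi 1 (\<sigma> n) (S G)) (Phi 1 (\<sigma> n) (Phi 1 (autstar_inverse (\<sigma> n)) G)) = lp_dist 1 (S G) (Phi 1 (autstar_inverse (\<sigma> n)) G)"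
        by (intro Phi_dist sA SL G PL) simp
      then show "lp_dist 1 (Phi 1 (\<sigma> n) (S G)) G \<le> lp_dist 1 (Phi 1 (autstar_inverse (\<sigma> n)) G) (S G)"
        using lp_dist_commute[of 1 "S G" "Phi 1 (autstar_inverse (\<sigma> n)) G"] SL[OF G] PL(2)[OF G] sA G
        by (simp add: Phi_inverse_app)
    qed (use PL SL G in auto)
  qed
  have ST: "S (T G) = G" if G: "G \<in> Lp 1" for G
  proof (rule lp_conv_unique[OF S[OF TL[OF G]]])
    show "lp_conv (\<lambda>n. Phi 1 (autstar_inverse (\<sigma> n)) (T G)) G"
    proof (rule lp_conv_dominated[OF _ G _ d0(1)[OF G]])
      fix n
      have "lp_dist 1 (Phi 1 (autstar_inverse (\<sigma> n)) (T G)) (Phi 1 (autstar_inverse (\<sigma> n)) (Phi 1 (\<sigma> n) G)) = lp_dist 1 (T G) (Phi 1 (\<sigma> n) G)"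
        by (intro Phi_dist siA TL G PL) simp
      then show "lp_dist 1 (Phi 1 (autstar_inverse (\<sigma> n)) (T G)) G \<le> lp_dist 1 (Phi 1 (\<sigma> n) G) (T G)"
        using lp_dist_commute[of 1 "T G" "Phi 1 (\<sigma> n) G"] TL[OF G] PL(1)[OF G] sA G
        by (simp add: Phi_inverse_app)
    qed (use PL TL G in auto)
  qed
  note al = aut_latticeD[OF Phi_aut_lattice[OF _ sA, where p=1, simplified]]
  note cl = lp_closed[where p=1, simplified]
  have "T \<in> aut_lattice 1"
    unfolding aut_lattice_def
  proof (intro CollectI conjI ballI allI)
    show "T \<in> extensional (Lp 1)" by (simp add: T_def)
    show "bij_betw T (Lp 1) (Lp 1)"
      by (rule bij_betw_byWitness[where f'=S]) (use TS ST TL SL in auto)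
    fix F assume F: "F \<in> Lp 1"
    show "lp_norm 1 (T F) = lp_norm 1 F"
      using LIMSEQ_unique[OF lp_conv_ops(5)[OF T[OF F] T[OF F]]] al(6)[OF F] by simp
    show "T (lp_scale 1 c F) = lp_scale 1 c (T F)" for c
      by (rule lp_conv_unique[OF T[OF cl(2)[OF F F]]]) (use lp_conv_ops(4)[OF T[OF F] T[OF F], of c] al(5)[OF F] in simp)
    fix G assume G: "G \<in> Lp 1"
    show "T (lp_add 1 F G) = lp_add 1 (T F) (T G)"
      by (rule lp_conv_unique[OF T[OF cl(1)[OF F G]]]) (use lp_conv_ops(1)[OF T[OF F] T[OF G]] al(4)[OF F G] in simp)
    show "T (lp_sup 1 F G) = lp_sup 1 (T F) (T G)"
      by (rule lp_conv_unique[OF T[OF cl(3)[OF F G]]]) (use lp_conv_ops(2)[OF T[OF F] T[OF G]] al(7)[OF F G] in simp)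
    show "T (lp_inf 1 F G) = lp_inf 1 (T F) (T G)"
      by (rule lp_conv_unique[OF T[OF cl(4)[OF F G]]]) (use lp_conv_ops(3)[OF T[OF F] T[OF G]] al(8)[OF F G] in simp)
  qed
  then obtain C where C: "C \<in> AutStar" "Phi 1 C = T" using Phi_surj[of 1 T] by auto
  have CS: "Phi 1 (autstar_inverse C) G = S G" if "G \<in> Lp 1" for G
    using Phi_inverse_app(2)[of 1 C "S G"] C TS[OF that] SL[OF that] by simp
  have L: "lp_class 1 (\<lambda>x. 1) \<in> Lp 1" "lp_class 1 (\<lambda>x. x) \<in> Lp 1" by (auto simp: lp_classI Lp_rep_const L1_id)
  have "(\<lambda>n. cdist (\<sigma> n) C) \<longlonglongrightarrow> (0 + 0) + (0 + 0)"
    unfolding cdist_def gdist_def pdist_def C(2) using C(1) sA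
    by (simp only: if_True simp_thms CS[OF L(1)] CS[OF L(2)]) (intro tendsto_add d0 L)
  then have "limitin cd.mtopology \<sigma> C sequentially"
    using C sA by (simp add: cd.limitin_metric_dist_null)
  then show "\<exists>x. limitin cd.mtopology \<sigma> x sequentially" by blast
qed

text \<open>Terms with rational coefficients give a set of vectors that is countable by construction
  and matches the clauses of \<open>Lp_induct\<close>, so that density is a direct
  induction.\<close>

datatype lterm = LOne | LIdent | LScale rat lterm | LPlus lterm lterm | LMax lterm lterm

instance lterm :: countable by countable_datatype

fun lterm_fun :: "lterm \<Rightarrow> real \<Rightarrow> real" where
  "lterm_fun LOne = (\<lambda>x. 1)"
| "lterm_fun LIdent = (\<lambda>x. x)"
| "lterm_fun (LScale r t) = (\<lambda>x. of_rat r * lterm_fun t x)"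
| "lterm_fun (LPlus s t) = (\<lambda>x. lterm_fun s x + lterm_fun t x)"
| "lterm_fun (LMax s t) = (\<lambda>x. max (lterm_fun s x) (lterm_fun t x))"

lemma lterm_fun_L1: "lterm_fun t \<in> Lp_rep 1"
  by (induction t) (auto simp: Lp_rep_const L1_id intro!: Lp_rep_scale Lp_rep_add Lp_rep_max)

lemma lterm_dense:
  assumes "f \<in> Lp_rep 1" "0 < e"
  shows "\<exists>t. nrm 1 (\<lambda>x. f x - lterm_fun t x) < e"
proof -
  have one: "1 \<le> (1::real)" by simp
  have "\<forall>e>0. \<exists>t. nrm 1 (\<lambda>x. f x - lterm_fun t x) < e"
  proof (rule Lp_induct[where p=1 and P="\<lambda>f. \<forall>e>0. \<exists>t. nrm 1 (\<lambda>x. f x - lterm_fun t x) < e"])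
    show "\<forall>e>0. \<exists>t. nrm 1 (\<lambda>x. 1 - lterm_fun t x) < e"
      by (intro allI impI exI[of _ LOne]) (simp add: nrm_def)
    show "\<forall>e>0. \<exists>t. nrm 1 (\<lambda>x. x - lterm_fun t x) < e"
      by (intro allI impI exI[of _ LIdent]) (simp add: nrm_def)
  next
    fix c and f :: "real \<Rightarrow> real" assume f: "f \<in> Lp_rep 1" and P: "\<forall>e>0. \<exists>t. nrm 1 (\<lambda>x. f x - lterm_fun t x) < e"
    show "\<forall>e>0. \<exists>t. nrm 1 (\<lambda>x. c * f x - lterm_fun t x) < e"
    proof (intro allI impI)
      fix e :: real assume e: "0 < e"
      \<comment> \<open>The added 1 makes \<open>M\<close> positive even for a vector of norm 0, so
        that a rational coefficient within \<open>e / 2 / M\<close> can be asked for.\<close>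
      define M where "M = nrm 1 f + 1"
      have M: "0 < M" "nrm 1 f \<le> M" using nrm_nonneg[of 1 f] by (auto simp: M_def)
      have "c < c + e / 2 / M" using e M by simp
      then obtain r where r: "c < of_rat r" "of_rat r < c + e / 2 / M" using of_rat_dense by blast
      define A where "A = \<bar>of_rat r :: real\<bar> + 1"
      have A: "0 < A" "\<bar>of_rat r :: real\<bar> \<le> A" unfolding A_def by linarith+
      have "0 < e / 2 / A" using e A by simp
      then obtain t where t: "nrm 1 (\<lambda>x. f x - lterm_fun t x) < e / 2 / A" using P by blast
      have "nrm 1 (\<lambda>x. c * f x - of_rat r * lterm_fun t x) \<le> nrm 1 (\<lambda>x. c * f x - of_rat r * f x) + nrm 1 (\<lambda>x. of_rat r * f x - of_rat r * lterm_fun t x)"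
        by (intro nrm_triangle_diff Lp_rep_scale f lterm_fun_L1) simp
      also have "nrm 1 (\<lambda>x. c * f x - of_rat r * f x) = \<bar>c - of_rat r\<bar> * nrm 1 f"
        using nrm_scale[of 1 "c - of_rat r" f] by (simp add: algebra_simps)
      also have "nrm 1 (\<lambda>x. of_rat r * f x - of_rat r * lterm_fun t x) = \<bar>of_rat r\<bar> * nrm 1 (\<lambda>x. f x - lterm_fun t x)"
        using nrm_scale[of 1 "of_rat r" "\<lambda>x. f x - lterm_fun t x"] by (simp add: algebra_simps)
      also have "\<bar>c - of_rat r\<bar> * nrm 1 f + \<bar>of_rat r\<bar> * nrm 1 (\<lambda>x. f x - lterm_fun t x) \<le> \<bar>c - of_rat r\<bar> * M + A * nrm 1 (\<lambda>x. f x - lterm_fun t x)"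
        using M A by (intro add_mono mult_left_mono mult_right_mono) (auto simp: nrm_nonneg)
      also have "\<dots> < e / 2 + e / 2"
      proof (rule add_strict_mono)
        have "\<bar>c - of_rat r\<bar> < e / 2 / M" using r by simp
        then show "\<bar>c - of_rat r\<bar> * M < e / 2" using M by (simp add: pos_less_divide_eq)
        show "A * nrm 1 (\<lambda>x. f x - lterm_fun t x) < e / 2" using t A by (simp add: pos_less_divide_eq mult.commute)
      qed
      finally have "nrm 1 (\<lambda>x. c * f x - lterm_fun (LScale r t) x) < e" by simp
      then show "\<exists>t. nrm 1 (\<lambda>x. c * f x - lterm_fun t x) < e" by blast
    qed
  next
    fix f g :: "real \<Rightarrow> real" assume f: "f \<in> Lp_rep 1" and g: "g \<in> Lp_rep 1"
      and P: "\<forall>e>0. \<exists>t. nrm 1 (\<lambda>x. f x - lterm_fun t x) < e" and Q: "\<forall>e>0. \<exists>t. nrm 1 (\<lambda>x. g x - lterm_fun t x) < e"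
    have *: "\<exists>s t. nrm 1 (\<lambda>x. f x - lterm_fun s x) + nrm 1 (\<lambda>x. g x - lterm_fun t x) < e" if e: "0 < e" for e
    proof -
      obtain s where s: "nrm 1 (\<lambda>x. f x - lterm_fun s x) < e / 2" using P e half_gt_zero by blast
      obtain t where t: "nrm 1 (\<lambda>x. g x - lterm_fun t x) < e / 2" using Q e half_gt_zero by blast
      show ?thesis using s t by (intro exI[of _ s] exI[of _ t]) simp
    qed
    have 1: "nrm 1 (\<lambda>x. f x + g x - lterm_fun (LPlus s t) x) \<le> nrm 1 (\<lambda>x. f x - lterm_fun s x) + nrm 1 (\<lambda>x. g x - lterm_fun t x)" for s t
      using lp_dist_add[OF one lp_classI[OF f] lp_classI[OF g] lp_classI[OF lterm_fun_L1[of s]] lp_classI[OF lterm_fun_L1[of t]]] f g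
      by (simp add: lp_add_class lp_dist_class lterm_fun_L1 Lp_rep_add)
    show "\<forall>e>0. \<exists>t. nrm 1 (\<lambda>x. f x + g x - lterm_fun t x) < e"
    proof (intro allI impI)
      fix e :: real assume "0 < e"
      from *[OF this] obtain s t where "nrm 1 (\<lambda>x. f x - lterm_fun s x) + nrm 1 (\<lambda>x. g x - lterm_fun t x) < e" by (elim exE)
      from le_less_trans[OF 1 this] show "\<exists>t. nrm 1 (\<lambda>x. f x + g x - lterm_fun t x) < e" by (rule exI)
    qed
    have 2: "nrm 1 (\<lambda>x. max (f x) (g x) - lterm_fun (LMax s t) x) \<le> nrm 1 (\<lambda>x. f x - lterm_fun s x) + nrm 1 (\<lambda>x. g x - lterm_fun t x)" for s t
      using lp_dist_lattice(1)[OF one lp_classI[OF f] lp_classI[OF g] lp_classI[OF lterm_fun_L1[of s]] lp_classI[OF lterm_fun_L1[of t]]] f g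
      by (simp add: lp_sup_class lp_dist_class lterm_fun_L1 Lp_rep_max)
    show "\<forall>e>0. \<exists>t. nrm 1 (\<lambda>x. max (f x) (g x) - lterm_fun t x) < e"
    proof (intro allI impI)
      fix e :: real assume "0 < e"
      from *[OF this] obtain s t where "nrm 1 (\<lambda>x. f x - lterm_fun s x) + nrm 1 (\<lambda>x. g x - lterm_fun t x) < e" by (elim exE)
      from le_less_trans[OF 2 this] show "\<exists>t. nrm 1 (\<lambda>x. max (f x) (g x) - lterm_fun t x) < e" by (rule exI)
    qed
  next
    fix F :: "nat \<Rightarrow> real \<Rightarrow> real" and f assume f: "f \<in> Lp_rep 1" and F: "\<And>n. F n \<in> Lp_rep 1"
      and P: "\<And>n. \<forall>e>0. \<exists>t. nrm 1 (\<lambda>x. F n x - lterm_fun t x) < e"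
      and lim: "(\<lambda>n. nrm 1 (\<lambda>x. F n x - f x)) \<longlonglongrightarrow> 0"
    show "\<forall>e>0. \<exists>t. nrm 1 (\<lambda>x. f x - lterm_fun t x) < e"
    proof (intro allI impI)
      fix e :: real assume e: "0 < e"
      obtain n where n: "nrm 1 (\<lambda>x. F n x - f x) < e / 2"
        using LIMSEQ_D[OF lim, of "e / 2"] e nrm_nonneg by (auto simp: abs_of_nonneg)
      obtain t where t: "nrm 1 (\<lambda>x. F n x - lterm_fun t x) < e / 2" using P[of n] e half_gt_zero by blast
      have "nrm 1 (\<lambda>x. f x - lterm_fun t x) < e"
        using nrm_triangle_diff[OF one f F[of n] lterm_fun_L1[of t]] nrm_minus_commute[of 1 f "F n"] n t by simp
      then show "\<exists>t. nrm 1 (\<lambda>x. f x - lterm_fun t x) < e" by blast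
    qed
  qed (use assms in auto)
  then show ?thesis using assms(2) by blast
qed

text \<open>The dense terms need not be images of 1 and the identity under group elements. So for
  each pair of terms and each precision one group element is selected whose two images are that
  close to the terms, provided one exists.\<close>

lemma autstar_separable: "separable_space autstar_top"
proof -
  define near where "near = (\<lambda>(s, t, n :: nat) C. C \<in> AutStar \<and>
      lp_dist 1 (Phi 1 C (lp_class 1 (\<lambda>x. 1))) (lp_class 1 (lterm_fun s)) < 1 / real (Suc n) \<and>
      lp_dist 1 (Phi 1 C (lp_class 1 (\<lambda>x. x))) (lp_class 1 (lterm_fun t)) < 1 / real (Suc n))"
  define A where "A = (\<lambda>z. SOME C. near z C) ` {z. \<exists>C. near z C}"
  have sel: "near z (SOME C. near z C)" if "near z C" for z C using that by (rule someI)
  have AA: "A \<subseteq> AutStar"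
  proof
    fix C assume "C \<in> A"
    then obtain z C' where "near z C'" "C = (SOME C. near z C)" unfolding A_def by blast
    then have "near z C" using sel by blast
    then show "C \<in> AutStar" by (cases z) (simp add: near_def)
  qed
  have "C \<in> autstar_top closure_of A" if C: "C \<in> AutStar" for C
    unfolding in_closure_of topspace_autstar_top
  proof (intro conjI C allI impI)
    fix U assume "C \<in> U \<and> openin autstar_top U"
    then have "\<forall>C\<in>U. \<exists>e>0. \<forall>D\<in>AutStar. gdist D C < e \<longrightarrow> D \<in> U" "C \<in> U"
      unfolding openin_autstar_iff by simp_all
    from bspec[OF this] obtain e where e: "0 < e" "\<forall>D\<in>AutStar. gdist D C < e \<longrightarrow> D \<in> U" by (elim exE conjE)
    obtain n where n: "1 / real (Suc n) < e / 4" using nat_approx_posE[of "e / 4"] e by auto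
    have n0: "0 < 1 / real (Suc n)" by simp
    note L = Phi1_L[OF C Lp_rep_const[of 1]] Phi1_L[OF C L1_id]
    have ap: "\<exists>t. lp_dist 1 F (lp_class 1 (lterm_fun t)) < 1 / real (Suc n)" if F: "F \<in> Lp 1" for F
    proof -
      obtain f where f: "f \<in> Lp_rep 1" "F = lp_class 1 f" using F by (rule Lp_cases)
      show ?thesis using lterm_dense[OF f(1) n0] f by (simp add: lp_dist_class lterm_fun_L1)
    qed
    obtain s t where st: "near (s, t, n) C" using ap[OF L(1)] ap[OF L(2)] C by (auto simp: near_def)
    define D where "D = (SOME D. near (s, t, n) D)"
    have nD: "near (s, t, n) D" unfolding D_def by (rule sel[OF st])
    have DA: "D \<in> A" unfolding A_def D_def using st by blast
    have D: "D \<in> AutStar" using nD by (simp add: near_def)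
    note L' = Phi1_L[OF D Lp_rep_const[of 1]] Phi1_L[OF D L1_id]
    have tr: "lp_dist 1 F G \<le> lp_dist 1 F H + lp_dist 1 G H" if "F \<in> Lp 1" "G \<in> Lp 1" "H \<in> Lp 1" for F G H
      using lp_dist_triangle[of 1 F H G] lp_dist_commute[of 1 H G] that by simp
    have "pdist D C (\<lambda>x. 1) < e / 2"
      using tr[OF L'(1) L(1) lp_classI[OF lterm_fun_L1[of s]]] st nD n by (simp add: near_def pdist_def)
    moreover have "pdist D C (\<lambda>x. x) < e / 2"
      using tr[OF L'(2) L(2) lp_classI[OF lterm_fun_L1[of t]]] st nD n by (simp add: near_def pdist_def)
    ultimately have "gdist D C < e" by (simp add: gdist_def)
    then have "D \<in> U" using e(2) D by simp
    then show "\<exists>y. y \<in> A \<and> y \<in> U" using DA by blast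
  qed
  then have "autstar_top closure_of A = topspace autstar_top"
    using closure_of_subset_topspace[of autstar_top A] by (auto simp: topspace_autstar_top)
  moreover have "countable A" unfolding A_def by (intro countable_image countableI_type)
  ultimately show ?thesis unfolding separable_space_def using AA by (auto simp: topspace_autstar_top)
qed

lemma autstar_Polish: "Polish_space autstar_top"
  unfolding Polish_space_def
  using autstar_separable cd.completely_metrizable_space_mtopology[OF cdist_complete]
  by (simp add: autstar_top_metric)

section \<open>Isomorphisms between sets of positive measure\<close>

lemma measure_mu_atMost: "0 \<le> c \<Longrightarrow> c \<le> 1 \<Longrightarrow> measure mu {0..c} = c"
proof -
  assume c: "0 \<le> c" "c \<le> 1"
  have "emeasure mu {0..c} = ennreal c"
    unfolding mu_def using c by (subst emeasure_restrict_space) auto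
  then show ?thesis using c by (simp add: measure_def)
qed

lemma atLeastAtMost_sets_mu: "0 \<le> a \<Longrightarrow> b \<le> 1 \<Longrightarrow> {a..b} \<in> sets mu"
  by (auto simp: sets_mu)

lemma mu_set_borel_rep:
  assumes "S \<in> sets mu"
  obtains S' where "S' \<in> sets borel" "AE x in mu. x \<in> S \<longleftrightarrow> x \<in> S'"
proof -
  have "(indicator S :: real \<Rightarrow> real) \<in> borel_measurable mu" using assms by measurable
  then obtain f where f: "f \<in> borel_measurable borel" "AE x in mu. (indicator S x :: real) = f x"
    using mu_borel_rep by blast
  show ?thesis
  proof (rule that[of "f -` {1}"])
    show "f -` {1} \<in> sets borel" using measurable_sets[OF f(1), of "{1}"] by simp
    show "AE x in mu. x \<in> S \<longleftrightarrow> x \<in> f -` {1}"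
      using f(2) by eventually_elim (auto simp: indicator_def split: if_splits)
  qed
qed

text \<open>For a set \<open>A\<close> of positive measure, the normalised distribution function \<open>F\<close> of \<open>A\<close> and its
  quantile function \<open>G\<close> identify \<open>A\<close> with the unit interval, up to scaling of the measure. Since
  \<open>F \<circ> G = id\<close> holds everywhere, only the distribution of \<open>G\<close> has to be computed.\<close>

definition unit_iso :: "real set \<Rightarrow> (real \<Rightarrow> real) \<Rightarrow> (real \<Rightarrow> real) \<Rightarrow> bool" where
  "unit_iso A F G \<longleftrightarrow> F \<in> borel_measurable mu \<and> G \<in> borel_measurable borel \<and>
    (\<forall>x\<in>{0..1}. F x \<in> {0..1}) \<and> (\<forall>t. G t \<in> {0..1}) \<and> (\<forall>t\<in>{0..1}. F (G t) = t) \<and>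
    (AE x in mu. x \<in> A \<longrightarrow> G (F x) = x) \<and> (\<forall>N\<in>null_sets mu. AE t in mu. G t \<notin> N) \<and>
    (\<forall>K\<in>borel_measurable mu.
       (\<integral>\<^sup>+t. K (G t) \<partial>mu) = (\<integral>\<^sup>+x. ennreal (indicator A x / measure mu A) * K x \<partial>mu))"

text \<open>\<open>F\<close> is Lipschitz, hence continuous and onto the unit interval. The
  equivalence of \<open>G t \<le> x\<close> with \<open>min t 1 \<le> F x\<close> shows that
  \<open>G\<close> has the normalised restriction of \<open>mu\<close> to \<open>A\<close> as its
  distribution; everything else follows from this and \<open>F (G t) = t\<close>.\<close>

lemma quantile_iso:
  assumes A [measurable]: "A \<in> sets mu" and m: "0 < measure mu A"
  shows "\<exists>F G. unit_iso A F G"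
proof -
  define m where "m = measure mu A"
  have m0: "0 < m" using assms(2) by (simp add: m_def)
  define F where "F x = measure mu (A \<inter> {0..x}) / m" for x
  have As: "A \<subseteq> {0..1}" using sets.sets_into_space[OF A] by simp
  have AI [measurable]: "A \<inter> {a..b} \<in> sets mu" for a b
  proof -
    have "A \<inter> {a..b} = A \<inter> ({a..b} \<inter> {0..1})" using As by auto
    also have "\<dots> \<in> sets mu" using borel_Int_mu[of "{a..b}"] A by auto
    finally show ?thesis .
  qed
  have F_diff: "F y - F x \<le> (y - x) / m" and F_mono: "F x \<le> F y" if "0 \<le> x" "x \<le> y" "y \<le> 1" for x y
  proof -
    have "measure mu (A \<inter> {0..y}) \<le> measure mu ((A \<inter> {0..x}) \<union> {x..y})"
      using that by (intro mu.finite_measure_mono sets.Un AI atLeastAtMost_sets_mu) auto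
    also have "\<dots> \<le> measure mu (A \<inter> {0..x}) + measure mu {x..y}"
      using that by (intro measure_Un_le AI atLeastAtMost_sets_mu)
    also have "measure mu {x..y} = y - x"
    proof -
      have "emeasure mu {x..y} = ennreal (y - x)"
        unfolding mu_def using that by (subst emeasure_restrict_space) auto
      then show ?thesis using that by (simp add: measure_def)
    qed
    finally have "measure mu (A \<inter> {0..y}) - measure mu (A \<inter> {0..x}) \<le> y - x" by simp
    then show "F y - F x \<le> (y - x) / m" using m0 by (simp add: F_def diff_divide_distrib[symmetric] divide_right_mono)
    have "measure mu (A \<inter> {0..x}) \<le> measure mu (A \<inter> {0..y})" using that by (intro mu.finite_measure_mono AI) auto
    then show "F x \<le> F y" using m0 by (simp add: F_def divide_right_mono)
  qed
  have F0: "F 0 = 0"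
    using mu.finite_measure_mono[of "A \<inter> {0..0}" "{0..0}"] measure_mu_atMost[of 0] atLeastAtMost_sets_mu[of 0 0]
    by (simp add: F_def measure_le_0_iff)
  have F1: "F 1 = 1" using As m0 by (simp add: F_def m_def Int_absorb2)
  have F01: "F x \<in> {0..1}" if "x \<in> {0..1}" for x using F_mono[of 0 x] F_mono[of x 1] that F0 F1 by auto
  have lip: "(1 / m)-lipschitz_on {0..1} F"
  proof (rule lipschitz_onI)
    fix x y :: real assume xy: "x \<in> {0..1}" "y \<in> {0..1}"
    show "dist (F x) (F y) \<le> 1 / m * dist x y"
      using F_diff[of x y] F_mono[of x y] F_diff[of y x] F_mono[of y x] xy
      by (cases "x \<le> y") (auto simp: dist_real_def abs_if field_simps)
  qed (use m0 in simp)
  have cont: "continuous_on {0..1} F" by (rule lipschitz_on_continuous_on[OF lip])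
  have Fm [measurable]: "F \<in> borel_measurable mu"
    unfolding mu_def by (rule continuous_imp_measurable_on_sets_lebesgue[OF cont]) simp
  \<comment> \<open>Cutting \<open>t\<close> at 1 keeps the set nonempty, so \<open>G\<close> is
    defined and Borel on the whole line.\<close>
  define G where "G t = Inf {x \<in> {0..1}. min t 1 \<le> F x}" for t
  have Gin: "G t \<in> {0..1} \<and> min t 1 \<le> F (G t)" for t
  proof -
    let ?S = "{x \<in> {0..1}. min t 1 \<le> F x}"
    have "closed {x \<in> {0..1}. F x \<in> {min t 1..}}"
      using continuous_closed_preimage[OF cont, of "{min t 1..}"] by (simp add: vimage_def Int_def)
    then have "closed ?S" by simp
    moreover have "1 \<in> ?S" using F1 by simp
    moreover have "bdd_below ?S" by (rule bdd_belowI[of _ 0]) auto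
    ultimately have "Inf ?S \<in> ?S" by (intro closed_contains_Inf) auto
    then show ?thesis by (simp add: G_def)
  qed
  have G0: "0 \<le> G t" "G t \<le> 1" for t using Gin[of t] by auto
  have gal: "G t \<le> x \<longleftrightarrow> min t 1 \<le> F x" if "x \<in> {0..1}" for t x
  proof
    assume "G t \<le> x"
    then show "min t 1 \<le> F x" using F_mono[of "G t" x] Gin[of t] that by auto
  next
    assume "min t 1 \<le> F x"
    then show "G t \<le> x" unfolding G_def using that by (intro cInf_lower bdd_belowI[of _ 0]) auto
  qed
  have FG: "F (G t) = t" if t: "t \<in> {0..1}" for t
  proof -
    have "t \<le> F (G t)" using Gin[of t] t by auto
    have "continuous_on {0..G t} F" by (rule continuous_on_subset[OF cont]) (use Gin[of t] in auto)
    with \<open>t \<le> F (G t)\<close> obtain x where x: "0 \<le> x" "x \<le> G t" "F x = t"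
      using IVT'[of F 0 t "G t"] Gin[of t] t F0 by auto
    then have "G t \<le> x" using gal[of x t] Gin[of t] t by auto
    then show ?thesis using x by simp
  qed
  have Gm [measurable]: "G \<in> borel_measurable borel"
    unfolding borel_measurable_iff_le
  proof
    fix a :: real
    consider "a < 0" | "a > 1" | "a \<in> {0..1}" by fastforce
    then show "{w \<in> space borel. G w \<le> a} \<in> sets borel"
    proof cases
      case 1
      have "\<not> G w \<le> a" for w using G0[of w] 1 by linarith
      then have e: "{w \<in> space borel. G w \<le> a} = {}" by simp
      show ?thesis unfolding e by simp
    next
      case 2
      have "G w \<le> a" for w using G0[of w] 2 by linarith
      then have e: "{w \<in> space borel. G w \<le> a} = UNIV" by simp
      show ?thesis unfolding e by simp
    next
      case 3
      have e: "{w \<in> space borel. G w \<le> a} = {w. min w 1 \<le> F a}" using gal[OF 3] by simp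
      show ?thesis unfolding e by measurable
    qed
  qed
  have Gmu [measurable]: "G \<in> borel_measurable mu" by (rule borel_measurable_mu[OF Gm])
  let ?w = "\<lambda>x. ennreal (indicator A x / m)"
  have wm [measurable]: "?w \<in> borel_measurable mu" by measurable
  have dens: "emeasure (density mu ?w) S = ennreal (measure mu (A \<inter> S) / m)" if [measurable]: "S \<in> sets mu" for S
  proof -
    have "emeasure (density mu ?w) S = (\<integral>\<^sup>+x. ennreal (1 / m) * indicator (A \<inter> S) x \<partial>mu)"
      by (subst emeasure_density) (auto intro!: nn_integral_cong simp: indicator_def)
    also have "\<dots> = ennreal (1 / m) * emeasure mu (A \<inter> S)" by (rule nn_integral_cmult_indicator) measurable
    also have "\<dots> = ennreal (measure mu (A \<inter> S) / m)"
      using m0 by (simp add: mu.emeasure_eq_measure ennreal_mult'[symmetric])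
    finally show ?thesis .
  qed
  have idm: "(\<lambda>x. x) \<in> density mu ?w \<rightarrow>\<^sub>M borel" using id_measurable_mu by simp
  \<comment> \<open>Measures on the line are compared on open half-lines, where the equivalence
    between \<open>G\<close> and \<open>F\<close> computes both sides as
    \<open>1 - F x\<close>.\<close>
  have eqm: "distr mu borel G = distr (density mu ?w) borel (\<lambda>x. x)"
  proof (rule measure_eqI_lessThan)
    interpret D: finite_measure "distr mu borel G" by (rule mu.finite_measure_distr) measurable
    show "emeasure (distr mu borel G) {x<..} < \<infinity>" for x by (simp add: D.emeasure_eq_measure)
    fix x :: real
    have L: "emeasure (distr mu borel G) {x<..} = emeasure mu {t \<in> space mu. x < G t}"
      by (subst emeasure_distr) (auto intro!: arg_cong[where f="emeasure mu"])
    have Sx: "{x<..} \<inter> {0..1} \<in> sets mu" using borel_Int_mu[of "{x<..}"] by simp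
    have R: "emeasure (distr (density mu ?w) borel (\<lambda>x. x)) {x<..} = ennreal (measure mu (A \<inter> ({x<..} \<inter> {0..1})) / m)"
      using idm by (subst emeasure_distr) (auto simp: dens[OF Sx])
    consider "x < 0" | "x \<ge> 1" | "0 \<le> x" "x < 1" by linarith
    then show "emeasure (distr mu borel G) {x<..} = emeasure (distr (density mu ?w) borel (\<lambda>x. x)) {x<..}"
    proof cases
      case 1
      have "x < G t" for t using G0[of t] 1 by linarith
      then have "{t \<in> space mu. x < G t} = {0..1}" "A \<inter> ({x<..} \<inter> {0..1}) = A" using 1 As by auto
      then show ?thesis unfolding L R using m0 emeasure_mu_space by (simp add: m_def)
    next
      case 2
      have "\<not> x < G t" for t using G0[of t] 2 by linarith
      then have e: "{t \<in> space mu. x < G t} = {}" by simp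
      have "A \<inter> ({x<..} \<inter> {0..1}) = {}" using 2 by auto
      then show ?thesis unfolding L R e by simp
    next
      case 3
      then have x: "x \<in> {0..1}" by auto
      have lt: "x < G t \<longleftrightarrow> F x < t" if "0 \<le> t" "t \<le> 1" for t
      proof -
        have "min t 1 = t" using that by simp
        then show ?thesis using gal[OF x, of t] by (simp add: linorder_not_le[symmetric])
      qed
      have "{t \<in> space mu. x < G t} = {0..1} - {0..F x}"
        unfolding space_mu by (rule set_eqI) (simp, metis lt linorder_not_le)
      then have "measure mu {t \<in> space mu. x < G t} = 1 - F x"
        using F01[OF x] mu.finite_measure_Diff[of "{0..1}" "{0..F x}"] by (simp add: measure_mu_atMost atLeastAtMost_sets_mu)
      moreover have "A \<inter> ({x<..} \<inter> {0..1}) = A - A \<inter> {0..x}" using As x by auto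
      then have "measure mu (A \<inter> ({x<..} \<inter> {0..1})) / m = 1 - F x"
        using mu.finite_measure_Diff[OF A AI[of 0 x]] m0 by (simp add: F_def m_def diff_divide_distrib)
      ultimately show ?thesis unfolding L R by (simp add: mu.emeasure_eq_measure)
    qed
  qed auto
  have Gb: "emeasure mu (G -` S \<inter> space mu) = ennreal (measure mu (A \<inter> (S \<inter> {0..1})) / m)" if S: "S \<in> sets borel" for S
  proof -
    have "emeasure mu (G -` S \<inter> space mu) = emeasure (distr mu borel G) S" using S by (simp add: emeasure_distr)
    also have "\<dots> = emeasure (density mu ?w) (S \<inter> {0..1})"
      unfolding eqm using idm S by (subst emeasure_distr) (auto simp: vimage_def intro!: arg_cong[where f="emeasure (density mu ?w)"])
    finally show ?thesis using dens[OF borel_Int_mu[OF S]] by simp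
  qed
  have Gnull: "AE t in mu. G t \<notin> N" if N: "N \<in> null_sets mu" for N
  proof -
    obtain N' where N': "N' \<in> sets borel" "N \<subseteq> N'" "N' \<inter> {0..1} \<in> null_sets mu" by (rule null_sets_mu_borel[OF N])
    have "measure mu (A \<inter> (N' \<inter> {0..1})) \<le> measure mu (N' \<inter> {0..1})"
      using N'(3) by (intro mu.finite_measure_mono) auto
    also have "\<dots> = 0" using N'(3) by (simp add: measure_def null_setsD1)
    finally have "emeasure mu (G -` N' \<inter> space mu) = 0" unfolding Gb[OF N'(1)] by (simp add: measure_le_0_iff)
    then have "G -` N' \<inter> space mu \<in> null_sets mu" using N'(1) by (intro null_setsI measurable_sets[OF Gmu])
    from AE_not_in[OF this] AE_space show ?thesis by eventually_elim (use N'(2) in auto)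
  qed
  have GG: "G \<in> mu \<rightarrow>\<^sub>M mu" by (rule measurable_mu_muI[OF Gmu _ Gnull]) (use Gin in auto)
  have eqmu: "distr mu mu G = density mu ?w"
  proof (rule measure_eqI)
    fix S assume "S \<in> sets (distr mu mu G)"
    then have S: "S \<in> sets mu" by simp
    obtain S' where S': "S' \<in> sets borel" "AE x in mu. x \<in> S \<longleftrightarrow> x \<in> S'" by (rule mu_set_borel_rep[OF S])
    have "AE x in mu. G x \<in> S \<longleftrightarrow> G x \<in> S'"
    proof (rule AE_pullback[OF _ _ S'(2)])
      show "G -` N \<inter> space mu \<in> null_sets mu" if "N \<in> null_sets mu" for N
        unfolding mu.null_sets_iff_AE using Gnull[OF that] by auto
    qed (use Gin in auto)
    then have "emeasure mu (G -` S \<inter> space mu) = emeasure mu (G -` S' \<inter> space mu)"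
      by (intro emeasure_eq_AE measurable_sets[OF GG S] measurable_sets[OF Gmu S'(1)]) (auto elim: eventually_mono)
    also have "\<dots> = ennreal (measure mu (A \<inter> (S' \<inter> {0..1})) / m)" by (rule Gb[OF S'(1)])
    also have "measure mu (A \<inter> (S' \<inter> {0..1})) = measure mu (A \<inter> S)"
    proof (rule measure_eq_AE)
      show "AE x in mu. x \<in> A \<inter> (S' \<inter> {0..1}) \<longleftrightarrow> x \<in> A \<inter> S" using S'(2) AE_space by eventually_elim auto
    qed (use S borel_Int_mu[OF S'(1)] in auto)
    finally show "emeasure (distr mu mu G) S = emeasure (density mu ?w) S"
      using S dens[OF S] by (simp add: emeasure_distr[OF GG])
  qed simp
  have int: "(\<integral>\<^sup>+t. K (G t) \<partial>mu) = (\<integral>\<^sup>+x. ?w x * K x \<partial>mu)" if [measurable]: "K \<in> borel_measurable mu" for K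
  proof -
    have "(\<integral>\<^sup>+t. K (G t) \<partial>mu) = (\<integral>\<^sup>+x. K x \<partial>distr mu mu G)" by (rule nn_integral_distr[symmetric, OF GG]) measurable
    also have "\<dots> = (\<integral>\<^sup>+x. ?w x * K x \<partial>mu)" unfolding eqmu by (rule nn_integral_density) measurable
    finally show ?thesis .
  qed
  \<comment> \<open>Integrate the indicator of the points of \<open>A\<close> where
    \<open>G (F x)\<close> differs from \<open>x\<close>. After substituting \<open>G\<close> it
    vanishes, because \<open>F (G t) = t\<close>.\<close>
  have GF: "AE x in mu. x \<in> A \<longrightarrow> G (F x) = x"
  proof -
    have [measurable]: "(\<lambda>x. G (F x)) \<in> borel_measurable mu" by measurable
    let ?K = "\<lambda>x. if G (F x) = x then 0 else 1 :: ennreal"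
    have Km [measurable]: "?K \<in> borel_measurable mu" using id_measurable_mu by measurable
    have "(\<integral>\<^sup>+x. ?w x * ?K x \<partial>mu) = (\<integral>\<^sup>+t. ?K (G t) \<partial>mu)" by (rule int[OF Km, symmetric])
    also have "\<dots> = (\<integral>\<^sup>+t. 0 \<partial>mu)" by (rule nn_integral_cong) (use FG in simp)
    finally have "(\<integral>\<^sup>+x. ?w x * ?K x \<partial>mu) = 0" by simp
    then have "AE x in mu. ?w x * ?K x = 0" by (subst (asm) nn_integral_0_iff_AE) auto
    moreover have "ennreal (1 / m) \<noteq> 0" using m0 by simp
    ultimately show ?thesis by (auto simp: indicator_def elim!: eventually_mono split: if_splits)
  qed
  have "unit_iso A F G"
    unfolding unit_iso_def m_def[symmetric]
    by (intro conjI ballI allI Fm Gm F01 FG GF Gnull int) (use Gin in auto)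
  then show ?thesis by blast
qed

lemma unit_isoD:
  assumes "unit_iso A F G"
  shows "F \<in> borel_measurable mu" "G \<in> borel_measurable borel" "\<And>x. x \<in> {0..1} \<Longrightarrow> F x \<in> {0..1}"
    "\<And>t. G t \<in> {0..1}" "\<And>t. t \<in> {0..1} \<Longrightarrow> F (G t) = t"
    "AE x in mu. x \<in> A \<longrightarrow> G (F x) = x" "\<And>N. N \<in> null_sets mu \<Longrightarrow> AE t in mu. G t \<notin> N"
    "\<And>K. K \<in> borel_measurable mu \<Longrightarrow>
       (\<integral>\<^sup>+t. K (G t) \<partial>mu) = (\<integral>\<^sup>+x. ennreal (indicator A x / measure mu A) * K x \<partial>mu)"
  using assms unfolding unit_iso_def by blast+

text \<open>Cover the exceptional set by a Borel null set and substitute \<open>G\<close> in the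
  integral of its indicator composed with \<open>F\<close>: since \<open>F (G t) = t\<close>, what
  remains is the indicator of a null set.\<close>

lemma unit_iso_pull:
  assumes A: "A \<in> sets mu" "0 < measure mu A" and iso: "unit_iso A F G" and P: "AE t in mu. P t"
  shows "AE x in mu. x \<in> A \<longrightarrow> P (F x)"
proof -
  note D = unit_isoD[OF iso]
  obtain N where N: "N \<in> null_sets mu" "{y \<in> space mu. \<not> P y} \<subseteq> N"
    using P unfolding eventually_ae_filter by auto
  obtain N' where N': "N' \<in> sets borel" "N \<subseteq> N'" "N' \<inter> {0..1} \<in> null_sets mu" by (rule null_sets_mu_borel[OF N(1)])
  let ?K = "\<lambda>x. indicator N' (F x) :: ennreal"
  have Km [measurable]: "?K \<in> borel_measurable mu" using D(1) N'(1) by measurable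
  have "(\<integral>\<^sup>+x. ennreal (indicator A x / measure mu A) * ?K x \<partial>mu) = (\<integral>\<^sup>+t. ?K (G t) \<partial>mu)"
    by (rule D(8)[OF Km, symmetric])
  also have "\<dots> = (\<integral>\<^sup>+t. 0 \<partial>mu)"
  proof (rule nn_integral_cong_AE)
    show "AE t in mu. ?K (G t) = 0" using AE_not_in[OF N'(3)] AE_space
      by eventually_elim (simp add: D(5))
  qed
  finally have "(\<integral>\<^sup>+x. ennreal (indicator A x / measure mu A) * ?K x \<partial>mu) = 0" by simp
  then have "AE x in mu. ennreal (indicator A x / measure mu A) * ?K x = 0"
    using A by (subst (asm) nn_integral_0_iff_AE) auto
  then show ?thesis using AE_space
  proof eventually_elim
    case (elim x)
    show ?case
    proof
      assume x: "x \<in> A"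
      then have "F x \<notin> N'" using elim(1) A(2) by (auto simp: indicator_def split: if_splits)
      moreover have "F x \<in> space mu" using D(3)[of x] elim(2) by simp
      ultimately show "P (F x)" using N(2) N'(2) by auto
    qed
  qed
qed

lemma unit_iso_into:
  assumes A: "A \<in> sets mu" and iso: "unit_iso A F G"
  shows "AE t in mu. G t \<in> A"
proof -
  note D = unit_isoD[OF iso]
  let ?K = "\<lambda>x. indicator (space mu - A) x :: ennreal"
  have Gmu: "G \<in> mu \<rightarrow>\<^sub>M mu" by (rule measurable_mu_muI[OF borel_measurable_mu[OF D(2)] D(4) D(7)])
  have Km: "?K \<in> borel_measurable mu" using A by measurable
  have "(\<integral>\<^sup>+t. ?K (G t) \<partial>mu) = (\<integral>\<^sup>+x. ennreal (indicator A x / measure mu A) * ?K x \<partial>mu)" by (rule D(8)[OF Km])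
  also have "\<dots> = (\<integral>\<^sup>+x. 0 \<partial>mu)" by (rule nn_integral_cong) (auto simp: indicator_def)
  finally have "(\<integral>\<^sup>+t. ?K (G t) \<partial>mu) = 0" by simp
  then have "AE t in mu. ?K (G t) = 0"
    using measurable_compose[OF Gmu Km] by (subst (asm) nn_integral_0_iff_AE) auto
  then show ?thesis
  proof eventually_elim
    case (elim t)
    then show ?case using D(4)[of t] by (auto simp: indicator_def split: if_splits)
  qed
qed

text \<open>Borel sets suffice in the change of variables: every Lebesgue set agrees with a Borel
  one almost everywhere, and \<open>g\<close> pulls this agreement back.\<close>

lemma nstI_borel:
  assumes n: "nsp f g" and w [measurable]: "w \<in> borel_measurable mu" and w0: "\<And>x. 0 \<le> w x"
    and S: "\<And>S. S \<in> sets borel \<Longrightarrow> (\<integral>\<^sup>+x. ennreal (w x) * indicator S (g x) \<partial>mu) = (\<integral>\<^sup>+x. indicator S x \<partial>mu)"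
  shows "nst f g w"
proof -
  have g [measurable]: "g \<in> mu \<rightarrow>\<^sub>M mu" using nsp_measurable[OF n] by simp
  have me: "distr (density mu w) mu g = mu"
  proof (rule measure_eqI)
    fix A assume "A \<in> sets (distr (density mu w) mu g)"
    then have A [measurable]: "A \<in> sets mu" by simp
    obtain A' where A': "A' \<in> sets borel" "AE x in mu. x \<in> A \<longleftrightarrow> x \<in> A'" by (rule mu_set_borel_rep[OF A])
    have "emeasure (distr (density mu w) mu g) A = (\<integral>\<^sup>+x. ennreal (w x) * indicator (g -` A \<inter> space mu) x \<partial>mu)"
    proof -
      have "g \<in> density mu w \<rightarrow>\<^sub>M mu" by simp
      from emeasure_distr[OF this A] show ?thesis
        using measurable_sets[OF g A] by (simp add: emeasure_density del: space_mu)
    qed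
    also have "\<dots> = (\<integral>\<^sup>+x. ennreal (w x) * indicator A' (g x) \<partial>mu)"
      by (rule nn_integral_cong_AE)
        (use nsp_AE(2)[OF n A'(2)] AE_space in \<open>eventually_elim, auto simp: indicator_def\<close>)
    also have "\<dots> = (\<integral>\<^sup>+x. indicator A' x \<partial>mu)" by (rule S[OF A'(1)])
    also have "\<dots> = (\<integral>\<^sup>+x. indicator A x \<partial>mu)"
      by (rule nn_integral_cong_AE) (use A'(2) in \<open>eventually_elim, auto simp: indicator_def\<close>)
    also have "\<dots> = emeasure mu A" by simp
    finally show "emeasure (distr (density mu w) mu g) A = emeasure mu A" .
  qed simp
  have "(\<integral>\<^sup>+x. ennreal (w x) * K (g x) \<partial>mu) = (\<integral>\<^sup>+x. K x \<partial>mu)" if [measurable]: "K \<in> borel_measurable mu" for K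
  proof -
    have "(\<integral>\<^sup>+x. ennreal (w x) * K (g x) \<partial>mu) = (\<integral>\<^sup>+x. K (g x) \<partial>density mu w)"
      by (rule nn_integral_density[symmetric]) measurable
    also have "\<dots> = (\<integral>\<^sup>+x. K x \<partial>distr (density mu w) mu g)"
      by (rule nn_integral_distr[symmetric]) measurable
    finally show ?thesis unfolding me .
  qed
  then show ?thesis using n w w0 by (simp add: nst_def)
qed

section \<open>Countable partitions and piecewise isomorphisms\<close>

lemma nn_integral_labels:
  fixes l :: "real \<Rightarrow> nat"
  assumes l: "l \<in> mu \<rightarrow>\<^sub>M count_space UNIV" and K [measurable]: "K \<in> borel_measurable mu"
  shows "(\<integral>\<^sup>+x. K x \<partial>mu) = (\<Sum>n. \<integral>\<^sup>+x. K x * indicator {n} (l x) \<partial>mu)"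
proof -
  have [measurable]: "(\<lambda>x. indicator {n} (l x) :: ennreal) \<in> borel_measurable mu" for n
    by (rule measurable_compose[OF l]) simp
  have "(\<integral>\<^sup>+x. K x \<partial>mu) = (\<integral>\<^sup>+x. (\<Sum>n. K x * indicator {n} (l x)) \<partial>mu)"
  proof (rule nn_integral_cong)
    fix x
    have "(\<Sum>n. K x * indicator {n} (l x)) = (\<Sum>n\<in>{l x}. K x * indicator {n} (l x))"
      by (rule suminf_finite) (auto simp: indicator_def)
    then show "K x = (\<Sum>n. K x * indicator {n} (l x))" by simp
  qed
  also have "\<dots> = (\<Sum>n. \<integral>\<^sup>+x. K x * indicator {n} (l x) \<partial>mu)"
    by (rule nn_integral_suminf) measurable
  finally show ?thesis .
qed

text \<open>A measurable partition into countably many pieces is encoded by its label function; maps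
  defined piecewise are then measurable by countability of the labels.\<close>

definition lset :: "(real \<Rightarrow> nat) \<Rightarrow> nat \<Rightarrow> real set" where
  "lset l n = {x \<in> space mu. l x = n}"

lemma lset_sets:
  assumes "l \<in> mu \<rightarrow>\<^sub>M count_space UNIV" shows "lset l n \<in> sets mu"
proof -
  have "lset l n = l -` {n} \<inter> space mu" by (auto simp: lset_def)
  then show ?thesis using measurable_sets[OF assms, of "{n}"] by simp
qed

lemma AE_not_label:
  assumes "l \<in> mu \<rightarrow>\<^sub>M count_space UNIV" "measure mu (lset l n) = 0"
  shows "AE x in mu. l x \<noteq> n"
proof -
  have "lset l n \<in> null_sets mu"
    using assms(2) lset_sets[OF assms(1)] by (intro null_setsI) (simp_all add: mu.emeasure_eq_measure)
  from AE_not_in[OF this] AE_space show ?thesis by eventually_elim (simp add: lset_def)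
qed

lemma AE_labels:
  fixes l :: "real \<Rightarrow> nat"
  assumes "\<And>n. AE x in mu. l x = n \<longrightarrow> P x"
  shows "AE x in mu. P x"
proof -
  have "AE x in mu. \<forall>n. l x = n \<longrightarrow> P x" using assms by (intro AE_all_countable[THEN iffD2] allI)
  then show ?thesis by eventually_elim simp
qed

text \<open>Each piece of positive measure is mapped to the piece of the same label by passing
  through the unit interval, which scales the measure by a constant; hence the quotient as density.
  Null pieces must correspond to null pieces, for no nonsingular map could match them
  otherwise.\<close>

lemma relabelling_iso:
  fixes l l' :: "real \<Rightarrow> nat"
  assumes l: "l \<in> mu \<rightarrow>\<^sub>M count_space UNIV" and l': "l' \<in> mu \<rightarrow>\<^sub>M count_space UNIV"
    and null: "\<And>n. measure mu (lset l n) = 0 \<longleftrightarrow> measure mu (lset l' n) = 0"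
  obtains f g where "nst f g (\<lambda>y. measure mu (lset l (l' y)) / measure mu (lset l' (l' y)))"
    "AE x in mu. l' (f x) = l x"
proof -
  \<comment> \<open>Null sets receive the constant maps 0, so that measurability holds for every
    label without a case distinction.\<close>
  define sel where "sel A = (if 0 < measure mu A then SOME FG. unit_iso A (fst FG) (snd FG) else (\<lambda>x. 0, \<lambda>x. 0))" for A
  define F where "F A = fst (sel A)" for A
  define G where "G A = snd (sel A)" for A
  have iso: "unit_iso A (F A) (G A)" if A: "A \<in> sets mu" "0 < measure mu A" for A
  proof -
    have "\<exists>FG. unit_iso A (fst FG) (snd FG)" using quantile_iso[OF A] by simp
    from someI_ex[OF this] show ?thesis using A by (simp add: sel_def F_def G_def)
  qed
  have Fm: "F A \<in> borel_measurable mu" and Gm: "G A \<in> borel_measurable borel"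
    and G01: "G A t \<in> {0..1}" if "A \<in> sets mu" for A t
    using unit_isoD(1,2,4)[OF iso[OF that]] by (cases "0 < measure mu A"; simp add: F_def G_def sel_def)+
  \<comment> \<open>Forward and backward map are the same expression with the label functions
    exchanged, so \<open>half\<close> is proved once and used twice.\<close>
  define tr where "tr a b x = G (lset b (a x)) (F (lset a (a x)) x)" for a b :: "real \<Rightarrow> nat" and x
  have half: "tr a b \<in> mu \<rightarrow>\<^sub>M mu \<and> (\<forall>N\<in>null_sets mu. AE x in mu. tr a b x \<notin> N) \<and>
      (AE x in mu. b (tr a b x) = a x) \<and> (AE x in mu. tr b a (tr a b x) = x)"
    if a: "a \<in> mu \<rightarrow>\<^sub>M count_space UNIV" and b: "b \<in> mu \<rightarrow>\<^sub>M count_space UNIV"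
      and ab: "\<And>n. measure mu (lset a n) = 0 \<longleftrightarrow> measure mu (lset b n) = 0" for a b
  proof -
    note sa = lset_sets[OF a] and sb = lset_sets[OF b]
    have meas: "tr a b \<in> borel_measurable mu"
      unfolding tr_def[abs_def]
      by (rule measurable_compose_countable[OF _ a]) (rule measurable_compose[OF Fm[OF sa] Gm[OF sb]])
    have tr01: "tr a b x \<in> {0..1}" for x unfolding tr_def by (rule G01[OF sb])
    have key: "AE x in mu. a x = n \<longrightarrow> tr a b x \<notin> N \<and> b (tr a b x) = a x \<and> tr b a (tr a b x) = x"
      if N: "N \<in> null_sets mu" for n N
    proof (cases "measure mu (lset a n) = 0")
      case True
      from AE_not_label[OF a True] show ?thesis by eventually_elim simp
    next
      case False
      then have pa: "0 < measure mu (lset a n)" and pb: "0 < measure mu (lset b n)"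
        using ab[of n] by (auto simp: zero_less_measure_iff)
      note ia = iso[OF sa pa] and ib = iso[OF sb pb]
      have "AE t in mu. G (lset b n) t \<notin> N \<and> G (lset b n) t \<in> lset b n"
        using unit_isoD(7)[OF ib N] unit_iso_into[OF sb ib] by eventually_elim simp
      from unit_iso_pull[OF sa pa ia this] unit_isoD(6)[OF ia] AE_space
      show ?thesis
      proof eventually_elim
        case (elim x)
        show ?case
        proof (intro impI)
          assume ax: "a x = n"
          then have x: "x \<in> lset a n" using elim(3) by (simp add: lset_def)
          have t: "tr a b x = G (lset b n) (F (lset a n) x)" by (simp add: tr_def ax)
          have bt: "b (tr a b x) = n" using elim(1) x t by (auto simp: lset_def)
          have "tr b a (tr a b x) = G (lset a n) (F (lset b n) (tr a b x))" unfolding tr_def[of b a] bt ..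
          also have "F (lset b n) (tr a b x) = F (lset a n) x"
            unfolding t using elim(3) by (intro unit_isoD(5)[OF ib] unit_isoD(3)[OF ia]) simp
          also have "G (lset a n) (F (lset a n) x) = x" using elim(2) x by simp
          finally show "tr a b x \<notin> N \<and> b (tr a b x) = a x \<and> tr b a (tr a b x) = x"
            using elim(1) x t bt ax by simp
        qed
      qed
    qed
    have nul: "AE x in mu. tr a b x \<notin> N" if "N \<in> null_sets mu" for N
      using AE_labels[OF key[OF that]] by eventually_elim simp
    have "tr a b \<in> mu \<rightarrow>\<^sub>M mu" by (rule measurable_mu_muI[OF meas tr01 nul])
    moreover have "AE x in mu. b (tr a b x) = a x" "AE x in mu. tr b a (tr a b x) = x"
      using AE_labels[OF key[OF null_sets.empty_sets]] by (eventually_elim, simp)+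
    ultimately show ?thesis using nul by blast
  qed
  note h1 = half[OF l l' null] and h2 = half[OF l' l null[symmetric]]
  have n: "nsp (tr l l') (tr l' l)" by (rule nspI) (use h1 h2 in auto)
  let ?w = "\<lambda>y. measure mu (lset l (l' y)) / measure mu (lset l' (l' y))"
  have wm: "?w \<in> borel_measurable mu" by (rule measurable_compose[OF l']) simp
  have "nst (tr l l') (tr l' l) ?w"
  proof (rule nstI_borel[OF n wm])
    fix S :: "real set" assume S: "S \<in> sets borel"
    have im [measurable]: "(\<lambda>x. indicator S x :: ennreal) \<in> borel_measurable mu"
      by (rule borel_measurable_mu) (use S in measurable)
    have "(\<lambda>x. ennreal (?w x)) \<in> borel_measurable mu" using wm by measurable
    moreover have "(\<lambda>x. indicator S (tr l' l x) :: ennreal) \<in> borel_measurable mu"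
      using measurable_compose[OF nsp_measurable(2)[OF n] im] .
    ultimately have Km: "(\<lambda>x. ennreal (?w x) * indicator S (tr l' l x)) \<in> borel_measurable mu" by measurable
    have "(\<integral>\<^sup>+x. ennreal (?w x) * indicator S (tr l' l x) * indicator {k} (l' x) \<partial>mu)
        = (\<integral>\<^sup>+x. indicator S x * indicator {k} (l x) \<partial>mu)" for k
    proof (cases "measure mu (lset l k) = 0")
      case True
      have ae: "AE x in mu. l x \<noteq> k" by (rule AE_not_label[OF l True])
      have eq: "(\<integral>\<^sup>+x. indicator S x * indicator {k} (l x) \<partial>mu) = (\<integral>\<^sup>+x. 0 \<partial>mu)"
        by (rule nn_integral_cong_AE) (use ae in \<open>eventually_elim, simp\<close>)
      have ae': "AE x in mu. l' x \<noteq> k" by (rule AE_not_label[OF l']) (use True null in simp)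
      have eq': "(\<integral>\<^sup>+x. ennreal (?w x) * indicator S (tr l' l x) * indicator {k} (l' x) \<partial>mu) = (\<integral>\<^sup>+x. 0 \<partial>mu)"
        by (rule nn_integral_cong_AE) (use ae' in \<open>eventually_elim, simp\<close>)
      show ?thesis unfolding eq eq' ..
    next
      case False
      define q where "q = measure mu (lset l k)"
      define q' where "q' = measure mu (lset l' k)"
      have q: "0 < q" "0 < q'" using False null[of k] by (auto simp: q_def q'_def zero_less_measure_iff)
      note s = lset_sets[OF l, of k] and s' = lset_sets[OF l', of k]
      note i = iso[OF s q(1)[unfolded q_def]] and i' = iso[OF s' q(2)[unfolded q'_def]]
      let ?H = "\<lambda>t. indicator S (G (lset l k) t) :: ennreal"
      have Hb: "?H \<in> borel_measurable borel" using unit_isoD(2)[OF i] S by measurable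
      have Hm [measurable]: "(\<lambda>y. ?H (F (lset l' k) y)) \<in> borel_measurable mu"
        by (rule measurable_compose[OF unit_isoD(1)[OF i'] Hb])
      have [measurable]: "lset l' k \<in> sets mu" "lset l k \<in> sets mu" using s s' by auto
      have "(\<integral>\<^sup>+x. ennreal (?w x) * indicator S (tr l' l x) * indicator {k} (l' x) \<partial>mu)
        = (\<integral>\<^sup>+y. ennreal q * (ennreal (indicator (lset l' k) y / q') * ?H (F (lset l' k) y)) \<partial>mu)"
      proof (rule nn_integral_cong)
        fix y assume "y \<in> space mu"
        then show "ennreal (?w y) * indicator S (tr l' l y) * indicator {k} (l' y)
          = ennreal q * (ennreal (indicator (lset l' k) y / q') * ?H (F (lset l' k) y))"
        proof (cases "l' y = k")
          case True
          then have "y \<in> lset l' k" using \<open>y \<in> space mu\<close> by (simp add: lset_def)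
          then show ?thesis
            using q True by (simp add: tr_def q_def[symmetric] q'_def[symmetric] ennreal_mult'[symmetric] mult.assoc[symmetric])
        next
          case False
          then show ?thesis by (simp add: lset_def)
        qed
      qed
      also have "\<dots> = ennreal q * (\<integral>\<^sup>+y. ennreal (indicator (lset l' k) y / q') * ?H (F (lset l' k) y) \<partial>mu)"
        by (rule nn_integral_cmult) measurable
      also have "(\<integral>\<^sup>+y. ennreal (indicator (lset l' k) y / q') * ?H (F (lset l' k) y) \<partial>mu)
        = (\<integral>\<^sup>+t. ?H (F (lset l' k) (G (lset l' k) t)) \<partial>mu)"
        unfolding q'_def by (rule unit_isoD(8)[OF i', OF Hm, symmetric])
      also have "\<dots> = (\<integral>\<^sup>+t. ?H t \<partial>mu)"
        by (rule nn_integral_cong) (simp add: unit_isoD(5)[OF i'])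
      also have "\<dots> = (\<integral>\<^sup>+x. ennreal (indicator (lset l k) x / q) * indicator S x \<partial>mu)"
        unfolding q_def by (rule unit_isoD(8)[OF i im])
      also have "ennreal q * \<dots> = (\<integral>\<^sup>+x. ennreal q * (ennreal (indicator (lset l k) x / q) * indicator S x) \<partial>mu)"
        by (rule nn_integral_cmult[symmetric]) measurable
      also have "\<dots> = (\<integral>\<^sup>+x. indicator S x * indicator {k} (l x) \<partial>mu)"
      proof (rule nn_integral_cong)
        fix x assume "x \<in> space mu"
        then show "ennreal q * (ennreal (indicator (lset l k) x / q) * indicator S x) = indicator S x * indicator {k} (l x)"
          using q by (cases "l x = k") (auto simp: lset_def ennreal_mult'[symmetric] mult.assoc[symmetric])
      qed
      finally show ?thesis .
    qed
    then show "(\<integral>\<^sup>+x. ennreal (?w x) * indicator S (tr l' l x) \<partial>mu) = (\<integral>\<^sup>+x. indicator S x \<partial>mu)"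
      unfolding nn_integral_labels[OF l' Km] nn_integral_labels[OF l im] by simp
  qed simp
  then show ?thesis using that h1 by blast
qed

text \<open>Both maps carry \<open>A\<close> to \<open>B\<close>, hence also the complements to each
  other, up to null sets; so the pieces fit together and the change of variables is the sum over the
  two parts.\<close>

lemma nst_glue:
  assumes a: "nst f1 g1 w1" and b: "nst f2 g2 w2" and A [measurable]: "A \<in> sets mu" and B [measurable]: "B \<in> sets mu"
    and fa: "AE x in mu. x \<in> A \<longleftrightarrow> f1 x \<in> B" and fb: "AE x in mu. x \<in> A \<longleftrightarrow> f2 x \<in> B"
  shows "nst (\<lambda>x. if x \<in> A then f1 x else f2 x) (\<lambda>y. if y \<in> B then g1 y else g2 y) (\<lambda>y. if y \<in> B then w1 y else w2 y)"
proof -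
  note na = nst_nsp[OF a] and nb = nst_nsp[OF b]
  have [measurable]: "f1 \<in> mu \<rightarrow>\<^sub>M mu" "g1 \<in> mu \<rightarrow>\<^sub>M mu" "f2 \<in> mu \<rightarrow>\<^sub>M mu" "g2 \<in> mu \<rightarrow>\<^sub>M mu"
    "w1 \<in> borel_measurable mu" "w2 \<in> borel_measurable mu"
    using nsp_measurable[OF na] nsp_measurable[OF nb] nst_borel a b by auto
  have pA: "Measurable.pred mu (\<lambda>x. x \<in> A)" "Measurable.pred mu (\<lambda>x. x \<in> B)" by measurable
  have ga: "AE y in mu. g1 y \<in> A \<longleftrightarrow> y \<in> B"
    using nsp_AE(2)[OF na fa] nsp_fg[OF na] by eventually_elim simp
  have gb: "AE y in mu. g2 y \<in> A \<longleftrightarrow> y \<in> B"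
    using nsp_AE(2)[OF nb fb] nsp_fg[OF nb] by eventually_elim simp
  let ?f = "\<lambda>x. if x \<in> A then f1 x else f2 x" and ?g = "\<lambda>y. if y \<in> B then g1 y else g2 y"
  have n: "nsp ?f ?g"
  proof (rule nspI)
    show "?f \<in> mu \<rightarrow>\<^sub>M mu" "?g \<in> mu \<rightarrow>\<^sub>M mu" by measurable
    show "AE x in mu. ?f x \<notin> N" if "N \<in> null_sets mu" for N
      using nsp_null[OF na that] nsp_null[OF nb that] by eventually_elim simp
    show "AE x in mu. ?g x \<notin> N" if "N \<in> null_sets mu" for N
      using nsp_null[OF nsp_sym[OF na] that] nsp_null[OF nsp_sym[OF nb] that] by eventually_elim simp
    show "AE x in mu. ?g (?f x) = x"
      using fa fb nsp_gf[OF na] nsp_gf[OF nb] by eventually_elim auto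
    show "AE x in mu. ?f (?g x) = x"
      using ga gb nsp_fg[OF na] nsp_fg[OF nb] by eventually_elim auto
  qed
  let ?w = "\<lambda>y. if y \<in> B then w1 y else w2 y"
  have "(\<integral>\<^sup>+y. ennreal (?w y) * K (?g y) \<partial>mu) = (\<integral>\<^sup>+x. K x \<partial>mu)" if [measurable]: "K \<in> borel_measurable mu" for K
  proof -
    let ?K1 = "\<lambda>x. indicator A x * K x" and ?K2 = "\<lambda>x. indicator (space mu - A) x * K x"
    have "(\<integral>\<^sup>+y. ennreal (?w y) * K (?g y) \<partial>mu) = (\<integral>\<^sup>+y. ennreal (w1 y) * ?K1 (g1 y) + ennreal (w2 y) * ?K2 (g2 y) \<partial>mu)"
    proof (rule nn_integral_cong_AE)
      show "AE y in mu. ennreal (?w y) * K (?g y) = ennreal (w1 y) * ?K1 (g1 y) + ennreal (w2 y) * ?K2 (g2 y)"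
        using ga gb AE_space
      proof eventually_elim
        case (elim y)
        have "g2 y \<in> space mu" using nsp_space(2)[OF nb, of y] elim(3) by simp
        then show ?case using elim(1,2) by (auto simp: indicator_def)
      qed
    qed
    also have "\<dots> = (\<integral>\<^sup>+y. ennreal (w1 y) * ?K1 (g1 y) \<partial>mu) + (\<integral>\<^sup>+y. ennreal (w2 y) * ?K2 (g2 y) \<partial>mu)"
      by (rule nn_integral_add) measurable
    also have "(\<integral>\<^sup>+y. ennreal (w1 y) * ?K1 (g1 y) \<partial>mu) = (\<integral>\<^sup>+x. ?K1 x \<partial>mu)" by (rule nst_nn_integral[OF a]) measurable
    also have "(\<integral>\<^sup>+y. ennreal (w2 y) * ?K2 (g2 y) \<partial>mu) = (\<integral>\<^sup>+x. ?K2 x \<partial>mu)" by (rule nst_nn_integral[OF b]) measurable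
    also have "(\<integral>\<^sup>+x. ?K1 x \<partial>mu) + (\<integral>\<^sup>+x. ?K2 x \<partial>mu) = (\<integral>\<^sup>+x. ?K1 x + ?K2 x \<partial>mu)"
      by (rule nn_integral_add[symmetric]) measurable
    also have "\<dots> = (\<integral>\<^sup>+x. K x \<partial>mu)" by (rule nn_integral_cong) (auto simp: indicator_def)
    finally show ?thesis .
  qed
  moreover have "?w \<in> borel_measurable mu" by measurable
  ultimately show ?thesis using n nst_nonneg[OF a] nst_nonneg[OF b] by (simp add: nst_def)
qed

section \<open>Transitive isometric actions\<close>

definition supp :: "(real \<Rightarrow> real) \<Rightarrow> real set \<Rightarrow> bool" where
  "supp f E \<longleftrightarrow> (AE x in mu. x \<notin> E \<longrightarrow> f x = x)"

lemma supp_inverse: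
  assumes "nsp f g" "supp f E" shows "supp g E"
  using assms(2) nsp_gf[OF assms(1)] unfolding supp_def by eventually_elim metis

lemma supp_mono: "supp f E \<Longrightarrow> E \<subseteq> E' \<Longrightarrow> supp f E'"
  unfolding supp_def by (erule eventually_mono) auto

text \<open>A point outside \<open>E\<close> stays put. If the image lies outside \<open>E\<close>,
  the inverse, which has the same support, fixes it, so the point equals its image.\<close>

lemma supp_invariant:
  assumes n: "nsp f g" and s: "supp f E"
  shows "AE x in mu. f x \<in> E \<longleftrightarrow> x \<in> E"
  using s[unfolded supp_def] nsp_AE(1)[OF n supp_inverse[OF n s, unfolded supp_def]] nsp_gf[OF n]
  by eventually_elim metis

lemma nsp_vimage_sets: "nsp f g \<Longrightarrow> A \<in> sets mu \<Longrightarrow> f -` A \<inter> space mu \<in> sets mu"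
  by (rule measurable_sets[OF nsp_measurable(1)])

lemma measure_mu_mono_AE:
  assumes "AE x in mu. x \<in> A \<longrightarrow> x \<in> B" "B \<in> sets mu"
  shows "measure mu A \<le> measure mu B"
  by (rule mu.finite_measure_mono_AE[OF assms])

lemma measure_mu_pos_iff:
  assumes "A \<in> sets mu"
  shows "0 < measure mu A \<longleftrightarrow> \<not> (AE x in mu. x \<notin> A)"
proof -
  have "A \<subseteq> space mu" using sets.sets_into_space[OF assms] .
  then have "A \<in> null_sets mu \<longleftrightarrow> (AE x in mu. x \<notin> A)" by (simp add: mu.null_sets_iff_AE)
  moreover have "A \<in> null_sets mu \<longleftrightarrow> measure mu A = 0"
    using assms by (simp add: null_sets_def mu.emeasure_eq_measure)
  ultimately show ?thesis using measure_nonneg[of mu A] by (simp add: less_le)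
qed

lemma nsp_vimage_pos:
  assumes n: "nsp f g" and A: "A \<in> sets mu" "0 < measure mu A"
  shows "0 < measure mu (f -` A \<inter> space mu)"
proof (rule ccontr)
  assume "\<not> ?thesis"
  then have "AE x in mu. x \<notin> f -` A \<inter> space mu" using measure_mu_pos_iff[OF nsp_vimage_sets[OF n A(1)]] by blast
  then have "AE x in mu. f x \<notin> A" using AE_space by eventually_elim simp
  then have "AE x in mu. x \<notin> A" using nsp_AE_iff[OF n, of "\<lambda>x. x \<notin> A"] by simp
  then show False using A measure_mu_pos_iff by blast
qed

text \<open>Otherwise there are sets of measure below \<open>(1/2) ^ n\<close> whose preimages all
  have measure at least \<open>e\<close>. By Borel-Cantelli almost every point lies in finitely many
  of them; pulled back along \<open>f\<close>, the indicators of the preimages tend to 0, against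
  dominated convergence.\<close>

lemma nsp_absolutely_continuous:
  assumes n: "nsp f g" and e: "0 < e"
  obtains \<delta> where "0 < \<delta>" "\<And>A. A \<in> sets mu \<Longrightarrow> measure mu A < \<delta> \<Longrightarrow> measure mu (f -` A \<inter> space mu) < e"
proof -
  have "\<exists>\<delta>>0. \<forall>A\<in>sets mu. measure mu A < \<delta> \<longrightarrow> measure mu (f -` A \<inter> space mu) < e"
  proof (rule ccontr)
    assume "\<not> ?thesis"
    then have neg: "\<forall>\<delta>>0. \<exists>A\<in>sets mu. measure mu A < \<delta> \<and> e \<le> measure mu (f -` A \<inter> space mu)"
      unfolding not_less[symmetric] by blast
    have "\<forall>n. \<exists>A\<in>sets mu. measure mu A < (1/2) ^ n \<and> e \<le> measure mu (f -` A \<inter> space mu)"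
      using neg by simp
    then obtain A where A: "\<And>n::nat. A n \<in> sets mu" "\<And>n. measure mu (A n) < (1/2) ^ n"
      "\<And>n. e \<le> measure mu (f -` A n \<inter> space mu)" by metis
    have "AE x in mu. eventually (\<lambda>n. x \<in> space mu - A n) sequentially"
    proof (rule borel_cantelli_AE1)
      show "summable (\<lambda>n. measure mu (A n))"
        by (rule summable_comparison_test'[of "\<lambda>n. (1/2) ^ n"]) (use A(2) in \<open>auto intro: less_imp_le\<close>)
    qed (use A(1) in \<open>auto simp: mu.emeasure_eq_measure\<close>)
    from nsp_AE(1)[OF n this]
    have ae: "AE x in mu. (\<lambda>n. indicator (f -` A n \<inter> space mu) x :: real) \<longlonglongrightarrow> 0"
      by eventually_elim (rule tendsto_eventually, erule eventually_mono, simp add: indicator_def)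
    have "(\<lambda>n. \<integral>x. indicator (f -` A n \<inter> space mu) x \<partial>mu) \<longlonglongrightarrow> (\<integral>x. 0 \<partial>mu :: real)"
    proof (rule integral_dominated_convergence[where w="\<lambda>x. 1"])
      show "(\<lambda>x. indicator (f -` A n \<inter> space mu) x :: real) \<in> borel_measurable mu" for n
        by (rule borel_measurable_indicator[OF nsp_vimage_sets[OF \<open>nsp f g\<close> A(1)]])
      show "AE x in mu. norm (indicator (f -` A n \<inter> space mu) x :: real) \<le> 1" for n by (simp add: indicator_def)
    qed (use ae in simp_all)
    then have "(\<lambda>n. measure mu (f -` A n \<inter> space mu)) \<longlonglongrightarrow> 0"
      using nsp_vimage_sets[OF n A(1)] by simp
    then have "e \<le> 0" by (rule LIMSEQ_le_const) (use A(3) in auto)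
    then show False using e by simp
  qed
  then show ?thesis using that by blast
qed

lemma small_subset:
  assumes A: "A \<in> sets mu" "0 < measure mu A" and e: "0 < e"
  obtains B where "B \<in> sets mu" "B \<subseteq> A" "0 < measure mu B" "measure mu B < e" "0 < measure mu (A - B)"
proof -
  obtain F G where iso: "unit_iso A F G" using quantile_iso[OF A] by blast
  note D = unit_isoD[OF iso]
  define m where "m = measure mu A"
  have m: "0 < m" using A by (simp add: m_def)
  \<comment> \<open>Cutting \<open>A\<close> at the quantile \<open>c\<close> gives measure
    \<open>c * m\<close>: the second bound makes this less than \<open>e\<close>, the bound
    \<open>1/2\<close> leaves a remainder of positive measure.\<close>
  define c where "c = min (1/2) (e / (2 * m))"
  have c: "0 < c" "c \<le> 1/2" "c * m < e"
  proof -
    show "0 < c" "c \<le> 1/2" using m e by (auto simp: c_def)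
    have "c * m \<le> e / (2 * m) * m" using m by (intro mult_right_mono) (auto simp: c_def)
    also have "\<dots> = e / 2" using m by simp
    finally show "c * m < e" using e by simp
  qed
  define B where "B = A \<inter> {x \<in> space mu. F x \<le> c}"
  have S: "{x \<in> space mu. F x \<le> c} \<in> sets mu" using D(1) by measurable
  have B: "B \<in> sets mu" unfolding B_def using A(1) S by blast
  let ?K = "\<lambda>x. indicator {..c} (F x) :: ennreal"
  have Km: "?K \<in> borel_measurable mu" using D(1) by measurable
  have "(\<integral>\<^sup>+x. ennreal (indicator A x / measure mu A) * ?K x \<partial>mu) = (\<integral>\<^sup>+t. ?K (G t) \<partial>mu)" by (rule D(8)[OF Km, symmetric])
  also have "\<dots> = (\<integral>\<^sup>+t. indicator {0..c} t \<partial>mu)"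
    by (rule nn_integral_cong) (auto simp: D(5) indicator_def)
  also have "\<dots> = ennreal c" using c measure_mu_atMost[of c] atLeastAtMost_sets_mu[of 0 c] by (simp add: mu.emeasure_eq_measure)
  finally have 1: "(\<integral>\<^sup>+x. ennreal (indicator A x / measure mu A) * ?K x \<partial>mu) = ennreal c" .
  have "(\<integral>\<^sup>+x. ennreal (indicator A x / measure mu A) * ?K x \<partial>mu) = (\<integral>\<^sup>+x. ennreal (1 / m) * indicator B x \<partial>mu)"
    by (rule nn_integral_cong) (auto simp: B_def indicator_def m_def)
  also have "\<dots> = ennreal (1 / m) * emeasure mu B" by (rule nn_integral_cmult_indicator[OF B])
  also have "\<dots> = ennreal (measure mu B / m)" using m by (simp add: mu.emeasure_eq_measure ennreal_mult'[symmetric])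
  finally have "ennreal (measure mu B / m) = ennreal c" using 1 by simp
  then have "measure mu B / m = c" using c m by (subst (asm) ennreal_inj) auto
  then have mB: "measure mu B = c * m" using m by (simp add: field_simps)
  have BA: "B \<subseteq> A" by (auto simp: B_def)
  have "measure mu (A - B) = m - c * m" using mu.finite_measure_Diff[OF A(1) B BA] mB by (simp add: m_def)
  also have "\<dots> = (1 - c) * m" by (simp add: algebra_simps)
  finally have "0 < measure mu (A - B)" using c m by simp
  then show ?thesis using that[OF B BA] mB c m by simp
qed

lemma label_measurable:
  assumes [measurable]: "A \<in> sets mu" "C \<in> sets mu"
  shows "(\<lambda>x. if x \<in> A then 0 else if x \<in> C then 1 else 2 :: nat) \<in> mu \<rightarrow>\<^sub>M count_space UNIV"
  by measurable

text \<open>The basic supply of group elements. Relabel \<open>A\<close>, \<open>C - A\<close> and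
  the complement of \<open>C\<close> as \<open>B\<close>, \<open>C - B\<close> and the complement,
  then replace the map by the identity off \<open>C\<close>. Positivity of all four pieces
  guarantees that null pieces match.\<close>

lemma move_within:
  assumes C: "C \<in> sets mu" and A: "A \<in> sets mu" "A \<subseteq> C" "0 < measure mu A" "0 < measure mu (C - A)"
    and B: "B \<in> sets mu" "B \<subseteq> C" "0 < measure mu B" "0 < measure mu (C - B)"
  obtains f g where "nsp f g" "supp f C" "AE x in mu. f x \<in> B \<longleftrightarrow> x \<in> A"
proof -
  define l where "l A x = (if x \<in> A then 0 else if x \<in> C then 1 else 2 :: nat)" for A x
  have lm: "l A \<in> mu \<rightarrow>\<^sub>M count_space UNIV" if "A \<in> sets mu" for A
    unfolding l_def[abs_def] by (rule label_measurable[OF that C])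
  have ls: "lset (l A) n = (if n = 0 then A else if n = 1 then C - A else if n = 2 then space mu - C else {})"
    if "A \<in> sets mu" "A \<subseteq> C" for A n
    using that sets.sets_into_space[OF C] by (auto simp: lset_def l_def)
  have nu: "measure mu (lset (l A) n) = 0 \<longleftrightarrow> measure mu (lset (l B) n) = 0" for n
    unfolding ls[OF A(1,2)] ls[OF B(1,2)] using A B by simp
  obtain f g where fg: "nst f g (\<lambda>y. measure mu (lset (l A) (l B y)) / measure mu (lset (l B) (l B y)))"
    "AE x in mu. l B (f x) = l A x"
    by (rule relabelling_iso[OF lm[OF A(1)] lm[OF B(1)] nu])
  have fC: "AE x in mu. x \<in> C \<longleftrightarrow> f x \<in> C"
    using fg(2)
  proof eventually_elim
    case (elim x)
    then show ?case using A(2) B(2) by (auto simp: l_def split: if_splits)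
  qed
  have fB: "AE x in mu. f x \<in> B \<longleftrightarrow> x \<in> A"
    using fg(2) by eventually_elim (auto simp: l_def split: if_splits)
  have ng: "nst (\<lambda>x. if x \<in> C then f x else x) (\<lambda>y. if y \<in> C then g y else y)
     (\<lambda>y. if y \<in> C then measure mu (lset (l A) (l B y)) / measure mu (lset (l B) (l B y)) else 1)"
    by (rule nst_glue[OF fg(1) nst_id C C fC]) simp
  show ?thesis
  proof (rule that[OF nst_nsp[OF ng]])
    show "supp (\<lambda>x. if x \<in> C then f x else x) C" by (simp add: supp_def)
    show "AE x in mu. (if x \<in> C then f x else x) \<in> B \<longleftrightarrow> x \<in> A"
      using fB by eventually_elim (use A(2) B(2) in auto)
  qed
qed

text \<open>Indexing by maps instead of classes allows elements to be built piecewise, and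
  \<open>a_cong\<close> makes the choice irrelevant. The threshold in \<open>a_small\<close> depends
  on the point; the constructions below displace one point and use its thresholds only.\<close>

locale transitive_isometric_action =
  fixes X :: "'x set" and d :: "'x \<Rightarrow> 'x \<Rightarrow> real" and a :: "(real \<Rightarrow> real) \<Rightarrow> 'x \<Rightarrow> 'x"
  assumes metric: "Metric_space X d" and complete: "Metric_space.mcomplete X d"
    and a_closed: "nsp f g \<Longrightarrow> x \<in> X \<Longrightarrow> a f x \<in> X"
    and a_id: "x \<in> X \<Longrightarrow> a (\<lambda>u. u) x = x"
    and a_comp: "nsp f g \<Longrightarrow> nsp f' g' \<Longrightarrow> x \<in> X \<Longrightarrow> a (f \<circ> f') x = a f (a f' x)"
    and a_cong: "nsp f g \<Longrightarrow> nsp f' g' \<Longrightarrow> AE u in mu. f u = f' u \<Longrightarrow> a f = a f'"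
    and a_dist: "nsp f g \<Longrightarrow> x \<in> X \<Longrightarrow> y \<in> X \<Longrightarrow> d (a f x) (a f y) = d x y"
    and a_small: "x \<in> X \<Longrightarrow> 0 < e \<Longrightarrow> \<exists>\<eta>>0. \<forall>f g A. nsp f g \<longrightarrow> A \<in> sets mu \<longrightarrow>
          measure mu A < \<eta> \<longrightarrow> supp f A \<longrightarrow> d x (a f x) < e"
    and a_trans: "x \<in> X \<Longrightarrow> y \<in> X \<Longrightarrow> \<exists>f g. nsp f g \<and> a f x = y"
begin

sublocale Metric_space X d by (rule metric)

lemma small:
  assumes "x \<in> X" "0 < e"
  obtains \<eta> where "0 < \<eta>" "\<eta> \<le> 1"
    "\<forall>f g A. nsp f g \<longrightarrow> A \<in> sets mu \<longrightarrow> measure mu A < \<eta> \<longrightarrow> supp f A \<longrightarrow> d x (a f x) < e"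
proof -
  obtain \<eta> where \<eta>: "0 < \<eta>" "\<forall>f g A. nsp f g \<longrightarrow> A \<in> sets mu \<longrightarrow> measure mu A < \<eta> \<longrightarrow> supp f A \<longrightarrow> d x (a f x) < e"
    using a_small[OF assms] by (elim exE conjE)
  show ?thesis by (rule that[of "min \<eta> 1"]) (use \<eta> in auto)
qed

lemma a_inv:
  assumes n: "nsp f g" and x: "x \<in> X" shows "a g (a f x) = x"
proof -
  have "a g (a f x) = a (g \<circ> f) x" using a_comp[OF nsp_sym[OF n] n x] by simp
  also have "a (g \<circ> f) = a (\<lambda>u. u)"
    by (rule a_cong[OF nsp_comp[OF nsp_sym[OF n] n] nsp_id]) (use nsp_gf[OF n] in simp)
  finally show ?thesis using a_id[OF x] by simp
qed

text \<open>The bound is not strict so that it survives limits; with bound 0 it says that the point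
  is fixed by every element supported on \<open>E\<close>.\<close>

definition osc :: "'x \<Rightarrow> real set \<Rightarrow> real \<Rightarrow> bool" where
  "osc x E e \<longleftrightarrow> (\<forall>f g. nsp f g \<longrightarrow> supp f E \<longrightarrow> d x (a f x) \<le> e)"

lemma oscD: "osc x E e \<Longrightarrow> nsp f g \<Longrightarrow> supp f E \<Longrightarrow> d x (a f x) \<le> e"
  by (auto simp: osc_def)

text \<open>Conjugation by \<open>t\<close> turns an element supported on \<open>E'\<close> into one
  supported on the preimage of \<open>E'\<close>, hence on \<open>E\<close>, and the displacement is
  unchanged because \<open>t\<close> acts isometrically.\<close>

lemma osc_move:
  assumes t: "nsp t t'" and x: "x \<in> X" and E: "AE s in mu. t s \<in> E' \<longrightarrow> s \<in> E" and o: "osc x E e"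
  shows "osc (a t x) E' e"
  unfolding osc_def
proof (intro allI impI)
  fix f g assume f: "nsp f g" "supp f E'"
  have n1: "nsp (f \<circ> t) (t' \<circ> g)" by (rule nsp_comp[OF f(1) t])
  have n: "nsp (t' \<circ> (f \<circ> t)) ((t' \<circ> g) \<circ> t)" by (rule nsp_comp[OF nsp_sym[OF t] n1])
  have "supp (t' \<circ> (f \<circ> t)) E"
    unfolding supp_def using E nsp_AE(1)[OF t f(2)[unfolded supp_def]] nsp_gf[OF t]
  proof eventually_elim
    case (elim s)
    then show ?case by auto
  qed
  from oscD[OF o n this] have le: "d x (a (t' \<circ> (f \<circ> t)) x) \<le> e" .
  have X: "a t x \<in> X" "a f (a t x) \<in> X" using a_closed f t x by auto
  have "a (t' \<circ> (f \<circ> t)) x = a t' (a f (a t x))"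
    using a_comp[OF nsp_sym[OF t] n1 x] a_comp[OF f(1) t x] by simp
  moreover have "d (a t' (a t x)) (a t' (a f (a t x))) = d (a t x) (a f (a t x))"
    by (rule a_dist[OF nsp_sym[OF t] X])
  ultimately show "d (a t x) (a f (a t x)) \<le> e" using le a_inv[OF t x] by simp
qed

lemma osc_perturb:
  assumes "x \<in> X" "y \<in> X" "osc x E e" shows "osc y E (2 * d x y + e)"
  unfolding osc_def
proof (intro allI impI)
  fix f g assume f: "nsp f g" "supp f E"
  have X: "a f x \<in> X" "a f y \<in> X" using a_closed[OF f(1)] assms by auto
  have "d y (a f y) \<le> d y x + d x (a f y)" by (rule triangle[OF assms(2,1) X(2)])
  also have "d x (a f y) \<le> d x (a f x) + d (a f x) (a f y)" by (rule triangle[OF assms(1) X])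
  also have "d (a f x) (a f y) = d x y" by (rule a_dist[OF f(1) assms(1,2)])
  also have "d x (a f x) \<le> e" by (rule oscD[OF assms(3) f])
  finally show "d y (a f y) \<le> 2 * d x y + e" using commute[of y x] by simp
qed

lemma osc_limit:
  assumes "\<And>n. osc x E (b n)" "b \<longlonglongrightarrow> 0" shows "osc x E 0"
  unfolding osc_def
proof (intro allI impI)
  fix f g assume f: "nsp f g" "supp f E"
  show "d x (a f x) \<le> 0" by (rule LIMSEQ_le_const[OF assms(2)]) (use oscD[OF assms(1) f] in auto)
qed

section \<open>Limits along an orbit and local fixing\<close>

lemma geometric_limit:
  assumes X: "\<And>n. x n \<in> X" and s: "\<And>n. d (x n) (x (Suc n)) < (1/2) ^ n"
  obtains y where "y \<in> X" "(\<lambda>n. d (x n) y) \<longlonglongrightarrow> 0"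
proof -
  have bd: "d (x n) (x (n + k)) \<le> 2 * (1/2) ^ n * (1 - (1/2) ^ k)" for n k
  proof (induction k)
    case (Suc k)
    have "d (x n) (x (n + Suc k)) \<le> d (x n) (x (n + k)) + d (x (n + k)) (x (Suc (n + k)))"
      using triangle[OF X X X] by simp
    also have "\<dots> \<le> 2 * (1/2) ^ n * (1 - (1/2) ^ k) + (1/2) ^ (n + k)"
      using Suc s[of "n + k"] by simp
    also have "\<dots> = 2 * (1/2) ^ n * (1 - (1/2) ^ Suc k)" by (simp add: power_add algebra_simps)
    finally show ?case .
  qed (use X in simp)
  have bd2: "d (x n) (x m) \<le> 2 * (1/2) ^ N" if N: "N \<le> n" and nm: "n \<le> m" for n m N
  proof -
    obtain k where k: "m = n + k" using nm le_Suc_ex by blast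
    have "d (x n) (x m) \<le> 2 * (1/2) ^ n * (1 - (1/2) ^ k)" using bd[of n k] k by simp
    also have "\<dots> \<le> 2 * (1/2) ^ n * 1" by (intro mult_left_mono) auto
    also have "\<dots> \<le> 2 * (1/2) ^ N" using N by (simp add: power_decreasing)
    finally show ?thesis .
  qed
  have "MCauchy x"
    unfolding MCauchy_def
  proof (intro conjI allI impI)
    show "range x \<subseteq> X" using X by auto
    fix e :: real assume e: "0 < e"
    obtain N where N: "(1/2) ^ N < e / 2" using real_arch_pow_inv[of "e / 2" "1/2"] e by auto
    show "\<exists>N. \<forall>n n'. N \<le> n \<longrightarrow> N \<le> n' \<longrightarrow> d (x n) (x n') < e"
    proof (intro exI[of _ N] allI impI)
      fix n n' assume nn: "N \<le> n" "N \<le> n'"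
      have "d (x n) (x n') \<le> 2 * (1/2) ^ N"
        using bd2[of N n n'] bd2[of N n' n] nn commute[of "x n" "x n'"] by (cases "n \<le> n'") auto
      then show "d (x n) (x n') < e" using N by simp
    qed
  qed
  then obtain y where "limitin mtopology x y sequentially" using complete unfolding mcomplete_def by blast
  then show ?thesis using that by (auto simp: limitin_metric_dist_null)
qed

text \<open>New factors enter on the right, so the isometry \<open>t n\<close> cancels from the
  step, whose length is the displacement of \<open>x\<close> by \<open>r n\<close> alone, however
  wild \<open>t n\<close> has become.\<close>

lemma orbit_limit:
  assumes x: "x \<in> X" and t: "\<And>n. nsp (t n) (t' n)" and r: "\<And>n. nsp (r n) (r' n)"
    and tr: "\<And>n. t (Suc n) = t n \<circ> r n" and dr: "\<And>n. d x (a (r n) x) < (1/2) ^ n"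
  obtains y where "y \<in> X" "(\<lambda>n. d (a (t n) x) y) \<longlonglongrightarrow> 0"
proof (rule geometric_limit[of "\<lambda>n. a (t n) x"])
  show "a (t n) x \<in> X" for n by (rule a_closed[OF t x])
  show "d (a (t n) x) (a (t (Suc n)) x) < (1/2) ^ n" for n
    unfolding tr a_comp[OF t r x] using a_dist[OF t x a_closed[OF r x]] dr by simp
qed (rule that)

text \<open>Elements supported on the interval up to \<open>c n\<close> move \<open>x\<close> by
  less than \<open>(1/2) ^ n\<close>. The map \<open>t n\<close> stretches the interval up to
  \<open>c (Suc n)\<close> over the fixed interval up to \<open>c 1\<close>; so elements supported
  on the fixed interval move \<open>a (t n) x\<close> at most that little, and in the limit not at
  all.\<close>

lemma exists_locally_fixed:
  assumes x: "x \<in> X"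
  shows "\<exists>y\<in>X. \<exists>E\<in>sets mu. 0 < measure mu E \<and> osc y E 0"
proof -
  have "\<forall>n::nat. \<exists>\<eta>>0. \<forall>f g A. nsp f g \<longrightarrow> A \<in> sets mu \<longrightarrow> measure mu A < \<eta> \<longrightarrow> supp f A \<longrightarrow> d x (a f x) < (1/2) ^ n"
    by (intro allI a_small[OF x]) simp
  then obtain \<eta> where \<eta>: "\<And>n::nat. 0 < \<eta> n"
    "\<And>n f g A. nsp f g \<Longrightarrow> A \<in> sets mu \<Longrightarrow> measure mu A < \<eta> n \<Longrightarrow> supp f A \<Longrightarrow> d x (a f x) < (1/2) ^ n"
    by metis
  \<comment> \<open>Halving the minimum makes the sequence positive, strictly decreasing and below
    the thresholds \<open>\<eta> n\<close>.\<close>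
  define c where "c = rec_nat (min 1 (\<eta> 0) / 2) (\<lambda>n y. min y (\<eta> (Suc n)) / 2)"
  have c0: "c 0 = min 1 (\<eta> 0) / 2" and cS: "c (Suc n) = min (c n) (\<eta> (Suc n)) / 2" for n by (auto simp: c_def)
  have cpos: "0 < c n" for n by (induction n) (auto simp: c0 cS \<eta>)
  have cdec: "c (Suc n) < c n" for n using cpos[of n] by (simp add: cS)
  have c1: "c n \<le> 1" for n
  proof (induction n)
    case (Suc n)
    then show ?case using cdec[of n] by simp
  qed (simp add: c0)
  have cle: "c n < \<eta> n" for n
  proof (cases n)
    case 0
    show ?thesis using \<eta>(1)[of 0] by (simp add: c0 0)
  next
    case (Suc k)
    show ?thesis using \<eta>(1)[of "Suc k"] unfolding Suc cS by linarith
  qed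
  have I: "{0..c n} \<in> sets mu" "measure mu {0..c n} = c n" for n
    using measure_mu_atMost[of "c n"] atLeastAtMost_sets_mu[of 0 "c n"] cpos[of n] c1[of n] by auto
  have Isub: "{0..c (Suc n)} \<subseteq> {0..c n}" for n using cdec[of n] by auto
  have Idiff: "0 < measure mu ({0..c n} - {0..c m})" if "c m < c n" for n m
  proof -
    have "{0..c m} \<subseteq> {0..c n}" using that by auto
    then have "measure mu ({0..c n} - {0..c m}) = c n - c m" using mu.finite_measure_Diff[OF I(1)[of n] I(1)[of m]] I(2) by simp
    then show ?thesis using that by simp
  qed
  have "\<forall>n. \<exists>f g. nsp f g \<and> supp f {0..c n} \<and> (AE u in mu. f u \<in> {0..c (Suc (Suc n))} \<longleftrightarrow> u \<in> {0..c (Suc n)})"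
  proof
    fix n
    obtain f g where "nsp f g" "supp f {0..c n}" "AE u in mu. f u \<in> {0..c (Suc (Suc n))} \<longleftrightarrow> u \<in> {0..c (Suc n)}"
    proof (rule move_within[OF I(1)[of n] I(1)[of "Suc n"] Isub _ _ I(1)[of "Suc (Suc n)"]])
      show "{0..c (Suc (Suc n))} \<subseteq> {0..c n}" using Isub[of n] Isub[of "Suc n"] by blast
      show "0 < measure mu ({0..c n} - {0..c (Suc (Suc n))})" using cdec[of n] cdec[of "Suc n"] by (intro Idiff) simp
    qed (use Idiff cdec I(2) cpos in auto)
    then show "\<exists>f g. nsp f g \<and> supp f {0..c n} \<and> (AE u in mu. f u \<in> {0..c (Suc (Suc n))} \<longleftrightarrow> u \<in> {0..c (Suc n)})" by blast
  qed
  then obtain s s' where s: "\<And>n. nsp (s n) (s' n)" "\<And>n. supp (s n) {0..c n}"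
    "\<And>n. AE u in mu. s n u \<in> {0..c (Suc (Suc n))} \<longleftrightarrow> u \<in> {0..c (Suc n)}" by metis
  \<comment> \<open>\<open>s n\<close> compresses the interval up to \<open>c (Suc n)\<close> to the
    next one; the inverses are composed, so \<open>t n\<close> expands, while each factor has
    support small enough for \<open>orbit_limit\<close>.\<close>
  define t where "t = rec_nat (\<lambda>u. u) (\<lambda>n f. f \<circ> s' n)"
  define t' where "t' = rec_nat (\<lambda>u. u) (\<lambda>n f. s n \<circ> f)"
  have t0: "t 0 = (\<lambda>u. u)" "t' 0 = (\<lambda>u. u)" and tS: "t (Suc n) = t n \<circ> s' n" "t' (Suc n) = s n \<circ> t' n" for n
    by (auto simp: t_def t'_def)
  have t: "nsp (t n) (t' n)" for n
  proof (induction n)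
    case (Suc n)
    show ?case unfolding tS by (rule nsp_comp[OF Suc nsp_sym[OF s(1)]])
  qed (simp add: t0 nsp_id)
  have mv: "AE u in mu. t n u \<in> {0..c 1} \<longrightarrow> u \<in> {0..c (Suc n)}" for n
  proof (induction n)
    case (Suc n)
    have "AE u in mu. s n (s' n u) \<in> {0..c (Suc (Suc n))} \<longleftrightarrow> s' n u \<in> {0..c (Suc n)}" by (rule nsp_AE(2)[OF s(1)[of n] s(3)])
    with nsp_AE(2)[OF s(1)[of n] Suc] nsp_fg[OF s(1)[of n]]
    show ?case
    proof eventually_elim
      case (elim u)
      then show ?case unfolding tS by (simp del: atLeastAtMost_iff)
    qed
  qed (simp add: t0)
  have osc: "osc x {0..c (Suc n)} ((1/2) ^ n)" for n
    unfolding osc_def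
  proof (intro allI impI)
    fix f g assume f: "nsp f g" "supp f {0..c (Suc n)}"
    have "measure mu {0..c (Suc n)} < \<eta> n" using I(2)[of "Suc n"] cdec[of n] cle[of n] by simp
    then show "d x (a f x) \<le> (1/2) ^ n" using \<eta>(2)[OF f(1) I(1) _ f(2), of n] by simp
  qed
  obtain y where y: "y \<in> X" "(\<lambda>n. d (a (t n) x) y) \<longlonglongrightarrow> 0"
  proof (rule orbit_limit[of x t t' s' s, OF x t nsp_sym[OF s(1)] tS(1)])
    show "d x (a (s' n) x) < (1/2) ^ n" for n
      using \<eta>(2)[OF nsp_sym[OF s(1)] I(1) _ supp_inverse[OF s(1) s(2)], of n n] I(2)[of n] cle[of n] by simp
  qed
  have "osc y {0..c 1} (2 * d (a (t n) x) y + (1/2) ^ n)" for n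
    by (rule osc_perturb[OF a_closed[OF t x] y(1) osc_move[OF t x mv osc]])
  moreover have "(\<lambda>n. 2 * d (a (t n) x) y + (1/2) ^ n) \<longlonglongrightarrow> 0"
    using tendsto_add[OF tendsto_mult_right_zero[OF y(2), of 2] LIMSEQ_power_zero[of "1/2::real"]] by simp
  ultimately have "osc y {0..c 1} 0" by (rule osc_limit)
  then show ?thesis using y(1) I[of 1] cpos[of 1] by (intro bexI[of _ y] bexI[of _ "{0..c 1}"]) auto
qed

text \<open>Transitivity carries the locally fixed limit point to the given point, and the set is
  transported along.\<close>

lemma locally_fixed:
  assumes x: "x \<in> X"
  obtains E where "E \<in> sets mu" "0 < measure mu E" "osc x E 0"
proof -
  obtain y E where y: "y \<in> X" "E \<in> sets mu" "0 < measure mu E" "osc y E 0"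
    using exists_locally_fixed[OF x] by blast
  obtain t t' where t: "nsp t t'" "a t y = x" using a_trans[OF y(1) x] by blast
  have "osc (a t y) (t' -` E \<inter> space mu) 0"
    by (rule osc_move[OF t(1) y(1) _ y(4)]) (use nsp_gf[OF t(1)] in \<open>eventually_elim, simp\<close>)
  then show ?thesis
    using that[OF nsp_vimage_sets[OF nsp_sym[OF t(1)] y(2)] nsp_vimage_pos[OF nsp_sym[OF t(1)] y(2,3)]] t(2) by simp
qed

text \<open>The preimage of \<open>E - P\<close> under \<open>g'\<close> is the image of
  \<open>E - P\<close> under \<open>g\<close>. So the stabiliser contains an element supported on
  \<open>E\<close> that stretches the small set \<open>P\<close> over all of \<open>E\<close> but a
  small part.\<close>

definition compressible :: "'x \<Rightarrow> real set \<Rightarrow> bool" where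
  "compressible x E \<longleftrightarrow> E \<in> sets mu \<and> (\<forall>\<delta>>0. \<exists>g g' P. nsp g g' \<and> supp g E \<and> a g x = x \<and>
      P \<in> sets mu \<and> P \<subseteq> E \<and> measure mu P < \<delta> \<and> measure mu (g' -` (E - P) \<inter> space mu) < \<delta>)"

lemma compressibleE:
  assumes "compressible x E" "0 < \<delta>"
  obtains g g' P where "nsp g g'" "supp g E" "a g x = x" "P \<in> sets mu" "P \<subseteq> E" "measure mu P < \<delta>"
    "measure mu (g' -` (E - P) \<inter> space mu) < \<delta>"
  using assms unfolding compressible_def by blast

lemma compressible_fixed:
  assumes x: "x \<in> X" and Z: "Z \<in> sets mu" "0 < measure mu Z" "osc x Z 0"
  shows "compressible x Z"
  unfolding compressible_def
proof (intro conjI allI impI Z(1))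
  fix \<delta> :: real assume \<delta>: "0 < \<delta>"
  obtain P where P: "P \<in> sets mu" "P \<subseteq> Z" "0 < measure mu P" "measure mu P < \<delta>" "0 < measure mu (Z - P)"
    by (rule small_subset[OF Z(1,2) \<delta>])
  have dd: "Z - (Z - P) = P" using P(2) by auto
  have ZP: "Z - P \<in> sets mu" using Z(1) P(1) by blast
  \<comment> \<open>\<open>g\<close> carries \<open>P\<close> onto \<open>Z - P\<close>, hence
    \<open>Z - P\<close> into the small set \<open>P\<close>. It fixes \<open>x\<close> since it is
    supported on \<open>Z\<close>.\<close>
  obtain g g' where g: "nsp g g'" "supp g Z" "AE u in mu. g u \<in> Z - P \<longleftrightarrow> u \<in> P"
    by (rule move_within[OF Z(1) P(1,2,3,5) ZP _ P(5)]) (use P(3) in \<open>auto simp: dd\<close>)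
  have "d x (a g x) \<le> 0" by (rule oscD[OF Z(3) g(1,2)])
  then have gx: "a g x = x" using nonneg[of x "a g x"] zero[OF x a_closed[OF g(1) x]] by simp
  have "AE u in mu. u \<in> g' -` (Z - P) \<inter> space mu \<longrightarrow> u \<in> P"
    using nsp_AE(2)[OF g(1) g(3)] nsp_fg[OF g(1)] supp_invariant[OF nsp_sym[OF g(1)] supp_inverse[OF g(1,2)]]
    by eventually_elim auto
  then have "measure mu (g' -` (Z - P) \<inter> space mu) \<le> measure mu P" by (rule measure_mu_mono_AE[OF _ P(1)])
  then show "\<exists>g g' P. nsp g g' \<and> supp g Z \<and> a g x = x \<and>
      P \<in> sets mu \<and> P \<subseteq> Z \<and> measure mu P < \<delta> \<and> measure mu (g' -` (Z - P) \<inter> space mu) < \<delta>"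
    using g gx P by (intro exI[of _ g] exI[of _ g'] exI[of _ P]) auto
qed

text \<open>Use \<open>g \<circ> h\<close>. A point of \<open>B - Q\<close> is sent by
  \<open>h\<close> into a small set, which \<open>g\<close> keeps small by absolute continuity. A
  point of \<open>A - P\<close> outside \<open>B\<close> is not moved by \<open>h\<close> and is
  sent by \<open>g\<close> into a small set. The set \<open>R\<close> collects the exceptions of
  both kinds.\<close>

lemma compressible_Un:
  assumes x: "x \<in> X" and A: "compressible x A" and B: "compressible x B"
  shows "compressible x (A \<union> B)"
  unfolding compressible_def
proof (intro conjI allI impI)
  have sA: "A \<in> sets mu" and sB: "B \<in> sets mu" using A B by (auto simp: compressible_def)
  then show "A \<union> B \<in> sets mu" by blast
  fix \<delta> :: real assume \<delta>: "0 < \<delta>"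
  then have "0 < \<delta> / 2" by simp
  then obtain g g' P where g: "nsp g g'" "supp g A" "a g x = x" "P \<in> sets mu" "P \<subseteq> A" "measure mu P < \<delta> / 2"
    "measure mu (g' -` (A - P) \<inter> space mu) < \<delta> / 2" by (rule compressibleE[OF A])
  \<comment> \<open>The precision demanded of \<open>h\<close> depends on how much \<open>g\<close>
    can enlarge small sets, so \<open>g\<close> is chosen before.\<close>
  obtain \<epsilon> where e: "0 < \<epsilon>" "\<And>S. S \<in> sets mu \<Longrightarrow> measure mu S < \<epsilon> \<Longrightarrow> measure mu (g' -` S \<inter> space mu) < \<delta> / 2"
    using nsp_absolutely_continuous[OF nsp_sym[OF g(1)] \<open>0 < \<delta> / 2\<close>] by blast
  have "0 < min \<epsilon> (\<delta> / 2)" using e \<delta> by simp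
  then obtain h h' Q where h: "nsp h h'" "supp h B" "a h x = x" "Q \<in> sets mu" "Q \<subseteq> B" "measure mu Q < min \<epsilon> (\<delta> / 2)"
    "measure mu (h' -` (B - Q) \<inter> space mu) < min \<epsilon> (\<delta> / 2)" by (rule compressibleE[OF B])
  define R where "R = Q \<union> (P - B)"
  have R: "R \<in> sets mu" "R \<subseteq> A \<union> B" using g h sB by (auto simp: R_def)
  have "measure mu R \<le> measure mu (Q \<union> P)" using h(4) g(4) by (intro mu.finite_measure_mono) (auto simp: R_def)
  also have "\<dots> \<le> measure mu Q + measure mu P" by (rule measure_Un_le[OF h(4) g(4)])
  finally have mR: "measure mu R < \<delta>" using h(6) g(6) by simp
  have n: "nsp (g \<circ> h) (h' \<circ> g')" by (rule nsp_comp[OF g(1) h(1)])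
  have sp: "supp (g \<circ> h) (A \<union> B)"
    unfolding supp_def using h(2)[unfolded supp_def] g(2)[unfolded supp_def] by eventually_elim auto
  have gh: "a (g \<circ> h) x = x" using a_comp[OF g(1) h(1) x] g(3) h(3) by simp
  let ?S1 = "g' -` (A - P) \<inter> space mu" and ?S2 = "g' -` (h' -` (B - Q) \<inter> space mu) \<inter> space mu"
  have S: "?S1 \<in> sets mu" "h' -` (B - Q) \<inter> space mu \<in> sets mu" "?S2 \<in> sets mu"
  proof -
    show 1: "?S1 \<in> sets mu" by (rule nsp_vimage_sets[OF nsp_sym[OF g(1)]]) (use sA g(4) in blast)
    show 2: "h' -` (B - Q) \<inter> space mu \<in> sets mu" by (rule nsp_vimage_sets[OF nsp_sym[OF h(1)]]) (use sB h(4) in blast)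
    show "?S2 \<in> sets mu" by (rule nsp_vimage_sets[OF nsp_sym[OF g(1)] 2])
  qed
  have "AE u in mu. u \<in> (h' \<circ> g') -` (A \<union> B - R) \<inter> space mu \<longrightarrow> u \<in> ?S1 \<union> ?S2"
    using nsp_AE(2)[OF g(1) supp_inverse[OF h(1,2), unfolded supp_def]]
      nsp_AE(2)[OF g(1) supp_invariant[OF nsp_sym[OF h(1)] supp_inverse[OF h(1,2)]]] AE_space
  proof eventually_elim
    case (elim u)
    have "g' u \<in> space mu" using nsp_space(2)[OF g(1), of u] elim(3) by simp
    then show ?case using elim by (auto simp: R_def)
  qed
  then have "measure mu ((h' \<circ> g') -` (A \<union> B - R) \<inter> space mu) \<le> measure mu (?S1 \<union> ?S2)"
    by (rule measure_mu_mono_AE) (use S in blast)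
  also have "\<dots> \<le> measure mu ?S1 + measure mu ?S2" by (rule measure_Un_le[OF S(1,3)])
  also have "\<dots> < \<delta>" using g(7) e(2)[OF S(2)] h(7) by simp
  finally show "\<exists>g g' P. nsp g g' \<and> supp g (A \<union> B) \<and> a g x = x \<and>
      P \<in> sets mu \<and> P \<subseteq> A \<union> B \<and> measure mu P < \<delta> \<and> measure mu (g' -` (A \<union> B - P) \<inter> space mu) < \<delta>"
    using n sp gh R mR by blast
qed

text \<open>An element for \<open>E n\<close> with \<open>n\<close> large also serves the union, as
  the missing part is small and is left in place by it.\<close>

lemma compressible_incseq:
  assumes E: "\<And>n::nat. compressible x (E n)" and inc: "incseq E"
  shows "compressible x (\<Union>n. E n)"
  unfolding compressible_def
proof (intro conjI allI impI)
  have sE: "\<And>n. E n \<in> sets mu" using E by (auto simp: compressible_def)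
  then show sU: "(\<Union>n. E n) \<in> sets mu" by blast
  fix \<delta> :: real assume \<delta>: "0 < \<delta>"
  have "(\<lambda>n. measure mu (E n)) \<longlonglongrightarrow> measure mu (\<Union>n. E n)"
    by (rule mu.finite_Lim_measure_incseq) (use sE inc in auto)
  from LIMSEQ_D[OF this, of "\<delta> / 2"] \<delta> obtain n where "norm (measure mu (E n) - measure mu (\<Union>n. E n)) < \<delta> / 2" by auto
  then have "measure mu (\<Union>n. E n) - measure mu (E n) < \<delta> / 2" by (simp only: real_norm_def abs_less_iff) linarith
  moreover have "measure mu ((\<Union>n. E n) - E n) = measure mu (\<Union>n. E n) - measure mu (E n)"
    by (rule mu.finite_measure_Diff[OF sU sE]) auto
  ultimately have n: "measure mu ((\<Union>n. E n) - E n) < \<delta> / 2" by simp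
  have "0 < \<delta> / 2" using \<delta> by simp
  then obtain g g' P where g: "nsp g g'" "supp g (E n)" "a g x = x" "P \<in> sets mu" "P \<subseteq> E n" "measure mu P < \<delta> / 2"
    "measure mu (g' -` (E n - P) \<inter> space mu) < \<delta> / 2" by (rule compressibleE[OF E])
  let ?S = "g' -` (E n - P) \<inter> space mu"
  have S: "?S \<in> sets mu" by (rule nsp_vimage_sets[OF nsp_sym[OF g(1)]]) (use sE g(4) in blast)
  have D: "(\<Union>n. E n) - E n \<in> sets mu" using sU sE by blast
  have "AE u in mu. u \<in> g' -` ((\<Union>n. E n) - P) \<inter> space mu \<longrightarrow> u \<in> ?S \<union> ((\<Union>n. E n) - E n)"
    using supp_inverse[OF g(1,2), unfolded supp_def] supp_invariant[OF nsp_sym[OF g(1)] supp_inverse[OF g(1,2)]]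
    by eventually_elim auto
  then have "measure mu (g' -` ((\<Union>n. E n) - P) \<inter> space mu) \<le> measure mu (?S \<union> ((\<Union>n. E n) - E n))"
    by (rule measure_mu_mono_AE) (use S D in blast)
  also have "\<dots> \<le> measure mu ?S + measure mu ((\<Union>n. E n) - E n)" by (rule measure_Un_le[OF S D])
  also have "\<dots> < \<delta>" using n g(7) by simp
  finally show "\<exists>g g' P. nsp g g' \<and> supp g (\<Union>n. E n) \<and> a g x = x \<and>
      P \<in> sets mu \<and> P \<subseteq> (\<Union>n. E n) \<and> measure mu P < \<delta> \<and> measure mu (g' -` ((\<Union>n. E n) - P) \<inter> space mu) < \<delta>"
    using g(1,3,4) supp_mono[OF g(2), of "\<Union>n. E n"] g(5,6) \<delta>
    by (intro exI[of _ g] exI[of _ g'] exI[of _ P]) auto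
qed

text \<open>Exhaustion: finite unions of a maximising sequence increase to a compressible set that
  attains the supremum of the measures.\<close>

lemma maximal_compressible:
  assumes x: "x \<in> X"
  obtains E where "compressible x E" "\<And>E'. compressible x E' \<Longrightarrow> measure mu E' \<le> measure mu E"
proof -
  define M where "M = measure mu ` {E. compressible x E}"
  have bd: "bdd_above M" unfolding M_def by (rule bdd_aboveI[of _ 1]) (use mu.bounded_measure in auto)
  obtain E0 where "E0 \<in> sets mu" "0 < measure mu E0" "osc x E0 0" by (rule locally_fixed[OF x])
  then have ne: "compressible x E0" by (rule compressible_fixed[OF x])
  then have M0: "M \<noteq> {}" by (auto simp: M_def)
  have "\<exists>E. compressible x E \<and> Sup M - 1 / real (Suc n) < measure mu E" for n
  proof -
    have "Sup M - 1 / real (Suc n) < Sup M" by simp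
    then obtain m where "m \<in> M" "Sup M - 1 / real (Suc n) < m" using less_cSup_iff[OF M0 bd] by blast
    then show ?thesis by (auto simp: M_def)
  qed
  then obtain E where E: "\<And>n. compressible x (E n)" "\<And>n. Sup M - 1 / real (Suc n) < measure mu (E n)" by metis
  define U where "U n = (\<Union>i\<le>n. E i)" for n
  have U: "compressible x (U n)" for n
  proof (induction n)
    case (Suc n)
    have "U (Suc n) = U n \<union> E (Suc n)" by (auto simp: U_def atMost_Suc)
    then show ?case using compressible_Un[OF x Suc E(1)] by simp
  qed (simp add: U_def E(1))
  have inc: "incseq U" unfolding incseq_def U_def by (fastforce intro: UN_mono)
  have V: "compressible x (\<Union>n. U n)" by (rule compressible_incseq[OF U inc])
  have "Sup M - 1 / real (Suc n) \<le> measure mu (\<Union>n. U n)" for n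
  proof -
    have "measure mu (E n) \<le> measure mu (\<Union>n. U n)"
      using V by (intro mu.finite_measure_mono) (auto simp: U_def compressible_def)
    then show ?thesis using E(2)[of n] by simp
  qed
  then have "Sup M \<le> measure mu (\<Union>n. U n)"
    using LIMSEQ_le_const2[of "\<lambda>n. Sup M - 1 / real (Suc n)" "Sup M"]
      tendsto_diff[OF tendsto_const LIMSEQ_inverse_real_of_nat, of "Sup M"] by (simp add: inverse_eq_divide)
  moreover have "measure mu E' \<le> Sup M" if "compressible x E'" for E'
    by (rule cSup_upper[OF _ bd]) (use that in \<open>auto simp: M_def\<close>)
  ultimately show ?thesis using that[OF V] by (meson order_trans)
qed

text \<open>Conjugation by \<open>g\<close>, which fixes \<open>x\<close>, transfers the small
  displacement from the small support \<open>P\<close> to the nearly full support \<open>B\<close>.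
  Any \<open>h\<close> agrees, off a small set, with some \<open>k\<close> supported on
  \<open>B\<close>. Then \<open>k\<close> and \<open>h' \<circ> k\<close> both move \<open>x\<close>
  little, and the two displacements add up to that of \<open>h\<close>.\<close>

lemma fixed_if_compressible_full:
  assumes x: "x \<in> X" and E: "compressible x E" "measure mu E = 1" and h: "nsp h h'"
  shows "a h x = x"
proof -
  have sE: "E \<in> sets mu" using E by (simp add: compressible_def)
  have hx: "a h x \<in> X" by (rule a_closed[OF h x])
  have bound: "d x (a h x) \<le> 2 * \<epsilon>" if \<epsilon>: "0 < \<epsilon>" for \<epsilon>
  proof -
    obtain \<eta> where \<eta>: "0 < \<eta>" "\<eta> \<le> 1"
      "\<forall>f g A. nsp f g \<longrightarrow> A \<in> sets mu \<longrightarrow> measure mu A < \<eta> \<longrightarrow> supp f A \<longrightarrow> d x (a f x) < \<epsilon>"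
      by (rule small[OF x \<epsilon>])
    have "0 < \<eta> / 3" using \<eta> by simp
    then obtain \<delta> where \<delta>: "0 < \<delta>" "\<And>A. A \<in> sets mu \<Longrightarrow> measure mu A < \<delta> \<Longrightarrow> measure mu (h -` A \<inter> space mu) < \<eta> / 3"
      using nsp_absolutely_continuous[OF h] by blast
    have "0 < min \<delta> (\<eta> / 3)" using \<delta> \<eta> by simp
    then obtain g g' P where g: "nsp g g'" "supp g E" "a g x = x" "P \<in> sets mu" "P \<subseteq> E" "measure mu P < min \<delta> (\<eta> / 3)"
      "measure mu (g' -` (E - P) \<inter> space mu) < min \<delta> (\<eta> / 3)" by (rule compressibleE[OF E(1)])
    define B where "B = g' -` P \<inter> space mu"
    have B: "B \<in> sets mu" unfolding B_def by (rule nsp_vimage_sets[OF nsp_sym[OF g(1)] g(4)])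
    have Bsp: "B \<subseteq> space mu" by (auto simp: B_def)
    have sB: "space mu - B \<in> sets mu" using B by blast
    have "measure mu (space mu - E) = 0"
      using mu.finite_measure_compl[OF sE] E(2) by simp
    then have "AE u in mu. u \<notin> space mu - E" using measure_mu_pos_iff[OF sets.compl_sets[OF sE]] by (simp del: space_mu)
    then have full: "AE u in mu. u \<in> E" using AE_space by eventually_elim simp
    have "AE u in mu. u \<in> space mu - B \<longrightarrow> u \<in> g' -` (E - P) \<inter> space mu"
      using nsp_AE(2)[OF g(1) full] by eventually_elim (auto simp: B_def)
    then have "measure mu (space mu - B) \<le> measure mu (g' -` (E - P) \<inter> space mu)"
      by (rule measure_mu_mono_AE) (rule nsp_vimage_sets[OF nsp_sym[OF g(1)]], use sE g(4) in blast)
    then have mB: "measure mu (space mu - B) < \<delta>" "measure mu (space mu - B) < \<eta> / 3" using g(7) by simp_all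
    have "osc x P \<epsilon>"
      unfolding osc_def
    proof (intro allI impI)
      fix f f' assume f: "nsp f f'" "supp f P"
      show "d x (a f x) \<le> \<epsilon>" using \<eta>(3)[rule_format, OF f(1) g(4) _ f(2)] g(6) \<eta>(1) by simp
    qed
    then have "osc (a g x) B \<epsilon>"
      by (rule osc_move[OF g(1) x, rotated]) (use nsp_gf[OF g(1)] in \<open>eventually_elim, simp add: B_def\<close>)
    then have oB: "osc x B \<epsilon>" using g(3) by simp
    \<comment> \<open>The points that start in \<open>B\<close> and are kept in \<open>B\<close> by
      \<open>h\<close>. The complement consists of two sets, each of measure below a third of
      \<eta>.\<close>
    define C where "C = B \<inter> (h -` B \<inter> space mu)"
    have hB: "h -` B \<inter> space mu \<in> sets mu" by (rule nsp_vimage_sets[OF h B])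
    have C: "C \<in> sets mu" "C \<subseteq> B" unfolding C_def using B hB by auto
    have hsB: "h -` (space mu - B) \<inter> space mu \<in> sets mu" by (rule nsp_vimage_sets[OF h sB])
    have "space mu - C \<subseteq> (space mu - B) \<union> (h -` (space mu - B) \<inter> space mu)"
      using nsp_space(1)[OF h] by (auto simp: C_def simp del: atLeastAtMost_iff)
    then have "measure mu (space mu - C) \<le> measure mu ((space mu - B) \<union> (h -` (space mu - B) \<inter> space mu))"
      by (intro mu.finite_measure_mono) (use sB hsB in blast)+
    also have "\<dots> \<le> measure mu (space mu - B) + measure mu (h -` (space mu - B) \<inter> space mu)"
      by (rule measure_Un_le[OF sB hsB])
    also have "\<dots> < 2 * \<eta> / 3" using mB(2) \<delta>(2)[OF sB mB(1)] by simp
    finally have mC: "measure mu (space mu - C) < 2 * \<eta> / 3" .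
    have "measure mu C = 1 - measure mu (space mu - C)" using mu.finite_measure_compl[OF C(1)] by simp
    then have Cpos: "0 < measure mu C" using mC \<eta>(2) by simp
    \<comment> \<open>Removing \<open>C1\<close>, for which the last third of \<eta> is spent,
      leaves room in \<open>B\<close> outside both \<open>C0\<close> and its image, as
      \<open>move_within\<close> demands.\<close>
    have "0 < \<eta> / 3" using \<eta> by simp
    then obtain C1 where C1: "C1 \<in> sets mu" "C1 \<subseteq> C" "0 < measure mu C1" "measure mu C1 < \<eta> / 3" "0 < measure mu (C - C1)"
      by (rule small_subset[OF C(1) Cpos])
    define C0 where "C0 = C - C1"
    have C0: "C0 \<in> sets mu" "C0 \<subseteq> B" "0 < measure mu C0" using C C1 by (auto simp: C0_def)
    define D where "D = B \<inter> (h' -` C0 \<inter> space mu)"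
    have hi: "h' -` S \<inter> space mu \<in> sets mu" if "S \<in> sets mu" for S by (rule nsp_vimage_sets[OF nsp_sym[OF h] that])
    have D: "D \<in> sets mu" "D \<subseteq> B" unfolding D_def using B hi[OF C0(1)] by auto
    have inB: "AE y in mu. y \<in> h' -` C \<inter> space mu \<longrightarrow> y \<in> B"
      using nsp_fg[OF h] by eventually_elim (auto simp: C_def)
    have Dpos: "0 < measure mu D"
    proof -
      have "AE y in mu. y \<in> h' -` C0 \<inter> space mu \<longrightarrow> y \<in> D" using inB by eventually_elim (auto simp: D_def C0_def)
      from measure_mu_mono_AE[OF this D(1)] show ?thesis using nsp_vimage_pos[OF nsp_sym[OF h] C0(1,3)] by simp
    qed
    have BD: "0 < measure mu (B - D)"
    proof -
      have "AE y in mu. y \<in> h' -` C1 \<inter> space mu \<longrightarrow> y \<in> B - D" using inB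
      proof eventually_elim
        case (elim y)
        then show ?case using C1(2) by (auto simp: D_def C0_def)
      qed
      then have "measure mu (h' -` C1 \<inter> space mu) \<le> measure mu (B - D)" by (rule measure_mu_mono_AE) (use B D in blast)
      then show ?thesis using nsp_vimage_pos[OF nsp_sym[OF h] C1(1,3)] by simp
    qed
    have BC0: "0 < measure mu (B - C0)"
    proof -
      have "measure mu C1 \<le> measure mu (B - C0)"
        by (rule mu.finite_measure_mono) (use B C0 C C1 in \<open>auto simp: C0_def\<close>)
      then show ?thesis using C1(3) by simp
    qed
    \<comment> \<open>\<open>m\<close> only has to complete \<open>h\<close> on \<open>C0\<close> to
      a bijection that stays inside \<open>B\<close>; how it acts off \<open>C0\<close> is
      immaterial.\<close>
    obtain m m' where m: "nsp m m'" "supp m B" "AE u in mu. m u \<in> D \<longleftrightarrow> u \<in> C0"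
      by (rule move_within[OF B C0 BC0 D Dpos BD])
    have hD: "AE u in mu. u \<in> C0 \<longleftrightarrow> h u \<in> D"
      using nsp_gf[OF h] AE_space
    proof eventually_elim
      case (elim u)
      have "h u \<in> space mu" using nsp_space(1)[OF h, of u] elim(2) by simp
      then show ?case using elim(1) by (auto simp: D_def C0_def C_def)
    qed
    have mD: "AE u in mu. u \<in> C0 \<longleftrightarrow> m u \<in> D" using m(3) by eventually_elim simp
    define k where "k u = (if u \<in> C0 then h u else m u)" for u
    define k' where "k' u = (if u \<in> D then h' u else m' u)" for u
    have k: "nsp k k'"
      unfolding k_def[abs_def] k'_def[abs_def]
      by (rule nst_nsp[OF nst_glue[OF nst_rnd[OF h] nst_rnd[OF m(1)] C0(1) D(1) hD mD]])
    have "supp k B"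
      unfolding supp_def using m(2)[unfolded supp_def] by eventually_elim (use C0(2) in \<open>auto simp: k_def\<close>)
    then have kx: "d x (a k x) \<le> \<epsilon>" by (rule oscD[OF oB k])
    have n: "nsp (h' \<circ> k) (k' \<circ> h)" by (rule nsp_comp[OF nsp_sym[OF h] k])
    have sC0: "space mu - C0 \<in> sets mu" using C0 by blast
    have "supp (h' \<circ> k) (space mu - C0)"
      unfolding supp_def using nsp_gf[OF h] AE_space by eventually_elim (auto simp: k_def)
    moreover have "measure mu (space mu - C0) < \<eta>"
    proof -
      have sC: "space mu - C \<in> sets mu" using C by blast
      have "measure mu (space mu - C0) \<le> measure mu ((space mu - C) \<union> C1)"
        by (rule mu.finite_measure_mono) (use sC C1 in \<open>auto simp: C0_def\<close>)
      also have "\<dots> \<le> measure mu (space mu - C) + measure mu C1" by (rule measure_Un_le[OF sC C1(1)])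
      finally show ?thesis using mC C1(4) by simp
    qed
    ultimately have "d x (a (h' \<circ> k) x) < \<epsilon>" using \<eta>(3)[rule_format, OF n sC0] by simp
    moreover have kX: "a k x \<in> X" by (rule a_closed[OF k x])
    have "a (h' \<circ> k) x = a h' (a k x)" by (rule a_comp[OF nsp_sym[OF h] k x])
    moreover have "d (a h' (a h x)) (a h' (a k x)) = d (a h x) (a k x)" by (rule a_dist[OF nsp_sym[OF h] hx kX])
    ultimately have "d (a h x) (a k x) < \<epsilon>" using a_inv[OF h x] by simp
    moreover have "d x (a h x) \<le> d x (a k x) + d (a k x) (a h x)" by (rule triangle[OF x kX hx])
    ultimately show ?thesis using kx commute[of "a k x" "a h x"] by simp
  qed
  have "d x (a h x) \<le> 0"
  proof (rule field_le_epsilon)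
    fix e :: real assume "0 < e"
    then show "d x (a h x) \<le> 0 + e" using bound[of "e / 2"] by simp
  qed
  then show ?thesis using nonneg[of x "a h x"] zero[OF x hx] by simp
qed

text \<open>\<open>s\<close>, of small support, pushes \<open>E\<close> off \<open>P\<close>, and
  then \<open>g\<close> compresses \<open>E - P\<close> into a small set. Since \<open>g\<close>
  fixes \<open>x\<close>, the displacement under \<open>g \<circ> s\<close> is that under
  \<open>s\<close>. The set \<open>R\<close> is the part outside \<open>E\<close> that has to give
  way; its image under \<open>t\<close> is kept small so that the infinite composition
  stabilises.\<close>

lemma shrinking_step:
  fixes n :: nat
  assumes x: "x \<in> X" and E: "compressible x E" "0 < measure mu E" "0 < measure mu (space mu - E)" and t: "nsp t t'"
  shows "\<exists>r r' R. nsp r r' \<and> d x (a r x) < (1/2) ^ n \<and> R \<in> sets mu \<and> (AE u in mu. u \<notin> E \<longrightarrow> u \<notin> R \<longrightarrow> r u = u) \<and>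
    measure mu (t' -` R \<inter> space mu) < (1/2) ^ n \<and> measure mu ((r' \<circ> t') -` E \<inter> space mu) < (1/2) ^ n"
proof -
  have sE: "E \<in> sets mu" using E by (simp add: compressible_def)
  have pn: "0 < (1/2::real) ^ n" by simp
  obtain \<eta> where \<eta>: "0 < \<eta>" "\<eta> \<le> 1"
    "\<forall>f g A. nsp f g \<longrightarrow> A \<in> sets mu \<longrightarrow> measure mu A < \<eta> \<longrightarrow> supp f A \<longrightarrow> d x (a f x) < (1/2) ^ n"
    by (rule small[OF x pn])
  obtain \<delta> where \<delta>: "0 < \<delta>" "\<And>A. A \<in> sets mu \<Longrightarrow> measure mu A < \<delta> \<Longrightarrow> measure mu (t' -` A \<inter> space mu) < (1/2) ^ n"
    using nsp_absolutely_continuous[OF nsp_sym[OF t] pn] by blast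
  \<comment> \<open>\<eta> bounds the support of \<open>s\<close>, \<delta> the images under
    \<open>t\<close>, and \<open>measure mu E\<close> ensures that \<open>E - P\<close> is not
    null.\<close>
  have "0 < min (min (\<eta> / 3) \<delta>) (measure mu E)" using \<eta> \<delta> E by simp
  then obtain g g' P where g: "nsp g g'" "supp g E" "a g x = x" "P \<in> sets mu" "P \<subseteq> E"
    "measure mu P < min (min (\<eta> / 3) \<delta>) (measure mu E)"
    "measure mu (g' -` (E - P) \<inter> space mu) < min (min (\<eta> / 3) \<delta>) (measure mu E)" by (rule compressibleE[OF E(1)])
  have EP: "E - P \<in> sets mu" "0 < measure mu (E - P)"
    using sE g(4) mu.finite_measure_Diff[OF sE g(4,5)] g(6) by auto
  have e3: "0 < \<eta> / 3" using \<eta> by simp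
  \<comment> \<open>A reserve inside \<open>E - P\<close>: it makes the complements of
    \<open>R\<close> and of \<open>R \<union> P\<close> in \<open>C\<close> non-null.\<close>
  obtain S where S: "S \<in> sets mu" "S \<subseteq> E - P" "0 < measure mu S" "measure mu S < \<eta> / 3" "0 < measure mu ((E - P) - S)"
    by (rule small_subset[OF EP e3])
  have cE: "space mu - E \<in> sets mu" using sE by blast
  have "0 < min (\<eta> / 3) \<delta>" using \<eta> \<delta> by simp
  then obtain R where R: "R \<in> sets mu" "R \<subseteq> space mu - E" "0 < measure mu R" "measure mu R < min (\<eta> / 3) \<delta>"
    "0 < measure mu ((space mu - E) - R)"
    by (rule small_subset[OF cE E(3)])
  define C where "C = (R \<union> S) \<union> P"
  have C: "C \<in> sets mu" using R S g(4) by (auto simp: C_def)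
  have "measure mu C \<le> measure mu (R \<union> S) + measure mu P"
    unfolding C_def by (rule measure_Un_le) (use R S g(4) in auto)
  also have "measure mu (R \<union> S) \<le> measure mu R + measure mu S" by (rule measure_Un_le[OF R(1) S(1)])
  finally have mC: "measure mu C < \<eta>" using R(4) S(4) g(6) by simp
  have RP: "R \<union> P \<in> sets mu" using R g(4) by blast
  have S1: "S \<subseteq> C - R" "S \<subseteq> C - (R \<union> P)" using S(2) R(2) by (auto simp: C_def)
  have p1: "0 < measure mu (C - R)" "0 < measure mu (C - (R \<union> P))"
  proof -
    have "measure mu S \<le> measure mu (C - R)" by (rule mu.finite_measure_mono[OF S1(1)]) (use C R in blast)
    then show "0 < measure mu (C - R)" using S(3) by simp
    have "measure mu S \<le> measure mu (C - (R \<union> P))" by (rule mu.finite_measure_mono[OF S1(2)]) (use C RP in blast)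
    then show "0 < measure mu (C - (R \<union> P))" using S(3) by simp
  qed
  have p2: "0 < measure mu (R \<union> P)"
  proof -
    have "measure mu R \<le> measure mu (R \<union> P)" by (rule mu.finite_measure_mono) (use RP in auto)
    then show ?thesis using R(3) by simp
  qed
  have sub: "R \<subseteq> C" "R \<union> P \<subseteq> C" by (auto simp: C_def)
  \<comment> \<open>\<open>R\<close> is spread over \<open>R \<union> P\<close>, so that the rest of
    \<open>C\<close>, including \<open>P\<close>, is squeezed into \<open>S\<close>.\<close>
  obtain s s' where s: "nsp s s'" "supp s C" "AE u in mu. s u \<in> R \<union> P \<longleftrightarrow> u \<in> R"
    by (rule move_within[OF C R(1) sub(1) R(3) p1(1) RP sub(2) p2 p1(2)])
  have r: "nsp (g \<circ> s) (s' \<circ> g')" by (rule nsp_comp[OF g(1) s(1)])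
  have "d x (a (g \<circ> s) x) = d (a g x) (a g (a s x))" using a_comp[OF g(1) s(1) x] g(3) by simp
  also have "\<dots> = d x (a s x)" by (rule a_dist[OF g(1) x a_closed[OF s(1) x]])
  also have "\<dots> < (1/2) ^ n" by (rule \<eta>(3)[rule_format, OF s(1) C mC s(2)])
  finally have dr: "d x (a (g \<circ> s) x) < (1/2) ^ n" .
  have fx: "AE u in mu. u \<notin> E \<longrightarrow> u \<notin> R \<longrightarrow> (g \<circ> s) u = u"
    using s(2)[unfolded supp_def] g(2)[unfolded supp_def]
  proof eventually_elim
    case (elim u)
    then show ?case using S(2) g(5) by (auto simp: C_def)
  qed
  have mR: "measure mu (t' -` R \<inter> space mu) < (1/2) ^ n" by (rule \<delta>(2)[OF R(1)]) (use R(4) in simp)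
  have gE: "g' -` (E - P) \<inter> space mu \<in> sets mu" by (rule nsp_vimage_sets[OF nsp_sym[OF g(1)] EP(1)])
  have "AE u in mu. u \<in> E \<longrightarrow> s u \<in> E - P"
    using s(2)[unfolded supp_def] s(3) supp_invariant[OF s(1,2)]
  proof eventually_elim
    case (elim u)
    then show ?case using S(2) R(2) g(5) by (auto simp: C_def)
  qed
  from nsp_AE(2)[OF t nsp_AE(2)[OF g(1) nsp_AE(2)[OF s(1) this]]]
  have "AE y in mu. s' (g' (t' y)) \<in> E \<longrightarrow> s (s' (g' (t' y))) \<in> E - P" .
  with nsp_AE(2)[OF t nsp_AE(2)[OF g(1) nsp_fg[OF s(1)]]] AE_space
  have "AE y in mu. y \<in> (s' \<circ> g' \<circ> t') -` E \<inter> space mu \<longrightarrow> y \<in> t' -` (g' -` (E - P) \<inter> space mu) \<inter> space mu"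
  proof eventually_elim
    case (elim y)
    have "t' y \<in> space mu" using nsp_space(2)[OF t, of y] elim(2) by simp
    then show ?case using elim by auto
  qed
  then have "measure mu ((s' \<circ> g' \<circ> t') -` E \<inter> space mu) \<le> measure mu (t' -` (g' -` (E - P) \<inter> space mu) \<inter> space mu)"
    by (rule measure_mu_mono_AE) (rule nsp_vimage_sets[OF nsp_sym[OF t] gE])
  also have "\<dots> < (1/2) ^ n" by (rule \<delta>(2)[OF gE]) (use g(7) in simp)
  finally have "measure mu ((s' \<circ> g' \<circ> t') -` E \<inter> space mu) < (1/2) ^ n" .
  then show ?thesis using r dr R(1) fx mR by blast
qed

text \<open>By Borel-Cantelli almost every point finally leaves the images of \<open>E\<close> and
  of the sets \<open>R n\<close> under \<open>t n\<close>, so its backward orbit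
  \<open>t' n u\<close> becomes constant outside \<open>E\<close>. The limit of
  \<open>a (t n) x\<close> is fixed over some \<open>E'\<close>. On a suitable \<open>Z\<close>
  outside \<open>E\<close> all later \<open>t m\<close> agree with \<open>t n\<close> and lead into
  \<open>E'\<close>, so undoing them moves the fixing back to \<open>x\<close>.\<close>

lemma fixed_outside_compressible:
  assumes x: "x \<in> X" and E: "compressible x E" "0 < measure mu E" "0 < measure mu (space mu - E)"
  obtains Z where "Z \<in> sets mu" "Z \<inter> E = {}" "0 < measure mu Z" "osc x Z 0"
proof -
  have sE: "E \<in> sets mu" using E by (simp add: compressible_def)
  define Q where "Q n t t' z \<longleftrightarrow> nsp (fst z) (fst (snd z)) \<and> d x (a (fst z) x) < (1/2) ^ n \<and>
      snd (snd z) \<in> sets mu \<and> (AE u in mu. u \<notin> E \<longrightarrow> u \<notin> snd (snd z) \<longrightarrow> fst z u = u) \<and>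
      measure mu (t' -` snd (snd z) \<inter> space mu) < (1/2) ^ n \<and> measure mu ((fst (snd z) \<circ> t') -` E \<inter> space mu) < (1/2) ^ n"
    for n :: nat and t t' :: "real \<Rightarrow> real" and z
  have ex: "\<exists>z. Q n t t' z" if "nsp t t'" for n t t'
    using shrinking_step[OF x E that, of n]
  proof (elim exE)
    fix r r' R
    assume "nsp r r' \<and> d x (a r x) < (1/2) ^ n \<and> R \<in> sets mu \<and> (AE u in mu. u \<notin> E \<longrightarrow> u \<notin> R \<longrightarrow> r u = u) \<and>
      measure mu (t' -` R \<inter> space mu) < (1/2) ^ n \<and> measure mu ((r' \<circ> t') -` E \<inter> space mu) < (1/2) ^ n"
    then have "Q n t t' (r, r', R)" unfolding Q_def fst_conv snd_conv .
    then show ?thesis by (rule exI)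
  qed
  define \<zeta> where "\<zeta> n t t' = (SOME z. Q n t t' z)" for n t t'
  define \<rho> where "\<rho> n t t' = fst (\<zeta> n t t')" for n t t'
  define \<rho>' where "\<rho>' n t t' = fst (snd (\<zeta> n t t'))" for n t t'
  define \<R> where "\<R> n t t' = snd (snd (\<zeta> n t t'))" for n t t'
  have step: "nsp (\<rho> n t t') (\<rho>' n t t') \<and> d x (a (\<rho> n t t') x) < (1/2) ^ n \<and>
      \<R> n t t' \<in> sets mu \<and> (AE u in mu. u \<notin> E \<longrightarrow> u \<notin> \<R> n t t' \<longrightarrow> \<rho> n t t' u = u) \<and>
      measure mu (t' -` \<R> n t t' \<inter> space mu) < (1/2) ^ n \<and> measure mu ((\<rho>' n t t' \<circ> t') -` E \<inter> space mu) < (1/2) ^ n"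
    if "nsp t t'" for n t t'
  proof -
    have "Q n t t' (\<zeta> n t t')" unfolding \<zeta>_def by (rule someI_ex[OF ex[OF that]])
    then show ?thesis unfolding Q_def \<rho>_def \<rho>'_def \<R>_def .
  qed
  \<comment> \<open>Map and inverse are constructed together, since each step depends on the current
    inverse through the smallness conditions.\<close>
  define T where "T = rec_nat (\<lambda>u. u, \<lambda>u. u) (\<lambda>n tt. (fst tt \<circ> \<rho> n (fst tt) (snd tt), \<rho>' n (fst tt) (snd tt) \<circ> snd tt))"
  define t where "t n = fst (T n)" for n
  define t' where "t' n = snd (T n)" for n
  define r where "r n = \<rho> n (t n) (t' n)" for n
  define r' where "r' n = \<rho>' n (t n) (t' n)" for n
  define R where "R n = \<R> n (t n) (t' n)" for n
  have t0: "t 0 = (\<lambda>u. u)" "t' 0 = (\<lambda>u. u)" and tS: "t (Suc n) = t n \<circ> r n" "t' (Suc n) = r' n \<circ> t' n" for n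
    by (auto simp: t_def t'_def T_def r_def r'_def)
  have t: "nsp (t n) (t' n)" for n
  proof (induction n)
    case (Suc n)
    have "nsp (r n) (r' n)" using step[OF Suc, of n] by (simp add: r_def r'_def)
    then show ?case unfolding tS by (rule nsp_comp[OF Suc])
  qed (simp add: t0 nsp_id)
  have r: "nsp (r n) (r' n)" and dr: "d x (a (r n) x) < (1/2) ^ n" and R: "R n \<in> sets mu"
    and rf: "AE u in mu. u \<notin> E \<longrightarrow> u \<notin> R n \<longrightarrow> r n u = u"
    and mR: "measure mu (t' n -` R n \<inter> space mu) < (1/2) ^ n"
    and mE: "measure mu (t' (Suc n) -` E \<inter> space mu) < (1/2) ^ n" for n
    using step[OF t, of n n] unfolding tS r_def r'_def R_def by blast+
  obtain y where y: "y \<in> X" "(\<lambda>n. d (a (t n) x) y) \<longlonglongrightarrow> 0"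
    by (rule orbit_limit[of x t t' r r', OF x t r tS(1) dr])
  obtain E' where E': "E' \<in> sets mu" "0 < measure mu E'" "osc y E' 0" by (rule locally_fixed[OF y(1)])
  have BC: "AE u in mu. eventually (\<lambda>n. u \<in> space mu - A n) sequentially"
    if "\<And>n. A n \<in> sets mu" "\<And>n. measure mu (A n) < (1/2) ^ n" for A
  proof (rule borel_cantelli_AE1)
    show "summable (\<lambda>n. measure mu (A n))"
      by (rule summable_comparison_test'[of "\<lambda>n. (1/2) ^ n"]) (use that(2) in \<open>auto intro: less_imp_le\<close>)
  qed (use that(1) in \<open>auto simp: mu.emeasure_eq_measure\<close>)
  have b1: "AE u in mu. eventually (\<lambda>n. u \<in> space mu - (t' n -` R n \<inter> space mu)) sequentially"
    by (rule BC[OF nsp_vimage_sets[OF nsp_sym[OF t] R] mR])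
  have b2: "AE u in mu. eventually (\<lambda>n. u \<in> space mu - (t' (Suc n) -` E \<inter> space mu)) sequentially"
    by (rule BC[OF nsp_vimage_sets[OF nsp_sym[OF t] sE] mE])
  have rf': "AE u in mu. t' n u \<notin> E \<longrightarrow> t' n u \<notin> R n \<longrightarrow> t' (Suc n) u = t' n u" for n
  proof -
    have "AE u in mu. u \<notin> E \<longrightarrow> u \<notin> R n \<longrightarrow> r' n u = u"
      using rf[of n] nsp_gf[OF r[of n]]
    proof eventually_elim
      case (elim u)
      then show ?case by metis
    qed
    from nsp_AE(2)[OF t this] show ?thesis unfolding tS by simp
  qed
  have rf'': "AE u in mu. \<forall>n. t' n u \<notin> E \<longrightarrow> t' n u \<notin> R n \<longrightarrow> t' (Suc n) u = t' n u"
    by (intro AE_all_countable[THEN iffD2] allI rf')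
  \<comment> \<open>The points whose backward orbit is constant from stage \<open>n\<close> on, with
    value outside \<open>E\<close>; these sets cover almost everything.\<close>
  define Y where "Y n = {u \<in> space mu. t' n u \<notin> E \<and> (\<forall>k. t' (n + k) u = t' n u)}" for n
  have cov: "AE u in mu. \<exists>n. u \<in> Y n"
    using b1 b2 rf'' AE_space
  proof eventually_elim
    case (elim u)
    have "eventually (\<lambda>n. u \<in> space mu - (t' n -` E \<inter> space mu)) sequentially"
      using elim(2) by (rule eventually_sequentially_Suc[THEN iffD1])
    from eventually_conj[OF elim(1) this]
    obtain n where n: "\<And>m. n \<le> m \<Longrightarrow> t' m u \<notin> R m \<and> t' m u \<notin> E" using elim(4) by (auto simp: eventually_sequentially)
    have "t' (n + k) u = t' n u" for k
    proof (induction k)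
      case (Suc k)
      have "t' (Suc (n + k)) u = t' (n + k) u" using elim(3) n[of "n + k"] by simp
      then show ?case using Suc by simp
    qed simp
    then have "u \<in> Y n" using n[of n] elim(4) by (simp add: Y_def)
    then show ?case by blast
  qed
  have Ym: "Y n \<in> sets mu" for n
  proof -
    have 1: "t' n -` E \<inter> space mu \<in> sets mu" by (rule nsp_vimage_sets[OF nsp_sym[OF t] sE])
    have 2: "{u \<in> space mu. t' (n + k) u = t' n u} \<in> sets mu" for k
      using nsp_borel(2)[OF t[of "n + k"]] nsp_borel(2)[OF t[of n]] by measurable
    have "Y n = (space mu - (t' n -` E \<inter> space mu)) \<inter> (\<Inter>k. {u \<in> space mu. t' (n + k) u = t' n u})"
      by (auto simp: Y_def)
    also have "\<dots> \<in> sets mu" by (intro sets.Int sets.compl_sets 1 sets.countable_INT) (use 2 in \<open>auto simp del: space_mu\<close>)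
    finally show ?thesis .
  qed
  have "\<exists>n. 0 < measure mu (E' \<inter> Y n)"
  proof (rule ccontr)
    assume "\<not> ?thesis"
    then have "AE u in mu. u \<notin> E' \<inter> Y n" for n
      using measure_mu_pos_iff[of "E' \<inter> Y n"] E'(1) Ym[of n] by blast
    then have "AE u in mu. \<forall>n. u \<notin> E' \<inter> Y n" by (intro AE_all_countable[THEN iffD2] allI)
    with cov have "AE u in mu. u \<notin> E'" by eventually_elim blast
    then show False using E' measure_mu_pos_iff by blast
  qed
  then obtain n where n: "0 < measure mu (E' \<inter> Y n)" by blast
  have EY: "E' \<inter> Y n \<in> sets mu" using E' Ym by blast
  \<comment> \<open>Discarding \<open>E\<close> costs nothing up to null sets, because
    \<open>t' n\<close> takes \<open>Y n\<close> outside \<open>E\<close>; the last condition makes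
    the inversion exact.\<close>
  define Z where "Z = ((t n -` (E' \<inter> Y n) \<inter> space mu) - E) \<inter> {z \<in> space mu. t' n (t n z) = z}"
  have Zm: "Z \<in> sets mu"
  proof -
    have "t n -` (E' \<inter> Y n) \<inter> space mu \<in> sets mu" by (rule nsp_vimage_sets[OF t EY])
    moreover have "{z \<in> space mu. t' n (t n z) = z} \<in> sets mu"
      using measurable_compose[OF nsp_measurable(1)[OF t[of n]] nsp_borel(2)[OF t[of n]]] id_measurable_mu by measurable
    ultimately show ?thesis unfolding Z_def using sE by blast
  qed
  have Zpos: "0 < measure mu Z"
  proof (rule ccontr)
    assume "\<not> ?thesis"
    then have "AE u in mu. u \<notin> Z" using measure_mu_pos_iff[OF Zm] by blast
    from nsp_AE(2)[OF t[of n] this] nsp_fg[OF t[of n]] AE_space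
    have "AE u in mu. u \<notin> E' \<inter> Y n"
    proof eventually_elim
      case (elim u)
      have "t' n u \<in> space mu" using nsp_space(2)[OF t, of u n] elim(3) by simp
      then show ?case using elim(1,2) by (auto simp: Z_def Y_def)
    qed
    then show False using n measure_mu_pos_iff[OF EY] by blast
  qed
  \<comment> \<open>A point over \<open>Z\<close> has, through \<open>Y n\<close>, the same value
    under \<open>t' m\<close> as under \<open>t' n\<close>; applying \<open>t m\<close> identifies
    it with a point of \<open>E'\<close>.\<close>
  have mv: "AE s in mu. t' m s \<in> Z \<longrightarrow> s \<in> E'" if m: "n \<le> m" for m
  proof -
    obtain k where k: "m = n + k" using m le_Suc_ex by blast
    have "AE s in mu. t m (t' m (t n (t' m s))) = t n (t' m s)"
      by (rule nsp_AE(2)[OF t nsp_AE(1)[OF t nsp_fg[OF t]]])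
    with nsp_fg[OF t[of m]] show ?thesis
    proof eventually_elim
      case (elim s)
      show ?case
      proof
        assume z: "t' m s \<in> Z"
        define y0 where "y0 = t n (t' m s)"
        have y0: "y0 \<in> E'" "y0 \<in> Y n" "t' n y0 = t' m s" using z by (auto simp: Z_def y0_def)
        have "t' m y0 = t' m s" using y0(2,3) unfolding k Y_def by simp
        then have "t m (t' m y0) = s" using elim(1) by simp
        then have "y0 = s" using elim(2) by (simp add: y0_def)
        then show "s \<in> E'" using y0(1) by simp
      qed
    qed
  qed
  have "osc x Z (2 * d (a (t (n + k)) x) y)" for k
  proof -
    let ?m = "n + k"
    have xm: "a (t ?m) x \<in> X" by (rule a_closed[OF t x])
    have "osc (a (t ?m) x) E' (2 * d y (a (t ?m) x) + 0)" by (rule osc_perturb[OF y(1) xm E'(3)])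
    from osc_move[OF nsp_sym[OF t] xm mv this, of ?m]
    show ?thesis using a_inv[OF t x, of ?m] commute[of y] by simp
  qed
  moreover have "(\<lambda>k. 2 * d (a (t (n + k)) x) y) \<longlonglongrightarrow> 0"
    using tendsto_mult_right_zero[OF LIMSEQ_ignore_initial_segment[OF y(2), of n], of 2] by (simp add: add.commute)
  ultimately have "osc x Z 0" by (rule osc_limit)
  moreover have "Z \<inter> E = {}" by (auto simp: Z_def)
  ultimately show ?thesis using that[OF Zm _ Zpos] by simp
qed

lemma fixed_point:
  assumes x: "x \<in> X" and h: "nsp h h'"
  shows "a h x = x"
proof -
  obtain E where E: "compressible x E" "\<And>E'. compressible x E' \<Longrightarrow> measure mu E' \<le> measure mu E"
    using maximal_compressible[OF x] by blast
  have sE: "E \<in> sets mu" using E by (simp add: compressible_def)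
  obtain E0 where E0: "E0 \<in> sets mu" "0 < measure mu E0" "osc x E0 0" by (rule locally_fixed[OF x])
  have pos: "0 < measure mu E" using E(2)[OF compressible_fixed[OF x E0]] E0(2) by simp
  have "\<not> 0 < measure mu (space mu - E)"
  proof
    assume "0 < measure mu (space mu - E)"
    then obtain Z where Z: "Z \<in> sets mu" "Z \<inter> E = {}" "0 < measure mu Z" "osc x Z 0"
      by (rule fixed_outside_compressible[OF x E(1) pos])
    have "measure mu (E \<union> Z) \<le> measure mu E"
      by (rule E(2)[OF compressible_Un[OF x E(1) compressible_fixed[OF x Z(1,3,4)]]])
    moreover have "measure mu (E \<union> Z) = measure mu E + measure mu Z"
      by (rule mu.finite_measure_Union[OF sE Z(1)]) (use Z(2) in blast)
    ultimately show False using Z(3) by simp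
  qed
  then have "measure mu E = 1" using mu.finite_measure_compl[OF sE] mu.bounded_measure[of E] by simp
  then show ?thesis by (rule fixed_if_compressible_full[OF x E(1) _ h])
qed

lemma singleton: "x \<in> X \<Longrightarrow> X = {x}"
  using a_trans fixed_point by blast

end

section \<open>Roelcke precompactness\<close>

lemma indicator_mu:
  assumes "A \<in> sets mu"
  shows "integrable mu (indicator A :: real \<Rightarrow> real)" "(\<integral>x. indicator A x \<partial>mu) = measure mu A"
proof -
  show "integrable mu (indicator A :: real \<Rightarrow> real)"
    using assms by (intro integrable_real_indicator) (simp_all add: mu.emeasure_eq_measure)
  have "A \<inter> space mu = A" using sets.sets_into_space[OF assms] by auto
  then show "(\<integral>x. indicator A x \<partial>mu) = measure mu A" using assms by simp
qed

lemma gdist_one: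
  assumes a: "nst f g w"
  shows "gdist (autstar_class f) autstar_one = (\<integral>x. \<bar>w x - 1\<bar> \<partial>mu) + (\<integral>x. \<bar>w x * g x - x\<bar> \<partial>mu)"
proof -
  have o: "opr 1 g w k x = w x * k (g x)" for k x using nst_nonneg[OF a, of x] by (simp add: opr_def)
  have i: "opr 1 (\<lambda>x. x) (\<lambda>x. 1) k x = k x" for k x by (simp add: opr_def)
  have e: "pdist (autstar_class f) autstar_one k = (\<integral>x. \<bar>w x * k (g x) - k x\<bar> \<partial>mu)" if k: "k \<in> Lp_rep 1" for k
  proof -
    have "pdist (autstar_class f) autstar_one k = nrm 1 (\<lambda>x. opr 1 g w k x - opr 1 (\<lambda>x. x) (\<lambda>x. 1) k x)"
      unfolding pdist_def autstar_one_class
      using Phi_class[OF a _ k] Phi_class[OF nst_id _ k] lp_dist_class[OF _ opr_Lp[OF a _ k] opr_Lp[OF nst_id _ k]] by simp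
    then show ?thesis by (simp add: nrm_1 o i)
  qed
  show ?thesis using e[OF Lp_rep_const[of 1]] e[OF L1_id] by (simp add: gdist_def)
qed

lemma nst_density_integral:
  assumes a: "nst f g w" and A: "A \<in> sets mu"
  shows "integrable mu (\<lambda>x. w x * indicator A (g x))" "(\<integral>x. w x * indicator A (g x) \<partial>mu) = measure mu A"
    "integrable mu w" "(\<integral>x. w x \<partial>mu) = 1"
proof -
  have "(indicator A :: real \<Rightarrow> real) \<in> borel_measurable mu" using A by simp
  from nst_integral[OF a this]
  show "integrable mu (\<lambda>x. w x * indicator A (g x))" "(\<integral>x. w x * indicator A (g x) \<partial>mu) = measure mu A"
    using indicator_mu[OF A] by simp_all
  show "integrable mu w" "(\<integral>x. w x \<partial>mu) = 1" using nst_integral[OF a, of "\<lambda>x. 1"] by auto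
qed

text \<open>Off \<open>A\<close> both integrands vanish. On \<open>A\<close> they are dominated by
  the density restricted to \<open>A\<close> plus the indicator of \<open>A\<close>, and each of
  these has integral \<open>measure mu A\<close>, as \<open>f\<close> preserves \<open>A\<close>;
  two terms of twice the measure give 4.\<close>

lemma gdist_small_support:
  assumes n: "nsp f g" and A [measurable]: "A \<in> sets mu" and s: "supp f A"
  shows "gdist (autstar_class f) autstar_one \<le> 4 * measure mu A"
proof -
  note a = nst_rnd[OF n]
  define w where "w = rnd f"
  note a = a[folded w_def]
  have inv: "AE x in mu. x \<in> A \<longleftrightarrow> f x \<in> A" using supp_invariant[OF n s] by eventually_elim simp
  have gs: "AE x in mu. x \<notin> A \<longrightarrow> g x = x" using supp_inverse[OF n s] by (simp add: supp_def)
  have gi: "AE x in mu. g x \<in> A \<longleftrightarrow> x \<in> A" by (rule supp_invariant[OF nsp_sym[OF n] supp_inverse[OF n s]])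
  have b: "nst (\<lambda>x. if x \<in> A then f x else x) (\<lambda>y. if y \<in> A then g y else y) (\<lambda>y. if y \<in> A then w y else 1)"
    by (rule nst_glue[OF a nst_id A A inv]) simp
  have "AE x in mu. f x = (if x \<in> A then f x else x)" using s[unfolded supp_def] by eventually_elim simp
  then have w1: "AE x in mu. w x = (if x \<in> A then w x else 1)" by (rule nst_unique[OF a b])
  have [measurable]: "w \<in> borel_measurable mu" "g \<in> borel_measurable mu" using nst_borel[OF a] nsp_borel[OF n] by auto
  let ?b = "\<lambda>x. w x * indicator A (g x) + indicator A x"
  have bi: "integrable mu ?b" using nst_density_integral(1)[OF a A] indicator_mu(1)[OF A] by (rule Bochner_Integration.integrable_add)
  have bI: "(\<integral>x. ?b x \<partial>mu) = 2 * measure mu A"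
    using nst_density_integral(1,2)[OF a A] indicator_mu[OF A] by simp
  have e1: "AE x in mu. \<bar>w x - 1\<bar> \<le> ?b x"
    using w1 gi
  proof eventually_elim
    case (elim x)
    show ?case using elim nst_nonneg[OF a, of x] by (auto simp: indicator_def split: if_splits)
  qed
  have e2: "AE x in mu. \<bar>w x * g x - x\<bar> \<le> ?b x"
    using w1 gi gs AE_space
  proof eventually_elim
    case (elim x)
    have g01: "g x \<in> {0..1}" using nsp_space(2)[OF n, of x] elim(4) by simp
    have "w x * g x \<le> w x" "0 \<le> w x * g x" using g01 nst_nonneg[OF a, of x] by (auto intro: mult_left_le)
    then show ?case using elim by (auto simp: indicator_def split: if_splits)
  qed
  have m2: "(\<lambda>x. \<bar>w x * g x - x\<bar>) \<in> borel_measurable mu" using id_measurable_mu by measurable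
  have "(\<integral>x. \<bar>w x - 1\<bar> \<partial>mu) \<le> (\<integral>x. ?b x \<partial>mu)"
    by (rule integral_mono_AE[OF _ bi e1]) (rule Bochner_Integration.integrable_bound[OF bi], use e1 in \<open>auto elim!: eventually_mono\<close>)
  moreover have "(\<integral>x. \<bar>w x * g x - x\<bar> \<partial>mu) \<le> (\<integral>x. ?b x \<partial>mu)"
    by (rule integral_mono_AE[OF _ bi e2]) (rule Bochner_Integration.integrable_bound[OF bi m2], use e2 in \<open>auto elim!: eventually_mono\<close>)
  ultimately show ?thesis using gdist_one[OF a] bI by simp
qed

text \<open>Write \<open>w x * g x - x\<close> as \<open>(w x - 1) * g x + (g x - x)\<close>. The
  identity vector thus costs \<open>c' + c\<close>, and the constant vector \<open>c'\<close> once
  more.\<close>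

lemma gdist_coarse:
  assumes a: "nst f g w" and c: "AE x in mu. \<bar>g x - x\<bar> \<le> c" and I: "(\<integral>x. \<bar>w x - 1\<bar> \<partial>mu) \<le> c'"
  shows "gdist (autstar_class f) autstar_one \<le> 2 * c' + c"
proof -
  have [measurable]: "w \<in> borel_measurable mu" "g \<in> borel_measurable mu" using nst_borel[OF a] nsp_borel[OF nst_nsp[OF a]] by auto
  have i: "integrable mu (\<lambda>x. \<bar>w x - 1\<bar>)" using nst_density_integral(3)[OF a sets.top] by auto
  have le: "AE x in mu. \<bar>w x * g x - x\<bar> \<le> \<bar>w x - 1\<bar> + c"
    using c AE_space
  proof eventually_elim
    case (elim x)
    have g01: "g x \<in> {0..1}" using nsp_space(2)[OF nst_nsp[OF a], of x] elim(2) by simp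
    have "w x * g x - x = (w x - 1) * g x + (g x - x)" by (simp add: algebra_simps)
    then have "\<bar>w x * g x - x\<bar> \<le> \<bar>w x - 1\<bar> * \<bar>g x\<bar> + \<bar>g x - x\<bar>" using abs_triangle_ineq[of "(w x - 1) * g x" "g x - x"] by (simp add: abs_mult)
    also have "\<bar>w x - 1\<bar> * \<bar>g x\<bar> \<le> \<bar>w x - 1\<bar>" using g01 by (intro mult_left_le) auto
    finally show ?case using elim(1) by simp
  qed
  have m2: "(\<lambda>x. \<bar>w x * g x - x\<bar>) \<in> borel_measurable mu" using id_measurable_mu by measurable
  have bi: "integrable mu (\<lambda>x. \<bar>w x - 1\<bar> + c)" using i by simp
  have "(\<integral>x. \<bar>w x * g x - x\<bar> \<partial>mu) \<le> (\<integral>x. \<bar>w x - 1\<bar> + c \<partial>mu)"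
    by (rule integral_mono_AE[OF _ bi le]) (rule Bochner_Integration.integrable_bound[OF bi m2], use le in \<open>auto elim!: eventually_mono\<close>)
  also have "\<dots> = (\<integral>x. \<bar>w x - 1\<bar> \<partial>mu) + c" using i by simp
  finally show ?thesis using gdist_one[OF a] I by simp
qed

lemma integral_labels:
  fixes l :: "real \<Rightarrow> nat" and h :: "nat \<Rightarrow> real"
  assumes l: "l \<in> mu \<rightarrow>\<^sub>M count_space UNIV" and L: "finite L" "\<And>x. x \<in> space mu \<Longrightarrow> l x \<in> L"
  shows "integrable mu (\<lambda>x. h (l x))" "(\<integral>x. h (l x) \<partial>mu) = (\<Sum>n\<in>L. h n * measure mu (lset l n))"
proof -
  have e: "h (l x) = (\<Sum>n\<in>L. h n * indicator (lset l n) x)" if "x \<in> space mu" for x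
  proof -
    have "(\<Sum>n\<in>L. h n * indicator (lset l n) x) = (\<Sum>n\<in>L. if n = l x then h n else 0)"
      using that by (intro sum.cong refl) (auto simp: lset_def indicator_def)
    also have "\<dots> = h (l x)" using L that by simp
    finally show ?thesis by simp
  qed
  have i: "integrable mu (\<lambda>x. h n * indicator (lset l n) x)" for n
    using indicator_mu(1)[OF lset_sets[OF l, of n]] by simp
  have I: "(\<integral>x. h n * indicator (lset l n) x \<partial>mu) = h n * measure mu (lset l n)" for n
    using indicator_mu[OF lset_sets[OF l, of n]] by simp
  have "integrable mu (\<lambda>x. h (l x)) \<longleftrightarrow> integrable mu (\<lambda>x. \<Sum>n\<in>L. h n * indicator (lset l n) x)"
    by (rule Bochner_Integration.integrable_cong[OF refl e])
  then show "integrable mu (\<lambda>x. h (l x))" using i by (auto intro: Bochner_Integration.integrable_sum)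
  have "(\<integral>x. h (l x) \<partial>mu) = (\<integral>x. (\<Sum>n\<in>L. h n * indicator (lset l n) x) \<partial>mu)"
    by (rule Bochner_Integration.integral_cong[OF refl e])
  also have "\<dots> = (\<Sum>n\<in>L. \<integral>x. h n * indicator (lset l n) x \<partial>mu)" by (rule Bochner_Integration.integral_sum) (rule i)
  finally show "(\<integral>x. h (l x) \<partial>mu) = (\<Sum>n\<in>L. h n * measure mu (lset l n))" by (simp only: I)
qed

text \<open>Because \<open>w\<close> and 1 have the same integral, \<open>\<bar>w - 1\<bar>\<close> is controlled by lower bounds on \<open>w\<close> alone.\<close>

lemma density_near_one:
  fixes m :: "real \<Rightarrow> nat"
  assumes a: "nst u u' w" and m: "m \<in> mu \<rightarrow>\<^sub>M count_space UNIV" and L: "finite L" "\<And>x. x \<in> space mu \<Longrightarrow> m x \<in> L"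
    and \<beta>: "\<And>n. 0 \<le> \<beta> n" "(\<Sum>n\<in>L. \<beta> n) \<le> 1" and \<kappa>: "(\<Sum>n\<in>L. \<bar>measure mu (lset m n) - \<beta> n\<bar>) \<le> \<kappa>"
    and \<theta>: "0 \<le> \<theta>" "\<theta> \<le> 1" and B: "B \<in> sets mu" "measure mu B \<le> \<delta>"
    and le: "AE y in mu. y \<notin> B \<longrightarrow> \<theta> * (\<beta> (m y) / measure mu (lset m (m y))) \<le> w y"
  shows "(\<integral>x. \<bar>w x - 1\<bar> \<partial>mu) \<le> 2 * (\<kappa> + (1 - \<theta>) + \<delta>)"
proof -
  define \<alpha> where "\<alpha> n = measure mu (lset m n)" for n
  define h where "h n = max 0 (1 - \<theta> * (\<beta> n / \<alpha> n))" for n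
  note wi = nst_density_integral(3,4)[OF a sets.top]
  have [measurable]: "w \<in> borel_measurable mu" "B \<in> sets mu" using nst_borel[OF a] B by auto
  note hi = integral_labels[OF m L, of h]
  have pi: "integrable mu (\<lambda>x. max 0 (1 - w x))" using wi(1) by auto
  have hB: "integrable mu (\<lambda>x. h (m x) + indicator B x)" using hi(1) indicator_mu(1)[OF B(1)] by (rule Bochner_Integration.integrable_add)
  have "(\<integral>x. max 0 (1 - w x) \<partial>mu) \<le> (\<integral>x. h (m x) + indicator B x \<partial>mu)"
  proof (rule integral_mono_AE[OF pi hB])
    show "AE x in mu. max 0 (1 - w x) \<le> h (m x) + indicator B x"
      using le
    proof eventually_elim
      case (elim x)
      have "0 \<le> h (m x)" by (simp add: h_def)
      then show ?case using elim nst_nonneg[OF a, of x] by (cases "x \<in> B") (auto simp: h_def \<alpha>_def)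
    qed
  qed
  also have "\<dots> = (\<Sum>n\<in>L. h n * \<alpha> n) + measure mu B" using hi indicator_mu[OF B(1)] by (simp add: \<alpha>_def)
  also have "(\<Sum>n\<in>L. h n * \<alpha> n) \<le> (\<Sum>n\<in>L. \<bar>\<alpha> n - \<beta> n\<bar> + (1 - \<theta>) * \<beta> n)"
  proof (rule sum_mono)
    fix n
    show "h n * \<alpha> n \<le> \<bar>\<alpha> n - \<beta> n\<bar> + (1 - \<theta>) * \<beta> n"
    proof (cases "\<alpha> n = 0")
      case True
      then show ?thesis using \<beta>(1)[of n] \<theta> by simp
    next
      case False
      then have "0 < \<alpha> n" using measure_nonneg[of mu "lset m n"] by (simp add: \<alpha>_def less_le)
      moreover from this have "(1 - \<theta> * (\<beta> n / \<alpha> n)) * \<alpha> n = \<alpha> n - \<theta> * \<beta> n" by (simp add: left_diff_distrib)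
      ultimately have "h n * \<alpha> n = max 0 (\<alpha> n - \<theta> * \<beta> n)" unfolding h_def max_mult_distrib_right by simp
      also have "\<dots> \<le> \<bar>\<alpha> n - \<beta> n\<bar> + (1 - \<theta>) * \<beta> n"
      proof -
        have "0 \<le> (1 - \<theta>) * \<beta> n" using \<theta> \<beta>(1) by simp
        then show ?thesis by (simp add: algebra_simps)
      qed
      finally show ?thesis .
    qed
  qed
  also have "\<dots> = (\<Sum>n\<in>L. \<bar>\<alpha> n - \<beta> n\<bar>) + (1 - \<theta>) * (\<Sum>n\<in>L. \<beta> n)" by (simp add: sum.distrib sum_distrib_left)
  also have "(1 - \<theta>) * (\<Sum>n\<in>L. \<beta> n) \<le> 1 - \<theta>" using \<theta> \<beta>(2) by (intro mult_left_le) auto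
  finally have half: "(\<integral>x. max 0 (1 - w x) \<partial>mu) \<le> \<kappa> + (1 - \<theta>) + \<delta>" using \<kappa> B(2) by (simp add: \<alpha>_def)
  have "(\<integral>x. \<bar>w x - 1\<bar> \<partial>mu) = (\<integral>x. 2 * max 0 (1 - w x) + (w x - 1) \<partial>mu)"
    by (rule Bochner_Integration.integral_cong) (auto simp: max_def abs_if)
  also have "\<dots> = 2 * (\<integral>x. max 0 (1 - w x) \<partial>mu)" using pi wi by simp
  finally show ?thesis using half by simp
qed

section \<open>Discrete data of a group element\<close>

lemma floor_label_close:
  fixes N :: nat
  assumes "0 < N" "0 \<le> x" "0 \<le> y" "nat \<lfloor>real N * x\<rfloor> = nat \<lfloor>real N * y\<rfloor>"
  shows "\<bar>x - y\<bar> \<le> 1 / real N"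
proof -
  have "\<lfloor>real N * x\<rfloor> = \<lfloor>real N * y\<rfloor>" using assms by (simp add: eq_nat_nat_iff)
  then have "\<bar>real N * x - real N * y\<bar> < 1" by linarith
  then have "real N * \<bar>x - y\<bar> < 1" using assms(1) by (simp only: right_diff_distrib[symmetric] abs_mult abs_of_nat)
  then show ?thesis using assms(1) by (simp add: field_simps)
qed

text \<open>0 and 1 mark the exceptional small and large densities. The range between \<delta> and
  \<open>1 / \<delta>\<close> is cut geometrically with ratio \<rho>, so that equal levels mean
  densities comparable up to \<rho>, with finitely many levels in all.\<close>

definition level :: "real \<Rightarrow> real \<Rightarrow> real \<Rightarrow> nat" where
  "level \<rho> \<delta> v = (if v < \<delta> then 0 else if 1 / \<delta> \<le> v then 1 else 2 + nat \<lfloor>log \<rho> (v / \<delta>)\<rfloor>)"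

lemma level_le:
  assumes "1 < \<rho>" "0 < \<delta>" shows "level \<rho> \<delta> v \<le> 2 + nat \<lfloor>log \<rho> (1 / \<delta> / \<delta>)\<rfloor>"
proof -
  have "log \<rho> (v / \<delta>) \<le> log \<rho> (1 / \<delta> / \<delta>)" if "\<delta> \<le> v" "v < 1 / \<delta>"
    using that assms by (intro log_mono divide_right_mono) auto
  then show ?thesis unfolding level_def by (auto intro!: nat_mono floor_mono)
qed

lemma level_eq_ratio:
  assumes "1 < \<rho>" "0 < \<delta>" and e: "level \<rho> \<delta> v = level \<rho> \<delta> v'" and ne: "level \<rho> \<delta> v \<noteq> 0" "level \<rho> \<delta> v \<noteq> 1"
  shows "0 < v" "0 < v'" "v \<le> \<rho> * v'"
proof -
  have v: "\<delta> \<le> v" "\<delta> \<le> v'" "level \<rho> \<delta> v = 2 + nat \<lfloor>log \<rho> (v / \<delta>)\<rfloor>" "level \<rho> \<delta> v' = 2 + nat \<lfloor>log \<rho> (v' / \<delta>)\<rfloor>"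
    using ne e by (auto simp: level_def split: if_splits)
  show p: "0 < v" "0 < v'" using v assms by auto
  have 1: "0 \<le> log \<rho> (v / \<delta>)" "0 \<le> log \<rho> (v' / \<delta>)" using v assms by (auto simp: zero_le_log_cancel_iff p)
  have "nat \<lfloor>log \<rho> (v / \<delta>)\<rfloor> = nat \<lfloor>log \<rho> (v' / \<delta>)\<rfloor>" using v e by simp
  then have "\<lfloor>log \<rho> (v / \<delta>)\<rfloor> = \<lfloor>log \<rho> (v' / \<delta>)\<rfloor>" using 1 by (simp add: eq_nat_nat_iff)
  then have "log \<rho> (v / \<delta>) \<le> 1 + log \<rho> (v' / \<delta>)" by linarith
  also have "\<dots> = log \<rho> (\<rho> * (v' / \<delta>))" using assms p by (subst log_mult) auto
  finally have "v / \<delta> \<le> \<rho> * (v' / \<delta>)" using assms p by (subst (asm) log_le_cancel_iff) auto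
  then show "v \<le> \<rho> * v'" using assms by (simp add: field_simps)
qed

lemma level_measurable: "level \<rho> \<delta> \<in> borel \<rightarrow>\<^sub>M count_space UNIV"
  unfolding level_def[abs_def] by measurable

text \<open>The density is read at \<open>f x\<close> because it lives on the target side. Coding
  the triple by one number lets the partition be used as a labelling.\<close>

definition glabel :: "nat \<Rightarrow> real \<Rightarrow> real \<Rightarrow> (real \<Rightarrow> real) \<Rightarrow> (real \<Rightarrow> real) \<Rightarrow> real \<Rightarrow> nat" where
  "glabel N \<rho> \<delta> f w x = to_nat (nat \<lfloor>real N * x\<rfloor>, nat \<lfloor>real N * f x\<rfloor>, level \<rho> \<delta> (w (f x)))"

lemma glabel_measurable:
  assumes a: "nst f g w"
  shows "glabel N \<rho> \<delta> f w \<in> mu \<rightarrow>\<^sub>M count_space UNIV"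
proof -
  have f: "f \<in> mu \<rightarrow>\<^sub>M mu" using nsp_measurable[OF nst_nsp[OF a]] by simp
  have fl: "(\<lambda>x. nat \<lfloor>real N * x\<rfloor>) \<in> mu \<rightarrow>\<^sub>M count_space UNIV" using id_measurable_mu by measurable
  have fl2: "(\<lambda>x. nat \<lfloor>real N * f x\<rfloor>) \<in> mu \<rightarrow>\<^sub>M count_space UNIV" by (rule measurable_compose[OF f fl])
  have lv: "(\<lambda>x. level \<rho> \<delta> (w (f x))) \<in> mu \<rightarrow>\<^sub>M count_space UNIV"
    by (rule measurable_compose[OF measurable_compose[OF f nst_borel[OF a]] level_measurable])
  have "(\<lambda>x. to_nat (i, j, level \<rho> \<delta> (w (f x)))) \<in> mu \<rightarrow>\<^sub>M count_space UNIV" for i j :: nat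
    by (rule measurable_compose[OF lv]) simp
  then have "(\<lambda>x. to_nat (i, nat \<lfloor>real N * f x\<rfloor>, level \<rho> \<delta> (w (f x)))) \<in> mu \<rightarrow>\<^sub>M count_space UNIV" for i :: nat
    by (rule measurable_compose_countable[OF _ fl2])
  then show ?thesis unfolding glabel_def[abs_def] by (rule measurable_compose_countable[OF _ fl])
qed

definition glabels :: "nat \<Rightarrow> real \<Rightarrow> real \<Rightarrow> nat set" where
  "glabels N \<rho> \<delta> = to_nat ` ({0..N} \<times> {0..N} \<times> {0..2 + nat \<lfloor>log \<rho> (1 / \<delta> / \<delta>)\<rfloor>})"

lemma finite_glabels: "finite (glabels N \<rho> \<delta>)"
  by (simp add: glabels_def)

lemma glabel_in:
  assumes a: "nsp f g" and p: "1 < \<rho>" "0 < \<delta>" and x: "x \<in> space mu"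
  shows "glabel N \<rho> \<delta> f w x \<in> glabels N \<rho> \<delta>"
proof -
  have fl: "nat \<lfloor>real N * y\<rfloor> \<le> N" if "y \<in> {0..1}" for y
  proof -
    have "real N * y \<le> real N" using that by (simp add: mult_left_le)
    then have "\<lfloor>real N * y\<rfloor> \<le> int N" by linarith
    then show ?thesis by simp
  qed
  have "x \<in> {0..1}" "f x \<in> {0..1}" using x nsp_space(1)[OF a, of x] by simp_all
  then show ?thesis unfolding glabel_def glabels_def
    using fl[of x] fl[of "f x"] level_le[OF p, of "w (f x)"] by (intro imageI) auto
qed

lemma lset_vimage:
  assumes n: "nsp f g" shows "lset (l \<circ> g) n = g -` lset l n \<inter> space mu"
  using nsp_space(2)[OF n] unfolding lset_def space_mu by (auto simp del: atLeastAtMost_iff)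

lemma lset_comp_null:
  assumes n: "nsp f g" and l: "l \<in> mu \<rightarrow>\<^sub>M count_space UNIV"
  shows "measure mu (lset (l \<circ> g) k) = 0 \<longleftrightarrow> measure mu (lset l k) = 0"
proof -
  have s: "lset l k \<in> sets mu" by (rule lset_sets[OF l])
  have n0: "measure mu A = 0 \<longleftrightarrow> \<not> 0 < measure mu A" for A using measure_nonneg[of mu A] by linarith
  have "0 < measure mu (lset l k) \<longrightarrow> 0 < measure mu (g -` lset l k \<inter> space mu)"
    using nsp_vimage_pos[OF nsp_sym[OF n] s] by blast
  moreover have "\<not> 0 < measure mu (g -` lset l k \<inter> space mu)" if "\<not> 0 < measure mu (lset l k)"
  proof -
    have "AE x in mu. x \<notin> lset l k" using that measure_mu_pos_iff[OF s] by blast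
    from nsp_AE(2)[OF n this] have "AE x in mu. x \<notin> g -` lset l k \<inter> space mu" by eventually_elim simp
    then show ?thesis using measure_mu_pos_iff[OF nsp_vimage_sets[OF nsp_sym[OF n] s]] by blast
  qed
  ultimately show ?thesis unfolding lset_vimage[OF n] n0 by blast
qed

lemma sum_lset_le_one:
  assumes l: "l \<in> mu \<rightarrow>\<^sub>M count_space UNIV" and L: "finite L" "\<And>x. x \<in> space mu \<Longrightarrow> l x \<in> L"
  shows "(\<Sum>n\<in>L. measure mu (lset l n)) \<le> 1"
  using integral_labels(2)[OF l L, of "\<lambda>_. 1"] by simp

text \<open>In \<open>u \<circ> f' \<circ> v = f\<close> either factor determines the other. Where
  the level is not small, \<open>v\<close> is the relabelling of source pieces and \<open>u\<close>
  is forced; where it is small, \<open>u\<close> is the relabelling of image pieces and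
  \<open>v\<close> is forced. Relabellings have densities near 1 because the masses nearly agree. A
  forced \<open>v\<close> occurs only on small source measure; a forced \<open>u\<close> has density
  nearly constant on pieces, except on the small image of the large level. Equal labels keep both
  factors close to the identity pointwise.\<close>

lemma roelcke_factor:
  fixes N :: nat
  assumes a: "nst f g w" and b: "nst f' g' w'" and N: "0 < N" and \<rho>: "1 < \<rho>" and \<delta>: "0 < \<delta>"
  defines "l \<equiv> glabel N \<rho> \<delta> f w" and "l' \<equiv> glabel N \<rho> \<delta> f' w'" and "L \<equiv> glabels N \<rho> \<delta>"
  assumes null: "\<And>n. n \<in> L \<Longrightarrow> measure mu (lset l n) = 0 \<longleftrightarrow> measure mu (lset l' n) = 0"
    and q: "(\<Sum>n\<in>L. \<bar>measure mu (lset l n) - measure mu (lset l' n)\<bar>) \<le> \<kappa>"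
    and p: "(\<Sum>n\<in>L. \<bar>measure mu (lset (l \<circ> g) n) - measure mu (lset (l' \<circ> g') n)\<bar>) \<le> \<kappa>"
  obtains u u' wu v v' wv where "nst u u' wu" "nst v v' wv" "AE x in mu. u (f' (v x)) = f x"
    "AE y in mu. \<bar>u' y - y\<bar> \<le> 1 / real N" "AE y in mu. \<bar>v' y - y\<bar> \<le> 1 / real N"
    "(\<integral>x. \<bar>wu x - 1\<bar> \<partial>mu) \<le> 2 * (\<kappa> + (1 - 1 / \<rho>\<^sup>2) + \<delta>)" "(\<integral>x. \<bar>wv x - 1\<bar> \<partial>mu) \<le> 2 * (\<kappa> + \<delta>)"
proof -
  note na = nst_nsp[OF a] and nb = nst_nsp[OF b]
  have lm: "l \<in> mu \<rightarrow>\<^sub>M count_space UNIV" "l' \<in> mu \<rightarrow>\<^sub>M count_space UNIV"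
    unfolding l_def l'_def by (rule glabel_measurable[OF a], rule glabel_measurable[OF b])
  have Lf: "finite L" unfolding L_def by (rule finite_glabels)
  have lL: "x \<in> space mu \<Longrightarrow> l x \<in> L" "x \<in> space mu \<Longrightarrow> l' x \<in> L" for x
    unfolding l_def l'_def L_def by (rule glabel_in[OF na \<rho> \<delta>], simp, rule glabel_in[OF nb \<rho> \<delta>], simp)
  define m where "m = l \<circ> g"
  define m' where "m' = l' \<circ> g'"
  have gs: "x \<in> space mu \<Longrightarrow> g x \<in> space mu" "x \<in> space mu \<Longrightarrow> g' x \<in> space mu" for x
    using nsp_space(2)[OF na, of x] nsp_space(2)[OF nb, of x] by simp_all
  have mm: "m \<in> mu \<rightarrow>\<^sub>M count_space UNIV" "m' \<in> mu \<rightarrow>\<^sub>M count_space UNIV"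
    unfolding m_def m'_def using lm nsp_measurable[OF na] nsp_measurable[OF nb] by (auto intro: measurable_comp)
  have mL: "x \<in> space mu \<Longrightarrow> m x \<in> L" "x \<in> space mu \<Longrightarrow> m' x \<in> L" for x
    using lL gs by (auto simp: m_def m'_def)
  have lsetL: "lset k n = {}" if "\<And>x. x \<in> space mu \<Longrightarrow> k x \<in> L" "n \<notin> L" for k n using that by (auto simp: lset_def)
  have null': "measure mu (lset l n) = 0 \<longleftrightarrow> measure mu (lset l' n) = 0" for n
    using null[of n] lsetL[of l n] lsetL[of l' n] lL by (cases "n \<in> L") auto
  have nullm: "measure mu (lset m' n) = 0 \<longleftrightarrow> measure mu (lset m n) = 0" for n
    unfolding m_def m'_def lset_comp_null[OF na lm(1)] lset_comp_null[OF nb lm(2)] using null'[of n] by simp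
  obtain v0 v0' where v0: "nst v0 v0' (\<lambda>y. measure mu (lset l (l' y)) / measure mu (lset l' (l' y)))" "AE x in mu. l' (v0 x) = l x"
    by (rule relabelling_iso[OF lm null'])
  obtain u0 u0' where u0: "nst u0 u0' (\<lambda>y. measure mu (lset m' (m y)) / measure mu (lset m (m y)))" "AE x in mu. m (u0 x) = m' x"
    by (rule relabelling_iso[OF mm(2,1) nullm])
  define wv0 where "wv0 y = measure mu (lset l (l' y)) / measure mu (lset l' (l' y))" for y
  define wu0 where "wu0 y = measure mu (lset m' (m y)) / measure mu (lset m (m y))" for y
  have v0n: "nst v0 v0' wv0" unfolding wv0_def[abs_def] by (rule v0(1))
  have u0n: "nst u0 u0' wu0" unfolding wu0_def[abs_def] by (rule u0(1))
  note nv0 = nst_nsp[OF v0n] and nu0 = nst_nsp[OF u0n]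
  have u0i: "AE y in mu. m' (u0' y) = m y"
    using nsp_AE(2)[OF nu0 u0(2)] nsp_fg[OF nu0] by eventually_elim simp
  have v0i: "AE z in mu. l (v0' z) = l' z"
    using nsp_AE(2)[OF nv0 v0(2)] nsp_fg[OF nv0] by eventually_elim simp
  have mf: "AE x in mu. m (f x) = l x" using nsp_gf[OF na] by eventually_elim (simp add: m_def)
  have mf': "AE x in mu. m' (f' x) = l' x" using nsp_gf[OF nb] by eventually_elim (simp add: m'_def)
  \<comment> \<open>The value of \<open>v\<close> forced by \<open>u0\<close>, obtained by solving
    for \<open>v\<close>.\<close>
  define v1 where "v1 = g' \<circ> (u0' \<circ> f)"
  have v1n: "\<exists>v1' wv1. nst v1 v1' wv1"
    unfolding v1_def using nst_comp[OF nst_inverse[OF b] nst_comp[OF nst_inverse[OF u0n] a]] by blast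
  then obtain v1' wv1 where v1n: "nst v1 v1' wv1" by blast
  have v1l: "AE x in mu. l' (v1 x) = l x"
    using nsp_AE(1)[OF na u0i] mf by eventually_elim (simp add: v1_def m'_def)
  \<comment> \<open>The value of \<open>u\<close> forced by \<open>v0\<close>, obtained by solving
    for \<open>u\<close>.\<close>
  define u1 where "u1 = f \<circ> (v0' \<circ> g')"
  define u1' where "u1' = (f' \<circ> v0) \<circ> g"
  define wu1 where "wu1 y = w y * (1 / wv0 (v0 (g y)) * (1 / w' (f' (v0 (g y)))))" for y
  have u1n: "nst u1 u1' wu1"
    unfolding u1_def u1'_def wu1_def[abs_def] using nst_comp[OF a nst_comp[OF nst_inverse[OF v0n] nst_inverse[OF b]]] by simp
  have u1l: "AE y in mu. m (u1 y) = m' y"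
    using nsp_AE(2)[OF nb nsp_AE(2)[OF nv0 mf]] nsp_AE(2)[OF nb v0i]
    by eventually_elim (simp add: u1_def m'_def)
  \<comment> \<open>The labels with level other than 0. The large level 1 belongs to them, so there
    \<open>v\<close> is the relabelling and \<open>u\<close> is forced.\<close>
  define NZ where "NZ = {n. \<exists>i j k. n = to_nat (i :: nat, j :: nat, k :: nat) \<and> k \<noteq> 0}"
  have lNZ: "l x \<in> NZ \<longleftrightarrow> level \<rho> \<delta> (w (f x)) \<noteq> 0" "l' x \<in> NZ \<longleftrightarrow> level \<rho> \<delta> (w' (f' x)) \<noteq> 0" for x
    by (auto simp: l_def l'_def glabel_def NZ_def)
  have vs: "k -` NZ \<inter> space mu \<in> sets mu" if "k \<in> mu \<rightarrow>\<^sub>M count_space UNIV" for k :: "real \<Rightarrow> nat"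
    by (rule measurable_sets[OF that]) simp
  have glue_iff: "AE x in mu. x \<in> k -` NZ \<inter> space mu \<longleftrightarrow> h x \<in> k' -` NZ \<inter> space mu"
    if "nsp h h'" "AE x in mu. k' (h x) = k x" for h h' k k'
    using that(2) AE_space
  proof eventually_elim
    case (elim x)
    have "h x \<in> space mu" using nsp_space(1)[OF that(1), of x] elim(2) by simp
    then show ?case using elim by auto
  qed
  define v where "v x = (if x \<in> l -` NZ \<inter> space mu then v0 x else v1 x)" for x
  define v' where "v' y = (if y \<in> l' -` NZ \<inter> space mu then v0' y else v1' y)" for y
  define wv where "wv y = (if y \<in> l' -` NZ \<inter> space mu then wv0 y else wv1 y)" for y
  have vn: "nst v v' wv"
    unfolding v_def[abs_def] v'_def[abs_def] wv_def[abs_def]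
    by (rule nst_glue[OF v0n v1n vs[OF lm(1)] vs[OF lm(2)] glue_iff[OF nv0 v0(2)] glue_iff[OF nst_nsp[OF v1n] v1l]])
  define u where "u x = (if x \<in> m' -` NZ \<inter> space mu then u1 x else u0 x)" for x
  define u' where "u' y = (if y \<in> m -` NZ \<inter> space mu then u1' y else u0' y)" for y
  define wu where "wu y = (if y \<in> m -` NZ \<inter> space mu then wu1 y else wu0 y)" for y
  have un: "nst u u' wu"
    unfolding u_def[abs_def] u'_def[abs_def] wu_def[abs_def]
    by (rule nst_glue[OF u1n u0n vs[OF mm(2)] vs[OF mm(1)] glue_iff[OF nst_nsp[OF u1n] u1l] glue_iff[OF nu0 u0(2)]])
  have vl: "AE x in mu. l' (v x) = l x" using v0(2) v1l by eventually_elim (simp add: v_def)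
  have ul: "AE x in mu. m (u x) = m' x" using u1l u0(2) by eventually_elim (simp add: u_def)
  have fact: "AE x in mu. u (f' (v x)) = f x"
    using AE_space v0(2) nsp_AE(1)[OF nv0 mf'] nsp_AE(1)[OF nv0 nsp_gf[OF nb]] nsp_gf[OF nv0]
      nsp_AE(1)[OF na nsp_AE(2)[OF nu0 nsp_fg[OF nb]]] nsp_AE(1)[OF na u0i] mf nsp_AE(1)[OF na nsp_fg[OF nu0]]
  proof eventually_elim
    case (elim x)
    show ?case
    proof (cases "l x \<in> NZ")
      case True
      then have vx: "v x = v0 x" using elim(1) by (simp add: v_def)
      have "v0 x \<in> space mu" "f' (v0 x) \<in> space mu"
        using nsp_space(1)[OF nv0, of x] nsp_space(1)[OF nb, of "v0 x"] elim(1) by simp_all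
      moreover have "m' (f' (v0 x)) \<in> NZ" using True elim(2,3) by simp
      ultimately have "u (f' (v x)) = u1 (f' (v0 x))" using vx by (simp add: u_def)
      then show ?thesis using elim(4,5) by (simp add: u1_def)
    next
      case False
      then have vx: "v x = g' (u0' (f x))" by (simp add: v_def v1_def)
      have "f' (v x) = u0' (f x)" using vx elim(6) by simp
      moreover have "m' (u0' (f x)) \<notin> NZ" using False elim(7,8) by simp
      ultimately have "u (f' (v x)) = u0 (u0' (f x))" by (simp add: u_def)
      then show ?thesis using elim(9) by simp
    qed
  qed
  have first: "nat \<lfloor>real N * x\<rfloor> = nat \<lfloor>real N * y\<rfloor>" if "l x = l' y" for x y
    using that by (simp add: l_def l'_def glabel_def)
  have vclose: "AE y in mu. \<bar>v' y - y\<bar> \<le> 1 / real N"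
    using nsp_AE(2)[OF nst_nsp[OF vn] vl] nsp_fg[OF nst_nsp[OF vn]] AE_space
  proof eventually_elim
    case (elim y)
    have "v' y \<in> {0..1}" using nsp_space(2)[OF nst_nsp[OF vn], of y] elim(3) by simp
    moreover have "nat \<lfloor>real N * v' y\<rfloor> = nat \<lfloor>real N * y\<rfloor>" using first[of "v' y" y] elim(1,2) by simp
    ultimately show ?case using elim(3) by (intro floor_label_close[OF N]) auto
  qed
  have second: "nat \<lfloor>real N * f x\<rfloor> = nat \<lfloor>real N * f' y\<rfloor>" if "l x = l' y" for x y
    using that by (simp add: l_def l'_def glabel_def)
  have uclose: "AE y in mu. \<bar>u' y - y\<bar> \<le> 1 / real N"
    using nsp_AE(2)[OF nst_nsp[OF un] ul] nsp_fg[OF nst_nsp[OF un]] AE_space nsp_fg[OF na] nsp_AE(2)[OF nst_nsp[OF un] nsp_fg[OF nb]]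
  proof eventually_elim
    case (elim y)
    have "u' y \<in> {0..1}" using nsp_space(2)[OF nst_nsp[OF un], of y] elim(3) by simp
    moreover have "l (g y) = l' (g' (u' y))" using elim(1,2) by (simp add: m_def m'_def)
    from second[OF this] have "nat \<lfloor>real N * u' y\<rfloor> = nat \<lfloor>real N * y\<rfloor>" using elim(4,5) by simp
    ultimately show ?case using elim(3) by (intro floor_label_close[OF N]) auto
  qed
  have wvI: "(\<integral>x. \<bar>wv x - 1\<bar> \<partial>mu) \<le> 2 * (\<kappa> + (1 - 1) + \<delta>)"
  proof (rule density_near_one[OF vn lm(2) Lf lL(2), where B="space mu - (l' -` NZ \<inter> space mu)" and \<beta>="\<lambda>n. measure mu (lset l n)"])
    show "(\<Sum>n\<in>L. measure mu (lset l n)) \<le> 1" by (rule sum_lset_le_one[OF lm(1) Lf lL(1)])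
    show "(\<Sum>n\<in>L. \<bar>measure mu (lset l' n) - measure mu (lset l n)\<bar>) \<le> \<kappa>" using q by (simp add: abs_minus_commute)
    show "space mu - (l' -` NZ \<inter> space mu) \<in> sets mu" by (rule sets.compl_sets[OF vs[OF lm(2)]])
    show "AE y in mu. y \<notin> space mu - (l' -` NZ \<inter> space mu) \<longrightarrow> 1 * (measure mu (lset l (l' y)) / measure mu (lset l' (l' y))) \<le> wv y"
      using AE_space by eventually_elim (simp add: wv_def wv0_def)
    have [measurable]: "w' \<in> borel_measurable mu" by (rule nst_borel[OF b])
    \<comment> \<open>The set where \<open>v\<close> is forced is the preimage of the set of small
      density; its measure is the integral of \<open>w'\<close> over the latter, hence at most
      \<delta>.\<close>
    define A where "A = {y \<in> space mu. w' y < \<delta>}"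
    have A: "A \<in> sets mu" unfolding A_def by measurable
    have e: "space mu - (l' -` NZ \<inter> space mu) = f' -` A \<inter> space mu"
    proof -
      have "l' x \<notin> NZ \<longleftrightarrow> w' (f' x) < \<delta>" for x unfolding lNZ by (simp add: level_def)
      moreover have "x \<in> space mu \<Longrightarrow> f' x \<in> space mu" for x using nsp_space(1)[OF nb, of x] by simp
      ultimately show ?thesis by (auto simp: A_def simp del: space_mu)
    qed
    have fA: "f' -` A \<inter> space mu \<in> sets mu" by (rule nsp_vimage_sets[OF nb A])
    have "measure mu (f' -` A \<inter> space mu) = (\<integral>x. w' x * indicator (f' -` A \<inter> space mu) (g' x) \<partial>mu)"
      using nst_density_integral(2)[OF b fA] by simp
    also have "\<dots> \<le> (\<integral>x. \<delta> \<partial>mu)"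
    proof (rule integral_mono_AE)
      show "AE x in mu. w' x * indicator (f' -` A \<inter> space mu) (g' x) \<le> \<delta>"
        using nsp_fg[OF nb] by eventually_elim (use \<delta> in \<open>auto simp: A_def indicator_def\<close>)
    qed (use nst_density_integral(1)[OF b fA] in auto)
    finally show "measure mu (space mu - (l' -` NZ \<inter> space mu)) \<le> \<delta>" unfolding e by simp
  qed auto
  have wuI: "(\<integral>x. \<bar>wu x - 1\<bar> \<partial>mu) \<le> 2 * (\<kappa> + (1 - 1 / \<rho>\<^sup>2) + \<delta>)"
  proof -
    have [measurable]: "w \<in> borel_measurable mu" by (rule nst_borel[OF a])
    \<comment> \<open>The image points of level 1. Since the density has integral 1, Markov's
      inequality bounds their measure by \<delta>.\<close>
    define B where "B = {y \<in> space mu. \<delta> \<le> w y \<and> 1 / \<delta> \<le> w y}"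
    have B: "B \<in> sets mu" unfolding B_def by measurable
    have mB: "measure mu B \<le> \<delta>"
    proof -
      have "(\<integral>x. indicator B x \<partial>mu) \<le> (\<integral>x. \<delta> * w x \<partial>mu)"
      proof (rule integral_mono)
        show "indicator B x \<le> \<delta> * w x" for x
          using \<delta> nst_nonneg[OF a, of x] by (auto simp: B_def indicator_def field_simps)
      qed (use indicator_mu(1)[OF B] nst_density_integral(3)[OF a B] in auto)
      then show ?thesis using nst_density_integral(4)[OF a B] indicator_mu(2)[OF B] by simp
    qed
    \<comment> \<open>on a piece with an intermediate level, \<open>wu1\<close> is within a factor \<open>\<rho>\<close> of a constant whose
      value is pinned down by the total mass of the piece\<close>
    have key: "AE y in mu. m y \<in> NZ \<longrightarrow> y \<notin> B \<longrightarrow> 1 / \<rho> * c (m y) \<le> wu1 y \<and> wu1 y \<le> \<rho> * c (m y)"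
      if c: "c = (\<lambda>n. measure mu (lset l' n) / measure mu (lset l n))" for c
      using nsp_AE(2)[OF na v0(2)] nsp_fg[OF na] AE_space
    proof eventually_elim
      case (elim y)
      show ?case
      proof (intro impI)
        assume y: "m y \<in> NZ" "y \<notin> B"
        define z where "z = f' (v0 (g y))"
        have lz: "l' (v0 (g y)) = m y" using elim(1) by (simp add: m_def)
        have lev: "level \<rho> \<delta> (w' z) = level \<rho> \<delta> (w y)"
          using elim(1,2) by (simp add: l_def l'_def glabel_def z_def)
        have "level \<rho> \<delta> (w (f (g y))) \<noteq> 0" using y(1) lNZ(1)[of "g y"] by (simp add: m_def)
        then have l0: "level \<rho> \<delta> (w y) \<noteq> 0" using elim(2) by simp
        have "\<not> 1 / \<delta> \<le> w y" using y(2) elim(3) l0 by (auto simp: B_def level_def)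
        then have l1: "level \<rho> \<delta> (w y) \<noteq> 1" using l0 by (auto simp: level_def split: if_splits)
        have r: "0 < w y" "0 < w' z" "w y \<le> \<rho> * w' z" "w' z \<le> \<rho> * w y"
          using level_eq_ratio[OF \<rho> \<delta> lev[symmetric] l0 l1] level_eq_ratio(3)[OF \<rho> \<delta> lev] l0 l1 lev by auto
        have W: "wu1 y = w y / w' z * c (m y)"
          unfolding wu1_def wv0_def lz z_def[symmetric] c by (simp add: field_simps)
        have c0: "0 \<le> c (m y)" unfolding c by simp
        have b: "1 / \<rho> \<le> w y / w' z" "w y / w' z \<le> \<rho>" using r \<rho> by (auto simp: field_simps)
        show "1 / \<rho> * c (m y) \<le> wu1 y \<and> wu1 y \<le> \<rho> * c (m y)"
          unfolding W by (intro conjI mult_right_mono[OF _ c0] b)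
      qed
    qed
    define c where "c = (\<lambda>n. measure mu (lset l' n) / measure mu (lset l n))"
    note key = key[OF c_def]
    \<comment> \<open>Integrating the upper bound for \<open>wu1\<close> over the whole piece
      compares the mass quotient of the images with the constant \<open>c n\<close>; this replaces a
      direct relation between source and image masses.\<close>
    have mid: "measure mu (lset m' n) \<le> \<rho> * c n * measure mu (lset m n)"
      if n: "n \<in> NZ" and dis: "AE y in mu. y \<in> lset m n \<longrightarrow> y \<notin> B" for n
    proof -
      have s: "lset m' n \<in> sets mu" "lset m n \<in> sets mu" using lset_sets[OF mm(1)] lset_sets[OF mm(2)] by auto
      have u1i: "AE y in mu. m' (u1' y) = m y"
        using nsp_AE(2)[OF nst_nsp[OF u1n] u1l] nsp_fg[OF nst_nsp[OF u1n]] by eventually_elim simp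
      have "measure mu (lset m' n) = (\<integral>y. wu1 y * indicator (lset m' n) (u1' y) \<partial>mu)"
        using nst_density_integral(2)[OF u1n s(1)] by simp
      also have "\<dots> \<le> (\<integral>y. \<rho> * c n * indicator (lset m n) y \<partial>mu)"
      proof (rule integral_mono_AE[OF nst_density_integral(1)[OF u1n s(1)]])
        show "integrable mu (\<lambda>y. \<rho> * c n * indicator (lset m n) y)" using indicator_mu(1)[OF s(2)] by simp
        show "AE y in mu. wu1 y * indicator (lset m' n) (u1' y) \<le> \<rho> * c n * indicator (lset m n) y"
          using key u1i dis AE_space
        proof eventually_elim
          case (elim y)
          show ?case
          proof (cases "u1' y \<in> lset m' n")
            case True
            then have "y \<in> lset m n" using elim(2,4) by (simp add: lset_def)
            moreover have "m y = n" using calculation by (simp add: lset_def)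
            ultimately show ?thesis using True elim(1,3) n by simp
          next
            case False
            have "0 \<le> \<rho> * c n" using \<rho> by (simp add: c_def)
            then show ?thesis using False by simp
          qed
        qed
      qed
      also have "\<dots> = \<rho> * c n * measure mu (lset m n)"
        using indicator_mu[OF s(2)] by simp
      finally show ?thesis .
    qed
    have Blab: "AE y in mu. y \<in> B \<longleftrightarrow> (\<exists>i j. m y = to_nat (i :: nat, j :: nat, 1 :: nat))"
      using nsp_fg[OF na] AE_space
    proof eventually_elim
      case (elim y)
      have "m y = to_nat (nat \<lfloor>real N * g y\<rfloor>, nat \<lfloor>real N * y\<rfloor>, level \<rho> \<delta> (w y))"
        using elim(1) by (simp add: m_def l_def glabel_def)
      moreover have "level \<rho> \<delta> (w y) = 1 \<longleftrightarrow> \<delta> \<le> w y \<and> 1 / \<delta> \<le> w y" by (auto simp: level_def)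
      ultimately show ?case using elim(2) by (auto simp: B_def)
    qed
    have r2: "0 \<le> 1 / \<rho>\<^sup>2" "1 / \<rho>\<^sup>2 \<le> 1" using \<rho> one_le_power[of \<rho> 2] by (auto simp: divide_le_eq_1)
    show ?thesis
    proof (rule density_near_one[OF un mm(1) Lf mL(1) _ _ _ r2 B mB, where \<beta>="\<lambda>n. measure mu (lset m' n)"])
      show "(\<Sum>n\<in>L. measure mu (lset m' n)) \<le> 1" by (rule sum_lset_le_one[OF mm(2) Lf mL(2)])
      show "(\<Sum>n\<in>L. \<bar>measure mu (lset m n) - measure mu (lset m' n)\<bar>) \<le> \<kappa>" using p unfolding m_def m'_def .
      show "AE y in mu. y \<notin> B \<longrightarrow> 1 / \<rho>\<^sup>2 * (measure mu (lset m' (m y)) / measure mu (lset m (m y))) \<le> wu y"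
        using Blab key AE_space
      proof eventually_elim
        case (elim y)
        show ?case
        proof
          assume yB: "y \<notin> B"
          define n where "n = m y"
          define r where "r = measure mu (lset m' n) / measure mu (lset m n)"
          have r0: "0 \<le> r" by (simp add: r_def)
          show "1 / \<rho>\<^sup>2 * (measure mu (lset m' (m y)) / measure mu (lset m (m y))) \<le> wu y"
          proof (cases "n \<in> NZ")
            case True
            have good: "\<not> (\<exists>i j. n = to_nat (i :: nat, j :: nat, 1 :: nat))" using elim(1) yB by (simp add: n_def)
            have "AE y in mu. y \<in> lset m n \<longrightarrow> y \<notin> B"
              using Blab
            proof eventually_elim
              case (elim z)
              show ?case
              proof
                assume "z \<in> lset m n"
                then have "m z = n" by (simp add: lset_def)
                then show "z \<notin> B" using elim good by simp
              qed
            qed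
            \<comment> \<open>One factor \<rho> comes from this comparison of the mass quotient with
              \<open>c n\<close>, a second from the lower bound of \<open>wu1\<close> by
              \<open>c n\<close>; hence the square.\<close>
            from mid[OF True this] have "r \<le> \<rho> * c n"
              using \<rho> by (cases "measure mu (lset m n) = 0") (auto simp: r_def c_def divide_le_eq zero_less_measure_iff)
            then have "1 / \<rho>\<^sup>2 * r \<le> 1 / \<rho>\<^sup>2 * (\<rho> * c n)" using r2 by (intro mult_left_mono) auto
            also have "\<dots> = 1 / \<rho> * c n" using \<rho> by (simp add: power2_eq_square)
            also have "\<dots> \<le> wu1 y" using elim(2) True yB by (simp add: n_def)
            also have "wu1 y = wu y" using True elim(3) by (simp add: wu_def n_def)
            finally show ?thesis by (simp add: r_def n_def)
          next
            case False
            then have "wu y = r" by (simp add: wu_def wu0_def n_def r_def)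
            then show ?thesis using mult_right_mono[OF r2(2) r0] by (simp add: r_def n_def)
          qed
        qed
      qed
    qed simp_all
  qed
  show ?thesis using that[OF un vn fact uclose vclose wuI] wvI by simp
qed

text \<open>Each element is coded by rounded masses of its pieces and image pieces, together with
  the information which pieces are null. There are finitely many codes, one element is kept for
  each, and elements with equal codes satisfy the hypotheses of
  \<open>roelcke_factor\<close>.\<close>

lemma autstar_roelcke: "roelcke_precompact_autstar"
  unfolding roelcke_precompact_autstar_def
proof (intro allI impI)
  fix U assume U: "openin autstar_top U \<and> autstar_one \<in> U"
  have UA: "U \<subseteq> AutStar" using U openin_autstar_iff by blast
  from U have "\<forall>C\<in>U. \<exists>e>0. \<forall>D\<in>AutStar. gdist D C < e \<longrightarrow> D \<in> U" "autstar_one \<in> U"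
    unfolding openin_autstar_iff by simp_all
  from bspec[OF this] obtain e0 where e0: "0 < e0" "\<forall>D\<in>AutStar. gdist D autstar_one < e0 \<longrightarrow> D \<in> U" by (elim exE conjE)
  define e where "e = min e0 1"
  have e: "0 < e" "e \<le> 1" "e \<le> e0" using e0 by (auto simp: e_def)
  \<comment> \<open>The two factors lie within \<open>12 * \<delta> + 1 / N\<close> of the identity;
    48 makes the first term \<open>e / 4\<close>, and \<open>N\<close> is chosen to make the second
    less than \<open>e / 4\<close>.\<close>
  define \<delta> where "\<delta> = e / 48"
  have \<delta>: "0 < \<delta>" "\<delta> < 1" using e by (auto simp: \<delta>_def)
  \<comment> \<open>Chosen so that the loss \<open>1 - 1 / \<rho>\<^sup>2\<close> equals
    \<delta>.\<close>
  define \<rho> where "\<rho> = sqrt (1 / (1 - \<delta>))"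
  have \<rho>2: "\<rho>\<^sup>2 = 1 / (1 - \<delta>)" using \<delta> by (simp add: \<rho>_def)
  have \<rho>: "1 < \<rho>" using \<delta> by (simp add: \<rho>_def)
  have th: "1 - 1 / \<rho>\<^sup>2 = \<delta>" using \<delta> by (simp add: \<rho>2)
  obtain N0 where N0: "1 / real (Suc N0) < e / 4" using nat_approx_posE[of "e / 4"] e by auto
  define N where "N = Suc N0"
  have N: "0 < N" "1 / real N < e / 4" using N0 by (auto simp: N_def)
  define L where "L = glabels N \<rho> \<delta>"
  have Lf: "finite L" by (simp add: L_def finite_glabels)
  \<comment> \<open>Rounding each mass to multiples of \<open>1 / K\<close> costs at most \<delta>
    in the sum over all labels.\<close>
  obtain K where K: "real (card L) / \<delta> < real K" using reals_Archimedean2 by blast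
  have K0: "0 < real K" using K \<delta> by (smt (verit) divide_nonneg_pos of_nat_0_le_iff)
  have "\<forall>C. \<exists>f g w. C \<in> AutStar \<longrightarrow> nst f g w \<and> C = autstar_class f" by (meson AutStar_nst)
  then obtain rf rg rw where rep: "\<And>C. C \<in> AutStar \<Longrightarrow> nst (rf C) (rg C) (rw C)" "\<And>C. C \<in> AutStar \<Longrightarrow> C = autstar_class (rf C)"
    by metis
  define l where "l C = glabel N \<rho> \<delta> (rf C) (rw C)" for C
  define q where "q C n = measure mu (lset (l C) n)" for C n
  define r where "r C n = measure mu (lset (l C \<circ> rg C) n)" for C n
  \<comment> \<open>Nullity is recorded exactly, since rounding cannot distinguish a null piece from
    one of tiny measure, and a relabelling needs this distinction. Image pieces are null together
    with the pieces, so \<open>q\<close> suffices.\<close>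
  define cd where "cd C = restrict (\<lambda>n. (nat \<lfloor>real K * q C n\<rfloor>, nat \<lfloor>real K * r C n\<rfloor>, q C n = 0)) L" for C
  have le1: "measure mu S \<le> 1" for S using mu.bounded_measure[of S] by simp
  have fin: "finite (cd ` AutStar)"
  proof (rule finite_subset)
    have fl: "nat \<lfloor>real K * y\<rfloor> \<in> {0..K}" if "y \<le> 1" for y
    proof -
      have "real K * y \<le> real K" using that by (simp add: mult_left_le)
      then have "\<lfloor>real K * y\<rfloor> \<le> int K" by linarith
      then show ?thesis by simp
    qed
    show "cd ` AutStar \<subseteq> (\<Pi>\<^sub>E n\<in>L. {0..K} \<times> {0..K} \<times> UNIV)"
      using fl le1 by (auto simp: cd_def q_def r_def)
    show "finite (\<Pi>\<^sub>E n\<in>L. {0..K} \<times> {0..K} \<times> (UNIV :: bool set))" by (intro finite_PiE Lf finite_cartesian_product) auto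
  qed
  define pick where "pick c = (SOME C. C \<in> AutStar \<and> cd C = c)" for c
  have pick: "pick c \<in> AutStar" "cd (pick c) = c" if "c \<in> cd ` AutStar" for c
  proof -
    have "\<exists>C. C \<in> AutStar \<and> cd C = c" using that by auto
    from someI_ex[OF this] show "pick c \<in> AutStar" "cd (pick c) = c" by (auto simp: pick_def)
  qed
  define F where "F = pick ` cd ` AutStar"
  have FA: "F \<subseteq> AutStar" using pick by (auto simp: F_def)
  have inU: "autstar_class f \<in> U" if "nst f g w" "AE y in mu. \<bar>g y - y\<bar> \<le> 1 / real N" "(\<integral>x. \<bar>w x - 1\<bar> \<partial>mu) \<le> 2 * (\<delta> + \<delta> + \<delta>)" for f g w
  proof -
    have "gdist (autstar_class f) autstar_one \<le> 2 * (2 * (\<delta> + \<delta> + \<delta>)) + 1 / real N" by (rule gdist_coarse[OF that])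
    also have "\<dots> < e0" using N(2) e by (simp add: \<delta>_def)
    finally show ?thesis using e0(2) nsp_AutStar[OF nst_nsp[OF that(1)]] by simp
  qed
  have "C \<in> {autstar_mult (autstar_mult u f) v |u f v. u \<in> U \<and> f \<in> F \<and> v \<in> U}" if C: "C \<in> AutStar" for C
  proof -
    define D where "D = pick (cd C)"
    have D: "D \<in> AutStar" "cd D = cd C" "D \<in> F" using pick[of "cd C"] C by (auto simp: D_def F_def)
    note a = rep(1)[OF C] and b = rep(1)[OF D(1)]
    have same: "nat \<lfloor>real K * q D n\<rfloor> = nat \<lfloor>real K * q C n\<rfloor>" "nat \<lfloor>real K * r D n\<rfloor> = nat \<lfloor>real K * r C n\<rfloor>"
      "q D n = 0 \<longleftrightarrow> q C n = 0" if "n \<in> L" for n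
      using fun_cong[OF D(2), of n] that by (auto simp: cd_def)
    have Kn: "0 < K" using K0 by simp
    have bd: "(\<Sum>n\<in>L. \<bar>x n - y n\<bar>) \<le> \<delta>" if "\<And>n. n \<in> L \<Longrightarrow> \<bar>x n - y n\<bar> \<le> 1 / real K" for x y :: "nat \<Rightarrow> real"
    proof -
      have "(\<Sum>n\<in>L. \<bar>x n - y n\<bar>) \<le> (\<Sum>n\<in>L. 1 / real K)" by (rule sum_mono[OF that])
      also have "\<dots> = real (card L) / real K" by simp
      also have "\<dots> \<le> \<delta>" using K K0 \<delta> by (simp add: field_simps)
      finally show ?thesis .
    qed
    obtain u u' wu v v' wv where uv: "nst u u' wu" "nst v v' wv" "AE x in mu. u (rf D (v x)) = rf C x"
      "AE y in mu. \<bar>u' y - y\<bar> \<le> 1 / real N" "AE y in mu. \<bar>v' y - y\<bar> \<le> 1 / real N"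
      "(\<integral>x. \<bar>wu x - 1\<bar> \<partial>mu) \<le> 2 * (\<delta> + (1 - 1 / \<rho>\<^sup>2) + \<delta>)" "(\<integral>x. \<bar>wv x - 1\<bar> \<partial>mu) \<le> 2 * (\<delta> + \<delta>)"
    proof (rule roelcke_factor[OF a b N(1) \<rho> \<delta>(1), where \<kappa>=\<delta>])
      fix n assume "n \<in> glabels N \<rho> \<delta>"
      then show "measure mu (lset (glabel N \<rho> \<delta> (rf C) (rw C)) n) = 0 \<longleftrightarrow> measure mu (lset (glabel N \<rho> \<delta> (rf D) (rw D)) n) = 0"
        using same(3)[of n] by (simp add: L_def q_def l_def)
    next
      have "(\<Sum>n\<in>L. \<bar>q C n - q D n\<bar>) \<le> \<delta>"
        by (rule bd, rule floor_label_close[OF Kn]) (use same in \<open>auto simp: q_def\<close>)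
      then show "(\<Sum>n\<in>glabels N \<rho> \<delta>. \<bar>measure mu (lset (glabel N \<rho> \<delta> (rf C) (rw C)) n) - measure mu (lset (glabel N \<rho> \<delta> (rf D) (rw D)) n)\<bar>) \<le> \<delta>"
        by (simp add: L_def q_def l_def)
      have "(\<Sum>n\<in>L. \<bar>r C n - r D n\<bar>) \<le> \<delta>"
        by (rule bd, rule floor_label_close[OF Kn]) (use same in \<open>auto simp: r_def\<close>)
      then show "(\<Sum>n\<in>glabels N \<rho> \<delta>. \<bar>measure mu (lset (glabel N \<rho> \<delta> (rf C) (rw C) \<circ> rg C) n) - measure mu (lset (glabel N \<rho> \<delta> (rf D) (rw D) \<circ> rg D) n)\<bar>) \<le> \<delta>"
        by (simp add: L_def r_def l_def)
    qed
    note nu = nst_nsp[OF uv(1)] and nv = nst_nsp[OF uv(2)] and nD = nst_nsp[OF b]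
    have 1: "autstar_class u \<in> U" by (rule inU[OF uv(1,4)]) (use uv(6) th in simp)
    have 2: "autstar_class v \<in> U" by (rule inU[OF uv(2,5)]) (use uv(7) \<delta> in simp)
    have "autstar_mult (autstar_mult (autstar_class u) D) (autstar_class v)
      = autstar_mult (autstar_mult (autstar_class u) (autstar_class (rf D))) (autstar_class v)" using rep(2)[OF D(1)] by simp
    also have "\<dots> = autstar_class ((u \<circ> rf D) \<circ> v)"
      by (simp only: autstar_mult_class[OF nu nD] autstar_mult_class[OF nsp_comp[OF nu nD] nv])
    also have "\<dots> = autstar_class (rf C)" by (rule autstar_class_eqI) (use uv(3) in simp)
    finally have "C = autstar_mult (autstar_mult (autstar_class u) D) (autstar_class v)" using rep(2)[OF C] by simp
    then show ?thesis using 1 2 D(3) by blast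
  qed
  moreover have "{autstar_mult (autstar_mult u f) v |u f v. u \<in> U \<and> f \<in> F \<and> v \<in> U} \<subseteq> AutStar"
    using UA FA AutStar_mult by blast
  ultimately have "{autstar_mult (autstar_mult u f) v |u f v. u \<in> U \<and> f \<in> F \<and> v \<in> U} = AutStar" by blast
  moreover have "finite F" using fin by (simp add: F_def)
  ultimately show "\<exists>F. finite F \<and> F \<subseteq> AutStar \<and> {autstar_mult (autstar_mult u f) v |u f v. u \<in> U \<and> f \<in> F \<and> v \<in> U} = AutStar"
    using FA by blast
qed

text \<open>Joint continuity at the identity and \<open>x\<close> supplies \<open>a_small\<close>,
  because elements of small support are close to the identity; the other locale assumptions
  translate from classes to maps.\<close>

lemma autstar_transitive_singleton:
  fixes X :: "'x set" and a :: "(real \<Rightarrow> real) set \<Rightarrow> 'x \<Rightarrow> 'x"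
  assumes met: "Metric_space X d" and comp: "Metric_space.mcomplete X d" and ne: "X \<noteq> {}"
    and cl: "\<forall>C \<in> AutStar. \<forall>x \<in> X. a C x \<in> X" and one: "\<forall>x \<in> X. a autstar_one x = x"
    and mult: "\<forall>C \<in> AutStar. \<forall>D \<in> AutStar. \<forall>x \<in> X. a (autstar_mult C D) x = a C (a D x)"
    and iso: "\<forall>C \<in> AutStar. \<forall>x \<in> X. \<forall>y \<in> X. d (a C x) (a C y) = d x y"
    and cont: "continuous_map (prod_topology autstar_top (Metric_space.mtopology X d)) (Metric_space.mtopology X d) (\<lambda>(C, x). a C x)"
    and trans: "\<forall>x \<in> X. \<forall>y \<in> X. \<exists>C \<in> AutStar. a C x = y"
  shows "\<exists>x. X = {x}"
proof -
  interpret Metric_space X d by (rule met)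
  interpret A: transitive_isometric_action X d "\<lambda>f. a (autstar_class f)"
  proof
    show "mcomplete" by (rule comp)
    show "a (autstar_class f) x \<in> X" if "nsp f g" "x \<in> X" for f g x using cl nsp_AutStar[OF that(1)] that(2) by blast
    show "a (autstar_class (\<lambda>u. u)) x = x" if "x \<in> X" for x using one that by (simp add: autstar_one_class)
    show "a (autstar_class (f \<circ> f')) x = a (autstar_class f) (a (autstar_class f') x)" if "nsp f g" "nsp f' g'" "x \<in> X" for f g f' g' x
      using bspec[OF bspec[OF bspec[OF mult nsp_AutStar[OF that(1)]] nsp_AutStar[OF that(2)]] that(3)]
      by (simp only: autstar_mult_class[OF that(1,2)])
    show "a (autstar_class f) = a (autstar_class f')" if "AE u in mu. f u = f' u" for f f'
      using autstar_class_eqI[OF that] by simp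
    show "d (a (autstar_class f) x) (a (autstar_class f) y) = d x y" if "nsp f g" "x \<in> X" "y \<in> X" for f g x y
      using iso nsp_AutStar[OF that(1)] that(2,3) by blast
    show "\<exists>f g. nsp f g \<and> a (autstar_class f) x = y" if xy: "x \<in> X" "y \<in> X" for x y
    proof -
      obtain C where C: "C \<in> AutStar" "a C x = y" using trans xy by blast
      obtain f g where "nsp f g" "C = autstar_class f" using C(1) by (rule AutStar_nsp)
      then show ?thesis using C by blast
    qed
    fix x and e :: real assume x: "x \<in> X" and e: "0 < e"
    have "openin (prod_topology autstar_top mtopology) {z \<in> topspace (prod_topology autstar_top mtopology). (\<lambda>(C, x). a C x) z \<in> mball x e}"
      by (rule openin_continuous_map_preimage[OF cont openin_mball])
    moreover have "(autstar_one, x) \<in> {z \<in> topspace (prod_topology autstar_top mtopology). (\<lambda>(C, x). a C x) z \<in> mball x e}"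
      using x e one AutStar_one by (simp add: topspace_autstar_top)
    ultimately obtain U V where UV: "openin autstar_top U" "autstar_one \<in> U" "x \<in> V"
      "U \<times> V \<subseteq> {z \<in> topspace (prod_topology autstar_top mtopology). (\<lambda>(C, x). a C x) z \<in> mball x e}"
      unfolding openin_prod_topology_alt by meson
    from UV(1,2) have "\<forall>C\<in>U. \<exists>e>0. \<forall>D\<in>AutStar. gdist D C < e \<longrightarrow> D \<in> U" "autstar_one \<in> U"
      unfolding openin_autstar_iff by simp_all
    from bspec[OF this] obtain e' where e': "0 < e'" "\<forall>D\<in>AutStar. gdist D autstar_one < e' \<longrightarrow> D \<in> U" by (elim exE conjE)
    \<comment> \<open>The quarter compensates the factor 4 in
      \<open>gdist_small_support\<close>.\<close>
    show "\<exists>\<eta>>0. \<forall>f g A. nsp f g \<longrightarrow> A \<in> sets mu \<longrightarrow> measure mu A < \<eta> \<longrightarrow> supp f A \<longrightarrow> d x (a (autstar_class f) x) < e"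
    proof (rule exI[of _ "e' / 4"], intro conjI allI impI)
      fix f g A assume f: "nsp f g" "A \<in> sets mu" "measure mu A < e' / 4" "supp f A"
      have "gdist (autstar_class f) autstar_one < e'" using gdist_small_support[OF f(1,2,4)] f(3) by simp
      then have "autstar_class f \<in> U" using e'(2) nsp_AutStar[OF f(1)] by simp
      then have "a (autstar_class f) x \<in> mball x e" using UV(3,4) by auto
      then show "d x (a (autstar_class f) x) < e" by simp
    qed (use e'(1) in simp)
  qed
  obtain x where "x \<in> X" using ne by blast
  from A.singleton[OF this] show ?thesis by blast
qed

theorem theorem2p4:
  shows "(\<forall>p::real. 1 \<le> p \<longrightarrow>
            (\<forall>C \<in> AutStar. Phi p C \<in> aut_lattice p) \<and>
            (\<forall>C \<in> AutStar. \<forall>D \<in> AutStar.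
               Phi p (autstar_mult C D) = compose (Lp p) (Phi p C) (Phi p D)) \<and>
            bij_betw (Phi p) AutStar (aut_lattice p) \<and>
            homeomorphic_map autstar_top (aut_lattice_top p) (Phi p))
       \<and> topspace autstar_top = AutStar
       \<and> continuous_map (prod_topology autstar_top autstar_top) autstar_top
           (\<lambda>(C, D). autstar_mult C D)
       \<and> continuous_map autstar_top autstar_top autstar_inverse
       \<and> Polish_space autstar_top
       \<and> roelcke_precompact_autstar
       \<and> (\<forall>(X :: 'x set) d (a :: (real \<Rightarrow> real) set \<Rightarrow> 'x \<Rightarrow> 'x).
            Metric_space X d \<and> Metric_space.mcomplete X d \<and> X \<noteq> {} \<and>
            (\<forall>C \<in> AutStar. \<forall>x \<in> X. a C x \<in> X) \<and>
            (\<forall>x \<in> X. a autstar_one x = x) \<and>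
            (\<forall>C \<in> AutStar. \<forall>D \<in> AutStar. \<forall>x \<in> X. a (autstar_mult C D) x = a C (a D x)) \<and>
            (\<forall>C \<in> AutStar. \<forall>x \<in> X. \<forall>y \<in> X. d (a C x) (a C y) = d x y) \<and>
            continuous_map (prod_topology autstar_top (Metric_space.mtopology X d))
              (Metric_space.mtopology X d) (\<lambda>(C, x). a C x) \<and>
            (\<forall>x \<in> X. \<forall>y \<in> X. \<exists>C \<in> AutStar. a C x = y)
            \<longrightarrow> (\<exists>x. X = {x}))"
proof (intro conjI allI impI ballI)
  fix p :: real assume p: "1 \<le> p"
  show "Phi p C \<in> aut_lattice p" if "C \<in> AutStar" for C by (rule Phi_aut_lattice[OF p that])
  show "Phi p (autstar_mult C D) = compose (Lp p) (Phi p C) (Phi p D)" if "C \<in> AutStar" "D \<in> AutStar" for C D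
    by (rule Phi_mult) (use p that in auto)
  show "bij_betw (Phi p) AutStar (aut_lattice p)" by (rule Phi_bij[OF p])
  show "homeomorphic_map autstar_top (aut_lattice_top p) (Phi p)" by (rule Phi_homeomorphic[OF p])
next
  show "topspace autstar_top = AutStar" by (rule topspace_autstar_top)
  show "continuous_map (prod_topology autstar_top autstar_top) autstar_top (\<lambda>(C, D). autstar_mult C D)"
    by (rule autstar_mult_continuous)
  show "continuous_map autstar_top autstar_top autstar_inverse" by (rule autstar_inverse_continuous)
  show "Polish_space autstar_top" by (rule autstar_Polish)
  show "roelcke_precompact_autstar" by (rule autstar_roelcke)
next
  fix X :: "'x set" and d and a :: "(real \<Rightarrow> real) set \<Rightarrow> 'x \<Rightarrow> 'x"
  assume "Metric_space X d \<and> Metric_space.mcomplete X d \<and> X \<noteq> {} \<and>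
            (\<forall>C \<in> AutStar. \<forall>x \<in> X. a C x \<in> X) \<and>
            (\<forall>x \<in> X. a autstar_one x = x) \<and>
            (\<forall>C \<in> AutStar. \<forall>D \<in> AutStar. \<forall>x \<in> X. a (autstar_mult C D) x = a C (a D x)) \<and>
            (\<forall>C \<in> AutStar. \<forall>x \<in> X. \<forall>y \<in> X. d (a C x) (a C y) = d x y) \<and>
            continuous_map (prod_topology autstar_top (Metric_space.mtopology X d))
              (Metric_space.mtopology X d) (\<lambda>(C, x). a C x) \<and>
            (\<forall>x \<in> X. \<forall>y \<in> X. \<exists>C \<in> AutStar. a C x = y)"
  then show "\<exists>x. X = {x}" by (elim conjE) (rule autstar_transitive_singleton)
qed

end
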